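(* (1) The set of indices of computable real numbers that are normal to at least one base is $\Sigma^0_4$-complete. (2) The set of real numbers that are normal to at least one base is $\mathbf{\Sigma}^0_4$-complete.
   Context: A base is an integer $r\geq 2$. For a real $x$, $\{x\}$ denotes its fractional part. For a finite sequence $\vec\xi=(\xi_1,\dots,\xi_N)$ of reals in $[0,1]$, its discrepancy is $D(\vec\xi)=\sup_{0\leq u<v\leq 1}\bigl|\#\{n:1\leq n\leq N,\ u\leq \xi_n<v\}/N-(v-u)\bigr|$. A real $\xi$ is normal to base $r$ iff $\lim_{N\to\infty}D(\{r^j\xi\}:0\leq j<N)=0$. An index of a computable real is a natural number $e$ such that the $e$-th partial computable function is total and computes (e.g. a sequence of rational approximations converging at a computable rate to) that real. A set $A\subseteq\mathbb{N}$ is $\Sigma^0_4$-complete if it is definable by a $\Sigma^0_4$ formula of arithmetic and for every $\Sigma^0_4$ set $B\subseteq\mathbb{N}$ there is a computable $f$ with $n\in B\iff f(n)\in A$ (equivalently, there is a computable map sending $\Sigma^0_4$ sentences to naturals $f(\psi)$ such that $\psi$ is true iff $f(\psi)\in A$). A set $B\subseteq\mathbb{R}$ is $\mathbf{\Sigma}^0_4$-complete if it is in the class $\mathbf{\Sigma}^0_4$ of the Borel hierarchy ($\mathbf\Sigma^0_1$ = open, $\mathbf\Pi^0_1$ = closed, $\mathbf\Sigma^0_{n+1}$ = countable unions of $\mathbf\Pi^0_n$ sets, $\mathbf\Pi^0_{n+1}$ = countable intersections of $\mathbf\Sigma^0_n$ sets) and for every $\mathbf{\Sigma}^0_4$ subset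 $A$ of Baire space $\mathbb{N}^{\mathbb{N}}$ there is a continuous $f:\mathbb{N}^{\mathbb{N}}\to\mathbb{R}$ with $x\in A\iff f(x)\in B$. *)

theory Defs
  imports "HOL-Analysis.Analysis" "HOL-Library.Nat_Bijection" "HOL-Library.Countable"
begin

text \<open>
  The partial recursive functions, presented as unary functions: tuples of arguments are coded by
  the pairing function \<^const>\<open>prod_encode\<close>, and projections and tupling are among the basic
  operations. \<^const>\<open>None\<close> means divergence.
\<close>

datatype recf =
    RZero
  | RSucc
  | RFst
  | RSnd
  | RPair recf recf
  | RComp recf recf
  | RPrim recf recf
  | RMin recf

primrec recf_eval :: "recf \<Rightarrow> nat \<Rightarrow> nat option" where
  "recf_eval RZero x = Some 0"
| "recf_eval RSucc x = Some (Suc x)"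
| "recf_eval RFst x = Some (fst (prod_decode x))"
| "recf_eval RSnd x = Some (snd (prod_decode x))"
| "recf_eval (RPair f g) x =
     Option.bind (recf_eval f x) (\<lambda>y.
     Option.bind (recf_eval g x) (\<lambda>z. Some (prod_encode (y, z))))"
| "recf_eval (RComp f g) x = Option.bind (recf_eval g x) (recf_eval f)"
| "recf_eval (RPrim f g) x =
     (case prod_decode x of (a, n) \<Rightarrow>
        rec_nat (recf_eval f a)
          (\<lambda>k r. Option.bind r (\<lambda>y. recf_eval g (prod_encode (a, prod_encode (k, y))))) n)"
| "recf_eval (RMin f) x =
     (if \<exists>n. recf_eval f (prod_encode (x, n)) = Some 0
             \<and> (\<forall>m<n. recf_eval f (prod_encode (x, m)) \<noteq> None)
      then Some (LEAST n. recf_eval f (prod_encode (x, n)) = Some 0)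
      else None)"

primrec recf_num :: "recf \<Rightarrow> nat" where
  "recf_num RZero = 0"
| "recf_num RSucc = 1"
| "recf_num RFst = 2"
| "recf_num RSnd = 3"
| "recf_num (RPair f g) = 4 * prod_encode (recf_num f, recf_num g) + 4"
| "recf_num (RComp f g) = 4 * prod_encode (recf_num f, recf_num g) + 5"
| "recf_num (RPrim f g) = 4 * prod_encode (recf_num f, recf_num g) + 6"
| "recf_num (RMin f) = 4 * recf_num f + 7"

lemma recf_num_inject: "recf_num f = recf_num g \<longleftrightarrow> f = g"
proof (induction f arbitrary: g)
  case RZero then show ?case by (cases g) auto
next
  case RSucc then show ?case by (cases g) auto
next
  case RFst then show ?case by (cases g) auto
next
  case RSnd then show ?case by (cases g) auto
next
  case (RPair f1 f2) then show ?case by (cases g) (auto, presburger+)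
next
  case (RComp f1 f2) then show ?case by (cases g) (auto, presburger+)
next
  case (RPrim f1 f2) then show ?case by (cases g) (auto, presburger+)
next
  case (RMin f) then show ?case by (cases g) (auto, presburger+)
qed

lemma recf_num_surj: "\<exists>f. recf_num f = n"
proof (induction n rule: less_induct)
  case (less n)
  show ?case
  proof (cases "n < 4")
    case True
    then have "n = 0 \<or> n = 1 \<or> n = 2 \<or> n = 3" by auto
    then show ?thesis
      using recf_num.simps(1-4) by metis
  next
    case False
    define k where "k = (n - 4) div 4"
    have n: "n = 4 * k + 4 \<or> n = 4 * k + 5 \<or> n = 4 * k + 6 \<or> n = 4 * k + 7"
      using False unfolding k_def by presburger
    obtain a b where ab: "k = prod_encode (a, b)"
      by (metis prod_decode_inverse surj_pair)
    have "a \<le> k" "b \<le> k" "k < n"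
      using ab n le_prod_encode_1 le_prod_encode_2 by auto
    then obtain f g h where "recf_num f = a" "recf_num g = b" "recf_num h = k"
      using less.IH le_less_trans by meson
    then show ?thesis
      using n ab recf_num.simps(5-8) by metis
  qed
qed

lemma bij_recf_num: "bij recf_num"
  unfolding bij_def inj_on_def surj_def using recf_num_inject recf_num_surj by metis

definition phi :: "nat \<Rightarrow> nat \<Rightarrow> nat option" where
  "phi e = recf_eval (inv recf_num e)"

definition computable :: "(nat \<Rightarrow> nat) \<Rightarrow> bool" where
  "computable f \<longleftrightarrow> (\<exists>e. \<forall>x. phi e x = Some (f x))"

text \<open>
  The \<open>n\<close>-th value of the total function \<open>phi e\<close> codes, via the effective enumeration
  \<^const>\<open>nat_to_rat_surj\<close> of the rationals, an approximation of \<open>\<xi>\<close> with error at most \<open>2\<^sup>-\<^sup>n\<close>.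
\<close>

definition computable_real_index :: "nat \<Rightarrow> real \<Rightarrow> bool" where
  "computable_real_index e \<xi> \<longleftrightarrow>
     (\<forall>n. \<exists>c. phi e n = Some c \<and> \<bar>of_rat (nat_to_rat_surj c) - \<xi>\<bar> \<le> 1 / 2 ^ n)"

text \<open>
  First-order formulas of arithmetic in de Bruijn notation. The bounded quantifiers
  \<open>\<forall>x \<le> t\<close> and \<open>\<exists>x \<le> t\<close> are primitive; since \<open>t\<close> is evaluated outside the binder, the bound
  variable cannot occur in it.
\<close>

datatype arith_tm =
    TVar nat
  | TZero
  | TSucc arith_tm
  | TAdd arith_tm arith_tm
  | TMul arith_tm arith_tm

datatype arith_fm =
    FEq arith_tm arith_tm
  | FLe arith_tm arith_tm
  | FNot arith_fm
  | FAnd arith_fm arith_fm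
  | FOr arith_fm arith_fm
  | FBAll arith_tm arith_fm
  | FBEx arith_tm arith_fm
  | FAll arith_fm
  | FEx arith_fm

primrec tm_val :: "(nat \<Rightarrow> nat) \<Rightarrow> arith_tm \<Rightarrow> nat" where
  "tm_val v (TVar i) = v i"
| "tm_val v TZero = 0"
| "tm_val v (TSucc t) = Suc (tm_val v t)"
| "tm_val v (TAdd s t) = tm_val v s + tm_val v t"
| "tm_val v (TMul s t) = tm_val v s * tm_val v t"

primrec fm_true :: "(nat \<Rightarrow> nat) \<Rightarrow> arith_fm \<Rightarrow> bool" where
  "fm_true v (FEq s t) \<longleftrightarrow> tm_val v s = tm_val v t"
| "fm_true v (FLe s t) \<longleftrightarrow> tm_val v s \<le> tm_val v t"
| "fm_true v (FNot \<phi>) \<longleftrightarrow> \<not> fm_true v \<phi>"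
| "fm_true v (FAnd \<phi> \<psi>) \<longleftrightarrow> fm_true v \<phi> \<and> fm_true v \<psi>"
| "fm_true v (FOr \<phi> \<psi>) \<longleftrightarrow> fm_true v \<phi> \<or> fm_true v \<psi>"
| "fm_true v (FBAll t \<phi>) \<longleftrightarrow> (\<forall>x \<le> tm_val v t. fm_true (case_nat x v) \<phi>)"
| "fm_true v (FBEx t \<phi>) \<longleftrightarrow> (\<exists>x \<le> tm_val v t. fm_true (case_nat x v) \<phi>)"
| "fm_true v (FAll \<phi>) \<longleftrightarrow> (\<forall>x. fm_true (case_nat x v) \<phi>)"
| "fm_true v (FEx \<phi>) \<longleftrightarrow> (\<exists>x. fm_true (case_nat x v) \<phi>)"

primrec bounded_fm :: "arith_fm \<Rightarrow> bool" where
  "bounded_fm (FEq s t) \<longleftrightarrow> True"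
| "bounded_fm (FLe s t) \<longleftrightarrow> True"
| "bounded_fm (FNot \<phi>) \<longleftrightarrow> bounded_fm \<phi>"
| "bounded_fm (FAnd \<phi> \<psi>) \<longleftrightarrow> bounded_fm \<phi> \<and> bounded_fm \<psi>"
| "bounded_fm (FOr \<phi> \<psi>) \<longleftrightarrow> bounded_fm \<phi> \<and> bounded_fm \<psi>"
| "bounded_fm (FBAll t \<phi>) \<longleftrightarrow> bounded_fm \<phi>"
| "bounded_fm (FBEx t \<phi>) \<longleftrightarrow> bounded_fm \<phi>"
| "bounded_fm (FAll \<phi>) \<longleftrightarrow> False"
| "bounded_fm (FEx \<phi>) \<longleftrightarrow> False"

text \<open>Quantifier blocks may have any length, including zero.\<close>

inductive Sigma_fm :: "nat \<Rightarrow> arith_fm \<Rightarrow> bool" and Pi_fm :: "nat \<Rightarrow> arith_fm \<Rightarrow> bool" where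
  "bounded_fm \<phi> \<Longrightarrow> Sigma_fm 0 \<phi>"
| "bounded_fm \<phi> \<Longrightarrow> Pi_fm 0 \<phi>"
| "Pi_fm n \<phi> \<Longrightarrow> Sigma_fm (Suc n) \<phi>"
| "Sigma_fm (Suc n) \<phi> \<Longrightarrow> Sigma_fm (Suc n) (FEx \<phi>)"
| "Sigma_fm n \<phi> \<Longrightarrow> Pi_fm (Suc n) \<phi>"
| "Pi_fm (Suc n) \<phi> \<Longrightarrow> Pi_fm (Suc n) (FAll \<phi>)"

text \<open>
  The defining formula has variable \<open>0\<close> as its only relevant free variable: its truth value must
  not depend on the values \<open>v\<close> of the others.
\<close>

definition arith_Sigma :: "nat \<Rightarrow> nat set \<Rightarrow> bool" where
  "arith_Sigma k A \<longleftrightarrow> (\<exists>\<phi>. Sigma_fm k \<phi> \<and> (\<forall>n v. n \<in> A \<longleftrightarrow> fm_true (case_nat n v) \<phi>))"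

definition arith_Sigma_complete :: "nat \<Rightarrow> nat set \<Rightarrow> bool" where
  "arith_Sigma_complete k A \<longleftrightarrow>
     arith_Sigma k A \<and>
     (\<forall>B. arith_Sigma k B \<longrightarrow> (\<exists>f. computable f \<and> (\<forall>n. n \<in> B \<longleftrightarrow> f n \<in> A)))"

text \<open>Levels start at 1; there are no sets at level 0.\<close>

inductive borel_Sigma :: "nat \<Rightarrow> 'a::topological_space set \<Rightarrow> bool"
  and borel_Pi :: "nat \<Rightarrow> 'a set \<Rightarrow> bool" where
  "open U \<Longrightarrow> borel_Sigma 1 U"
| "closed C \<Longrightarrow> borel_Pi 1 C"
| "(\<And>i::nat. borel_Pi n (F i)) \<Longrightarrow> borel_Sigma (Suc n) (\<Union>i. F i)"
| "(\<And>i::nat. borel_Sigma n (F i)) \<Longrightarrow> borel_Pi (Suc n) (\<Inter>i. F i)"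

text \<open>Baire space is the type \<^typ>\<open>nat \<Rightarrow> nat\<close> with its library (product) topology.\<close>

definition borel_Sigma_complete :: "nat \<Rightarrow> real set \<Rightarrow> bool" where
  "borel_Sigma_complete k B \<longleftrightarrow>
     borel_Sigma k B \<and>
     (\<forall>A :: (nat \<Rightarrow> nat) set. borel_Sigma k A \<longrightarrow>
        (\<exists>f :: (nat \<Rightarrow> nat) \<Rightarrow> real. continuous_on UNIV f \<and> (\<forall>x. x \<in> A \<longleftrightarrow> f x \<in> B)))"

definition discrepancy :: "real list \<Rightarrow> real" where
  "discrepancy xs =
     (SUP (u, v) \<in> {(u, v). 0 \<le> u \<and> u < v \<and> v \<le> 1}.
        \<bar>real (card {n. n < length xs \<and> u \<le> xs ! n \<and> xs ! n < v}) / real (length xs) - (v - u)\<bar>)"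

definition normal_to_base :: "nat \<Rightarrow> real \<Rightarrow> bool" where
  "normal_to_base r \<xi> \<longleftrightarrow>
     (\<lambda>N. discrepancy (map (\<lambda>j. frac (real r ^ j * \<xi>)) [0..<N])) \<longlonglongrightarrow> 0"

definition normal_to_some_base :: "real \<Rightarrow> bool" where
  "normal_to_some_base \<xi> \<longleftrightarrow> (\<exists>r\<ge>2. normal_to_base r \<xi>)"

end

theory Submission
  imports Defs
begin

text \<open>
  A \<open>\<Sigma>\<^sup>0\<^sub>4\<close> question can be rephrased as: does some member of a countable family of integer sequences
  tend to infinity? Attach the \<open>i\<close>-th sequence to the \<open>i\<close>-th prime and build a real through nested dyadic
  intervals of length \<open>1 / 2 ^ 2 ^ n\<close>. Task \<open>(s, u)\<close> makes the base-\<open>s\<close> digit \<open>0\<close> slightly too frequent over one long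
  block, by an amount that shrinks as the \<open>u\<close>-th term of the sequence of \<open>s\<close> grows, while all prime bases
  other than \<open>s\<close> stay equidistributed up to the current precision. The real is then normal to the prime \<open>s\<close>
  exactly when the sequence of \<open>s\<close> diverges. Bases that are not prime powers receive a fixed bias infinitely
  often, and a prime power is a normal base only if its prime is.

  A task is possible since random digits with a biased law for base \<open>s\<close> have, by Schmidt's argument, small
  mean exponential sums along \<open>r\<^sup>j\<close> for every base \<open>r\<close> having no power in common with \<open>s\<close>: for most \<open>j\<close> many base-\<open>s\<close>
  shifts of \<open>h r\<^sup>j\<close> are far from integers, and each contributes a factor bounded away from \<open>1\<close> to the
  characteristic function. The construction depends only on finitely many terms of the sequences at each stage;
  this gives continuity and computability alike. For the upper bounds, normality to base \<open>r\<close> says that for each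
  \<open>k\<close> the averages of finitely many tent functions are eventually, for all \<open>N\<close>, within \<open>1 / k\<close> of their
  integrals, and this last condition is closed, respectively decidable from rational approximations.
\<close>


section \<open>Normality through averages of tent functions\<close>

text \<open>Normality concerns limits only, so a bias must remain visible in the averages. Stage
  lengths therefore double: stage n settles the binary digits from 2^n to 2^(n+1), each block of
  base-\<open>r\<close> digits is about half of all digits so far, and an excess on one block shows
  in the frequency at its end. The conflict lies in base \<open>s\<close> itself: every task for
  \<open>s\<close> biases it, yet the limit must be normal to \<open>s\<close> when its sequence
  diverges. The excess at level \<open>m\<close> is thus of order \<open>1 / bias_denom m\<close>,
  weak enough for the same block to pass the test \<open>spread s m\<close>; a sequence that does
  not diverge repeats some level forever, and with it one fixed excess. Tents replace intervals for
  three reasons: they are Lipschitz, so passing to a finite approximation costs a bounded total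
  error; their averages are continuous in the real, so the tests are closed; and at rational points
  they reduce to integer arithmetic. Distinct primes are multiplicatively independent, and a base
  that is not a prime power is independent of every prime, so a task for one base leaves the other
  primes equidistributed.\<close>

definition tent :: "nat \<Rightarrow> nat \<Rightarrow> real \<Rightarrow> real" where
  "tent d a x = max 0 (1 - \<bar>real d * frac x - real a\<bar>)"

lemma tent_bounds: "0 \<le> tent d a x" "tent d a x \<le> 1"
  by (auto simp: tent_def)

text \<open>The restriction \<open>1 \<le> a < d\<close> keeps the support of the hat inside one
  period, so the tent vanishes at integers and the jumps of \<open>frac\<close> are not felt. Across
  one integer each value is at most \<open>d\<close> times the distance to it; larger gaps are
  covered by the bound 1.\<close>

lemma tent_lipschitz:
  assumes "1 \<le> a" "a < d"
  shows "\<bar>tent d a x - tent d a y\<bar> \<le> real d * \<bar>x - y\<bar>"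
proof -
  have main: "\<bar>tent d a x - tent d a y\<bar> \<le> real d * (y - x)" if "x \<le> y" for x y
  proof -
    consider "\<lfloor>x\<rfloor> = \<lfloor>y\<rfloor>" | "y - x \<ge> 1" | "y - x < 1" "\<lfloor>x\<rfloor> \<noteq> \<lfloor>y\<rfloor>" by linarith
    then show ?thesis
    proof cases
      case 1
      have *: "\<bar>max 0 (1 - \<bar>p\<bar>) - max 0 (1 - \<bar>q\<bar>)\<bar> \<le> \<bar>p - q\<bar>" for p q :: real by linarith
      have "real d * frac x - a - (real d * frac y - a) = - (real d * (y - x))"
        using 1 by (simp add: frac_def algebra_simps)
      then show ?thesis using *[of "real d * frac x - a" "real d * frac y - a"] that
        by (simp add: tent_def abs_mult)
    next
      case 2
      have "\<bar>tent d a x - tent d a y\<bar> \<le> 1" using tent_bounds[of d a x] tent_bounds[of d a y] by linarith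
      also have "\<dots> \<le> real d * (y - x)" using assms 2 mult_mono[of 1 "real d" 1 "y - x"] by simp
      finally show ?thesis .
    next
      case 3
      then have f: "\<lfloor>y\<rfloor> = \<lfloor>x\<rfloor> + 1" using that by linarith
      define z where "z = real_of_int \<lfloor>y\<rfloor>"
      have fx: "frac x = x - z + 1" and fy: "frac y = y - z" using f by (auto simp: frac_def z_def)
      have zx: "x \<le> z" "z \<le> y" using f unfolding z_def by linarith+
      have da: "real a \<le> real d - 1" using assms by (simp add: of_nat_diff)
      have "1 - \<bar>real d * frac x - a\<bar> \<le> real d * (z - x)"
        unfolding fx using da by (simp add: algebra_simps)
      then have A: "tent d a x \<le> real d * (z - x)" using zx unfolding tent_def by simp
      have "1 - \<bar>real d * frac y - a\<bar> \<le> real d * (y - z)"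
        unfolding fy using assms by (simp add: algebra_simps)
      then have B: "tent d a y \<le> real d * (y - z)" using zx unfolding tent_def by simp
      have "real d * (z - x) \<le> real d * (y - x)" "real d * (y - z) \<le> real d * (y - x)"
        using zx by (auto intro: mult_left_mono)
      then show ?thesis using A B tent_bounds[of d a x] tent_bounds[of d a y] by linarith
    qed
  qed
  show ?thesis using main[of x y] main[of y x] by (cases "x \<le> y") (auto simp: abs_if split: if_splits)
qed

lemma continuous_tent:
  assumes "1 \<le> a" "a < d"
  shows "continuous_on S (tent d a)"
proof -
  have "d-lipschitz_on S (tent d a)"
    using tent_lipschitz[OF assms] by (auto simp: lipschitz_on_def dist_real_def)
  then show ?thesis by (rule lipschitz_on_continuous_on)
qed

lemma tent_add_int [simp]: "tent d a (x + of_int k) = tent d a x"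
  by (simp add: tent_def frac_def)

text \<open>Hats at consecutive integers form a partition of unity: only the two neighbours of
  \<open>d * frac x\<close> can be nonzero, and they add up to 1.\<close>

lemma tent_sum_le_1:
  assumes "finite S"
  shows "(\<Sum>a\<in>S. tent d a x) \<le> 1"
proof -
  define t where "t = real d * frac x"
  define i where "i = nat \<lfloor>t\<rfloor>"
  have t0: "t \<ge> 0" by (simp add: t_def)
  have i: "real i \<le> t" "t < real i + 1" using t0 unfolding i_def by linarith+
  have z: "tent d a x = 0" if "a \<notin> {i, Suc i}" for a
  proof -
    have "a < i \<or> a > Suc i" using that by auto
    then have "real a + 1 \<le> real i \<or> real a \<ge> real i + 2" by auto
    then have "\<bar>t - real a\<bar> \<ge> 1" using i by auto
    then show ?thesis unfolding tent_def t_def by simp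
  qed
  have "(\<Sum>a\<in>S. tent d a x) = (\<Sum>a\<in>S \<inter> {i, Suc i}. tent d a x)"
    using z assms by (intro sum.mono_neutral_right) auto
  also have "\<dots> \<le> (\<Sum>a\<in>{i, Suc i}. tent d a x)"
    by (intro sum_mono2) (auto simp: tent_bounds)
  also have "\<dots> = tent d i x + tent d (Suc i) x" by simp
  also have "\<dots> = 1" using i unfolding tent_def t_def[symmetric] by simp
  finally show ?thesis .
qed

text \<open>The kinks of the hat lie on the grid, so sampling integrates exactly: the rising edge
  contributes \<open>i / g\<close>, the falling edge \<open>1 - i / g\<close>, and these pair up to
  1.\<close>

lemma tent_grid_sum:
  assumes "1 \<le> a" "a < d" "0 < g"
  shows "(\<Sum>b<d * g. tent d a (real b / real (d * g))) = real g"
proof -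
  have v: "tent d a (real b / real (d * g)) = max 0 (1 - \<bar>real b / g - a\<bar>)" if "b < d * g" for b
  proof -
    have "real b < real (d * g)" using that by (simp only: of_nat_less_iff)
    moreover have "real (d * g) > 0" using assms by simp
    ultimately have "real b / real (d * g) < 1" by (simp only: divide_less_eq_1_pos)
    then have "frac (real b / real (d * g)) = real b / real (d * g)"
      by (simp only: frac_eq) simp
    then show ?thesis using assms by (simp add: tent_def)
  qed
  have sub: "(a - 1) * g \<le> a * g" "a * g \<le> (a + 1) * g" "(a + 1) * g \<le> d * g"
    using assms mult_right_mono[of "a + 1" d g] by (auto simp: Suc_leI)
  have "(\<Sum>b<d * g. tent d a (real b / real (d * g))) = (\<Sum>b<d * g. max 0 (1 - \<bar>real b / g - a\<bar>))"
    using v by (intro sum.cong) auto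
  also have "\<dots> = (\<Sum>b\<in>{(a - 1) * g..<(a + 1) * g}. max 0 (1 - \<bar>real b / g - a\<bar>))"
  proof (rule sum.mono_neutral_right)
    show "{(a - 1) * g..<(a + 1) * g} \<subseteq> {..<d * g}"
      using sub(3) by (meson atLeastLessThan_iff lessThan_iff less_le_trans subsetI)
    show "\<forall>b\<in>{..<d * g} - {(a - 1) * g..<(a + 1) * g}. max 0 (1 - \<bar>real b / g - a\<bar>) = 0"
    proof
      fix b assume "b \<in> {..<d * g} - {(a - 1) * g..<(a + 1) * g}"
      then have "b < (a - 1) * g \<or> (a + 1) * g \<le> b" by auto
      then have "real b < real ((a - 1) * g) \<or> real ((a + 1) * g) \<le> real b"
        by (simp only: of_nat_less_iff of_nat_le_iff)
      then have "real b / g \<le> real a - 1 \<or> real a + 1 \<le> real b / g"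
        using assms by (auto simp: field_simps of_nat_diff)
      then show "max 0 (1 - \<bar>real b / g - a\<bar>) = 0" by auto
    qed
  qed simp
  also have "\<dots> = (\<Sum>b\<in>{(a - 1) * g..<a * g}. max 0 (1 - \<bar>real b / g - a\<bar>))
     + (\<Sum>b\<in>{a * g..<(a + 1) * g}. max 0 (1 - \<bar>real b / g - a\<bar>))"
    using sub by (simp add: sum.atLeastLessThan_concat)
  also have "(\<Sum>b\<in>{(a - 1) * g..<a * g}. max 0 (1 - \<bar>real b / g - a\<bar>)) = (\<Sum>i<g. real i / g)"
  proof -
    have e: "a * g = g + (a - 1) * g" using assms by (cases a) auto
    have "(\<Sum>b\<in>{(a - 1) * g..<a * g}. max 0 (1 - \<bar>real b / g - a\<bar>))
      = (\<Sum>i\<in>{0..<g}. max 0 (1 - \<bar>real (i + (a - 1) * g) / g - a\<bar>))"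
      unfolding e using sum.shift_bounds_nat_ivl[of "\<lambda>b. max 0 (1 - \<bar>real b / g - a\<bar>)" 0 "(a-1)*g" g] by simp
    also have "\<dots> = (\<Sum>i<g. real i / g)"
    proof (rule sum.cong)
      fix i assume "i \<in> {..<g}"
      then have "real i / g \<le> 1" by simp
      moreover have "real (i + (a - 1) * g) / g - a = real i / g - 1"
        using assms by (simp add: field_simps of_nat_diff)
      ultimately show "max 0 (1 - \<bar>real (i + (a - 1) * g) / g - a\<bar>) = real i / g" by simp
    qed auto
    finally show ?thesis .
  qed
  also have "(\<Sum>b\<in>{a * g..<(a + 1) * g}. max 0 (1 - \<bar>real b / g - a\<bar>)) = (\<Sum>i<g. 1 - real i / g)"
  proof -
    have e: "(a + 1) * g = g + a * g" by simp
    have "(\<Sum>b\<in>{a * g..<(a + 1) * g}. max 0 (1 - \<bar>real b / g - a\<bar>))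
      = (\<Sum>i\<in>{0..<g}. max 0 (1 - \<bar>real (i + a * g) / g - a\<bar>))"
      unfolding e using sum.shift_bounds_nat_ivl[of "\<lambda>b. max 0 (1 - \<bar>real b / g - a\<bar>)" 0 "a*g" g] by simp
    also have "\<dots> = (\<Sum>i<g. 1 - real i / g)"
    proof (rule sum.cong)
      fix i assume "i \<in> {..<g}"
      then have "real i / g \<le> 1" by simp
      moreover have "real (i + a * g) / g - a = real i / g"
        using assms by (simp add: field_simps)
      ultimately show "max 0 (1 - \<bar>real (i + a * g) / g - a\<bar>) = 1 - real i / g" by simp
    qed auto
    finally show ?thesis .
  qed
  finally show ?thesis by (simp add: sum_subtractf)
qed

lemma abs_diff_trans:
  fixes p q c :: real
  shows "\<bar>p - q\<bar> \<le> a \<Longrightarrow> \<bar>q - c\<bar> \<le> b \<Longrightarrow> a + b \<le> e \<Longrightarrow> \<bar>p - c\<bar> \<le> e"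
  by linarith

lemma abs_diff_add:
  fixes p q :: real
  shows "\<bar>p - c\<bar> \<le> a \<Longrightarrow> \<bar>q - d\<bar> \<le> b \<Longrightarrow> a + b \<le> e \<Longrightarrow> \<bar>(p + q) - (c + d)\<bar> \<le> e"
  by linarith

section \<open>Cesaro averages and interval frequencies\<close>

definition avg_to :: "(nat \<Rightarrow> real) \<Rightarrow> real \<Rightarrow> bool" where
  "avg_to f c \<longleftrightarrow> (\<forall>\<epsilon>>0. \<exists>N0. \<forall>N\<ge>N0. \<bar>(\<Sum>j<N. f j) - c * real N\<bar> \<le> \<epsilon> * real N)"

lemma avg_to_sum:
  assumes "finite I" "\<And>i. i \<in> I \<Longrightarrow> avg_to (f i) (c i)"
  shows "avg_to (\<lambda>j. \<Sum>i\<in>I. f i j) (\<Sum>i\<in>I. c i)"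
  using assms
proof (induction I)
  case empty show ?case by (auto simp: avg_to_def)
next
  case (insert i I)
  show ?case unfolding avg_to_def
  proof (intro allI impI)
    fix e :: real assume e: "e > 0"
    obtain N1 where N1: "\<And>N. N \<ge> N1 \<Longrightarrow> \<bar>(\<Sum>j<N. f i j) - c i * real N\<bar> \<le> e/2 * real N"
      using insert.prems[of i] e unfolding avg_to_def by (metis half_gt_zero insertI1)
    obtain N2 where N2: "\<And>N. N \<ge> N2 \<Longrightarrow> \<bar>(\<Sum>j<N. \<Sum>i\<in>I. f i j) - (\<Sum>i\<in>I. c i) * real N\<bar> \<le> e/2 * real N"
      using insert e unfolding avg_to_def by (metis (no_types, lifting) half_gt_zero insertI2)
    show "\<exists>N0. \<forall>N\<ge>N0. \<bar>(\<Sum>j<N. \<Sum>i\<in>insert i I. f i j) - (\<Sum>i\<in>insert i I. c i) * real N\<bar> \<le> e * real N"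
    proof (intro exI[of _ "max N1 N2"] allI impI)
      fix N assume "N \<ge> max N1 N2"
      then show "\<bar>(\<Sum>j<N. \<Sum>i\<in>insert i I. f i j) - (\<Sum>i\<in>insert i I. c i) * real N\<bar> \<le> e * real N"
        using abs_diff_add[OF N1[of N] N2[of N], of "e * N"] insert.hyps
        by (simp add: sum.distrib ring_distribs)
    qed
  qed
qed

lemma avg_to_cmult:
  assumes "avg_to f c" shows "avg_to (\<lambda>j. k * f j) (k * c)"
  unfolding avg_to_def
proof (intro allI impI)
  fix e :: real assume e: "e > 0"
  then have "e / (\<bar>k\<bar> + 1) > 0" by simp
  then obtain N0 where N0: "\<And>N. N \<ge> N0 \<Longrightarrow> \<bar>(\<Sum>j<N. f j) - c * real N\<bar> \<le> e / (\<bar>k\<bar> + 1) * real N"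
    using assms unfolding avg_to_def by meson
  show "\<exists>N0. \<forall>N\<ge>N0. \<bar>(\<Sum>j<N. k * f j) - k * c * real N\<bar> \<le> e * real N"
  proof (intro exI[of _ N0] allI impI)
    fix N assume "N \<ge> N0"
    have "\<bar>(\<Sum>j<N. k * f j) - k * c * real N\<bar> = \<bar>k\<bar> * \<bar>(\<Sum>j<N. f j) - c * real N\<bar>"
      by (simp add: sum_distrib_left[symmetric] abs_mult[symmetric] algebra_simps)
    also have "\<dots> \<le> \<bar>k\<bar> * (e / (\<bar>k\<bar> + 1) * real N)" using N0[OF \<open>N \<ge> N0\<close>] by (intro mult_left_mono) auto
    also have "\<dots> = (\<bar>k\<bar> / (\<bar>k\<bar> + 1)) * (e * N)" by simp
    also have "\<dots> \<le> 1 * (e * N)" using e by (intro mult_right_mono) auto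
    finally show "\<bar>(\<Sum>j<N. k * f j) - k * c * real N\<bar> \<le> e * real N" by simp
  qed
qed

lemma avg_to_approx:
  assumes "\<And>\<epsilon>. \<epsilon> > 0 \<Longrightarrow> \<exists>g. avg_to g c \<and> (\<forall>j. \<bar>f j - g j\<bar> \<le> \<epsilon>)"
  shows "avg_to f c"
  unfolding avg_to_def
proof (intro allI impI)
  fix e :: real assume e: "e > 0"
  obtain g where g: "avg_to g c" "\<And>j. \<bar>f j - g j\<bar> \<le> e/2" using assms[of "e/2"] e by auto
  obtain N0 where N0: "\<And>N. N \<ge> N0 \<Longrightarrow> \<bar>(\<Sum>j<N. g j) - c * real N\<bar> \<le> e/2 * real N"
    using g(1) e unfolding avg_to_def by (metis half_gt_zero)
  show "\<exists>N0. \<forall>N\<ge>N0. \<bar>(\<Sum>j<N. f j) - c * real N\<bar> \<le> e * real N"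
  proof (intro exI[of _ N0] allI impI)
    fix N assume "N \<ge> N0"
    have "\<bar>(\<Sum>j<N. f j) - (\<Sum>j<N. g j)\<bar> \<le> (\<Sum>j<N. e/2)"
      unfolding sum_subtractf[symmetric] by (rule order_trans[OF sum_abs]) (intro sum_mono g(2))
    then show "\<bar>(\<Sum>j<N. f j) - c * real N\<bar> \<le> e * real N" using N0[OF \<open>N \<ge> N0\<close>] by (rule abs_diff_trans) simp
  qed
qed

definition interval_freq :: "(nat \<Rightarrow> real) \<Rightarrow> bool" where
  "interval_freq x \<longleftrightarrow> (\<forall>u v. 0 \<le> u \<longrightarrow> u < v \<longrightarrow> v \<le> 1 \<longrightarrow>
      avg_to (\<lambda>j. of_bool (u \<le> frac (x j) \<and> frac (x j) < v)) (v - u))"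

definition tent_freq :: "(nat \<Rightarrow> real) \<Rightarrow> bool" where
  "tent_freq x \<longleftrightarrow> (\<forall>d a. 1 \<le> a \<longrightarrow> a < d \<longrightarrow> avg_to (\<lambda>j. tent d a (x j)) (1 / real d))"

lemma card_eq_sum_of_bool:
  fixes N :: nat shows "real (card {n. n < N \<and> P n}) = (\<Sum>j<N. of_bool (P j))"
proof -
  have "real (card {j \<in> {..<N}. P j}) = (\<Sum>j\<in>{j \<in> {..<N}. P j}. 1)" by simp
  also have "\<dots> = (\<Sum>j<N. if P j then 1 else 0)" by (rule sum.inter_filter) simp
  finally show ?thesis by (simp add: of_bool_def)
qed

lemma discrepancy_seq:
  "discrepancy (map (\<lambda>j. frac (x j)) [0..<N]) =
   (SUP (u, v) \<in> {(u, v). 0 \<le> u \<and> u < v \<and> v \<le> 1}.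
      \<bar>(\<Sum>j<N. of_bool (u \<le> frac (x j) \<and> frac (x j) < v)) / real N - (v - u)\<bar>)"
proof -
  have "card {n. n < length (map (\<lambda>j. frac (x j)) [0..<N]) \<and> u \<le> map (\<lambda>j. frac (x j)) [0..<N] ! n \<and> map (\<lambda>j. frac (x j)) [0..<N] ! n < v}
    = card {n. n < N \<and> (u \<le> frac (x n) \<and> frac (x n) < v)}" for u v
    by (intro arg_cong[where f=card]) auto
  then show ?thesis unfolding discrepancy_def by (simp add: card_eq_sum_of_bool)
qed

lemma discrepancy_imp_interval_freq:
  assumes "(\<lambda>N. discrepancy (map (\<lambda>j. frac (x j)) [0..<N])) \<longlonglongrightarrow> 0"
  shows "interval_freq x"
  unfolding interval_freq_def avg_to_def
proof (intro allI impI)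
  fix u v e :: real assume uv: "0 \<le> u" "u < v" "v \<le> 1" and e: "e > 0"
  define S where "S N u v = (\<Sum>j<N. of_bool (u \<le> frac (x j) \<and> frac (x j) < v) :: real)" for N u v
  obtain N0 where N0: "\<And>N. N \<ge> N0 \<Longrightarrow> \<bar>discrepancy (map (\<lambda>j. frac (x j)) [0..<N])\<bar> < e"
    using LIMSEQ_D[OF assms e] by auto
  show "\<exists>N0. \<forall>N\<ge>N0. \<bar>(\<Sum>j<N. of_bool (u \<le> frac (x j) \<and> frac (x j) < v)) - (v - u) * real N\<bar> \<le> e * real N"
  proof (intro exI[of _ "max 1 N0"] allI impI)
    fix N assume N: "N \<ge> max 1 N0"
    have b: "0 \<le> S N u v / N" "S N u v / N \<le> 1" for u v
    proof -
      have "S N u v \<le> (\<Sum>j<N. 1)" unfolding S_def by (intro sum_mono) auto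
      then show "S N u v / N \<le> 1" using N by (simp add: divide_le_eq)
      show "0 \<le> S N u v / N" unfolding S_def by (auto intro!: divide_nonneg_nonneg sum_nonneg)
    qed
    have "\<bar>S N u v / N - (v - u)\<bar> \<le> discrepancy (map (\<lambda>j. frac (x j)) [0..<N])"
      unfolding discrepancy_seq S_def[symmetric]
    proof (rule cSUP_upper2[where x="(u,v)"])
      show "(u, v) \<in> {(u, v). 0 \<le> u \<and> u < v \<and> v \<le> 1}" using uv by simp
      have "\<bar>S N u v / N - (v - u)\<bar> \<le> 2" if "0 \<le> u" "u < v" "v \<le> 1" for u v
        using b[of u v] that by linarith
      then show "bdd_above ((\<lambda>(u, v). \<bar>S N u v / real N - (v - u)\<bar>) ` {(u, v). 0 \<le> u \<and> u < v \<and> v \<le> 1})"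
        by (intro bdd_aboveI[where M=2]) auto
    qed simp
    then have "\<bar>S N u v / N - (v - u)\<bar> \<le> e" using N0[of N] N by auto
    then have "\<bar>S N u v / N - (v - u)\<bar> * N \<le> e * N" by (rule mult_right_mono) simp
    also have "\<bar>S N u v / N - (v - u)\<bar> * N = \<bar>S N u v - (v - u) * N\<bar>"
      using N by (simp add: abs_mult_pos field_simps)
    finally show "\<bar>(\<Sum>j<N. of_bool (u \<le> frac (x j) \<and> frac (x j) < v)) - (v - u) * real N\<bar> \<le> e * real N"
      unfolding S_def .
  qed
qed

text \<open>The multiplier \<open>R\<close> is what lets normality to a power of a base descend to the base.\<close>

lemma interval_freq_imp_tent:
  assumes x: "interval_freq x" and R: "0 < R" and a: "1 \<le> a" "a < d"
  shows "avg_to (\<lambda>j. tent d a (real R * x j)) (1 / real d)"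
proof (rule avg_to_approx)
  fix e :: real assume e: "e > 0"
  obtain g0 :: nat where g0: "1 / e < real g0" using reals_Archimedean2 by blast
  define g where "g = Suc g0"
  have g: "0 < g" "1 / e \<le> real g" using g0 by (auto simp: g_def)
  \<comment> \<open>As a function of \<open>y\<close>, \<open>tent d a (R * y)\<close> has Lipschitz
    constant \<open>d * R\<close>, so freezing it on cells of length \<open>1 / L\<close> costs at
    most \<open>1 / g\<close>, which is at most \<open>e\<close>. Each of its \<open>R\<close>
    periods holds exactly \<open>d * g\<close> cells, as the exact grid sum requires.\<close>
  define L where "L = d * g * R"
  have L: "0 < L" using g a R by (simp add: L_def)
  define I where "I = (\<lambda>i::nat. \<lambda>j. real i / L \<le> frac (x j) \<and> frac (x j) < (real i + 1) / L)"
  define h where "h = (\<lambda>j. \<Sum>i<L. tent d a (real R * (real i / L)) * (of_bool (I i j) :: real))"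
  have "avg_to h (\<Sum>i<L. tent d a (real R * (real i / L)) * ((real i + 1) / L - real i / L))"
    unfolding h_def
  proof (intro avg_to_sum avg_to_cmult)
    fix i assume "i \<in> {..<L}"
    then have "real i + 1 \<le> L" by simp
    then show "avg_to (\<lambda>j. of_bool (I i j)) ((real i + 1) / real L - real i / real L)"
      using x L unfolding interval_freq_def I_def by (auto simp: divide_strict_right_mono)
  qed auto
  also have "(\<Sum>i<L. tent d a (real R * (real i / L)) * ((real i + 1) / L - real i / L)) = (\<Sum>i<L. tent d a (real R * (real i / L))) / L"
    unfolding sum_divide_distrib by (intro sum.cong) (auto simp: diff_divide_distrib[symmetric])
  also have "(\<Sum>i<L. tent d a (real R * (real i / L))) = (\<Sum>i<R * (d * g). tent d a (real i / real (d * g)))"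
  proof -
    have "L = R * (d * g)" by (simp add: L_def)
    moreover have "real R * (real i / L) = real i / real (d * g)" for i using R by (simp add: L_def)
    ultimately show ?thesis by simp
  qed
  also have "\<dots> = (\<Sum>m<R. \<Sum>i = m * (d * g)..<m * (d * g) + d * g. tent d a (real i / real (d * g)))"
    by (rule sum.nat_group[symmetric])
  also have "\<dots> = (\<Sum>m<R. real g)"
  proof (rule sum.cong)
    fix m assume "m \<in> {..<R}"
    have "(\<Sum>i = m * (d * g)..<m * (d * g) + d * g. tent d a (real i / real (d * g))) = (\<Sum>i<d * g. tent d a (real (i + m * (d * g)) / real (d * g)))"
      using sum.shift_bounds_nat_ivl[of "\<lambda>i. tent d a (real i / real (d * g))" 0 "m * (d*g)" "d*g"]
      by (simp add: add.commute atLeast0LessThan)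
    also have "\<dots> = (\<Sum>i<d * g. tent d a (real i / real (d * g)))"
    proof (rule sum.cong)
      fix i
      have "real (i + m * (d * g)) / real (d * g) = real i / real (d * g) + of_int (int m)"
        using a g by (simp add: field_simps)
      then show "tent d a (real (i + m * (d * g)) / real (d * g)) = tent d a (real i / real (d * g))"
        by (simp only: tent_add_int)
    qed auto
    also have "\<dots> = real g" by (rule tent_grid_sum) (use a g in auto)
    finally show "(\<Sum>i = m * (d * g)..<m * (d * g) + d * g. tent d a (real i / real (d * g))) = real g" .
  qed auto
  also have "(\<Sum>m<R. real g) / real L = 1 / d" using R g a by (simp add: L_def)
  finally have h: "avg_to h (1 / d)" .
  have "\<bar>tent d a (real R * x j) - h j\<bar> \<le> e" for j
  proof -
    define y where "y = frac (x j)"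
    have y: "0 \<le> y" "y < 1" by (auto simp: y_def frac_lt_1)
    define i0 where "i0 = nat \<lfloor>y * L\<rfloor>"
    have yL: "y * L < L" "0 \<le> y * L" using y L by auto
    then have "i0 < L" unfolding i0_def by linarith
    have i0: "real i0 \<le> y * L" "y * L < real i0 + 1" using yL unfolding i0_def by linarith+
    have I: "I i j \<longleftrightarrow> i = i0" for i
    proof -
      have "I i j \<longleftrightarrow> real i \<le> y * L \<and> y * L < real i + 1"
        using L unfolding I_def y_def[symmetric] by (auto simp: field_simps)
      also have "\<dots> \<longleftrightarrow> i = i0" using i0 by auto
      finally show ?thesis .
    qed
    have "h j = (\<Sum>i<L. if i = i0 then tent d a (real R * (real i / L)) else 0)"
      unfolding h_def I by (intro sum.cong) auto
    then have hj: "h j = tent d a (real R * (real i0 / L))" using \<open>i0 < L\<close> by simp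
    have "real R * x j = real R * y + of_int (int R * \<lfloor>x j\<rfloor>)" by (simp add: y_def frac_def algebra_simps)
    then have "tent d a (real R * x j) = tent d a (real R * y)" by (simp only: tent_add_int)
    then have "\<bar>tent d a (real R * x j) - h j\<bar> \<le> d * \<bar>real R * y - real R * (real i0 / L)\<bar>"
      unfolding hj using tent_lipschitz[OF a, of "real R * y" "real R * (real i0 / L)"] by simp
    also have "\<bar>real R * y - real R * (real i0 / L)\<bar> = R * \<bar>y - real i0 / L\<bar>"
      unfolding right_diff_distrib[symmetric] by (simp add: abs_mult)
    also have "\<bar>y - real i0 / L\<bar> \<le> 1 / L" 
    proof -
      have "y - real i0 / L = (y * L - i0) / L" using L by (simp add: field_simps)
      then show ?thesis using i0 L by (simp add: abs_divide divide_le_cancel)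
    qed
    also have "real d * (real R * (1 / L)) = 1 / g" using R a by (simp add: L_def)
    also have "\<dots> \<le> e" using g e by (simp add: field_simps)
    finally show ?thesis by (simp add: mult_left_mono)
  qed
  then show "\<exists>g. avg_to g (1 / d) \<and> (\<forall>j. \<bar>tent d a (real R * x j) - g j\<bar> \<le> e)" using h by blast
qed

text \<open>The hats supported inside the interval sum to a minorant of its indicator. About
  \<open>d * (v - u)\<close> of them fit, each with average close to \<open>1 / d\<close>; the
  boundary loses at most three, and the error \<open>1 / d^2\<close> per hat costs at most one more
  \<open>1 / d\<close>. Only the \<open>d - 1\<close> hats of one resolution enter, hence a
  threshold uniform in \<open>u\<close> and \<open>v\<close>.\<close>

lemma tent_freq_lower:
  assumes x: "tent_freq x" and e: "e > 0"
  shows "\<exists>N0. \<forall>N\<ge>N0. \<forall>u v. 0 \<le> u \<longrightarrow> u \<le> v \<longrightarrow> v \<le> 1 \<longrightarrow>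
     (v - u - e) * real N \<le> (\<Sum>j<N. of_bool (u \<le> frac (x j) \<and> frac (x j) < v))"
proof -
  obtain d0 :: nat where d0: "4 / e < real d0" using reals_Archimedean2 by blast
  define d where "d = Suc (Suc d0)"
  have d: "d \<ge> 2" "4 / e \<le> d" using d0 by (auto simp: d_def)
  have "\<exists>N0. \<forall>N\<ge>N0. \<bar>(\<Sum>j<N. tent d a (x j)) - 1/d * real N\<bar> \<le> 1/d^2 * real N" if "a \<in> {1..<d}" for a
  proof -
    have "(0::real) < 1/d^2" using d by simp
    then show ?thesis using x that unfolding tent_freq_def avg_to_def by (meson atLeastLessThan_iff)
  qed
  then obtain F where F: "\<And>a N. a \<in> {1..<d} \<Longrightarrow> N \<ge> F a \<Longrightarrow> \<bar>(\<Sum>j<N. tent d a (x j)) - 1/d * real N\<bar> \<le> 1/d^2 * real N"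
    by metis
  show ?thesis
  proof (intro exI[of _ "\<Sum>a\<in>{1..<d}. F a"] allI impI)
    fix N u v assume N: "(\<Sum>a\<in>{1..<d}. F a) \<le> N" and uv: "0 \<le> u" "u \<le> v" "v \<le> (1::real)"
    have FN: "F a \<le> N" if "a \<in> {1..<d}" for a
      using N member_le_sum[of a "{1..<d}" F] that by auto
    define S where "S = {a \<in> {1..<d}. u * d + 1 \<le> real a \<and> real a \<le> v * d - 1}"
    have "S \<subseteq> {1..<d}" "finite S" by (auto simp: S_def)
    have cS: "real (card S) \<ge> d * (v - u) - 3"
    proof (cases "d * (v - u) \<ge> 3")
      case True
      define p q where "p = nat \<lceil>u * d + 1\<rceil>" and "q = nat \<lfloor>v * d - 1\<rfloor>"
      have "v * d \<le> d" "u * d \<ge> 0" using uv by (auto simp: mult_left_le_one_le)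
      moreover have "v * d - u * d \<ge> 3" using True by (simp add: algebra_simps)
      ultimately have p: "u * d + 1 \<le> p" "p < u * d + 2" and q: "real q \<le> v * d - 1" "v * d - 2 < q"
        unfolding p_def q_def by linarith+
      have vd: "v * d \<le> d" using \<open>v * d \<le> d\<close> .
      have ud: "u * d \<ge> 0" using \<open>u * d \<ge> 0\<close> .
      have "{p..q} \<subseteq> S"
      proof
        fix a assume a: "a \<in> {p..q}"
        then have "real p \<le> real a" "real a \<le> real q" by auto
        then have "u * d + 1 \<le> real a" "real a \<le> v * d - 1" using p q by linarith+
        moreover have "real a < d" "real a \<ge> 1" using calculation vd ud by linarith+
        ultimately show "a \<in> S" by (auto simp: S_def)
      qed
      then have "card {p..q} \<le> card S" by (intro card_mono) (auto simp: S_def)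
      moreover have "real (card {p..q}) \<ge> real q + 1 - real p" by simp
      ultimately have "real (card S) \<ge> real q + 1 - real p" by linarith
      then show ?thesis using p q by (simp add: algebra_simps)
    qed auto
    have pt: "(\<Sum>a\<in>S. tent d a y) \<le> of_bool (u \<le> frac y \<and> frac y < v)" for y
    proof (cases "u \<le> frac y \<and> frac y < v")
      case True then show ?thesis using tent_sum_le_1[OF \<open>finite S\<close>] by simp
    next
      case False
      have "tent d a y = 0" if "a \<in> S" for a
      proof -
        have "d * frac y \<le> d * u \<or> d * v \<le> d * frac y" using False by (auto intro: mult_left_mono)
        moreover have "d * u + 1 \<le> a" "a \<le> d * v - 1" using that by (auto simp: S_def mult.commute)
        ultimately have "\<bar>real d * frac y - a\<bar> \<ge> 1" by linarith
        then show ?thesis by (simp add: tent_def)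
      qed
      then show ?thesis by simp
    qed
    have dpos: "1/d - 1/d^2 \<ge> (0::real)" using d by (simp add: field_simps power2_eq_square)
    have "v - u - e \<le> (d * (v - u) - 3) * (1/d - 1/d^2)"
    proof -
      have "(d * (v - u) - 3) * (1/d - 1/d^2) = (v - u) - (v - u)/d - 3 * (1/d - 1/d^2)"
        using d by (simp add: field_simps power2_eq_square)
      moreover have "(v - u)/d \<le> 1/d" using uv by (intro divide_right_mono) auto
      moreover have "1/d - 1/d^2 \<le> 1/(d::real)" by simp
      moreover have "4/d \<le> e" using d e by (simp add: field_simps)
      moreover have "4/d = 1/d + 3 * (1/(d::real))" by (simp add: field_simps)
      ultimately show ?thesis by argo
    qed
    also have "\<dots> \<le> card S * (1/d - 1/d^2)" using cS dpos by (intro mult_right_mono) auto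
    finally have "(v - u - e) * N \<le> card S * (1/d - 1/d^2) * N" by (rule mult_right_mono) simp
    also have "\<dots> = (\<Sum>a\<in>S. (1/d - 1/d^2) * N)" by simp
    also have "\<dots> \<le> (\<Sum>a\<in>S. \<Sum>j<N. tent d a (x j))"
    proof (rule sum_mono)
      fix a assume "a \<in> S"
      then have "a \<in> {1..<d}" by (auto simp: S_def)
      from F[OF this FN[OF this]] show "(1/d - 1/d^2) * N \<le> (\<Sum>j<N. tent d a (x j))"
        by (simp add: algebra_simps abs_le_iff)
    qed
    also have "\<dots> = (\<Sum>j<N. \<Sum>a\<in>S. tent d a (x j))" by (rule sum.swap)
    also have "\<dots> \<le> (\<Sum>j<N. of_bool (u \<le> frac (x j) \<and> frac (x j) < v))" by (intro sum_mono pt)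
    finally show "(v - u - e) * N \<le> (\<Sum>j<N. of_bool (u \<le> frac (x j) \<and> frac (x j) < v))" .
  qed
qed

text \<open>Lower bounds suffice: the counts in [0, u), [u, v) and [v, 1) add up to
  \<open>N\<close>, so lower bounds on the outer two bound the middle one from above, with twice the
  error.\<close>

lemma tent_freq_imp_discrepancy:
  assumes x: "tent_freq x"
  shows "(\<lambda>N. discrepancy (map (\<lambda>j. frac (x j)) [0..<N])) \<longlonglongrightarrow> 0"
proof (rule LIMSEQ_I)
  fix e :: real assume e: "e > 0"
  define S where "S N u v = (\<Sum>j<N. of_bool (u \<le> frac (x j) \<and> frac (x j) < v) :: real)" for N u v
  have "e/4 > 0" using e by simp
  from tent_freq_lower[OF x this] obtain N0 where N0: "\<And>N u v. N \<ge> N0 \<Longrightarrow> 0 \<le> u \<Longrightarrow> u \<le> v \<Longrightarrow> v \<le> 1 \<Longrightarrow> (v - u - e/4) * N \<le> S N u v"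
    unfolding S_def by blast
  show "\<exists>n0. \<forall>N\<ge>n0. norm (discrepancy (map (\<lambda>j. frac (x j)) [0..<N]) - 0) < e"
  proof (intro exI[of _ "max 1 N0"] allI impI)
    fix N assume N: "N \<ge> max 1 N0"
    have b: "\<bar>S N u v / N - (v - u)\<bar> \<le> e/2" if uv: "0 \<le> u" "u < v" "v \<le> 1" for u v
    proof -
      have "S N 0 u + S N u v + S N v 1 = (\<Sum>j<N. 1)"
        unfolding S_def sum.distrib[symmetric]
        using uv by (intro sum.cong) (auto simp: frac_lt_1)
      then have t: "S N 0 u + S N u v + S N v 1 = N" by simp
      have "(u - 0 - e/4) * N \<le> S N 0 u" "(1 - v - e/4) * N \<le> S N v 1" "(v - u - e/4) * N \<le> S N u v"
        using N0[of N 0 u] N0[of N u v] N0[of N v 1] N uv by auto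
      with t have "(v - u - e/4) * N \<le> S N u v" "S N u v \<le> (v - u + e/2) * N"
        by (auto simp: algebra_simps)
      then have "v - u - e/4 \<le> S N u v / N" "S N u v / N \<le> v - u + e/2"
        using N by (auto simp: field_simps)
      then show ?thesis using e by linarith
    qed
    let ?D = "discrepancy (map (\<lambda>j. frac (x j)) [0..<N])"
    have "?D \<le> e/2"
      unfolding discrepancy_seq S_def[symmetric]
    proof (rule cSUP_least)
      have "(0, 1) \<in> {(u, v). 0 \<le> u \<and> u < v \<and> v \<le> (1::real)}" by simp
      then show "{(u, v). 0 \<le> u \<and> u < v \<and> v \<le> (1::real)} \<noteq> {}" by blast
    qed (use b in auto)
    moreover have "0 \<le> ?D"
      unfolding discrepancy_seq S_def[symmetric]
    proof (rule cSUP_upper2[where x="(0,1)"])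
      show "bdd_above ((\<lambda>(u, v). \<bar>S N u v / real N - (v - u)\<bar>) ` {(u, v). 0 \<le> u \<and> u < v \<and> v \<le> 1})"
        by (rule bdd_aboveI[where M="e/2"]) (use b in auto)
    qed simp_all
    ultimately show "norm (?D - 0) < e" using e by simp
  qed
qed

lemma normal_iff_tent_freq: "normal_to_base r \<xi> \<longleftrightarrow> tent_freq (\<lambda>j. real r ^ j * \<xi>)"
proof
  assume "normal_to_base r \<xi>"
  then have "interval_freq (\<lambda>j. real r ^ j * \<xi>)"
    unfolding normal_to_base_def by (rule discrepancy_imp_interval_freq)
  from interval_freq_imp_tent[OF this, of 1] show "tent_freq (\<lambda>j. real r ^ j * \<xi>)"
    by (simp add: tent_freq_def)
next
  assume "tent_freq (\<lambda>j. real r ^ j * \<xi>)"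
  then show "normal_to_base r \<xi>" unfolding normal_to_base_def by (rule tent_freq_imp_discrepancy)
qed

lemma normal_interval_freq: "normal_to_base r \<xi> \<Longrightarrow> interval_freq (\<lambda>j. real r ^ j * \<xi>)"
  unfolding normal_to_base_def by (rule discrepancy_imp_interval_freq)

text \<open>Write the exponent as \<open>q * e + t\<close> with \<open>t < e\<close>. For fixed
  \<open>t\<close> the points are \<open>r^t\<close> times the orbit in base \<open>r^e\<close>, and
  \<open>r^t\<close> is the multiplier allowed in \<open>interval_freq_imp_tent\<close>. Summing
  over \<open>t\<close> settles complete blocks of length \<open>e\<close>; an incomplete last block
  changes the sum by at most \<open>e\<close>.\<close>

lemma normal_power_imp_normal:
  assumes "normal_to_base (r ^ e) \<xi>" "0 < e" "0 < r"
  shows "normal_to_base r \<xi>"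
  unfolding normal_iff_tent_freq tent_freq_def
proof (intro allI impI)
  fix d a :: nat assume a: "1 \<le> a" "a < d"
  define f where "f = (\<lambda>j. tent d a (real r ^ j * \<xi>))"
  have "avg_to (\<lambda>q. \<Sum>t<e. tent d a (real (r ^ t) * (real (r ^ e) ^ q * \<xi>))) (\<Sum>t<e. 1/d)"
    using assms a by (intro avg_to_sum interval_freq_imp_tent normal_interval_freq) auto
  also have "(\<lambda>q. \<Sum>t<e. tent d a (real (r ^ t) * (real (r ^ e) ^ q * \<xi>))) = (\<lambda>q. sum f {q * e..<q * e + e})"
  proof
    fix q
    have "sum f {q * e..<q * e + e} = (\<Sum>t<e. f (t + q * e))"
      using sum.shift_bounds_nat_ivl[of f 0 "q*e" e] by (simp add: add.commute atLeast0LessThan)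
    also have "\<dots> = (\<Sum>t<e. tent d a (real (r ^ t) * (real (r ^ e) ^ q * \<xi>)))"
      by (simp add: f_def power_add power_mult mult.assoc mult.commute[of q e])
    finally show "(\<Sum>t<e. tent d a (real (r ^ t) * (real (r ^ e) ^ q * \<xi>))) = sum f {q * e..<q * e + e}" by simp
  qed
  finally have av: "avg_to (\<lambda>q. sum f {q * e..<q * e + e}) (e/d)" by simp
  show "avg_to (\<lambda>j. tent d a (real r ^ j * \<xi>)) (1/d)"
    unfolding avg_to_def f_def[symmetric]
  proof (intro allI impI)
    fix \<epsilon> :: real assume e: "\<epsilon> > 0"
    then obtain Q0 where Q0: "\<And>Q. Q \<ge> Q0 \<Longrightarrow> \<bar>sum f {..<Q * e} - e/d * Q\<bar> \<le> \<epsilon>/2 * Q"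
      using av unfolding avg_to_def sum.nat_group by (metis half_gt_zero)
    obtain N1 :: nat where N1: "2 * real e / \<epsilon> < N1" using reals_Archimedean2 by blast
    show "\<exists>N0. \<forall>N\<ge>N0. \<bar>sum f {..<N} - 1/d * real N\<bar> \<le> \<epsilon> * real N"
    proof (intro exI[of _ "max (Q0 * e) N1"] allI impI)
      fix N assume N: "N \<ge> max (Q0 * e) N1"
      define Q where "Q = N div e"
      have Q: "Q * e \<le> N" "N < Q * e + e" using assms(2) unfolding Q_def
        by (simp, metis mod_less_divisor div_mult_mod_eq nat_add_left_cancel_less add.commute)
      have "Q0 \<le> Q" using N assms(2) unfolding Q_def by (simp add: less_eq_div_iff_mult_less_eq)
      have "Q \<le> N" using Q(1) assms(2) by (metis Q_def div_le_dividend)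
      have "sum f {..<N} = sum f {..<Q * e} + sum f {Q * e..<N}"
        using Q(1) by (metis atLeast0LessThan le0 sum.atLeastLessThan_concat)
      moreover have "\<bar>(sum f {..<Q * e} + sum f {Q * e..<N}) - 1/d * N\<bar> \<le> \<bar>sum f {..<Q * e} - e/d * Q\<bar> + \<bar>sum f {Q*e..<N} - 1/d * (real N - real (Q * e))\<bar>"
        by (rule order_trans[OF _ abs_triangle_ineq]) (simp add: algebra_simps)
      moreover have "\<bar>sum f {Q*e..<N} - 1/d * (real N - real (Q * e))\<bar> \<le> e"
      proof -
        have "0 \<le> sum f {Q*e..<N}" by (intro sum_nonneg) (auto simp: f_def tent_bounds)
        moreover have "sum f {Q*e..<N} \<le> (\<Sum>j\<in>{Q*e..<N}. 1)" by (intro sum_mono) (auto simp: f_def tent_bounds)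
        moreover have "(\<Sum>j\<in>{Q*e..<N}. 1 :: real) \<le> e"
        proof -
          have "N - Q * e \<le> e" using Q by linarith
          then have "real (N - Q * e) \<le> e" by (simp only: of_nat_le_iff)
          then show ?thesis by simp
        qed
        ultimately have *: "sum f {Q*e..<N} \<le> e" by linarith
        have "0 \<le> sum f {Q*e..<N}" by (intro sum_nonneg) (auto simp: f_def tent_bounds)
        moreover have "0 \<le> 1/d * (real N - real (Q * e))" using Q(1)
          by (metis diff_ge_0_iff_ge mult_nonneg_nonneg of_nat_0_le_iff of_nat_le_iff zero_le_divide_1_iff)
        moreover have "1/d * (real N - real (Q * e)) \<le> 1 * real e"
        proof (intro mult_mono)
          have "real N \<le> real (Q * e + e)" using Q(2) by (simp only: of_nat_le_iff)
          then show "real N - real (Q * e) \<le> e" by simp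
          show "0 \<le> real N - real (Q * e)" using Q(1) by (metis diff_ge_0_iff_ge of_nat_le_iff)
        qed (use a in auto)
        ultimately show ?thesis using * by linarith
      qed
      moreover have "\<bar>sum f {..<Q * e} - e/d * Q\<bar> \<le> \<epsilon>/2 * Q" by (rule Q0) fact
      moreover have "\<epsilon>/2 * Q \<le> \<epsilon>/2 * N" using \<open>Q \<le> N\<close> e by (intro mult_left_mono) auto
      moreover have "real e \<le> \<epsilon>/2 * N"
      proof -
        have "2 * real e / \<epsilon> \<le> N" using N N1 by linarith
        then show ?thesis using e by (simp add: field_simps)
      qed
      ultimately show "\<bar>sum f {..<N} - 1/d * real N\<bar> \<le> \<epsilon> * N" by (simp add: algebra_simps)
    qed
  qed
qed

section \<open>Exponential sums\<close>

definition e1 :: "real \<Rightarrow> complex" where "e1 t = cis (2 * pi * t)"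

lemma e1_add: "e1 (s + t) = e1 s * e1 t"
  by (simp add: e1_def cis_mult ring_distribs)

lemma norm_e1 [simp]: "cmod (e1 t) = 1"
  by (simp add: e1_def)

lemma e1_of_int [simp]: "e1 (of_int k) = 1"
  unfolding e1_def by (rule cis_multiple_2pi) simp

lemma e1_0 [simp]: "e1 0 = 1"
  by (simp add: e1_def)

lemma e1_uminus: "e1 (- t) = cnj (e1 t)"
  by (simp add: e1_def cis_cnj)

lemma e1_mult_nat: "e1 (real n * t) = e1 t ^ n"
  unfolding e1_def Complex.DeMoivre by (simp add: mult_ac)

lemma e1_eq_1_iff: "e1 t = 1 \<longleftrightarrow> t \<in> \<int>"
proof
  assume "e1 t = 1"
  then have "cos (2 * pi * t) = 1" by (simp add: e1_def complex_eq_iff)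
  then obtain n :: int where "2 * pi * t = of_int n * 2 * pi" using cos_one_2pi_int by blast
  then have "t = of_int n" by simp
  then show "t \<in> \<int>" by simp
qed (auto elim!: Ints_cases)

lemma sum_roots_of_unity:
  fixes m :: int
  assumes "q > 0"
  shows "(\<Sum>b<q. e1 (of_int m * (x - real b / real q))) = (if int q dvd m then of_nat q * e1 (of_int m * x) else 0)"
proof -
  define w where "w = e1 (- of_int m / q)"
  have "e1 (of_int m * (x - real b / real q)) = e1 (of_int m * x) * w ^ b" for b
    unfolding w_def e1_mult_nat[symmetric] e1_add[symmetric] by (simp add: algebra_simps)
  then have *: "(\<Sum>b<q. e1 (of_int m * (x - real b / real q))) = e1 (of_int m * x) * (\<Sum>b<q. w ^ b)"
    by (simp add: sum_distrib_left)
  show ?thesis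
  proof (cases "int q dvd m")
    case True
    then obtain c where "m = int q * c" by blast
    then have "- of_int m / real q = of_int (- c)" using assms by simp
    then have "w = 1" unfolding w_def by (simp only: e1_of_int)
    then show ?thesis unfolding * using True by simp
  next
    case False
    have "w \<noteq> 1"
    proof
      assume "w = 1"
      then obtain c :: int where "- of_int m / real q = of_int c" unfolding w_def e1_eq_1_iff by (erule Ints_cases)
      then have "real_of_int m = of_int (int q * (- c))" using assms by (simp add: field_simps)
      then have "m = int q * (- c)" by (simp only: of_int_eq_iff)
      then show False using False by simp
    qed
    moreover have "w ^ q = 1"
    proof -
      have "w ^ q = e1 (of_int (- m))" unfolding w_def e1_mult_nat[symmetric] using assms by simp
      then show ?thesis by (simp only: e1_of_int)
    qed
    ultimately have "(\<Sum>b<q. w ^ b) = 0" by (simp add: geometric_sum)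
    then show ?thesis unfolding * using False by simp
  qed
qed

section \<open>Distance to the nearest integer and the kernel of cosine powers\<close>

lemma sin_ge_linear:
  assumes "0 \<le> z" "z \<le> 1/2"
  shows "z \<le> sin (pi * z)"
\<comment> \<open>Up to 1/3 the function \<open>sin x - x / 2\<close> has nonnegative derivative;
  beyond, monotonicity gives a sine of at least 1/2.\<close>
proof (cases "z \<le> 1/3")
  case True
  have "(\<lambda>x. sin x - x / 2) 0 \<le> (\<lambda>x. sin x - x / 2) (pi * z)"
  proof (rule DERIV_nonneg_imp_nondecreasing[where f="\<lambda>x. sin x - x / 2" and a=0 and b="pi * z"])
    fix x assume x: "0 \<le> x" "x \<le> pi * z"
    have "pi * z \<le> pi / 3" using True by simp
    then have "x \<le> pi / 3" "pi / 3 \<le> pi" using x pi_ge_zero by linarith+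
    then have "cos (pi / 3) \<le> cos x" using x by (intro cos_monotone_0_pi_le) auto
    then have "0 \<le> cos x - 1/2" by (simp add: cos_60)
    moreover have "((\<lambda>x. sin x - x / 2) has_real_derivative cos x - 1/2) (at x)"
      by (auto intro!: derivative_eq_intros)
    ultimately show "\<exists>y. ((\<lambda>x. sin x - x / 2) has_real_derivative y) (at x) \<and> 0 \<le> y" by blast
  qed (use assms in auto)
  moreover have "z \<le> pi * z / 2" using assms pi_ge_two mult_right_mono[of 2 pi z] by simp
  ultimately show ?thesis by simp
next
  case False
  have "sin (pi / 6) \<le> sin (pi * z)"
    using assms False by (intro sin_monotone_2pi_le) auto
  then show ?thesis using assms by (simp add: sin_30)
qed

definition idist :: "real \<Rightarrow> real" where "idist y = \<bar>y - of_int (round y)\<bar>"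

lemma idist_nonneg: "0 \<le> idist y"
  by (simp add: idist_def)

lemma idist_le_sin: "idist y \<le> \<bar>sin (pi * y)\<bar>"
proof -
  define z where "z = y - of_int (round y)"
  have z: "\<bar>z\<bar> \<le> 1/2" using of_int_round_abs_le[of y] by (simp add: z_def abs_minus_commute)
  have "sin (pi * y) = sin (pi * z) * cos (pi * of_int (round y))"
  proof -
    have "pi * y = pi * z + pi * of_int (round y)" by (simp add: z_def algebra_simps)
    then show ?thesis by (simp add: sin_add sin_int_times_real)
  qed
  moreover have "\<bar>cos (pi * of_int (round y))\<bar> = 1"
  proof -
    have "sin (pi * of_int (round y)) = 0" by (metis mult.commute sin_npi_int)
    then show ?thesis using sin_cos_squared_add[of "pi * of_int (round y)"] by (simp add: power2_eq_1_iff)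
  qed
  ultimately have "\<bar>sin (pi * y)\<bar> = \<bar>sin (pi * z)\<bar>" by (simp add: abs_mult)
  moreover have "\<bar>z\<bar> \<le> \<bar>sin (pi * z)\<bar>"
    using sin_ge_linear[of z] sin_ge_linear[of "- z"] z by (cases "z \<ge> 0") auto
  ultimately show ?thesis by (simp add: idist_def z_def)
qed

lemma cos_power_expansion:
  "complex_of_real (cos (pi * y) ^ (2 * H)) =
     (\<Sum>k\<le>2 * H. of_real (real (2 * H choose k) / 4 ^ H) * e1 (of_int (int k - int H) * y))"
proof -
  have "complex_of_real (cos (pi * y)) = (cis (pi * y) + cis (- (pi * y))) / 2"
    by (simp add: complex_eq_iff)
  then have "complex_of_real (cos (pi * y) ^ (2 * H)) = ((cis (pi * y) + cis (- (pi * y))) / 2) ^ (2 * H)"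
    by (simp only: of_real_power)
  also have "\<dots> = (cis (pi * y) + cis (- (pi * y))) ^ (2 * H) / 4 ^ H"
    unfolding power_divide by (simp add: power_mult)
  also have "(cis (pi * y) + cis (- (pi * y))) ^ (2 * H) =
     (\<Sum>k\<le>2 * H. of_nat (2 * H choose k) * cis (pi * y) ^ k * cis (- (pi * y)) ^ (2 * H - k))"
    by (rule binomial_ring)
  also have "\<dots> = (\<Sum>k\<le>2 * H. of_nat (2 * H choose k) * e1 (of_int (int k - int H) * y))"
  proof (rule sum.cong)
    fix k assume "k \<in> {..2 * H}"
    then have "real k * (pi * y) + real (2 * H - k) * (- (pi * y)) = 2 * pi * (of_int (int k - int H) * y)"
      by (simp add: of_nat_diff algebra_simps)
    then show "of_nat (2 * H choose k) * cis (pi * y) ^ k * cis (- (pi * y)) ^ (2 * H - k) = of_nat (2 * H choose k) * e1 (of_int (int k - int H) * y)"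
      by (simp only: Complex.DeMoivre cis_mult e1_def mult.assoc)
  qed auto
  finally show ?thesis by (simp add: sum_divide_distrib)
qed

text \<open>Every frequency \<open>k - H\<close> has modulus at most \<open>H < q\<close>, so
  summing over the \<open>q\<close> grid points removes all but frequency zero. The total weight of
  the translates is therefore independent of \<open>x\<close>.\<close>

lemma cos_power_grid_sum:
  assumes "H < q"
  shows "(\<Sum>b<q. cos (pi * (x - real b / real q)) ^ (2 * H)) = real q * real (2 * H choose H) / 4 ^ H"
proof -
  have "complex_of_real (\<Sum>b<q. cos (pi * (x - real b / real q)) ^ (2 * H))
    = (\<Sum>b<q. \<Sum>k\<le>2 * H. of_real (real (2 * H choose k) / 4 ^ H) * e1 (of_int (int k - int H) * (x - real b / real q)))"
    by (simp only: of_real_sum cos_power_expansion)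
  also have "\<dots> = (\<Sum>k\<le>2 * H. of_real (real (2 * H choose k) / 4 ^ H) * (\<Sum>b<q. e1 (of_int (int k - int H) * (x - real b / real q))))"
    unfolding sum_distrib_left by (rule sum.swap)
  also have "\<dots> = (\<Sum>k\<le>2 * H. if k = H then of_real (real (2 * H choose H) / 4 ^ H) * of_nat q else 0)"
  proof (rule sum.cong)
    fix k assume k: "k \<in> {..2 * H}"
    show "of_real (real (2 * H choose k) / 4 ^ H) * (\<Sum>b<q. e1 (of_int (int k - int H) * (x - real b / real q)))
       = (if k = H then of_real (real (2 * H choose H) / 4 ^ H) * of_nat q else 0)"
    proof (cases "k = H")
      case False
      have "\<not> int q dvd int k - int H"
      proof
        assume "int q dvd int k - int H"
        then have "\<bar>int q\<bar> \<le> \<bar>int k - int H\<bar>" using False by (intro dvd_imp_le_int) auto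
        then show False using k assms by auto
      qed
      moreover have "0 < q" using assms by simp
      ultimately show ?thesis using False by (simp add: sum_roots_of_unity del: of_int_diff)
    qed simp
  qed auto
  also have "\<dots> = complex_of_real (real q * real (2 * H choose H) / 4 ^ H)" by simp
  finally show ?thesis by (simp only: of_real_eq_iff)
qed

text \<open>Gives the ratio of the total weights of the kernels of orders \<open>H + 1\<close> and
  \<open>H\<close>, from which the second moment of the kernel is read off.\<close>

lemma central_binomial_Suc: "(real H + 1) * real (2 * Suc H choose Suc H) = 2 * (2 * real H + 1) * real (2 * H choose H)"
proof -
  have "Suc (2 * H + 1) * (2 * H + 1 choose H) = (Suc (2 * H + 1) choose Suc H) * Suc H"
    by (rule Suc_times_binomial_eq)
  moreover have "Suc (2 * H) * (2 * H choose H) = (Suc (2 * H) choose Suc H) * Suc H"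
    by (rule Suc_times_binomial_eq)
  moreover have "(Suc (2 * H) choose Suc H) = (2 * H + 1 choose H)"
    using binomial_symmetric[of H "2 * H + 1"] by simp
  ultimately have "Suc H * (2 * Suc H choose Suc H) = 2 * (Suc (2 * H) * (2 * H choose H))"
    by (simp add: algebra_simps)
  then have "real (Suc H * (2 * Suc H choose Suc H)) = real (2 * (Suc (2 * H) * (2 * H choose H)))"
    by (simp only: )
  then show ?thesis by (simp add: algebra_simps del: binomial_Suc_Suc)
qed

text \<open>A quantitative Weyl criterion: the tent is sampled at \<open>d (H + 1)\<close> points and interpolated with
  translates of the trigonometric kernel \<open>cos\<^sup>2\<^sup>H\<close>, whose first moment is \<open>O(1 / sqrt H)\<close>.\<close>

lemma weyl_tent:
  fixes x :: "'a \<Rightarrow> real"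
  assumes J: "finite J" and a: "1 \<le> a" "a < d"
  shows "\<bar>\<Sum>j\<in>J. (tent d a (x j) - 1 / d)\<bar> \<le>
     2 * (\<Sum>h=1..H. cmod (\<Sum>j\<in>J. e1 (real h * x j))) + real (card J) * real d / sqrt (2 * (real H + 1))"
proof -
  \<comment> \<open>A multiple of \<open>d\<close>, so that the tent is summed exactly over the
    grid, and larger than \<open>H + 1\<close>, so that the kernels of orders \<open>H\<close> and
    \<open>H + 1\<close> both have constant total weight.\<close>
  define q where "q = d * (H + 1)"
  have "2 * (H + 1) \<le> q" unfolding q_def using a by (intro mult_right_mono) auto
  then have q: "H < q" "Suc H < q" "0 < q" by auto
  define K where "K y = cos (pi * y) ^ (2 * H)" for y
  define \<kappa> where "\<kappa> = real q * real (2 * H choose H) / 4 ^ H"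
  have C0: "real (2 * H choose H) > 0" by simp
  have \<kappa>: "\<kappa> > 0" using q C0 by (simp add: \<kappa>_def)
  have K0: "0 \<le> K y" for y by (simp add: K_def power_mult)
  have Ksum: "(\<Sum>b<q. K (x - real b / q)) = \<kappa>" for x
    unfolding K_def \<kappa>_def by (rule cos_power_grid_sum) (rule q)
  \<comment> \<open>The second moment of the sine is \<open>\<alpha>^2\<close> times the total
    weight; with this choice the two terms of
    \<open>u \<le> \<alpha> / 2 + u^2 / (2 * \<alpha>)\<close> balance.\<close>
  define \<alpha> where "\<alpha> = 1 / sqrt (2 * (real H + 1))"
  have \<alpha>: "\<alpha> > 0" "\<alpha>^2 = 1 / (2 * (real H + 1))" by (auto simp: \<alpha>_def power_divide)
  have moment: "(\<Sum>b<q. idist (x - real b / q) * K (x - real b / q)) \<le> \<alpha> * \<kappa>" for x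
  proof -
    have "(\<Sum>b<q. idist (x - real b / q) * K (x - real b / q)) \<le> (\<Sum>b<q. (\<alpha>/2 + sin (pi * (x - real b / q))^2 / (2 * \<alpha>)) * K (x - real b / q))"
    proof (intro sum_mono mult_right_mono K0)
      fix b
      define u where "u = idist (x - real b / q)"
      have "u^2 \<le> sin (pi * (x - real b / q))^2"
        using idist_le_sin[of "x - real b / q"] by (metis abs_le_square_iff abs_of_nonneg idist_nonneg u_def)
      then have "u^2 / (2 * \<alpha>) \<le> sin (pi * (x - real b / q))^2 / (2 * \<alpha>)" using \<alpha> by (intro divide_right_mono) auto
      moreover have "u \<le> \<alpha>/2 + u^2 / (2 * \<alpha>)"
      proof -
        have "0 \<le> (u - \<alpha>)^2 / (2 * \<alpha>)" using \<alpha> by simp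
        also have "\<dots> = u^2 / (2 * \<alpha>) - u + \<alpha>/2" using \<alpha>(1) by (simp add: power2_eq_square field_simps)
        finally show ?thesis by simp
      qed
      ultimately show "idist (x - real b / q) \<le> \<alpha>/2 + sin (pi * (x - real b / q))^2 / (2 * \<alpha>)" unfolding u_def by linarith
    qed
    also have "\<dots> = \<alpha>/2 * (\<Sum>b<q. K (x - real b / q)) + ((\<Sum>b<q. K (x - real b / q)) - (\<Sum>b<q. cos (pi * (x - real b / q)) ^ (2 * Suc H))) / (2 * \<alpha>)"
    proof -
      have "(\<alpha>/2 + sin (pi * (x - real b / q))^2 / (2 * \<alpha>)) * K (x - real b / q) = \<alpha>/2 * K (x - real b / q) + (K (x - real b / q) - cos (pi * (x - real b / q)) ^ (2 * Suc H)) / (2 * \<alpha>)" for b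
      proof -
        have "cos (pi * (x - real b / q)) ^ (2 * Suc H) = (1 - sin (pi * (x - real b / q))^2) * K (x - real b / q)"
          by (simp add: K_def cos_squared_eq[symmetric] power_add[symmetric])
        then show ?thesis by (simp add: algebra_simps)
      qed
      then show ?thesis by (simp add: sum.distrib sum_distrib_left sum_subtractf sum_divide_distrib diff_divide_distrib)
    qed
    also have "(\<Sum>b<q. cos (pi * (x - real b / q)) ^ (2 * Suc H)) = \<kappa> * ((2 * real H + 1) / (2 * real H + 2))"
    proof -
      have "(\<Sum>b<q. cos (pi * (x - real b / q)) ^ (2 * Suc H)) = real q * real (2 * Suc H choose Suc H) / 4 ^ Suc H"
        by (rule cos_power_grid_sum) (rule q)
      also have "real (2 * Suc H choose Suc H) = 2 * (2 * real H + 1) * real (2 * H choose H) / (real H + 1)"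
        using central_binomial_Suc[of H] by (simp add: eq_divide_eq mult.commute del: binomial_Suc_Suc)
      also have "real q * (2 * (2 * real H + 1) * real (2 * H choose H) / (real H + 1)) / 4 ^ Suc H = \<kappa> * ((2 * real H + 1) / (2 * real H + 2))"
        unfolding \<kappa>_def by (simp add: divide_simps) (simp add: algebra_simps)
      finally show ?thesis .
    qed
    also have "\<alpha>/2 * (\<Sum>b<q. K (x - real b / q)) + ((\<Sum>b<q. K (x - real b / q)) - \<kappa> * ((2 * real H + 1) / (2 * real H + 2))) / (2 * \<alpha>)
       = \<alpha>/2 * \<kappa> + \<kappa> * \<alpha>^2 / (2 * \<alpha>)"
    proof -
      have "\<kappa> - \<kappa> * ((2 * real H + 1) / (2 * real H + 2)) = \<kappa> * \<alpha>^2" unfolding \<alpha>(2) by (simp add: field_simps)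
      then show ?thesis unfolding Ksum by simp
    qed
    also have "\<dots> = \<alpha> * \<kappa>" using \<alpha>(1) by (simp add: power2_eq_square)
    finally show ?thesis .
  qed
  define T where "T x = (\<Sum>b<q. tent d a (real b / q) * K (x - real b / q)) / \<kappa>" for x
  have approx: "\<bar>tent d a y - T y\<bar> \<le> d * \<alpha>" for y
  proof -
    have "tent d a y - T y = (\<Sum>b<q. (tent d a y - tent d a (real b / q)) * K (y - real b / q)) / \<kappa>"
    proof -
      have "tent d a y = (\<Sum>b<q. tent d a y * K (y - real b / q)) / \<kappa>"
        unfolding sum_distrib_left[symmetric] Ksum using \<kappa> by simp
      then show ?thesis by (simp add: T_def left_diff_distrib sum_subtractf diff_divide_distrib)
    qed
    then have "\<bar>tent d a y - T y\<bar> \<le> (\<Sum>b<q. \<bar>(tent d a y - tent d a (real b / q)) * K (y - real b / q)\<bar>) / \<kappa>"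
      using \<kappa> by (simp add: divide_right_mono)
    also have "\<dots> \<le> (\<Sum>b<q. d * (idist (y - real b / q) * K (y - real b / q))) / \<kappa>"
    proof (intro divide_right_mono sum_mono)
      fix b
      have "tent d a (real b / q) = tent d a (real b / q + of_int (round (y - real b / q)))" by simp
      then have "\<bar>tent d a y - tent d a (real b / q)\<bar> \<le> d * \<bar>y - (real b / q + of_int (round (y - real b / q)))\<bar>"
        using tent_lipschitz[OF a] by metis
      also have "\<bar>y - (real b / q + of_int (round (y - real b / q)))\<bar> = idist (y - real b / q)" unfolding idist_def by (simp add: algebra_simps)
      finally show "\<bar>(tent d a y - tent d a (real b / q)) * K (y - real b / q)\<bar> \<le> d * (idist (y - real b / q) * K (y - real b / q))"
        using mult_right_mono[OF _ K0[of "y - real b / q"]] K0[of "y - real b / q"] by (simp add: abs_mult mult.assoc[symmetric])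
    qed (use \<kappa> in auto)
    also have "\<dots> \<le> d * (\<alpha> * \<kappa>) / \<kappa>"
      unfolding sum_distrib_left[symmetric] using \<kappa> by (intro divide_right_mono mult_left_mono moment) auto
    finally show ?thesis using \<kappa> by simp
  qed
  define S where "S m = (\<Sum>j\<in>J. e1 (of_int m * x j))" for m
  define c where "c k = real (2 * H choose k) / 4 ^ H" for k
  have Teq: "complex_of_real (\<Sum>j\<in>J. T (x j)) = (\<Sum>k\<le>2 * H. of_real (c k) * S (int k - int H) * (\<Sum>b<q. of_real (tent d a (real b / q)) * e1 (- (of_int (int k - int H) * (real b / q))))) / of_real \<kappa>"
  proof -
    have "complex_of_real (\<Sum>j\<in>J. T (x j)) = (\<Sum>j\<in>J. \<Sum>b<q. of_real (tent d a (real b / q)) * (\<Sum>k\<le>2 * H. of_real (c k) * e1 (of_int (int k - int H) * (x j - real b / q)))) / of_real \<kappa>"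
      by (simp only: T_def of_real_sum of_real_divide of_real_mult K_def cos_power_expansion c_def sum_divide_distrib)
    also have "(\<Sum>j\<in>J. \<Sum>b<q. of_real (tent d a (real b / q)) * (\<Sum>k\<le>2 * H. of_real (c k) * e1 (of_int (int k - int H) * (x j - real b / q))))
      = (\<Sum>j\<in>J. \<Sum>k\<le>2*H. \<Sum>b<q. of_real (c k) * e1 (of_int (int k - int H) * x j) * (of_real (tent d a (real b / q)) * e1 (- (of_int (int k - int H) * (real b / q)))))"
    proof (rule sum.cong)
      fix j assume "j \<in> J"
      have "of_real (tent d a (real b / q)) * (\<Sum>k\<le>2 * H. of_real (c k) * e1 (of_int (int k - int H) * (x j - real b / q)))
        = (\<Sum>k\<le>2*H. of_real (c k) * e1 (of_int (int k - int H) * x j) * (of_real (tent d a (real b / q)) * e1 (- (of_int (int k - int H) * (real b / q)))))" for b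
        unfolding sum_distrib_left
      proof (rule sum.cong)
        fix k
        have "of_int (int k - int H) * (x j - real b / q) = of_int (int k - int H) * x j + - (of_int (int k - int H) * (real b / q))"
          by (simp add: algebra_simps)
        then show "of_real (tent d a (real b / q)) * (of_real (c k) * e1 (of_int (int k - int H) * (x j - real b / q))) = of_real (c k) * e1 (of_int (int k - int H) * x j) * (of_real (tent d a (real b / q)) * e1 (- (of_int (int k - int H) * (real b / q))))"
          by (simp only: e1_add) (simp add: mult_ac)
      qed auto
      then show "(\<Sum>b<q. of_real (tent d a (real b / q)) * (\<Sum>k\<le>2 * H. of_real (c k) * e1 (of_int (int k - int H) * (x j - real b / q)))) =
         (\<Sum>k\<le>2*H. \<Sum>b<q. of_real (c k) * e1 (of_int (int k - int H) * x j) * (of_real (tent d a (real b / q)) * e1 (- (of_int (int k - int H) * (real b / q)))))"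
        by (simp only: sum.swap[of _ "{..<q}"])
    qed auto
    also have "\<dots> = (\<Sum>k\<le>2*H. \<Sum>j\<in>J. \<Sum>b<q. of_real (c k) * e1 (of_int (int k - int H) * x j) * (of_real (tent d a (real b / q)) * e1 (- (of_int (int k - int H) * (real b / q)))))"
      by (rule sum.swap)
    also have "\<dots> = (\<Sum>k\<le>2 * H. of_real (c k) * S (int k - int H) * (\<Sum>b<q. of_real (tent d a (real b / q)) * e1 (- (of_int (int k - int H) * (real b / q)))))"
      unfolding S_def sum_distrib_left sum_distrib_right
      by (rule sum.cong[OF refl], rule sum.swap)
    finally show ?thesis .
  qed
  have grid: "(\<Sum>b<q. tent d a (real b / q)) = real (H + 1)"
    unfolding q_def by (rule tent_grid_sum) (use a in auto)
  define R where "R k = of_real (c k) * S (int k - int H) * (\<Sum>b<q. of_real (tent d a (real b / q)) * e1 (- (of_int (int k - int H) * (real b / q)))) / of_real \<kappa>" for k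
  have cH: "c H * real (H + 1) / \<kappa> = 1 / d"
  proof -
    have "c H = \<kappa> / real q" unfolding c_def \<kappa>_def using q by simp
    then have "c H * real (H + 1) / \<kappa> = real (H + 1) / real q" using \<kappa> by simp
    also have "\<dots> = 1 / d" unfolding q_def of_nat_mult by simp
    finally show ?thesis .
  qed
  have R_main: "R H = of_real (card J / d)"
  proof -
    have "R H = of_real (c H * card J * (\<Sum>b<q. tent d a (real b / q)) / \<kappa>)"
      by (simp add: R_def S_def)
    also have "c H * card J * (\<Sum>b<q. tent d a (real b / q)) / \<kappa> = card J / d"
    proof -
      show ?thesis using cH unfolding grid by (metis (no_types, lifting) mult.commute mult.left_commute mult.right_neutral times_divide_eq_right)
    qed
    finally show ?thesis .
  qed
  \<comment> \<open>The nonnegative tent values sum to \<open>H + 1\<close> on the grid, and the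
    central binomial coefficient is the largest one, so each Fourier coefficient is at most the mean
    value \<open>1 / d\<close>.\<close>
  have R_bound: "cmod (R k) \<le> cmod (S (int k - int H))" for k
  proof -
    have "cmod (\<Sum>b<q. of_real (tent d a (real b / q)) * e1 (- (of_int (int k - int H) * (real b / q)))) \<le> (\<Sum>b<q. tent d a (real b / q))"
      by (rule sum_norm_le) (simp add: norm_mult tent_bounds)
    then have *: "cmod (\<Sum>b<q. of_real (tent d a (real b / q)) * e1 (- (of_int (int k - int H) * (real b / q)))) \<le> real (H + 1)"
      using grid by simp
    have "cmod (R k) = c k * cmod (S (int k - int H)) * cmod (\<Sum>b<q. of_real (tent d a (real b / q)) * e1 (- (of_int (int k - int H) * (real b / q)))) / \<kappa>"
      using \<kappa> unfolding R_def norm_divide norm_mult norm_of_real by (simp add: c_def)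
    also have "\<dots> \<le> c k * cmod (S (int k - int H)) * real (H + 1) / \<kappa>"
      using \<kappa> * by (intro divide_right_mono mult_left_mono) (auto simp: c_def)
    also have "\<dots> = cmod (S (int k - int H)) * (c k * real (H + 1) / \<kappa>)" by simp
    also have "\<dots> \<le> cmod (S (int k - int H)) * 1"
    proof (intro mult_left_mono)
      have "c k \<le> c H" unfolding c_def using binomial_maximum'[of H k] by (intro divide_right_mono) auto
      then have "c k * real (H + 1) / \<kappa> \<le> c H * real (H + 1) / \<kappa>" using \<kappa> by (intro divide_right_mono mult_right_mono) auto
      also have "\<dots> = 1 / d" by (rule cH)
      also have "\<dots> \<le> 1" using a by simp
      finally show "c k * real (H + 1) / \<kappa> \<le> 1" .
    qed auto
    finally show ?thesis by simp
  qed
  have Ssym: "cmod (S (- m)) = cmod (S m)" for m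
  proof -
    have "S (- m) = cnj (S m)" unfolding S_def by (simp add: e1_uminus)
    then show ?thesis by simp
  qed
  have "complex_of_real ((\<Sum>j\<in>J. T (x j)) - card J / d) = (\<Sum>k\<le>2 * H. R k) - R H"
    unfolding of_real_diff Teq R_main by (simp add: R_def sum_divide_distrib)
  also have "\<dots> = (\<Sum>k\<in>{..2 * H} - {H}. R k)" by (simp add: sum_diff1)
  finally have "\<bar>(\<Sum>j\<in>J. T (x j)) - card J / d\<bar> = cmod (\<Sum>k\<in>{..2 * H} - {H}. R k)"
    by (metis norm_of_real real_norm_def)
  also have "\<dots> \<le> (\<Sum>k\<in>{..2 * H} - {H}. cmod (S (int k - int H)))"
    by (intro sum_norm_le R_bound)
  also have "{..2 * H} - {H} = (\<lambda>h. H - h) ` {1..H} \<union> (\<lambda>h. H + h) ` {1..H}"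
  proof (intro equalityI subsetI)
    fix k assume k: "k \<in> {..2 * H} - {H}"
    show "k \<in> (\<lambda>h. H - h) ` {1..H} \<union> (\<lambda>h. H + h) ` {1..H}"
    proof (cases "k < H")
      case True then have "k = H - (H - k)" "H - k \<in> {1..H}" by auto
      then show ?thesis by blast
    next
      case False with k have "k = H + (k - H)" "k - H \<in> {1..H}" by auto
      then show ?thesis by blast
    qed
  qed auto
  also have "(\<Sum>k\<in>(\<lambda>h. H - h) ` {1..H} \<union> (\<lambda>h. H + h) ` {1..H}. cmod (S (int k - int H)))
     = (\<Sum>k\<in>(\<lambda>h. H - h) ` {1..H}. cmod (S (int k - int H))) + (\<Sum>k\<in>(\<lambda>h. H + h) ` {1..H}. cmod (S (int k - int H)))"
    by (rule sum.union_disjoint) auto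
  also have "(\<Sum>k\<in>(\<lambda>h. H + h) ` {1..H}. cmod (S (int k - int H))) = (\<Sum>h=1..H. cmod (S (int h)))"
    by (subst sum.reindex) (auto simp: inj_on_def)
  also have "(\<Sum>k\<in>(\<lambda>h. H - h) ` {1..H}. cmod (S (int k - int H))) = (\<Sum>h=1..H. cmod (S (int h)))"
    by (subst sum.reindex) (auto simp: inj_on_def of_nat_diff Ssym intro!: sum.cong)
  finally have main: "\<bar>(\<Sum>j\<in>J. T (x j)) - card J / d\<bar> \<le> 2 * (\<Sum>h=1..H. cmod (\<Sum>j\<in>J. e1 (real h * x j)))"
    by (simp add: S_def)
  have "\<bar>(\<Sum>j\<in>J. tent d a (x j)) - (\<Sum>j\<in>J. T (x j))\<bar> \<le> (\<Sum>j\<in>J. d * \<alpha>)"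
    unfolding sum_subtractf[symmetric] by (rule order_trans[OF sum_abs]) (intro sum_mono approx)
  also have "\<dots> = real (card J) * real d / sqrt (2 * (real H + 1))" by (simp add: \<alpha>_def)
  finally have "\<bar>(\<Sum>j\<in>J. tent d a (x j)) - (\<Sum>j\<in>J. T (x j))\<bar> \<le> real (card J) * real d / sqrt (2 * (real H + 1))" .
  from abs_diff_trans[OF this main order.refl] show ?thesis
    by (simp add: sum_subtractf add.commute)
qed

section \<open>Bases without common powers\<close>

text \<open>Division by \<open>G + 1\<close> separates points that are more than \<open>G\<close>
  apart.\<close>

lemma card_spaced:
  fixes S :: "nat set"
  assumes "S \<subseteq> {..<N}" "\<And>x y. x \<in> S \<Longrightarrow> y \<in> S \<Longrightarrow> x < y \<Longrightarrow> G < y - x"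
  shows "card S \<le> N div (G + 1) + 1"
proof -
  have "inj_on (\<lambda>x. x div (G + 1)) S"
  proof (rule linorder_inj_onI')
    fix x y assume "x \<in> S" "y \<in> S" "x < y"
    then have "x + (G + 1) \<le> y" using assms(2)[of x y] by simp
    then have "(x + (G + 1)) div (G + 1) \<le> y div (G + 1)" by (rule div_le_mono)
    moreover have "(x + (G + 1)) div (G + 1) = x div (G + 1) + 1" by (rule div_add_self2) simp
    ultimately show "x div (G + 1) \<noteq> y div (G + 1)" by simp
  qed
  moreover have "(\<lambda>x. x div (G + 1)) ` S \<subseteq> {..N div (G + 1)}"
    using assms(1) by (auto intro!: div_le_mono)
  ultimately have "card S \<le> card {..N div (G + 1)}" by (metis card_inj_on_le finite_atMost)
  then show ?thesis by simp
qed

definition mult_indep :: "nat \<Rightarrow> nat \<Rightarrow> bool" where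
  "mult_indep r s \<longleftrightarrow> (\<forall>g i. 0 < g \<longrightarrow> r ^ g \<noteq> s ^ i)"

text \<open>Comparing the two approximations gives \<open>r^g * s^i\<close> close to
  \<open>s^i'\<close>, with an error below \<open>s^i\<close> because
  \<open>\<eta> * r^G \<le> 1/4\<close>. If \<open>i \<le> i'\<close>, dividing by
  \<open>s^i\<close> leaves two integers at distance below 1, hence \<open>r^g = s^(i' - i)\<close>,
  against independence. If \<open>i > i'\<close>, the two sides differ by a factor of at least 4,
  too much for the relative error.\<close>

lemma near_multiple_gap:
  fixes X n \<eta> :: real
  assumes indep: "mult_indep r s" and r: "2 \<le> r" and s: "2 \<le> s" and g: "0 < g" "g \<le> G"
    and n: "0 < n" and \<eta>: "0 \<le> \<eta>" "\<eta> \<le> 1 / (4 * real r ^ G)"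
    and X: "\<bar>X - n * real s ^ i\<bar> \<le> \<eta> * (n * real s ^ i)"
    and Y: "\<bar>X * real r ^ g - n * real s ^ i'\<bar> \<le> \<eta> * (n * real s ^ i')"
  shows False
proof -
  define a where "a = real r ^ g"
  define b where "b = real s ^ i"
  define c where "c = real s ^ i'"
  have pos: "0 < b" "0 < c" using s by (auto simp: b_def c_def)
  have a2: "2 \<le> a" using r g unfolding a_def by (metis of_nat_le_iff of_nat_numeral self_le_power
      le_trans numeral_le_one_iff one_le_numeral order.trans of_nat_1)
  have aG: "a \<le> real r ^ G" unfolding a_def using r g by (intro power_increasing) auto
  have "\<bar>X - n * b\<bar> * a \<le> \<eta> * (n * b) * a" using X a2 unfolding b_def by (intro mult_right_mono) auto
  then have "\<bar>X * a - n * b * a\<bar> \<le> \<eta> * (n * b * a)" using a2 by (simp add: abs_mult_pos left_diff_distrib mult.assoc)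
  moreover have "\<bar>X * a - n * c\<bar> \<le> \<eta> * (n * c)" using Y unfolding a_def c_def .
  ultimately have "\<bar>n * b * a - n * c\<bar> \<le> \<eta> * (n * b * a) + \<eta> * (n * c)" by linarith
  then have "n * \<bar>b * a - c\<bar> \<le> n * (\<eta> * (b * a + c))"
    using n by (simp add: abs_mult[of n, symmetric, simplified abs_of_pos[OF n]] right_diff_distrib algebra_simps abs_mult_pos')
  then have D: "\<bar>b * a - c\<bar> \<le> \<eta> * (b * a + c)" using n by simp
  have rG: "1 \<le> real r ^ G" using r by simp
  have \<eta>8: "\<eta> * real r ^ G \<le> 1/4" 
  proof -
    have "\<eta> * real r ^ G \<le> 1 / (4 * real r ^ G) * real r ^ G" using \<eta>(2) rG by (intro mult_right_mono) auto
    also have "\<dots> = 1/4" using rG r by simp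
    finally show ?thesis .
  qed
  moreover have "\<eta> * 2 \<le> \<eta> * real r ^ G" using a2 aG \<eta>(1) by (intro mult_left_mono) auto
  ultimately have \<eta>1: "\<eta> \<le> 1/8" by simp
  have "\<eta> * (b * a + c) \<le> 1/8 * (b * a + c)" using \<eta>1 pos a2 by (intro mult_right_mono) auto
  then have c_le: "7 * c \<le> 9 * (b * a)" and ba_le: "7 * (b * a) \<le> 9 * c" using D by (auto simp: abs_le_iff)
  have "\<eta> * (b * a + c) \<le> \<eta> * (3 * (b * a))" 
  proof (rule mult_left_mono)
    have "0 \<le> b * a" using pos a2 by simp
    then show "b * a + c \<le> 3 * (b * a)" using c_le by linarith
  qed (rule \<eta>)
  then have D2: "\<bar>b * a - c\<bar> \<le> 3 * (\<eta> * a) * b" using D by (simp add: algebra_simps)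
  have "\<eta> * a \<le> \<eta> * real r ^ G" using aG \<eta>(1) by (rule mult_left_mono)
  then have \<eta>a: "3 * (\<eta> * a) < 1" using \<eta>8 by simp
  have D3: "\<bar>b * a - c\<bar> < b" using mult_strict_right_mono[OF \<eta>a pos(1)] D2 by simp
  show False
  proof (cases "i \<le> i'")
    case True
    define k where "k = i' - i"
    have c: "c = b * real s ^ k" unfolding c_def b_def k_def using True by (simp add: power_add[symmetric])
    have "b * \<bar>a - real s ^ k\<bar> < b * 1" using D3 pos unfolding c by (simp add: abs_mult right_diff_distrib[symmetric])
    then have "\<bar>a - real s ^ k\<bar> < 1" using pos by simp
    then have "\<bar>real_of_int (int r ^ g - int s ^ k)\<bar> < 1" by (simp add: a_def)
    then have "int r ^ g = int s ^ k" by linarith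
    then have "r ^ g = s ^ k" by (metis of_nat_eq_iff of_nat_power)
    then show False using indep g by (auto simp: mult_indep_def)
  next
    case False
    define k where "k = i - i'"
    have b: "b = c * real s ^ k" unfolding c_def b_def k_def using False by (simp add: power_add[symmetric])
    have "1 < k + 1" using False by (simp add: k_def)
    then have "real 2 \<le> real (s ^ k)" using s self_le_power[of s k] by (intro of_nat_mono) auto
    then have "2 \<le> real s ^ k" by simp
    then have "c * 2 \<le> b" unfolding b using pos by (intro mult_left_mono) auto
    moreover have "b * 2 \<le> b * a" using pos a2 by (intro mult_left_mono) auto
    ultimately show False using ba_le pos by linarith
  qed
qed

lemma card_near_multiple:
  assumes indep: "mult_indep r s" and r: "2 \<le> r" and s: "2 \<le> s" and n: "0 < n" and L: "0 < L"
    and \<eta>: "0 \<le> \<eta>" "\<eta> \<le> 1 / (4 * real r ^ G)"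
  shows "card {j. j < N \<and> (\<exists>i. \<bar>L * real r ^ j - n * real s ^ i\<bar> \<le> \<eta> * (n * real s ^ i))} \<le> N div (G + 1) + 1"
proof (rule card_spaced)
  fix x y assume x: "x \<in> {j. j < N \<and> (\<exists>i. \<bar>L * real r ^ j - n * real s ^ i\<bar> \<le> \<eta> * (n * real s ^ i))}"
    and y: "y \<in> {j. j < N \<and> (\<exists>i. \<bar>L * real r ^ j - n * real s ^ i\<bar> \<le> \<eta> * (n * real s ^ i))}"
    and xy: "x < y"
  show "G < y - x"
  proof (rule ccontr)
    assume "\<not> G < y - x"
    moreover have "L * real r ^ y = (L * real r ^ x) * real r ^ (y - x)"
      using xy by (simp add: power_add[symmetric])
    ultimately show False
      using x y near_multiple_gap[OF indep r s _ _ n \<eta>, of "y - x" "L * real r ^ x"] xy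
      by (auto simp: not_less mult.assoc)
  qed
qed auto

lemma idist_scale:
  assumes "idist y < 1 / (2 * real s)" "0 < s"
  shows "idist (real s * y) = real s * idist y"
proof -
  define m where "m = round y"
  have "\<bar>y - of_int m\<bar> < 1 / (2 * real s)" using assms by (simp add: idist_def m_def)
  then have "real s * \<bar>y - of_int m\<bar> < 1/2" using assms(2) by (simp add: field_simps)
  moreover have "real s * \<bar>y - of_int m\<bar> = \<bar>real s * y - of_int (int s * m)\<bar>"
    by (simp add: abs_mult right_diff_distrib[symmetric])
  ultimately have *: "\<bar>real s * y - of_int (int s * m)\<bar> < 1/2" by simp
  then have "round (real s * y) = int s * m" by (rule round_unique')
  then show ?thesis
    unfolding idist_def m_def[symmetric] by (simp add: abs_mult right_diff_distrib[symmetric])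
qed

text \<open>As long as every iterate stays within \<open>1 / (2 * s)\<close> of the integers,
  multiplication by \<open>s\<close> expands the distance without wrapping around. A long quiet run
  thus forces the starting distance to be exponentially small.\<close>

lemma idist_run:
  assumes "0 < s" "\<And>k. k < l \<Longrightarrow> idist (real s ^ k * y) < 1 / (2 * real s)"
  shows "k < l \<Longrightarrow> idist (real s ^ k * y) = real s ^ k * idist y"
proof (induction k)
  case (Suc k)
  have "idist (real s * (real s ^ k * y)) = real s * idist (real s ^ k * y)"
    using Suc.prems assms by (intro idist_scale) auto
  then show ?case using Suc by (simp add: mult.assoc)
qed simp

text \<open>Counts, among the \<open>\<Lambda>\<close> largest powers of \<open>s\<close> not
  exceeding \<open>X\<close>, the places at which the characteristic function of a digit is bounded
  away from 1.\<close>

definition nonint_count :: "nat \<Rightarrow> nat \<Rightarrow> real \<Rightarrow> nat" where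
  "nonint_count s \<Lambda> X = card {i. real s ^ i \<le> X \<and> X < real s ^ (i + \<Lambda>) \<and> 1 / (2 * real s) \<le> idist (X / real s ^ i)}"

lemma finite_power_le: "2 \<le> s \<Longrightarrow> finite {i. real s ^ i \<le> X \<and> P i}"
proof -
  assume s: "2 \<le> s"
  obtain n where n: "X < real s ^ n" using real_arch_pow[of "real s" X] s by auto
  have "i < n" if "real s ^ i \<le> X" for i
  proof (rule ccontr)
    assume "\<not> i < n"
    then have "real s ^ n \<le> real s ^ i" using s by (intro power_increasing) auto
    then show False using that n by simp
  qed
  then have "{i. real s ^ i \<le> X \<and> P i} \<subseteq> {..<n}" by auto
  then show ?thesis by (rule finite_subset) simp
qed

lemma obtain_top_power:
  assumes "2 \<le> s" "real s ^ \<Lambda> \<le> X"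
  obtains i where "\<Lambda> \<le> i" "real s ^ i \<le> X" "X < real s ^ (i + 1)"
proof -
  define i where "i = Max {i. real s ^ i \<le> X}"
  have fin: "finite {i. real s ^ i \<le> X}" using finite_power_le[OF assms(1), of X "\<lambda>_. True"] by simp
  have "i \<in> {i. real s ^ i \<le> X}" unfolding i_def using fin assms by (intro Max_in) auto
  moreover have "\<Lambda> \<le> i" unfolding i_def using fin assms by (intro Max_ge) auto
  moreover have "X < real s ^ (i + 1)"
  proof (rule ccontr)
    assume "\<not> X < real s ^ (i + 1)"
    then have "i + 1 \<le> i" unfolding i_def[symmetric] using fin by (subst (2) i_def, intro Max_ge) auto
    then show False by simp
  qed
  ultimately show ?thesis using that by auto
qed

text \<open>If none of the \<open>l\<close> positions following the top \<open>\<Lambda>\<close> ones is far from an integer, then \<open>X\<close> agrees to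
  relative precision \<open>s\<^sup>-\<^sup>l\<close> with \<open>n s\<^sup>i\<close> for one of boundedly many \<open>n\<close>. By independence of \<open>r\<close> and \<open>s\<close> such
  coincidences are sparse along \<open>L r\<^sup>j\<close>, so \<open>l\<close> may be chosen after \<open>\<Lambda>\<close>.\<close>

lemma nonint_count_step:
  assumes s: "2 \<le> s" and l: "0 < l" and X: "real s ^ (\<Lambda> + l) \<le> X" and c: "nonint_count s (\<Lambda> + l) X < Suc K"
    and c': "\<not> nonint_count s \<Lambda> X < K"
  shows "\<exists>n i. 1 \<le> n \<and> n \<le> s ^ (\<Lambda> + 1) \<and> \<bar>X - real n * real s ^ i\<bar> \<le> 1 / (2 * real s ^ l) * (real n * real s ^ i)"
proof -
  define A where "A \<Lambda> = {i. real s ^ i \<le> X \<and> X < real s ^ (i + \<Lambda>) \<and> 1 / (2 * real s) \<le> idist (X / real s ^ i)}" for \<Lambda>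
  obtain i0 where i0: "\<Lambda> + l \<le> i0" "real s ^ i0 \<le> X" "X < real s ^ (i0 + 1)"
    using obtain_top_power[OF s X] .
  have "A \<Lambda> \<subseteq> A (\<Lambda> + l)" unfolding A_def
    using s by (auto intro: less_le_trans power_increasing)
  moreover have fin: "finite (A (\<Lambda> + l))" unfolding A_def by (rule finite_power_le[OF s])
  \<comment> \<open>At least \<open>K\<close> places are counted in the smaller window and at most
    \<open>K\<close> in the larger, so the \<open>l\<close> new places contribute none.\<close>
  moreover have "card (A (\<Lambda> + l)) \<le> card (A \<Lambda>)" using c c' unfolding nonint_count_def A_def by linarith
  ultimately have A: "A (\<Lambda> + l) = A \<Lambda>" using card_seteq by metis
  define i1 where "i1 = i0 - \<Lambda>"
  have i1: "l \<le> i1" "i1 + \<Lambda> = i0" using i0 by (auto simp: i1_def)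
  define y where "y = X / real s ^ i1"
  have small: "idist (real s ^ k * y) < 1 / (2 * real s)" if "k < l" for k
  proof (rule ccontr)
    assume *: "\<not> idist (real s ^ k * y) < 1 / (2 * real s)"
    define i where "i = i1 - k"
    have i: "i + k = i1" using that i1 by (simp add: i_def)
    have "real s ^ k * y = X / real s ^ i" unfolding y_def i[symmetric] using s by (simp add: power_add)
    moreover have "real s ^ i \<le> X"

    proof -
      have "real s ^ i \<le> real s ^ i0" using i i1 s by (intro power_increasing) auto
      then show ?thesis using i0(2) by linarith
    qed
    moreover have "X < real s ^ (i + (\<Lambda> + l))"

    proof -
      have "real s ^ (i0 + 1) \<le> real s ^ (i + (\<Lambda> + l))" using i i1 s that by (intro power_increasing) auto
      then show ?thesis using i0(3) by linarith
    qed
    ultimately have "i \<in> A (\<Lambda> + l)" using * unfolding A_def by auto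
    then have "X < real s ^ (i + \<Lambda>)" unfolding A by (simp add: A_def)
    moreover have "real s ^ (i + \<Lambda>) \<le> real s ^ i0" using i i1 s by (intro power_increasing) auto
    ultimately show False using i0(2) by simp
  qed
  \<comment> \<open>A quiet run of length \<open>l\<close> forces \<open>y = X / s^i1\<close> to lie
    within \<open>1 / (2 * s^l)\<close> of an integer, and that integer is at most
    \<open>s^(\<Lambda> + 1)\<close>.\<close>
  have "real s ^ (l - 1) * idist y < 1 / (2 * real s)"
    using idist_run[of s l y "l - 1"] small s l by (metis diff_less less_one zero_less_one less_le_trans pos2)
  moreover have sl: "real s ^ l = real s * real s ^ (l - 1)" using l by (simp add: power_eq_if)
  ultimately have iy: "idist y \<le> 1 / (2 * real s ^ l)" using s by (simp add: field_simps)
  have y: "real s ^ \<Lambda> \<le> y" "y < real s ^ (\<Lambda> + 1)"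
    unfolding y_def using i0 s by (auto simp: field_simps i1(2)[symmetric] power_add)
  have y1: "1 \<le> y" 
  proof -
    have "1 \<le> real s ^ \<Lambda>" using s by (intro one_le_power) simp
    then show ?thesis using y(1) by linarith
  qed
  define n where "n = nat (round y)"
  have ry: "1 \<le> round y" using y1 round_mono[of 1 y] by simp
  have "round y \<le> round (real_of_int (int s ^ (\<Lambda> + 1)))" using y(2) by (intro round_mono) simp
  then have "round y \<le> int s ^ (\<Lambda> + 1)" by (simp only: round_of_int)
  then have n: "1 \<le> n" "n \<le> s ^ (\<Lambda> + 1)" unfolding n_def using ry by (auto simp: nat_le_iff le_nat_iff)
  have "real n = of_int (round y)" using ry by (simp add: n_def)
  then have "\<bar>y - real n\<bar> \<le> 1 / (2 * real s ^ l)" using iy by (simp add: idist_def)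
  then have "\<bar>y - real n\<bar> * real s ^ i1 \<le> 1 / (2 * real s ^ l) * real s ^ i1" by (rule mult_right_mono) simp
  also have "\<bar>y - real n\<bar> * real s ^ i1 = \<bar>X - real n * real s ^ i1\<bar>"
    using s by (simp add: y_def abs_mult_pos left_diff_distrib)
  also have "1 / (2 * real s ^ l) * real s ^ i1 \<le> 1 / (2 * real s ^ l) * (real n * real s ^ i1)"
    using n mult_right_mono[of 1 "real n" "real s ^ i1"] by (intro mult_left_mono) auto
  finally show ?thesis using n by blast
qed

text \<open>Induction on \<open>K\<close>, enlarging the window from \<open>\<Lambda>\<close> to
  \<open>\<Lambda> + l\<close>. A new exception is close to some \<open>n * s^i\<close> with
  \<open>n\<close> up to \<open>P = s^(\<Lambda> + 1)\<close>, and for each \<open>n\<close> such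
  exceptions are more than \<open>G\<close> apart; so \<open>G\<close> is chosen against
  \<open>P\<close>, then \<open>l\<close> against \<open>G\<close>. Uniformity in \<open>L\<close>
  matters because all factors \<open>h * (r^g - 1)\<close> of the frequencies will enter through
  \<open>L\<close>.\<close>

lemma nonint_count_sparse:
  assumes indep: "mult_indep r s" and r: "2 \<le> r" and s: "2 \<le> s"
  shows "0 < \<epsilon> \<Longrightarrow> \<exists>\<Lambda> N0. \<forall>L>0. \<forall>N\<ge>N0.
     real (card {j. j < N \<and> real s ^ \<Lambda> \<le> L * real r ^ j \<and> nonint_count s \<Lambda> (L * real r ^ j) < K}) \<le> \<epsilon> * real N"
proof (induction K arbitrary: \<epsilon>)
  case 0
  then show ?case by auto
next
  case (Suc K)
  obtain \<Lambda> N0 where IH: "\<And>L N. L > 0 \<Longrightarrow> N \<ge> N0 \<Longrightarrow>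
     real (card {j. j < N \<and> real s ^ \<Lambda> \<le> L * real r ^ j \<and> nonint_count s \<Lambda> (L * real r ^ j) < K}) \<le> \<epsilon>/2 * real N"
    using Suc.IH[of "\<epsilon>/2"] Suc.prems by auto
  define P where "P = s ^ (\<Lambda> + 1)"
  obtain G :: nat where G: "4 * real P / \<epsilon> < real G" using reals_Archimedean2 by blast
  \<comment> \<open>Since \<open>l < 2^l \<le> s^l\<close>, this makes \<open>1 / (2 * s^l)\<close>
    small enough for the gap lemma.\<close>
  define l where "l = 2 * r ^ G"
  have l: "0 < l" using r by (simp add: l_def)
  have "2 * real r ^ G \<le> real s ^ l"
  proof -
    have "real l \<le> 2 ^ l" using less_imp_le[OF of_nat_less_two_power[of l]] by simp
    also have "\<dots> \<le> real s ^ l" using s by (intro power_mono) auto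
    finally show ?thesis by (simp add: l_def)
  qed
  then have \<eta>: "1 / (2 * real s ^ l) \<le> 1 / (4 * real r ^ G)" using r s by (intro divide_left_mono mult_pos_pos zero_less_power) auto
  obtain N1 :: nat where N1: "4 * real P / \<epsilon> < real N1" using reals_Archimedean2 by blast
  show ?case
  proof (rule exI[of _ "\<Lambda> + l"], rule exI[of _ "max N0 N1"], intro allI impI)
    fix L :: real and N assume L: "L > 0" and N: "max N0 N1 \<le> N"
    define near where "near n = {j. j < N \<and> (\<exists>i. \<bar>L * real r ^ j - real n * real s ^ i\<bar> \<le> 1 / (2 * real s ^ l) * (real n * real s ^ i))}" for n
    define A where "A = {j. j < N \<and> real s ^ \<Lambda> \<le> L * real r ^ j \<and> nonint_count s \<Lambda> (L * real r ^ j) < K}"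
    define B where "B = {j. j < N \<and> real s ^ (\<Lambda> + l) \<le> L * real r ^ j \<and> nonint_count s (\<Lambda> + l) (L * real r ^ j) < Suc K}"
    have "B \<subseteq> A \<union> (\<Union>n\<in>{1..P}. near n)"
    proof
      fix j assume j: "j \<in> B"
      have "real s ^ \<Lambda> \<le> real s ^ (\<Lambda> + l)" using s by (intro power_increasing) auto
      then have X: "real s ^ \<Lambda> \<le> L * real r ^ j" using j by (auto simp: B_def)
      show "j \<in> A \<union> (\<Union>n\<in>{1..P}. near n)"
      proof (cases "nonint_count s \<Lambda> (L * real r ^ j) < K")
        case True then show ?thesis using j X by (auto simp: A_def B_def)
      next
        case False
        have "\<exists>n i. 1 \<le> n \<and> n \<le> s ^ (\<Lambda> + 1) \<and> \<bar>L * real r ^ j - real n * real s ^ i\<bar> \<le> 1 / (2 * real s ^ l) * (real n * real s ^ i)"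
          by (rule nonint_count_step[OF s l _ _ False]) (use j in \<open>auto simp: B_def\<close>)
        then obtain n i where "1 \<le> n" "n \<le> P" "\<bar>L * real r ^ j - real n * real s ^ i\<bar> \<le> 1 / (2 * real s ^ l) * (real n * real s ^ i)"
          unfolding P_def by blast
        moreover have "j < N" using j by (simp add: B_def)
        ultimately have "n \<in> {1..P}" "j \<in> near n" unfolding near_def by auto
        then show ?thesis by blast
      qed
    qed
    then have "card B \<le> card (A \<union> (\<Union>n\<in>{1..P}. near n))" by (intro card_mono) (auto simp: A_def near_def)
    also have "\<dots> \<le> card A + card (\<Union>n\<in>{1..P}. near n)" by (rule card_Un_le)
    also have "card (\<Union>n\<in>{1..P}. near n) \<le> (\<Sum>n\<in>{1..P}. card (near n))" by (rule card_UN_le) simp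
    also have "(\<Sum>n\<in>{1..P}. card (near n)) \<le> (\<Sum>n\<in>{1..P}. N div (G + 1) + 1)"
      unfolding near_def using L \<eta> by (intro sum_mono card_near_multiple[OF indep r s]) auto
    also have "\<dots> = P * (N div (G + 1) + 1)" by simp
    finally have "card B \<le> card A + P * (N div (G + 1) + 1)" by simp
    then have "real (card B) \<le> real (card A) + P * (real (N div (G + 1)) + 1)"
      by (metis (mono_tags) of_nat_1 of_nat_add of_nat_le_iff of_nat_mult)
    also have "\<dots> \<le> \<epsilon>/2 * N + P * (N / (G + 1) + 1)"
    proof -
      have "real (card A) \<le> \<epsilon>/2 * N" unfolding A_def using L N by (intro IH) auto
      moreover have "real (N div (G + 1)) \<le> N / (G + 1)"
        using of_nat_div_le_of_nat[of N "G + 1", where ?'a = real] by (simp add: add.commute)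
      then have "P * (real (N div (G + 1)) + 1) \<le> P * (N / (G + 1) + 1)"
        by (intro mult_left_mono) auto
      ultimately show ?thesis by linarith
    qed
    also have "\<dots> \<le> \<epsilon>/2 * N + (\<epsilon>/4 * N + \<epsilon>/4 * N)"
    proof -
      have "P / (G + 1) \<le> \<epsilon>/4" using G Suc.prems by (simp add: field_simps)
      from mult_right_mono[OF this, of "real N"] have "P * (N / (G + 1)) \<le> \<epsilon>/4 * N" by (simp add: mult.commute)
      moreover have "P * 1 \<le> \<epsilon>/4 * N"
      proof -
        have "4 * real P / \<epsilon> \<le> N" using N1 N by linarith
        then show ?thesis using Suc.prems by (simp add: field_simps)
      qed
      ultimately have "P * (N / (G + 1)) + P * 1 \<le> \<epsilon>/4 * N + \<epsilon>/4 * N" by (rule add_mono)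
      moreover have "P * (N / (G + 1) + 1) = P * (N / (G + 1)) + P * (1::real)" by (rule distrib_left)
      ultimately show ?thesis by linarith
    qed
    also have "\<dots> = \<epsilon> * N" by simp
    finally show "real (card {j. j < N \<and> real s ^ (\<Lambda> + l) \<le> L * real r ^ j \<and> nonint_count s (\<Lambda> + l) (L * real r ^ j) < Suc K}) \<le> \<epsilon> * real N"
      unfolding B_def .
  qed
qed

section \<open>Random words with biased digits\<close>

definition mean :: "'a set \<Rightarrow> ('a \<Rightarrow> 'b::real_normed_field) \<Rightarrow> 'b" where
  "mean W F = (\<Sum>w\<in>W. F w) / of_nat (card W)"

lemma mean_add: "mean W (\<lambda>w. F w + G w) = mean W F + mean W G"
  by (simp add: mean_def sum.distrib add_divide_distrib)

lemma mean_sum: "mean W (\<lambda>w. \<Sum>i\<in>I. F i w) = (\<Sum>i\<in>I. mean W (F i))"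
  unfolding mean_def sum_divide_distrib[symmetric] by (subst sum.swap) rule

lemma mean_cmult: "mean W (\<lambda>w. c * F w) = c * mean W F"
  by (simp add: mean_def sum_distrib_left[symmetric])

lemma mean_divide: "mean W (\<lambda>w. F w / c) = mean W F / c"
  by (simp add: mean_def sum_divide_distrib[symmetric])

lemma norm_mean_le:
  assumes "finite W" "W \<noteq> {}" "\<And>w. w \<in> W \<Longrightarrow> norm (F w) \<le> c"
  shows "norm (mean W F) \<le> c"
proof -
  have "norm (\<Sum>w\<in>W. F w) \<le> (\<Sum>w\<in>W. c)" using assms(3) by (rule sum_norm_le)
  then show ?thesis using assms(1,2) by (simp add: mean_def norm_divide divide_le_eq card_gt_0_iff mult.commute)
qed

lemma ex_less_mean:
  fixes F :: "'a \<Rightarrow> real"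
  assumes "finite W" "W \<noteq> {}" "mean W F < c"
  shows "\<exists>w\<in>W. F w < c"
proof (rule ccontr)
  assume "\<not> ?thesis"
  then have "(\<Sum>w\<in>W. c) \<le> (\<Sum>w\<in>W. F w)" by (intro sum_mono) auto
  then have "c \<le> mean W F" using assms(1,2) by (simp add: mean_def le_divide_eq card_gt_0_iff mult.commute)
  then show False using assms(3) by simp
qed

definition words :: "nat \<Rightarrow> nat \<Rightarrow> (nat \<Rightarrow> nat) set" where
  "words Q n = PiE {..<n} (\<lambda>_. {..<Q})"

lemma finite_words [simp]: "finite (words Q n)"
  unfolding words_def by (intro finite_PiE) auto

lemma card_words: "card (words Q n) = Q ^ n"
  unfolding words_def by (simp add: card_PiE)

lemma words_nonempty: "0 < Q \<Longrightarrow> words Q n \<noteq> {}"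
  using card_words[of Q n] by (metis card.empty power_not_zero not_gr0)

text \<open>Independence of the letters of a uniformly chosen word.\<close>

lemma mean_words_prod:
  fixes F :: "nat \<Rightarrow> nat \<Rightarrow> 'b::real_normed_field"
  shows "mean (words Q n) (\<lambda>w. \<Prod>i<n. F i (w i)) = (\<Prod>i<n. (\<Sum>u<Q. F i u) / of_nat Q)"
  unfolding mean_def card_words
  by (simp add: words_def prod_sum_PiE[symmetric] prod_dividef)

text \<open>Reading letters \<open>u < s q\<close> through this map yields independent base-\<open>s\<close> digits that are \<open>0\<close> with
  probability \<open>1 / q\<close> and uniform otherwise.\<close>

definition digit :: "nat \<Rightarrow> nat \<Rightarrow> nat" where
  "digit s u = (if u < s then 0 else u mod s)"

definition word_val :: "nat \<Rightarrow> nat \<Rightarrow> (nat \<Rightarrow> nat) \<Rightarrow> real" where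
  "word_val s n w = (\<Sum>i<n. real (digit s (w i)) / real s ^ (i + 1))"

text \<open>The characteristic function of one digit at frequency \<open>t\<close>, its law being
  realised by a uniform count over \<open>s * q\<close> letters.\<close>

definition digit_cf :: "nat \<Rightarrow> nat \<Rightarrow> real \<Rightarrow> complex" where
  "digit_cf s q t = (\<Sum>u<s * q. e1 (t * real (digit s u))) / of_nat (s * q)"

lemma digit_less: "0 < s \<Longrightarrow> digit s u < s"
  by (simp add: digit_def)

lemma e1_sum: "e1 (\<Sum>i\<in>I. f i) = (\<Prod>i\<in>I. e1 (f i))"
  by (induction I rule: infinite_finite_induct) (auto simp: e1_add)

lemma mean_e1_word_val:
  "mean (words (s * q) n) (\<lambda>w. e1 (\<nu> * word_val s n w)) = (\<Prod>i<n. digit_cf s q (\<nu> / real s ^ (i + 1)))"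
proof -
  have "e1 (\<nu> * word_val s n w) = (\<Prod>i<n. e1 (\<nu> / real s ^ (i + 1) * real (digit s (w i))))" for w
    unfolding word_val_def sum_distrib_left e1_sum by (simp add: mult.commute)
  then show ?thesis unfolding digit_cf_def
    using mean_words_prod[of "s * q" n "\<lambda>i u. e1 (\<nu> / real s ^ (i + 1) * real (digit s u))"] by simp
qed

text \<open>The first block of \<open>s\<close> letters is sent to 0; each of the other
  \<open>q - 1\<close> blocks runs once through all digits.\<close>

lemma sum_digit_split:
  fixes f :: "nat \<Rightarrow> 'b::real_normed_field"
  assumes "0 < s" "0 < q"
  shows "(\<Sum>u<s * q. f (digit s u)) = of_nat s * f 0 + of_nat (q - 1) * (\<Sum>c<s. f c)"
proof -
  obtain q' where q: "q = Suc q'" using assms by (cases q) auto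
  have "(\<Sum>u<s * q. f (digit s u)) = (\<Sum>k<q. \<Sum>u = k * s..<k * s + s. f (digit s u))"
    by (simp add: sum.nat_group mult.commute)
  also have "\<dots> = (\<Sum>k<q. if k = 0 then of_nat s * f 0 else (\<Sum>c<s. f c))"
  proof (rule sum.cong)
    fix k
    have *: "(\<Sum>u = k * s..<k * s + s. f (digit s u)) = (\<Sum>c<s. f (digit s (c + k * s)))"
      using sum.shift_bounds_nat_ivl[of "\<lambda>u. f (digit s u)" 0 "k * s" s] by (simp add: add.commute atLeast0LessThan)
    show "(\<Sum>u = k * s..<k * s + s. f (digit s u)) = (if k = 0 then of_nat s * f 0 else (\<Sum>c<s. f c))"
    proof (cases "k = 0")
      case False
      then have "1 * s \<le> k * s" by (intro mult_right_mono) auto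
      then have "s \<le> k * s" by (simp only: mult_1)
      then have n: "\<not> c + k * s < s" for c by linarith
      have "digit s (c + k * s) = c" if "c < s" for c unfolding digit_def if_not_P[OF n] using that by simp
      then show ?thesis unfolding * using False by (auto intro!: sum.cong)
    qed (unfold *, auto simp: digit_def intro!: sum.cong)
  qed auto
  also have "\<dots> = of_nat s * f 0 + of_nat (q - 1) * (\<Sum>c<s. f c)"
    unfolding q by (subst sum.lessThan_Suc_shift) simp
  finally show ?thesis .
qed

lemma digit_cf_split:
  assumes "0 < s" "0 < q"
  shows "digit_cf s q t = (of_nat s + of_nat (q - 1) * (\<Sum>c<s. e1 (t * real c))) / of_nat (s * q)"
  unfolding digit_cf_def using sum_digit_split[OF assms, of "\<lambda>c. e1 (t * real c)"] by simp

lemma norm_digit_cf_le_1: "cmod (digit_cf s q t) \<le> 1"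
proof -
  have "cmod (\<Sum>u<s * q. e1 (t * real (digit s u))) \<le> (\<Sum>u<s * q. 1)" by (rule sum_norm_le) simp
  then show ?thesis unfolding digit_cf_def norm_divide by (cases "s * q = 0") (auto simp: divide_le_eq norm_mult)
qed

text \<open>The uniform part of the law has vanishing character sum at a nontrivial frequency modulo
  \<open>s\<close>; only the extra mass \<open>1 / q\<close> at the digit 0 remains.\<close>

lemma digit_cf_nonmultiple:
  assumes "0 < s" "0 < q" "\<not> int s dvd u"
  shows "digit_cf s q (of_int u / real s) = 1 / of_nat q"
proof -
  have "(\<Sum>c<s. e1 (of_int u / real s * real c)) = (\<Sum>c<s. e1 (of_int (- u) * (0 - real c / real s)))"
    by (simp add: mult.commute)
  also have "\<dots> = 0" using assms by (subst sum_roots_of_unity) auto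
  finally show ?thesis using assms by (simp add: digit_cf_split)
qed

lemma norm_one_plus_e1: "cmod (1 + e1 t) = 2 * \<bar>cos (pi * t)\<bar>"
proof -
  have "1 + e1 t = cis (pi * t) * (cis (pi * t) + cis (- (pi * t)))"
    by (simp add: e1_def cis_mult ring_distribs) (simp add: algebra_simps)
  also have "cis (pi * t) + cis (- (pi * t)) = of_real (2 * cos (pi * t))" by (simp add: complex_eq_iff)
  finally show ?thesis by (simp add: norm_mult)
qed

text \<open>The digits 0 and 1 already cancel: \<open>|1 + e1 t| = 2 * |cos (pi * t)|\<close> falls
  short of 2 by at least \<open>\<tau>^2\<close>, where \<open>\<tau> = 1 / (2 * s)\<close>, and the
  other \<open>s - 2\<close> terms are bounded trivially. The uniform part has weight
  \<open>(q - 1) / q\<close>, at least 1/2, so the bound is independent of \<open>q\<close>.\<close>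

lemma norm_digit_cf_bound:
  assumes s: "2 \<le> s" and q: "2 \<le> q" and t: "1 / (2 * real s) \<le> idist t"
  shows "cmod (digit_cf s q t) \<le> 1 - 1 / (8 * real s ^ 3)"
proof -
  define C where "C = \<bar>cos (pi * t)\<bar>"
  define \<tau> where "\<tau> = 1 / (2 * real s)"
  have "\<tau> \<le> \<bar>sin (pi * t)\<bar>" using t idist_le_sin[of t] unfolding \<tau>_def by linarith
  then have "\<tau>^2 \<le> (sin (pi * t))^2" unfolding \<tau>_def using s by (subst abs_le_square_iff[symmetric]) auto
  then have "C^2 \<le> 1 - \<tau>^2" by (simp add: C_def cos_squared_eq)
  also have "\<dots> \<le> (1 - \<tau>^2 / 2)^2"
  proof -
    have "(1 - \<tau>^2 / 2)^2 = 1 - \<tau>^2 + (\<tau>^2)^2 / 4" by (simp add: power2_diff power_divide)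
    then show ?thesis by simp
  qed
  finally have "C^2 \<le> (1 - \<tau>^2 / 2)^2" .
  moreover have "\<tau> \<le> 1" unfolding \<tau>_def using s by simp
  then have "0 \<le> 1 - \<tau>^2 / 2" using power_le_one[of \<tau> 2] by (simp add: \<tau>_def)
  ultimately have C: "C \<le> 1 - \<tau>^2 / 2" by (rule power2_le_imp_le)
  have "(\<Sum>c<s. e1 (t * real c)) = 1 + e1 t + (\<Sum>c\<in>{2..<s}. e1 (t * real c))"
  proof -
    have "{..<s} = {0, 1} \<union> {2..<s}" using s by auto
    then show ?thesis by (simp add: sum.union_disjoint)
  qed
  then have "cmod (\<Sum>c<s. e1 (t * real c)) \<le> 2 * C + cmod (\<Sum>c\<in>{2..<s}. e1 (t * real c))"
    using norm_triangle_ineq[of "1 + e1 t"] by (simp add: norm_one_plus_e1 C_def)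
  also have "cmod (\<Sum>c\<in>{2..<s}. e1 (t * real c)) \<le> (\<Sum>c\<in>{2..<s}. 1)" by (rule sum_norm_le) simp
  also have "\<dots> = real s - 2" using s by (simp add: of_nat_diff)
  finally have D: "cmod (\<Sum>c<s. e1 (t * real c)) \<le> real s - \<tau>^2" using C by simp
  have "cmod (digit_cf s q t) = cmod (of_nat s + of_nat (q - 1) * (\<Sum>c<s. e1 (t * real c))) / (s * q)"
    using s q by (simp add: digit_cf_split norm_divide norm_mult)
  also have "\<dots> \<le> (s + (q - 1) * (real s - \<tau>^2)) / (s * q)"
  proof (rule divide_right_mono)
    have "cmod (of_nat s + of_nat (q - 1) * (\<Sum>c<s. e1 (t * real c))) \<le> s + real (q - 1) * cmod (\<Sum>c<s. e1 (t * real c))"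
      using norm_triangle_ineq[of "of_nat s"] by (metis norm_mult norm_of_nat)
    also have "\<dots> \<le> s + (q - 1) * (real s - \<tau>^2)" using D by (intro add_left_mono mult_left_mono) auto
    finally show "cmod (of_nat s + of_nat (q - 1) * (\<Sum>c<s. e1 (t * real c))) \<le> s + (q - 1) * (real s - \<tau>^2)" .
  qed auto
  also have "\<dots> = 1 - ((q - 1) / q) * \<tau>^2 / s" using s q by (simp add: field_simps of_nat_diff)
  also have "\<dots> \<le> 1 - (1/2) * \<tau>^2 / s"
  proof -
    have "q \<le> 2 * (q - 1)" using q by simp
    then have "real q \<le> real (2 * (q - 1))" by (simp only: of_nat_le_iff)
    then have "(1/2::real) \<le> (q - 1) / q" using q by (simp add: le_divide_eq)
    then have "(1/2) * \<tau>^2 / s \<le> ((q - 1) / q) * \<tau>^2 / s" using q by (intro divide_right_mono mult_right_mono) auto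
    then show ?thesis by simp
  qed
  also have "(1/2) * \<tau>^2 / s = 1 / (8 * real s ^ 3)" by (simp add: \<tau>_def power2_eq_square power3_eq_cube)
  finally show ?thesis .
qed

definition decay :: "nat \<Rightarrow> real" where "decay s = 1 - 1 / (8 * real s ^ 3)"

lemma decay: "2 \<le> s \<Longrightarrow> 0 \<le> decay s \<and> decay s < 1"
proof -
  assume "2 \<le> s"
  then have "1 \<le> real s ^ 3" by (intro one_le_power) simp
  then have "1 \<le> 8 * real s ^ 3" by linarith
  then show ?thesis unfolding decay_def using \<open>2 \<le> s\<close> by (simp add: divide_le_eq)
qed

text \<open>Each counted place supplies a factor of at most \<open>decay s\<close>, all others at
  most 1. The bounds on \<open>X\<close> put every counted place between 1 and \<open>n\<close>:
  place 0 would need \<open>X < s^\<Lambda>\<close>. Factor number \<open>i\<close> belongs to place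
  \<open>i + 1\<close>.\<close>

lemma norm_prod_digit_cf:
  assumes s: "2 \<le> s" and q: "2 \<le> q" and X: "real s ^ \<Lambda> \<le> X" "X \<le> real s ^ n" and K: "K \<le> nonint_count s \<Lambda> X"
  shows "cmod (\<Prod>i<n. digit_cf s q (X / real s ^ (i + 1))) \<le> decay s ^ K"
proof -
  define S where "S = {i. real s ^ i \<le> X \<and> X < real s ^ (i + \<Lambda>) \<and> 1 / (2 * real s) \<le> idist (X / real s ^ i)}"
  define T where "T = {i. i < n \<and> Suc i \<in> S}"
  have S0: "0 < i \<and> i \<le> n" if "i \<in> S" for i
  proof
    show "0 < i"
    proof (rule ccontr)
      assume "\<not> 0 < i" then show False using that X(1) by (simp add: S_def)
    qed
    have "real s ^ i \<le> real s ^ n" using that X(2) by (auto simp: S_def)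
    then show "i \<le> n" using s by (simp add: power_le_imp_le_exp)
  qed
  have "S = Suc ` T"
  proof (intro equalityI subsetI)
    fix i assume i: "i \<in> S"
    then obtain i' where "i = Suc i'" using S0[OF i] by (cases i) auto
    then show "i \<in> Suc ` T" using i S0[OF i] by (auto simp: T_def)
  qed (auto simp: T_def)
  then have cT: "card T = nonint_count s \<Lambda> X"
    by (simp add: nonint_count_def S_def[symmetric] card_image)
  have "cmod (\<Prod>i<n. digit_cf s q (X / real s ^ (i + 1))) = (\<Prod>i<n. cmod (digit_cf s q (X / real s ^ (i + 1))))"
    by (rule prod_norm[symmetric])
  also have "\<dots> \<le> (\<Prod>i<n. if i \<in> T then decay s else 1)"
    using norm_digit_cf_bound[OF s q] norm_digit_cf_le_1 unfolding decay_def
    by (intro prod_mono) (auto simp: T_def S_def)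
  also have "\<dots> = decay s ^ card T"
  proof -
    have "{..<n} \<inter> {i. i \<in> T} = T" by (auto simp: T_def)
    then show ?thesis by (simp add: prod.If_cases)
  qed
  also have "\<dots> \<le> decay s ^ K" unfolding cT using decay[OF s] K by (intro power_decreasing) auto
  finally show ?thesis .
qed

section \<open>Second moments of exponential sums\<close>

lemma mean_norm_sum_sq:
  fixes f :: "'b \<Rightarrow> real" and x :: "'a \<Rightarrow> real"
  shows "mean W (\<lambda>w. (cmod (\<Sum>j\<in>J. e1 (f j * x w)))^2) \<le>
     (\<Sum>j\<in>J. \<Sum>k\<in>J. cmod (mean W (\<lambda>w. e1 ((f j - f k) * x w))))"
proof -
  have sq: "complex_of_real ((cmod (\<Sum>j\<in>J. e1 (f j * x w)))^2) = (\<Sum>j\<in>J. \<Sum>k\<in>J. e1 ((f j - f k) * x w))" for w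
  proof -
    have "complex_of_real ((cmod (\<Sum>j\<in>J. e1 (f j * x w)))^2) = (\<Sum>j\<in>J. e1 (f j * x w)) * cnj (\<Sum>k\<in>J. e1 (f k * x w))"
      by (rule complex_norm_square)
    also have "\<dots> = (\<Sum>j\<in>J. \<Sum>k\<in>J. e1 (f j * x w) * e1 (- (f k * x w)))"
      by (simp only: cnj_sum e1_uminus sum_product)
    finally show ?thesis by (simp add: e1_add[symmetric] algebra_simps)
  qed
  have "complex_of_real (mean W (\<lambda>w. (cmod (\<Sum>j\<in>J. e1 (f j * x w)))^2)) = mean W (\<lambda>w. \<Sum>j\<in>J. \<Sum>k\<in>J. e1 ((f j - f k) * x w))"
    unfolding mean_def by (simp only: of_real_divide of_real_sum sq of_real_of_nat_eq)
  also have "\<dots> = (\<Sum>j\<in>J. \<Sum>k\<in>J. mean W (\<lambda>w. e1 ((f j - f k) * x w)))" by (simp only: mean_sum)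
  finally have "cmod (complex_of_real (mean W (\<lambda>w. (cmod (\<Sum>j\<in>J. e1 (f j * x w)))^2))) = cmod (\<Sum>j\<in>J. \<Sum>k\<in>J. mean W (\<lambda>w. e1 ((f j - f k) * x w)))"
    by (rule arg_cong)
  then have "\<bar>mean W (\<lambda>w. (cmod (\<Sum>j\<in>J. e1 (f j * x w)))^2)\<bar> = cmod (\<Sum>j\<in>J. \<Sum>k\<in>J. mean W (\<lambda>w. e1 ((f j - f k) * x w)))"
    by (simp only: norm_of_real)
  also have "\<dots> \<le> (\<Sum>j\<in>J. \<Sum>k\<in>J. cmod (mean W (\<lambda>w. e1 ((f j - f k) * x w))))"
    by (intro sum_norm_le order.refl)
  finally show ?thesis by simp
qed

lemma norm_mean_e1_uminus: "cmod (mean W (\<lambda>w. e1 (- f w))) = cmod (mean W (\<lambda>w. e1 (f w)))"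
proof -
  have "mean W (\<lambda>w. e1 (- f w)) = cnj (mean W (\<lambda>w. e1 (f w)))" by (simp add: mean_def e1_uminus)
  then show ?thesis by simp
qed

text \<open>Symmetric pairs are folded together and sorted by their difference \<open>g\<close>,
  because \<open>g\<close> fixes the factor \<open>r^g - 1\<close> of the frequency.\<close>

lemma sum_square_le_triangle:
  fixes F :: "nat \<Rightarrow> nat \<Rightarrow> real"
  assumes "\<And>u v. F u v = F v u" "\<And>u v. 0 \<le> F u v"
  shows "(\<Sum>u<M. \<Sum>v<M. F u v) \<le> 2 * (\<Sum>g<M. \<Sum>u<M - g. F (u + g) u)"
proof -
  have "(\<Sum>u<M. \<Sum>v<M. F u v) \<le> 2 * (\<Sum>v<M. \<Sum>u\<le>v. F v u)"
  proof (induction M)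
    case (Suc M)
    have "(\<Sum>u<Suc M. \<Sum>v<Suc M. F u v) = (\<Sum>u<M. \<Sum>v<M. F u v) + (\<Sum>u<M. F u M) + (\<Sum>v<M. F M v) + F M M"
      by (simp add: sum.distrib)
    also have "(\<Sum>u<M. F u M) = (\<Sum>v<M. F M v)" using assms(1) by simp
    also have "(\<Sum>u<M. \<Sum>v<M. F u v) + (\<Sum>v<M. F M v) + (\<Sum>v<M. F M v) + F M M \<le> 2 * (\<Sum>v<Suc M. \<Sum>u\<le>v. F v u)"
      using Suc.IH assms(2)[of M M] by (simp add: lessThan_Suc_atMost[symmetric])
    finally show ?case .
  qed simp
  also have "(\<Sum>v<M. \<Sum>u\<le>v. F v u) = (\<Sum>v<M. \<Sum>u\<le>v. F (u + (v - u)) u)" by (intro sum.cong) auto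
  also have "\<dots> = (\<Sum>(u, g)\<in>{(u, g). u + g < M}. F (u + g) u)"
    by (rule sum.triangle_reindex[symmetric])
  also have "\<dots> = (\<Sum>(g, u)\<in>Sigma {..<M} (\<lambda>g. {..<M - g}). F (u + g) u)"
    by (rule sum.reindex_bij_witness[of _ "\<lambda>(g, u). (u, g)" "\<lambda>(u, g). (g, u)"]) auto
  also have "\<dots> = (\<Sum>g<M. \<Sum>u<M - g. F (u + g) u)" by (rule sum.Sigma[symmetric]) auto
  finally show ?thesis by simp
qed

text \<open>The starting point \<open>x0\<close> contributes only a phase, so the moments do not
  depend on where the word is placed.\<close>

lemma mean_word_e1:
  "cmod (mean (words (s * q) n) (\<lambda>w. e1 (\<nu> * (x0 + word_val s n w / real s ^ A)))) =
   cmod (\<Prod>i<n. digit_cf s q (\<nu> / real s ^ A / real s ^ (i + 1)))"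
proof -
  have "e1 (\<nu> * (x0 + word_val s n w / real s ^ A)) = e1 (\<nu> * x0) * e1 ((\<nu> / real s ^ A) * word_val s n w)" for w
    by (simp add: e1_add[symmetric] algebra_simps)
  then show ?thesis by (simp only: mean_cmult norm_mult norm_e1 mult_1 mean_e1_word_val)
qed

definition exp_sum :: "nat \<Rightarrow> nat \<Rightarrow> nat \<Rightarrow> nat \<Rightarrow> real \<Rightarrow> complex" where
  "exp_sum r h a N x = (\<Sum>j\<in>{a..<N}. e1 (real h * (real r ^ j * x)))"

lemma mean_exp_sum_sq:
  assumes a: "a \<le> N"
  shows "mean W (\<lambda>w. (cmod (exp_sum r h a N (x w)))^2) \<le>
     2 * (\<Sum>g<N - a. \<Sum>u<N - a - g. cmod (mean W (\<lambda>w. e1 (real h * (real r ^ g - 1) * real r ^ (a + u) * x w))))"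
proof -
  define F where "F u v = cmod (mean W (\<lambda>w. e1 ((real h * real r ^ (a + u) - real h * real r ^ (a + v)) * x w)))" for u v
  have "exp_sum r h a N y = (\<Sum>u<N - a. e1 (real h * real r ^ (a + u) * y))" for y
    unfolding exp_sum_def using a sum.shift_bounds_nat_ivl[of "\<lambda>j. e1 (real h * (real r ^ j * y))" 0 a "N - a"]
    by (simp add: add.commute atLeast0LessThan mult.assoc)
  then have "mean W (\<lambda>w. (cmod (exp_sum r h a N (x w)))^2) \<le> (\<Sum>u<N - a. \<Sum>v<N - a. F u v)"
    unfolding F_def by (simp only: mean_norm_sum_sq)
  also have "\<dots> \<le> 2 * (\<Sum>g<N - a. \<Sum>u<N - a - g. F (u + g) u)"
  proof (rule sum_square_le_triangle)
    show "F u v = F v u" for u v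
      unfolding F_def by (subst norm_mean_e1_uminus[symmetric]) (simp add: algebra_simps)
  qed (simp add: F_def)
  also have "(\<Sum>g<N - a. \<Sum>u<N - a - g. F (u + g) u) =
     (\<Sum>g<N - a. \<Sum>u<N - a - g. cmod (mean W (\<lambda>w. e1 (real h * (real r ^ g - 1) * real r ^ (a + u) * x w))))"
    unfolding F_def by (simp add: power_add algebra_simps)
  finally show ?thesis .
qed

text \<open>After expanding the square, the difference \<open>g\<close> leads to frequencies
  \<open>L * r^u\<close> with \<open>L \<ge> 1 / C0\<close>. The diagonal \<open>g = 0\<close> costs
  at most \<open>B\<close>, the first \<open>c1\<close> values of \<open>u\<close> may have too
  small a frequency, exceptional \<open>u\<close> are sparse, and for all others \<open>K\<close>
  factors bring the mean down to \<open>decay s ^ K\<close>. The threshold \<open>B0\<close>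
  precedes the position, the starting point and \<open>q\<close>, so it can be fixed before the
  stage is known.\<close>

lemma mean_exp_sum_indep:
  assumes indep: "mult_indep r s" and r: "2 \<le> r" and s: "2 \<le> s" and h: "1 \<le> h" and \<epsilon>: "0 < \<epsilon>" and C0: "0 < C0"
  shows "\<exists>B0. \<forall>B\<ge>B0. \<forall>A n a N q x0. a \<le> N \<longrightarrow> N \<le> B \<longrightarrow> 2 \<le> q \<longrightarrow> real s ^ A \<le> C0 * real r ^ a \<longrightarrow>
     real h * real r ^ N \<le> real s ^ (A + n) \<longrightarrow>
     mean (words (s * q) n) (\<lambda>w. (cmod (exp_sum r h a N (x0 + word_val s n w / real s ^ A)))^2) \<le> \<epsilon> * real B ^ 2"
proof -
  define \<epsilon>' where "\<epsilon>' = \<epsilon> / 8"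
  have \<epsilon>': "0 < \<epsilon>'" using \<epsilon> by (simp add: \<epsilon>'_def)
  obtain K where K: "decay s ^ K < \<epsilon>'" using real_arch_pow_inv[OF \<epsilon>'] decay[OF s] by blast
  obtain \<Lambda> N0 where sparse: "\<And>L N. L > 0 \<Longrightarrow> N \<ge> N0 \<Longrightarrow>
     real (card {j. j < N \<and> real s ^ \<Lambda> \<le> L * real r ^ j \<and> nonint_count s \<Lambda> (L * real r ^ j) < K}) \<le> \<epsilon>' * real N"
    using nonint_count_sparse[OF indep r s \<epsilon>'] by blast
  obtain c1 where c1: "C0 * real s ^ \<Lambda> < real r ^ c1" using real_arch_pow[of "real r"] r by auto
  obtain B0 :: nat where B0: "(2 + 2 * c1 + 2 * \<epsilon>' * N0) / (\<epsilon> / 2) < real B0" using reals_Archimedean2 by blast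
  show ?thesis
  proof (intro exI[of _ B0] allI impI)
    fix B A n a N q x0 assume B: "B0 \<le> B" and aN: "a \<le> N" "N \<le> B" and q: "2 \<le> (q::nat)"
      and start: "real s ^ A \<le> C0 * real r ^ a" and fin: "real h * real r ^ N \<le> real s ^ (A + n)"
    define W where "W = words (s * q) n"
    define x where "x w = x0 + word_val s n w / real s ^ A" for w
    have W: "finite W" "W \<noteq> {}" using s q by (auto simp: W_def intro!: words_nonempty)
    define M where "M = N - a"
    define P where "P g u = cmod (mean W (\<lambda>w. e1 (real h * (real r ^ g - 1) * real r ^ (a + u) * x w)))" for g u
    have P1: "P g u \<le> 1" for g u unfolding P_def by (rule norm_mean_le[OF W]) simp
    have col: "(\<Sum>u<M - g. P g u) \<le> c1 + \<epsilon>' * (real B + N0) + \<epsilon>' * B" if g: "0 < g" "g < M" for g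
    proof -
      define L where "L = real h * (real r ^ g - 1) * real r ^ a / real s ^ A"
      have "2 \<le> real r ^ g"
      proof -
        have "real r ^ 1 \<le> real r ^ g" using g r by (intro power_increasing) auto
        then have "real r \<le> real r ^ g" by (simp only: power_one_right)
        moreover have "2 \<le> real r" using r by simp
        ultimately show ?thesis by linarith
      qed
      then have "1 * 1 \<le> real h * (real r ^ g - 1)" using h by (intro mult_mono) auto
      then have "1 / C0 \<le> real h * (real r ^ g - 1) * (1 / C0)" using C0 by (simp add: divide_right_mono)
      also have "\<dots> \<le> real h * (real r ^ g - 1) * (real r ^ a / real s ^ A)"
        using start C0 s \<open>2 \<le> real r ^ g\<close> by (intro mult_left_mono mult_nonneg_nonneg) (auto simp: field_simps)
      finally have L: "1 / C0 \<le> L" by (simp add: L_def)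
      then have L0: "0 < L" using C0 by (meson less_le_trans zero_less_divide_1_iff)
      \<comment> \<open>Padding by \<open>N0\<close> meets the threshold of the sparseness estimate
        even when \<open>M\<close> is small; the total cost is linear in \<open>B\<close> and
        absorbed by \<open>B0\<close>.\<close>
      define bad where "bad = {u. u < M + N0 \<and> real s ^ \<Lambda> \<le> L * real r ^ u \<and> nonint_count s \<Lambda> (L * real r ^ u) < K}"
      have Pu: "P g u \<le> of_bool (u < c1) + of_bool (u \<in> bad) + \<epsilon>'" if u: "u < M - g" for u
      proof (cases "u < c1 \<or> u \<in> bad")
        case True then show ?thesis using P1[of g u] \<epsilon>' by auto
      next
        case False
        define X where "X = L * real r ^ u"
        have "real r ^ c1 \<le> real r ^ u" using False r by (intro power_increasing) auto
        then have "C0 * real s ^ \<Lambda> \<le> real r ^ u" using c1 by simp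
        then have "real s ^ \<Lambda> \<le> 1 / C0 * real r ^ u" using C0 by (simp add: field_simps)
        also have "\<dots> \<le> X" unfolding X_def using L by (intro mult_right_mono) auto
        finally have X1: "real s ^ \<Lambda> \<le> X" .
        have "X \<le> real h * real r ^ g * real r ^ a / real s ^ A * real r ^ u"
          unfolding X_def L_def by (intro mult_right_mono divide_right_mono) (auto simp: algebra_simps)
        also have "\<dots> = real h * real r ^ (g + a + u) / real s ^ A" by (simp add: power_add)
        also have "\<dots> \<le> real h * real r ^ N / real s ^ A"
          using u r by (intro divide_right_mono mult_left_mono power_increasing) (auto simp: M_def)
        also have "\<dots> \<le> real s ^ (A + n) / real s ^ A" using fin by (rule divide_right_mono) simp
        also have "\<dots> = real s ^ n" using s by (simp add: power_add)
        finally have X2: "X \<le> real s ^ n" .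
        have "u < M + N0" using u by simp
        then have "K \<le> nonint_count s \<Lambda> X" using False X1 unfolding bad_def X_def by auto
        moreover have "real h * (real r ^ g - 1) * real r ^ (a + u) / real s ^ A = X"
          by (simp add: X_def L_def power_add)
        ultimately have "P g u \<le> decay s ^ K"
          unfolding P_def W_def x_def mean_word_e1 using norm_prod_digit_cf[OF s q X1 X2] by simp
        then show ?thesis using K by simp
      qed
      have "(\<Sum>u<M - g. P g u) \<le> (\<Sum>u<M - g. of_bool (u < c1) + of_bool (u \<in> bad) + \<epsilon>')"
        using Pu by (intro sum_mono) auto
      also have "\<dots> = real (card ({..<M - g} \<inter> {u. u < c1})) + real (card ({..<M - g} \<inter> {u. u \<in> bad})) + (M - g) * \<epsilon>'"
        by (simp add: sum.distrib)
      also have "real (card ({..<M - g} \<inter> {u. u < c1})) \<le> c1"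
        using card_mono[of "{..<c1}" "{..<M - g} \<inter> {u. u < c1}"] by auto
      also have "real (card ({..<M - g} \<inter> {u. u \<in> bad})) \<le> real (card bad)"
        using card_mono[of bad "{..<M - g} \<inter> {u. u \<in> bad}"] by (auto simp: bad_def)
      also have "real (card bad) \<le> \<epsilon>' * (real (M + N0))" unfolding bad_def using L0 by (intro sparse) auto
      also have "\<epsilon>' * (real (M + N0)) \<le> \<epsilon>' * (real B + N0)" using \<epsilon>' aN by (intro mult_left_mono) (auto simp: M_def)
      also have "(M - g) * \<epsilon>' \<le> \<epsilon>' * B" using \<epsilon>' aN by (subst mult.commute, intro mult_left_mono) (auto simp: M_def)
      finally show ?thesis by simp
    qed
    have MB: "real M \<le> real B" using aN by (simp add: M_def)
    have "(\<Sum>g<M. \<Sum>u<M - g. P g u) \<le> (\<Sum>g<M. (if g = 0 then real M else 0) + (c1 + \<epsilon>' * (real B + N0) + \<epsilon>' * B))"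
    proof (rule sum_mono)
      fix g assume g: "g \<in> {..<M}"
      show "(\<Sum>u<M - g. P g u) \<le> (if g = 0 then real M else 0) + (c1 + \<epsilon>' * (real B + N0) + \<epsilon>' * B)"
      proof (cases "g = 0")
        case True
        have "(\<Sum>u<M. P 0 u) \<le> (\<Sum>u<M. 1)" by (intro sum_mono P1)
        moreover have "0 \<le> c1 + \<epsilon>' * (real B + N0) + \<epsilon>' * B" using \<epsilon>' by simp
        ultimately show ?thesis using True by simp
      next
        case False then show ?thesis using col[of g] g by simp
      qed
    qed
    also have "\<dots> = (\<Sum>g<M. if g = 0 then real M else 0) + M * (c1 + \<epsilon>' * (real B + N0) + \<epsilon>' * B)"
      by (simp add: sum.distrib)
    also have "(\<Sum>g<M. if g = 0 then real M else 0) \<le> real M" by simp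
    also have "M * (c1 + \<epsilon>' * (real B + N0) + \<epsilon>' * B) \<le> B * (c1 + \<epsilon>' * (real B + N0) + \<epsilon>' * B)"
      using MB \<epsilon>' by (intro mult_right_mono) auto
    finally have "2 * (\<Sum>g<M. \<Sum>u<M - g. P g u) \<le> 2 * (B + B * (c1 + \<epsilon>' * (real B + N0) + \<epsilon>' * B))"
      using MB by simp
    also have "\<dots> = B * (2 + 2 * c1 + 2 * \<epsilon>' * N0) + \<epsilon> / 2 * real B ^ 2"
      by (simp add: \<epsilon>'_def power2_eq_square field_simps)
    also have "\<dots> \<le> B * (\<epsilon> / 2 * B) + \<epsilon> / 2 * real B ^ 2"
    proof (intro add_right_mono mult_left_mono)
      have "(2 + 2 * c1 + 2 * \<epsilon>' * N0) / (\<epsilon> / 2) \<le> real B" using B0 B by linarith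
      then show "2 + 2 * c1 + 2 * \<epsilon>' * N0 \<le> \<epsilon> / 2 * B" using \<epsilon> by (simp add: field_simps)
    qed auto
    also have "\<dots> = \<epsilon> * real B ^ 2" by (simp add: power2_eq_square)
    finally have "2 * (\<Sum>g<M. \<Sum>u<M - g. P g u) \<le> \<epsilon> * real B ^ 2" .
    then show "mean (words (s * q) n) (\<lambda>w. (cmod (exp_sum r h a N (x0 + word_val s n w / real s ^ A)))^2) \<le> \<epsilon> * real B ^ 2"
      using mean_exp_sum_sq[OF aN(1), of W r h x] unfolding P_def M_def W_def x_def by linarith
  qed
qed

text \<open>In base \<open>s\<close> itself the smallness of \<open>1 / q\<close> does the work.
  Removing the power \<open>s^v\<close> from \<open>h * (s^g - 1)\<close> leaves a cofactor not
  divisible by \<open>s\<close>, and the factor at the matching place has modulus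
  \<open>1 / q\<close>. Being coprime to \<open>s^g - 1\<close>, the power \<open>s^v\<close>
  divides \<open>h\<close>, so \<open>v < h\<close> and the place lies inside the word.\<close>

lemma mean_exp_sum_same:
  assumes s: "2 \<le> s" and h: "1 \<le> h" and q: "1 \<le> q" and aN: "a \<le> N" "N \<le> B" and A: "A \<le> a + 3" and n: "B + h \<le> A + n"
  shows "mean (words (s * q) n) (\<lambda>w. (cmod (exp_sum s h a N (x0 + word_val s n w / real s ^ A)))^2) \<le> 8 * real B + 2 * real B ^ 2 / q"
proof -
  define W where "W = words (s * q) n"
  define x where "x w = x0 + word_val s n w / real s ^ A" for w
  have W: "finite W" "W \<noteq> {}" using s q by (auto simp: W_def intro!: words_nonempty)
  define M where "M = N - a"
  define P where "P g u = cmod (mean W (\<lambda>w. e1 (real h * (real s ^ g - 1) * real s ^ (a + u) * x w)))" for g u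
  have P1: "P g u \<le> 1" for g u unfolding P_def by (rule norm_mean_le[OF W]) simp
  have Pu: "P g u \<le> of_bool (u < 3) + 1 / q" if g: "0 < g" and u: "u < M - g" for g u
  \<comment> \<open>The first three shifts may point in front of the word, since \<open>A\<close>
    can exceed \<open>a\<close> by 3.\<close>
  proof (cases "u < 3")
    case True then show ?thesis using P1[of g u] by (simp add: add_increasing2)
  next
    case False
    define X where "X = h * (s ^ g - 1)"
    have sg: "2 \<le> s ^ g" using self_le_power[of s g] s g by linarith
    have X0: "X > 0" using h sg by (simp add: X_def)
    obtain u' where X: "X = s ^ multiplicity s X * u'" "\<not> s dvd u'"
      using multiplicity_decompose'[of X s] X0 s by auto
    define v where "v = multiplicity s X"
    have "coprime (s ^ v) (s ^ g - 1)"
    proof -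
      have "coprime (s ^ g) (s ^ g - 1)" using sg s by (intro coprime_diff_one_right_nat) auto
      then have "coprime s (s ^ g - 1)" using g by (simp only: coprime_power_left_iff) auto
      then show ?thesis by (simp only: coprime_power_left_iff) simp
    qed
    moreover have "s ^ v dvd h * (s ^ g - 1)" using X(1) unfolding X_def[symmetric] v_def by (intro multiplicity_dvd)
    ultimately have "s ^ v dvd h" by (simp add: coprime_dvd_mult_left_iff)
    then have "s ^ v \<le> h" using h by (intro dvd_imp_le) auto
    moreover have "v < s ^ v" 
    proof -
      have "v < 2 ^ v" by (rule less_exp)
      also have "\<dots> \<le> s ^ v" using s by (rule power_mono) simp
      finally show ?thesis .
    qed
    ultimately have v: "v < h" by simp
    define i where "i = a + u + v - A"
    have i: "A + i = a + u + v" "i < n" using False A u v aN n by (auto simp: i_def M_def)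
    have "real h * (real s ^ g - 1) = real X" using sg by (simp add: X_def of_nat_diff)
    also have "\<dots> = real s ^ v * real u'" using X(1) unfolding v_def[symmetric] using arg_cong[of X _ real] by fastforce
    finally have "real h * (real s ^ g - 1) * real s ^ (a + u) / real s ^ A / real s ^ (i + 1) = real u' * (real s ^ (a + u + v) / (real s ^ A * real s ^ (i + 1)))"
      by (simp add: power_add)
    also have "\<dots> = real u' * (real s ^ (A + i) / (real s ^ (A + i) * real s))" unfolding i(1)[symmetric] by (simp add: power_add mult_ac)
    also have "\<dots> = of_int (int u') / real s" using s by simp
    finally have eq: "real h * (real s ^ g - 1) * real s ^ (a + u) / real s ^ A / real s ^ (i + 1) = of_int (int u') / real s" .
    have "P g u = (\<Prod>k<n. cmod (digit_cf s q (real h * (real s ^ g - 1) * real s ^ (a + u) / real s ^ A / real s ^ (k + 1))))"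
      unfolding P_def W_def x_def mean_word_e1 by (rule prod_norm[symmetric])
    also have "\<dots> \<le> (\<Prod>k<n. if k = i then 1 / q else 1)"
    proof (intro prod_mono conjI)
      fix k
      have "cmod (digit_cf s q (of_int (int u') / real s)) = 1 / q"
        using s q X(2) by (subst digit_cf_nonmultiple) (auto simp: norm_divide)
      then show "cmod (digit_cf s q (real h * (real s ^ g - 1) * real s ^ (a + u) / real s ^ A / real s ^ (k + 1))) \<le> (if k = i then 1 / q else 1)"
        using eq norm_digit_cf_le_1 by auto
    qed auto
    also have "\<dots> = 1 / q" using i(2) by (simp add: prod.delta)
    finally show ?thesis by simp
  qed
  have MB: "real M \<le> real B" using aN by (simp add: M_def)
  have "(\<Sum>g<M. \<Sum>u<M - g. P g u) \<le> (\<Sum>g<M. (if g = 0 then real M else 0) + (3 + M / q))"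
  proof (rule sum_mono)
    fix g assume g: "g \<in> {..<M}"
    show "(\<Sum>u<M - g. P g u) \<le> (if g = 0 then real M else 0) + (3 + M / q)"
    proof (cases "g = 0")
      case True
      have "(\<Sum>u<M. P 0 u) \<le> (\<Sum>u<M. 1)" by (intro sum_mono P1)
      then show ?thesis using True by (simp add: add_increasing2)
    next
      case False
      have "(\<Sum>u<M - g. P g u) \<le> (\<Sum>u<M - g. of_bool (u < 3) + 1 / q)" using Pu False by (intro sum_mono) auto
      also have "\<dots> = real (card ({..<M - g} \<inter> {u. u < 3})) + (M - g) / q" by (simp add: sum.distrib)
      also have "card ({..<M - g} \<inter> {u. u < 3}) \<le> card {..<3::nat}" by (rule card_mono) auto
      also have "(M - g) / q \<le> M / q" by (intro divide_right_mono) auto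
      finally show ?thesis using False by simp
    qed
  qed
  also have "\<dots> = (\<Sum>g<M. if g = 0 then real M else 0) + M * (3 + M / q)" by (simp add: sum.distrib)
  also have "(\<Sum>g<M. if g = 0 then real M else 0) \<le> real M" by simp
  also have "M * (3 + M / q) \<le> B * (3 + B / q)" using MB by (intro mult_mono add_left_mono divide_right_mono) auto
  finally have "2 * (\<Sum>g<M. \<Sum>u<M - g. P g u) \<le> 2 * (real M + B * (3 + B / q))" by simp
  also have "\<dots> \<le> 2 * (real B + B * (3 + B / q))" using MB by simp
  also have "\<dots> = 8 * real B + 2 * real B ^ 2 / q" by (simp add: power2_eq_square algebra_simps)
  finally have "2 * (\<Sum>g<M. \<Sum>u<M - g. P g u) \<le> 8 * real B + 2 * real B ^ 2 / q" .
  then show ?thesis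
    using mean_exp_sum_sq[OF aN(1), of W s h x] unfolding P_def M_def W_def x_def by linarith
qed

section \<open>Frequency of the digit zero\<close>

definition zero_prob :: "nat \<Rightarrow> nat \<Rightarrow> real" where
  "zero_prob s q = 1 / q + (1 - 1 / q) / s"

text \<open>A variance bound: the centred indicators have modulus at most 1, and products for two
  different letters have mean 0.\<close>

lemma mean_zero_count:
  assumes s: "2 \<le> s" and q: "1 \<le> q" and m: "m \<le> n"
  shows "mean (words (s * q) n) (\<lambda>w. ((\<Sum>i<m. of_bool (digit s (w i) = 0)) - zero_prob s q * real m)^2) \<le> real m"
proof -
  define p where "p = zero_prob s q"
  define X where "X u = of_bool (digit s u = 0) - p" for u
  define W where "W = words (s * q) n"
  have W: "finite W" "W \<noteq> {}" using s q by (auto simp: W_def intro!: words_nonempty)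
  have q': "0 < real q" "1 \<le> real q" using q by auto
  have p: "0 \<le> p" "p \<le> 1"
  proof -
    show "0 \<le> p" unfolding p_def zero_prob_def using s q' by (intro add_nonneg_nonneg divide_nonneg_nonneg) auto
    have "(1 - 1 / q) / s \<le> (1 - 1 / q) / 1" using s q' by (intro divide_left_mono) auto
    then show "p \<le> 1" unfolding p_def zero_prob_def by simp
  qed
  have "(\<Sum>u<s * q. X u) = 0"
  proof -
    have "(\<Sum>c<s. of_bool (c = 0) :: real) = 1"
    proof -
      have "{..<s} \<inter> {c. c = 0} = {0}" using s by auto
      then show ?thesis by simp
    qed
    moreover have "(\<Sum>u<s * q. of_bool (digit s u = 0) :: real) = of_nat s * of_bool (0 = (0::nat)) + of_nat (q - 1) * (\<Sum>c<s. of_bool (c = 0))"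
      using s q by (intro sum_digit_split) auto
    ultimately have "(\<Sum>u<s * q. of_bool (digit s u = 0) :: real) = s + (real q - 1)" using q by (simp add: of_nat_diff)
    moreover have "p * (s * q) = s + (real q - 1)" unfolding p_def zero_prob_def using s q' by (simp add: field_simps)
    ultimately show ?thesis unfolding X_def sum_subtractf by (simp add: mult.commute)
  qed
  have cov: "mean W (\<lambda>w. X (w i) * X (w k)) \<le> of_bool (i = k)" if ik: "i < m" "k < m" for i k
  proof (cases "i = k")
    case True
    have "\<bar>X u\<bar> \<le> 1" for u using p by (auto simp: X_def)
    then have "\<bar>X u * X u\<bar> \<le> 1" for u unfolding abs_mult by (intro mult_le_one) auto
    then have "norm (mean W (\<lambda>w. X (w i) * X (w i))) \<le> 1" by (intro norm_mean_le[OF W]) simp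
    then show ?thesis using True by simp
  next
    case False
    define F where "F j u = (if j = i \<or> j = k then X u else 1)" for j u
    have "X (w i) * X (w k) = (\<Prod>j<n. F j (w j))" for w
    proof -
      have "(\<Prod>j<n. F j (w j)) = (\<Prod>j\<in>{i, k}. F j (w j))"
        using ik m by (intro prod.mono_neutral_right) (auto simp: F_def)
      then show ?thesis using False by (simp add: F_def)
    qed
    then have "mean W (\<lambda>w. X (w i) * X (w k)) = (\<Prod>j<n. (\<Sum>u<s * q. F j u) / of_nat (s * q))"
      unfolding W_def by (simp only: mean_words_prod)
    also have "\<dots> = 0"
    proof (rule prod_zero)
      show "\<exists>j\<in>{..<n}. (\<Sum>u<s * q. F j u) / of_nat (s * q) = 0"
        using ik m \<open>(\<Sum>u<s * q. X u) = 0\<close> by (intro bexI[of _ i]) (auto simp: F_def)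
    qed simp
    finally show ?thesis by simp
  qed
  have "mean W (\<lambda>w. ((\<Sum>i<m. of_bool (digit s (w i) = 0)) - p * real m)^2) = mean W (\<lambda>w. \<Sum>i<m. \<Sum>k<m. X (w i) * X (w k))"
    by (simp add: X_def sum_subtractf power2_eq_square sum_product[symmetric] mult.commute)
  also have "\<dots> = (\<Sum>i<m. \<Sum>k<m. mean W (\<lambda>w. X (w i) * X (w k)))" by (simp only: mean_sum)
  also have "\<dots> \<le> (\<Sum>i<m. \<Sum>k<m. of_bool (i = k))" using cov by (intro sum_mono) auto
  also have "\<dots> = (\<Sum>i<m. 1)"
  proof (rule sum.cong)
    fix i assume "i \<in> {..<m}"
    then have "{..<m} \<inter> {k. i = k} = {i}" by auto
    then show "(\<Sum>k<m. of_bool (i = k) :: real) = 1" by simp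
  qed auto
  finally show ?thesis unfolding p_def W_def by simp
qed

section \<open>Finite approximations to normality and to bias\<close>

text \<open>For \<open>r \<ge> 2\<close> the largest \<open>e\<close> with
  \<open>r^e \<le> 2^M\<close>, that is, the number of base-\<open>r\<close> digits matched by
  \<open>M\<close> bits. The form of a bounded count makes it visibly computable.\<close>

definition expo :: "nat \<Rightarrow> nat \<Rightarrow> nat" where
  "expo r M = card {i. i < M \<and> r ^ Suc i \<le> 2 ^ M}"

lemma expo_eqI:
  assumes r: "2 \<le> r" and e: "r ^ e \<le> 2 ^ M" "2 ^ M < r ^ Suc e"
  shows "expo r M = e"
proof -
  have "{i. i < M \<and> r ^ Suc i \<le> 2 ^ M} = {..<e}"
  proof (intro equalityI subsetI)
    fix i assume "i \<in> {i. i < M \<and> r ^ Suc i \<le> 2 ^ M}"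
    then have "r ^ Suc i \<le> 2 ^ M" by blast
    then have "r ^ Suc i < r ^ Suc e" using e(2) by linarith
    then show "i \<in> {..<e}" using r by (simp only: power_strict_increasing_iff) auto
  next
    fix i assume i: "i \<in> {..<e}"
    then have "r ^ Suc i \<le> r ^ e" using r by (intro power_increasing) auto
    then have ri: "r ^ Suc i \<le> 2 ^ M" using e(1) by linarith
    have "(2::nat) ^ Suc i \<le> r ^ Suc i" using r by (intro power_mono) auto
    then have "(2::nat) ^ Suc i \<le> 2 ^ M" using ri by linarith
    then have "Suc i \<le> M" by (simp only: power_increasing_iff[of "2::nat"])
    then show "i \<in> {i. i < M \<and> r ^ Suc i \<le> 2 ^ M}" using ri by auto
  qed
  then show ?thesis by (simp add: expo_def)
qed

lemma expo_bounds:
  assumes r: "2 \<le> r" shows "r ^ expo r M \<le> 2 ^ M" "2 ^ M < r ^ Suc (expo r M)"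
proof -
  obtain e where "r ^ e \<le> 2 ^ M" "2 ^ M < r ^ (e + 1)"
    using ex_power_ivl1[OF r, of "2 ^ M"] by auto
  then show "r ^ expo r M \<le> 2 ^ M" "2 ^ M < r ^ Suc (expo r M)"
    using expo_eqI[OF r] by auto
qed

lemma le_expo_iff: "2 \<le> r \<Longrightarrow> e \<le> expo r M \<longleftrightarrow> r ^ e \<le> 2 ^ M"
proof
  assume r: "2 \<le> r" and "e \<le> expo r M"
  then have "r ^ e \<le> r ^ expo r M" by (intro power_increasing) auto
  then show "r ^ e \<le> 2 ^ M" using expo_bounds(1)[OF r, of M] by linarith
next
  assume r: "2 \<le> r" and "r ^ e \<le> 2 ^ M"
  then have "r ^ e < r ^ Suc (expo r M)" using expo_bounds(2)[OF r, of M] by linarith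
  then have "e < Suc (expo r M)" using r power_strict_increasing_iff[of r e "Suc (expo r M)"] by linarith
  then show "e \<le> expo r M" by simp
qed

lemma expo_double:
  assumes r: "2 \<le> r" shows "2 * expo r M \<le> expo r (2 * M)" "expo r (2 * M) \<le> 2 * expo r M + 1"
proof -
  have "(r ^ expo r M) ^ 2 \<le> (2 ^ M) ^ 2" by (intro power_mono expo_bounds r) auto
  then show "2 * expo r M \<le> expo r (2 * M)"
    using r by (simp add: le_expo_iff power_mult[symmetric] mult.commute)
  have "(2 ^ M) ^ 2 < (r ^ Suc (expo r M)) ^ 2" by (intro power_strict_mono expo_bounds r) auto
  then have "2 ^ (2 * M) < r ^ (2 * expo r M + 2)" by (simp only: power_mult[symmetric]) (simp add: mult.commute)
  then have "\<not> 2 * expo r M + 2 \<le> expo r (2 * M)" using r by (simp add: le_expo_iff)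
  then show "expo r (2 * M) \<le> 2 * expo r M + 1" by simp
qed

lemma expo_le: "2 \<le> r \<Longrightarrow> expo r M \<le> M"
  unfolding expo_def by (rule order_trans[OF card_mono[of "{..<M}"]]) auto

lemma expo_ge: assumes r: "2 \<le> r" and "r * e \<le> M" shows "e \<le> expo r M"
proof -
  have "r ^ e \<le> (2 ^ r) ^ e" by (intro power_mono) (auto intro: less_imp_le less_exp)
  also have "\<dots> \<le> 2 ^ M" unfolding power_mult[symmetric] using assms by (intro power_increasing) auto
  finally show ?thesis using r by (simp add: le_expo_iff)
qed

definition tent_dev :: "nat \<Rightarrow> nat \<Rightarrow> nat \<Rightarrow> nat \<Rightarrow> nat \<Rightarrow> real \<Rightarrow> real" where
  "tent_dev r d a A N x = (\<Sum>j\<in>{A..<N}. (tent d a (real r ^ j * x) - 1 / real d))"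

text \<open>The places from \<open>expo r M\<close> to \<open>expo r (2 * M)\<close> are those
  settled by passing from \<open>M\<close> to \<open>2 * M\<close> bits. All end points
  \<open>N\<close> are tested, since normality speaks of every average; \<open>K\<close> is both
  resolution and precision. For \<open>K = 0\<close> the condition is void, which guarantees a
  fallback in every stage.\<close>

definition spread :: "nat \<Rightarrow> nat \<Rightarrow> nat \<Rightarrow> nat \<Rightarrow> bool" where
  "spread r K M p \<longleftrightarrow> (\<forall>d a N. 1 \<le> a \<longrightarrow> a < d \<longrightarrow> d \<le> K \<longrightarrow> N \<le> expo r (2 * M) \<longrightarrow>
     \<bar>tent_dev r d a (expo r M) N (real p / 2 ^ (2 * M))\<bar> \<le> real N / real K)"

text \<open>Dictated by the mean of \<open>exp_energy\<close>: with \<open>q = bias_denom m\<close>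
  the bound \<open>114425856 * (m + 1)^15 * 17 / (8 * q)\<close> is at most 1/4, so the bias is too
  weak to disturb \<open>spread s m\<close>.\<close>

definition bias_denom :: "nat \<Rightarrow> nat" where
  "bias_denom m = 10 ^ 9 * (m + 1) ^ 15"

text \<open>With \<open>q = bias_denom m\<close>, zeros are expected at rate at least
  \<open>1/s + 1/(2*q)\<close>. The demanded rate \<open>1/s + 1/(4*q)\<close> leaves room for
  fluctuation, and the interval ends at \<open>1/s + 1/(8*q)\<close> to tolerate rounding; the rate
  still exceeds the interval length by \<open>1/(8*q)\<close>.\<close>

definition biased :: "nat \<Rightarrow> nat \<Rightarrow> nat \<Rightarrow> nat \<Rightarrow> bool" where
  "biased s m M p \<longleftrightarrow> (1 / real s + 1 / (4 * real (bias_denom m))) * (real (expo s (2 * M)) - real (expo s M)) \<le>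
     real (card {j \<in> {expo s M..<expo s (2 * M)}. frac (real s ^ j * (real p / 2 ^ (2 * M))) < 1 / real s + 1 / (8 * real (bias_denom m))})"

definition task_ok :: "nat \<Rightarrow> nat \<Rightarrow> nat \<Rightarrow> nat \<Rightarrow> nat \<Rightarrow> bool" where
  "task_ok s m k M p \<longleftrightarrow> (\<forall>r\<le>k. prime r \<longrightarrow> r \<noteq> s \<longrightarrow> spread r k M p) \<and> (prime s \<longrightarrow> spread s m M p) \<and> biased s m M p"

lemma sum_geometric_le:
  assumes "2 \<le> r" shows "(\<Sum>j<N. real r ^ j) \<le> real r ^ N"
proof (induction N)
  case (Suc N)
  have "(\<Sum>j<Suc N. real r ^ j) \<le> 2 * real r ^ N" using Suc by simp
  also have "\<dots> \<le> real r ^ Suc N" using assms by (simp add: mult_right_mono)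
  finally show ?case .
qed simp

text \<open>The errors \<open>d * r^j / c\<close> form a geometric series, so their total is at most
  \<open>d\<close> however long the block is.\<close>

lemma tent_dev_perturb:
  assumes r: "2 \<le> r" and a: "1 \<le> a" "a < d" and N: "real r ^ N \<le> c" and xy: "\<bar>x - y\<bar> \<le> 1 / c" and c: "0 < c"
  shows "\<bar>tent_dev r d a A N x - tent_dev r d a A N y\<bar> \<le> real d"
proof -
  have "\<bar>tent_dev r d a A N x - tent_dev r d a A N y\<bar> = \<bar>\<Sum>j\<in>{A..<N}. tent d a (real r ^ j * x) - tent d a (real r ^ j * y)\<bar>"
    unfolding tent_dev_def by (simp add: sum_subtractf)
  also have "\<dots> \<le> (\<Sum>j\<in>{A..<N}. \<bar>tent d a (real r ^ j * x) - tent d a (real r ^ j * y)\<bar>)" by (rule sum_abs)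
  also have "\<dots> \<le> (\<Sum>j<N. \<bar>tent d a (real r ^ j * x) - tent d a (real r ^ j * y)\<bar>)" by (intro sum_mono2) auto
  also have "\<dots> \<le> (\<Sum>j<N. real d * (real r ^ j * (1 / c)))"
  proof (rule sum_mono)
    fix j
    have "\<bar>tent d a (real r ^ j * x) - tent d a (real r ^ j * y)\<bar> \<le> d * \<bar>real r ^ j * x - real r ^ j * y\<bar>"
      by (rule tent_lipschitz[OF a])
    also have "\<bar>real r ^ j * x - real r ^ j * y\<bar> = real r ^ j * \<bar>x - y\<bar>"
      by (simp add: right_diff_distrib[symmetric] abs_mult)
    also have "d * (real r ^ j * \<bar>x - y\<bar>) \<le> d * (real r ^ j * (1 / c))" using xy by (intro mult_left_mono) auto
    finally show "\<bar>tent d a (real r ^ j * x) - tent d a (real r ^ j * y)\<bar> \<le> real d * (real r ^ j * (1 / c))" .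
  qed
  also have "\<dots> = real d / c * (\<Sum>j<N. real r ^ j)" by (simp add: sum_distrib_left)
  also have "\<dots> \<le> real d / c * c"
    using sum_geometric_le[OF r, of N] N c by (intro mult_left_mono) auto
  finally show ?thesis using c by simp
qed

definition step_len :: "nat \<Rightarrow> nat \<Rightarrow> nat \<Rightarrow> nat" where "step_len r K M = expo r M div (16 * K)"

text \<open>Squares scaled so that a total below 1 forces every single exponential sum below its
  threshold; one random variable replaces a family of conditions. The frequencies up to
  \<open>8 * K^4\<close> are those of the tent criterion. Only multiples of \<open>step_len\<close>
  serve as end points, at most \<open>96 * K + 1\<close> of them, so the number of terms is bounded
  in \<open>K\<close> alone.\<close>

definition exp_energy :: "nat \<Rightarrow> nat \<Rightarrow> nat \<Rightarrow> real \<Rightarrow> real" where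
  "exp_energy r K M x = (\<Sum>h=1..8 * K ^ 4. \<Sum>t\<in>{t. t \<le> 96 * K \<and> expo r M \<le> step_len r K M * t \<and> step_len r K M * t \<le> expo r (2 * M)}.
     (cmod (exp_sum r h (expo r M) (step_len r K M * t) x))^2 / (real (expo r (2 * M)) / (384 * real K ^ 5))^2)"

lemma exp_energy_nonneg: "0 \<le> exp_energy r K M x"
  unfolding exp_energy_def by (intro sum_nonneg) auto

lemma exp_energy_bound:
  assumes en: "exp_energy r K M x < 1" and h: "1 \<le> h" "h \<le> 8 * K ^ 4"
    and t: "t \<le> 96 * K" "expo r M \<le> step_len r K M * t" "step_len r K M * t \<le> expo r (2 * M)" and B: "0 < expo r (2 * M)" and K: "0 < K"
  shows "cmod (exp_sum r h (expo r M) (step_len r K M * t) x) \<le> real (expo r (2 * M)) / (384 * real K ^ 5)"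
proof -
  define D where "D = real (expo r (2 * M)) / (384 * real K ^ 5)"
  have D: "0 < D" unfolding D_def using B K by simp
  define T where "T = {t. t \<le> 96 * K \<and> expo r M \<le> step_len r K M * t \<and> step_len r K M * t \<le> expo r (2 * M)}"
  have T: "finite T" "t \<in> T" using t unfolding T_def by auto
  define f where "f h t = (cmod (exp_sum r h (expo r M) (step_len r K M * t) x))^2 / D^2" for h t
  have "f h t \<le> (\<Sum>t\<in>T. f h t)" using T by (intro member_le_sum) (auto simp: f_def)
  also have "\<dots> \<le> (\<Sum>h=1..8 * K ^ 4. \<Sum>t\<in>T. f h t)"
    using h by (intro member_le_sum[of h "{1..8 * K ^ 4}" "\<lambda>h. \<Sum>t\<in>T. f h t"]) (auto simp: f_def intro!: sum_nonneg)
  also have "\<dots> < 1" using en unfolding exp_energy_def T_def f_def D_def .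
  finally have "(cmod (exp_sum r h (expo r M) (step_len r K M * t) x))^2 < D^2" using D by (simp add: f_def divide_less_eq)
  then have "(cmod (exp_sum r h (expo r M) (step_len r K M * t) x))^2 \<le> D^2" by (rule less_imp_le)
  then show ?thesis unfolding D_def[symmetric] by (rule power2_le_imp_le) (use D in simp)
qed

lemma sqrt_8: "4 * real K ^ 2 \<le> sqrt (2 * (real (8 * K ^ 4) + 1))"
  by (rule real_le_rsqrt) (simp add: power_mult_distrib power_mult[symmetric])

text \<open>The error budget is \<open>N / (8 * K)\<close> from the exponential sums,
  \<open>N / (4 * K)\<close> from the width of the kernel, \<open>N / (16 * K)\<close> from lowering
  \<open>N\<close> to a checkpoint, and \<open>N / (16 * K)\<close> from replacing \<open>x\<close>
  by the dyadic point. Quantities measured by the end of the block are converted to \<open>N\<close>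
  through \<open>expo r (2 * M) \<le> 3 * expo r M\<close>.\<close>

lemma spread_if_exp_energy:
  assumes r: "2 \<le> r" and K: "1 \<le> K" and A: "16 * K ^ 2 \<le> expo r M"
    and en: "exp_energy r K M x < 1" and xp: "\<bar>real p / 2 ^ (2 * M) - x\<bar> \<le> 1 / 2 ^ (2 * M)"
  shows "spread r K M p"
  unfolding spread_def
proof (intro allI impI)
  fix d a N assume a: "1 \<le> a" "a < d" and dK: "d \<le> K" and N: "N \<le> expo r (2 * M)"
  define e where "e = expo r M"
  define B where "B = expo r (2 * M)"
  define st where "st = step_len r K M"
  have A': "16 * K ^ 2 \<le> e" using A by (simp add: e_def)
  have K2: "K \<le> K ^ 2" using K by (simp add: power2_eq_square)
  have e16: "16 * K \<le> e" using A' K2 by linarith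
  have Be: "B \<le> 3 * e" "0 < B" unfolding B_def e_def using expo_double[OF r, of M] e16 K unfolding e_def by linarith+
  have st1: "1 \<le> st" unfolding st_def step_len_def using e16 K unfolding e_def by (simp add: Suc_leI div_greater_zero_iff)
  have st2: "e \<le> st * (32 * K)"
  proof -
    have "e < (st + 1) * (16 * K)" unfolding st_def step_len_def e_def using K
      by (metis Suc_eq_plus1 add.commute dividend_less_times_div mult.commute mult_Suc_right mult_pos_pos zero_less_numeral less_le_trans zero_less_one)
    also have "\<dots> \<le> (2 * st) * (16 * K)" using st1 by (intro mult_right_mono) auto
    finally show ?thesis by simp
  qed
  have st3: "16 * K * st \<le> e" unfolding st_def step_len_def e_def by simp
  show "\<bar>tent_dev r d a (expo r M) N (real p / 2 ^ (2 * M))\<bar> \<le> real N / real K"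
  proof (cases "N \<le> e")
    case True then show ?thesis by (simp add: tent_dev_def e_def)
  next
    case False
    define y where "y = real p / 2 ^ (2 * M)"
    have NB: "N \<le> B" using N by (simp add: B_def)
    have pert: "\<bar>tent_dev r d a e N y - tent_dev r d a e N x\<bar> \<le> d"
    proof (rule tent_dev_perturb[OF r a])
      have "r ^ N \<le> 2 ^ (2 * M)" using N r by (simp add: le_expo_iff)
      then have "real (r ^ N) \<le> real (2 ^ (2 * M))" by (simp only: of_nat_le_iff)
      then show "real r ^ N \<le> 2 ^ (2 * M)" by simp
    qed (use xp in \<open>auto simp: y_def\<close>)
    define t where "t = N div st"
    define N' where "N' = st * t"
    have "N = N' + N mod st" unfolding N'_def t_def by simp
    moreover have "N mod st < st" using st1 by simp
    ultimately have N': "N' \<le> N" "N < N' + st" by linarith+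
    have tail: "\<bar>\<Sum>j\<in>{max e N'..<N}. (tent d a (real r ^ j * x) - 1 / d)\<bar> \<le> N / (16 * K)"
    proof -
      have "\<bar>\<Sum>j\<in>{max e N'..<N}. (tent d a (real r ^ j * x) - 1 / d)\<bar> \<le> (\<Sum>j\<in>{max e N'..<N}. 1)"
      proof (rule order_trans[OF sum_abs], rule sum_mono)
        fix j
        have "0 \<le> 1 / real d" "1 / real d \<le> 1" using a by auto
        then show "\<bar>tent d a (real r ^ j * x) - 1 / d\<bar> \<le> 1" using tent_bounds[of d a "real r ^ j * x"] by linarith
      qed
      also have "\<dots> \<le> real st" using N' by simp
      also have "\<dots> \<le> N / (16 * K)"
      proof -
        have "16 * K * st \<le> N" using st3 False by simp
        then have "real (16 * K * st) \<le> real N" by (simp only: of_nat_le_iff)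
        then show ?thesis using K by (simp add: le_divide_eq mult.commute)
      qed
      finally show ?thesis .
    qed
    have main: "\<bar>tent_dev r d a e N' x\<bar> \<le> N / (8 * K) + N / (4 * K)"
    proof (cases "e \<le> N'")
      case False then show ?thesis by (simp add: tent_dev_def)
    next
      case True
      \<comment> \<open>The block ends by \<open>3 * e\<close>, and \<open>e\<close> is at most
        \<open>32 * K\<close> steps.\<close>
      have t96: "t \<le> 96 * K"
      proof -
        have "st * t \<le> 3 * (st * (32 * K))" using N' NB Be st2 unfolding N'_def by linarith
        then have "st * t \<le> st * (96 * K)" by (simp add: algebra_simps)
        then show ?thesis using st1 by simp
      qed
      have "\<bar>tent_dev r d a e N' x\<bar> \<le> 2 * (\<Sum>h=1..8 * K ^ 4. cmod (exp_sum r h e N' x)) + real (card {e..<N'}) * real d / sqrt (2 * (real (8 * K ^ 4) + 1))"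
        unfolding tent_dev_def exp_sum_def by (rule weyl_tent[OF _ a]) simp
      also have "\<dots> \<le> 2 * (\<Sum>h=1..8 * K ^ 4. real B / (384 * real K ^ 5)) + real N * real K / (4 * real K ^ 2)"
      proof (intro add_mono mult_left_mono sum_mono)
        fix h assume "h \<in> {1..8 * K ^ 4}"
        then show "cmod (exp_sum r h e N' x) \<le> real B / (384 * real K ^ 5)"
          unfolding N'_def e_def st_def B_def using K True N' NB t96 Be unfolding N'_def e_def st_def B_def
          by (intro exp_energy_bound[OF en]) auto
      next
        have "real (card {e..<N'}) \<le> real N" using N' by simp
        then show "real (card {e..<N'}) * real d / sqrt (2 * (real (8 * K ^ 4) + 1)) \<le> real N * real K / (4 * real K ^ 2)"
          using dK sqrt_8[of K] K by (intro frac_le mult_mono) auto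
      qed auto
      also have "2 * (\<Sum>h=1..8 * K ^ 4. real B / (384 * real K ^ 5)) = real B / (24 * K)"
        using K by (simp add: field_simps eval_nat_numeral)
      also have "real B / (24 * K) \<le> N / (8 * K)"
      proof -
        have "real B \<le> 3 * real N" using Be \<open>\<not> N \<le> e\<close> by linarith
        then have "real B / (24 * K) \<le> 3 * real N / (24 * K)" by (rule divide_right_mono) simp
        then show ?thesis by simp
      qed
      also have "real N * real K / (4 * real K ^ 2) = N / (4 * K)" using K by (simp add: power2_eq_square)
      finally show ?thesis by simp
    qed
    have split: "tent_dev r d a e N x = tent_dev r d a e N' x + (\<Sum>j\<in>{max e N'..<N}. (tent d a (real r ^ j * x) - 1 / d))"
    proof (cases "e \<le> N'")
      case True then show ?thesis unfolding tent_dev_def using N' by (simp add: sum.atLeastLessThan_concat max_def)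
    next
      case nle: False then show ?thesis unfolding tent_dev_def by (simp add: max_def)
    qed
    have dN: "real d \<le> N / (16 * K)"
    proof -
      have "16 * K * d \<le> 16 * K ^ 2" using dK by (simp add: power2_eq_square)
      also have "\<dots> \<le> N" using A' False by simp
      finally have "real (16 * K * d) \<le> real N" by (simp only: of_nat_le_iff)
      then show ?thesis using K by (simp add: le_divide_eq mult.commute)
    qed
    have "\<bar>tent_dev r d a e N y\<bar> \<le> N / (8 * K) + N / (4 * K) + N / (16 * K) + N / (16 * K)"
      using pert main tail dN split by linarith
    also have "\<dots> \<le> N / K" using K by (simp add: field_simps)
    finally show ?thesis by (simp add: y_def e_def)
  qed
qed

text \<open>The constant 114425856 is 8 * 97 * 384^2, from the number of frequencies, the number of
  checkpoints and the squared threshold; the exponent is 15 = 4 + 1 + 10.\<close>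

lemma mean_exp_energy:
  assumes K: "1 \<le> K" and B: "0 < expo r (2 * M)"
    and bound: "\<And>h N. 1 \<le> h \<Longrightarrow> h \<le> 8 * K ^ 4 \<Longrightarrow> expo r M \<le> N \<Longrightarrow> N \<le> expo r (2 * M) \<Longrightarrow>
      mean W (\<lambda>w. (cmod (exp_sum r h (expo r M) N (x w)))^2) \<le> c * real (expo r (2 * M)) ^ 2"
    and c: "0 \<le> c"
  shows "mean W (\<lambda>w. exp_energy r K M (x w)) \<le> 114425856 * real K ^ 15 * c"
proof -
  define B where "B = real (expo r (2 * M))"
  have B0: "B > 0" using assms by (simp add: B_def)
  define T where "T = {t. t \<le> 96 * K \<and> expo r M \<le> step_len r K M * t \<and> step_len r K M * t \<le> expo r (2 * M)}"
  have T: "finite T" "T \<subseteq> {..96 * K}" unfolding T_def by auto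
  have cT: "card T \<le> 97 * K" using card_mono[OF _ T(2)] K by simp
  have "mean W (\<lambda>w. exp_energy r K M (x w)) = (\<Sum>h=1..8 * K ^ 4. \<Sum>t\<in>T.
     mean W (\<lambda>w. (cmod (exp_sum r h (expo r M) (step_len r K M * t) (x w)))^2) / (B / (384 * real K ^ 5))^2)"
    unfolding exp_energy_def T_def[symmetric] B_def[symmetric] by (simp only: mean_sum mean_divide)
  also have "\<dots> \<le> (\<Sum>h=1..8 * K ^ 4. \<Sum>t\<in>T. (c * B ^ 2) / (B / (384 * real K ^ 5))^2)"
    unfolding B_def by (intro sum_mono divide_right_mono bound) (auto simp: T_def)
  also have "\<dots> = 8 * real K ^ 4 * real (card T) * ((c * B ^ 2) / (B / (384 * real K ^ 5))^2)" by simp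
  also have "(c * B ^ 2) / (B / (384 * real K ^ 5))^2 = 147456 * real K ^ 10 * c"
    using B0 K by (simp add: field_simps power_mult_distrib power_divide power_mult[symmetric])
  also have "8 * real K ^ 4 * real (card T) * (147456 * real K ^ 10 * c) \<le> 8 * real K ^ 4 * (97 * real K) * (147456 * real K ^ 10 * c)"
  proof (intro mult_right_mono mult_left_mono)
    show "real (card T) \<le> 97 * real K" using cT by (metis of_nat_le_iff of_nat_mult of_nat_numeral)
  qed (use c in auto)
  also have "\<dots> = 114425856 * real K ^ 15 * c" by (simp add: eval_nat_numeral)
  finally show ?thesis .
qed


section \<open>From zero digits to biased blocks\<close>

lemma frac_of_int_add: "frac (of_int k + x) = frac x" for x :: real
  by (simp add: frac_def)

text \<open>Earlier digits contribute an integer and digit \<open>i\<close> nothing; the rest is a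
  finite expansion starting one place later, hence strictly below \<open>1 / s\<close>.\<close>

lemma zero_digit_frac:
  assumes s: "2 \<le> s" and i: "i < n" and z: "digit s (w i) = 0"
  shows "frac (real s ^ i * word_val s n w) < 1 / real s"
proof -
  define dg where "dg k = real (digit s (w k))" for k
  have dg: "0 \<le> dg k" "dg k \<le> real s - 1" for k
  proof -
    have "digit s (w k) < s" using s by (intro digit_less) simp
    then have "real (digit s (w k) + 1) \<le> real s" by (simp only: of_nat_le_iff)
    then show "dg k \<le> real s - 1" by (simp add: dg_def)
  qed (simp add: dg_def)
  define tl where "tl = (\<Sum>k\<in>{Suc i..<n}. dg k / real s ^ (k - i + 1))"
  have "real s ^ i * word_val s n w = (\<Sum>k<n. real s ^ i * (dg k / real s ^ (k + 1)))"
    by (simp add: word_val_def dg_def sum_distrib_left)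
  also have "\<dots> = (\<Sum>k\<in>{0..<i}. real s ^ i * (dg k / real s ^ (k + 1))) + (\<Sum>k\<in>{i..<n}. real s ^ i * (dg k / real s ^ (k + 1)))"
    using i by (simp add: sum.atLeastLessThan_concat atLeast0LessThan[symmetric] del: atLeast0LessThan)
  also have "(\<Sum>k\<in>{i..<n}. real s ^ i * (dg k / real s ^ (k + 1))) = real s ^ i * (dg i / real s ^ (i + 1)) + (\<Sum>k\<in>{Suc i..<n}. real s ^ i * (dg k / real s ^ (k + 1)))"
    using i by (rule sum.atLeast_Suc_lessThan)
  also have "(\<Sum>k\<in>{Suc i..<n}. real s ^ i * (dg k / real s ^ (k + 1))) = tl"
    unfolding tl_def
  proof (rule sum.cong)
    fix k assume "k \<in> {Suc i..<n}"
    then have "k + 1 = i + (k - i + 1)" by simp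
    then have "real s ^ (k + 1) = real s ^ i * real s ^ (k - i + 1)" by (metis power_add)
    then show "real s ^ i * (dg k / real s ^ (k + 1)) = dg k / real s ^ (k - i + 1)" using s by simp
  qed auto
  also have "real s ^ i * (dg i / real s ^ (i + 1)) = 0" using z by (simp add: dg_def)
  also have "(\<Sum>k\<in>{0..<i}. real s ^ i * (dg k / real s ^ (k + 1))) = of_int (\<Sum>k\<in>{0..<i}. int (digit s (w k)) * int s ^ (i - k - 1))"
    unfolding of_int_sum
  proof (rule sum.cong)
    fix k assume "k \<in> {0..<i}"
    then have "i = (k + 1) + (i - k - 1)" by simp
    then have "real s ^ i = real s ^ (k + 1) * real s ^ (i - k - 1)" by (metis power_add)
    then show "real s ^ i * (dg k / real s ^ (k + 1)) = of_int (int (digit s (w k)) * int s ^ (i - k - 1))"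
      using s by (simp add: dg_def)
  qed auto
  finally have "frac (real s ^ i * word_val s n w) = frac tl" by (simp only: add_0 frac_of_int_add)
  moreover have tl: "0 \<le> tl" "tl < 1 / real s"
  proof -
    show "0 \<le> tl" unfolding tl_def using dg by (intro sum_nonneg) auto
    have "(\<Sum>k\<in>{Suc i..<n}. dg k / real s ^ (k - i + 1)) \<le> (\<Sum>k\<in>{Suc i..<n}. 1 / real s ^ (k - i) - 1 / real s ^ (Suc k - i))"
    proof (rule sum_mono)
      fix k assume k: "k \<in> {Suc i..<n}"
      have "dg k / real s ^ (k - i + 1) \<le> (real s - 1) / real s ^ (k - i + 1)" using dg by (intro divide_right_mono) auto
      also have "\<dots> = 1 / real s ^ (k - i) - 1 / real s ^ (Suc k - i)"
        using s k by (simp add: Suc_diff_le field_simps)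
      finally show "dg k / real s ^ (k - i + 1) \<le> 1 / real s ^ (k - i) - 1 / real s ^ (Suc k - i)" .
    qed
    also have "\<dots> = 1 / real s ^ (Suc i - i) - 1 / real s ^ (n - i)"
      using i sum_Suc_diff'[of "Suc i" n "\<lambda>k. - 1 / real s ^ (k - i)"] by (simp add: algebra_simps)
    also have "\<dots> < 1 / real s" using s by simp
    finally show "tl < 1 / real s" unfolding tl_def .
  qed
  moreover have "frac tl = tl"
  proof -
    have "1 / real s \<le> 1" using s by simp
    then show ?thesis using tl by (simp add: frac_eq)
  qed
  ultimately show ?thesis by simp
qed

lemma word_val_bounds:
  assumes "2 \<le> s" shows "0 \<le> word_val s n w" "word_val s n w \<le> 1"
proof -
  show "0 \<le> word_val s n w" unfolding word_val_def by (intro sum_nonneg) auto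
  have "word_val s n w \<le> 1 - 1 / real s ^ n"
  proof (induction n)
    case (Suc n)
    have "digit s (w n) < s" using assms by (intro digit_less) simp
    then have "real (digit s (w n) + 1) \<le> real s" by (simp only: of_nat_le_iff)
    then have "real (digit s (w n)) / real s ^ (n + 1) \<le> (real s - 1) / real s ^ (n + 1)" by (intro divide_right_mono) auto
    also have "\<dots> = 1 / real s ^ n - 1 / real s ^ Suc n" using assms by (simp add: field_simps)
    finally show ?case using Suc by (simp add: word_val_def)
  qed (simp add: word_val_def)
  also have "\<dots> \<le> 1" by simp
  finally show "word_val s n w \<le> 1" .
qed

lemma zero_prob_ge:
  assumes "2 \<le> s" "1 \<le> q" shows "1 / real s + 1 / (2 * real q) \<le> zero_prob s q"
proof -
  have "zero_prob s q = 1 / real s + (1 - 1 / real s) / real q"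
    using assms by (simp add: zero_prob_def field_simps)
  moreover have "1/2 / real q \<le> (1 - 1 / real s) / real q" using assms by (intro divide_right_mono) (auto simp: field_simps)
  ultimately show ?thesis by simp
qed

text \<open>A zero at place \<open>j\<close> puts the orbit of \<open>x\<close> below
  \<open>1 / s\<close>, and rounding \<open>x\<close> up to the dyadic point moves the orbit by less
  than \<open>\<beta> = 1 / (8 * q)\<close> unless \<open>j\<close> is among the last
  \<open>c\<beta>\<close> places. These and the three places from \<open>e\<close> to
  \<open>A\<close> are few by the last hypothesis: the rate of zeros is at least
  \<open>1 / s + 3 * \<beta>\<close>, while \<open>1 / s + 2 * \<beta>\<close> is demanded.\<close>

lemma biased_if_zero_count:
  fixes m M s p :: nat and x :: real
  defines "q \<equiv> bias_denom m" and "e \<equiv> expo s M" and "B \<equiv> expo s (2 * M)"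
  assumes s: "2 \<le> s" and A: "A = e + 3" and x: "x = real c / real s ^ A + word_val s n w / real s ^ A"
    and xp: "x \<le> real p / 2 ^ (2 * M)" "real p / 2 ^ (2 * M) - x \<le> 1 / 2 ^ (2 * M)"
    and c\<beta>: "8 * q \<le> 2 ^ c\<beta>" and m': "A + m' + c\<beta> = B" "m' \<le> n"
    and cnt: "(zero_prob s q - 1 / (8 * real q)) * m' \<le> (\<Sum>i<m'. of_bool (digit s (w i) = 0))"
    and len: "8 * q * (c\<beta> + 3) \<le> B - e"
  shows "biased s m M p"
proof -
  define \<beta> where "\<beta> = 1 / (8 * real q)"
  have q: "1 \<le> q" by (simp add: q_def bias_denom_def)
  have \<beta>: "0 < \<beta>" "\<beta> \<le> 1/8" using q by (auto simp: \<beta>_def field_simps)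
  define y where "y = real p / 2 ^ (2 * M)"
  define Z where "Z = {i. i < m' \<and> digit s (w i) = 0}"
  have sub: "(\<lambda>i. A + i) ` Z \<subseteq> {j \<in> {e..<B}. frac (real s ^ j * y) < 1 / real s + \<beta>}"
  proof
    fix j assume "j \<in> (\<lambda>i. A + i) ` Z"
    then obtain i where i: "j = A + i" "i < m'" "digit s (w i) = 0" by (auto simp: Z_def)
    have jB: "j + c\<beta> < B" using i m' by simp
    have "real s ^ j * x = of_int (int c * int s ^ i) + real s ^ i * word_val s n w"
      using s unfolding x i(1) by (simp add: power_add field_simps)
    then have fx: "frac (real s ^ j * x) = frac (real s ^ i * word_val s n w)" by (simp add: frac_def)
    also have "\<dots> < 1 / real s" using i m' by (intro zero_digit_frac s) auto
    finally have fx: "frac (real s ^ j * x) < 1 / real s" .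
    define err where "err = real s ^ j * (y - x)"
    have "s ^ B \<le> 2 ^ (2 * M)" unfolding B_def by (rule expo_bounds[OF s])
    then have sB: "real s ^ B \<le> 2 ^ (2 * M)" by (metis of_nat_le_iff of_nat_numeral of_nat_power)
    have err0: "0 \<le> err" unfolding err_def using xp by (intro mult_nonneg_nonneg) (auto simp: y_def)
    have "err \<le> real s ^ j * (1 / 2 ^ (2 * M))" unfolding err_def using xp by (intro mult_left_mono) (auto simp: y_def)
    also have "\<dots> \<le> real s ^ j * (1 / real s ^ B)" using sB s by (intro mult_left_mono divide_left_mono) auto
    also have "\<dots> = 1 / real s ^ (B - j)"
    proof -
      have "B = j + (B - j)" using jB by simp
      then have "real s ^ B = real s ^ j * real s ^ (B - j)" by (metis power_add)
      then show ?thesis using s by simp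
    qed
    also have "\<dots> < \<beta>"
    proof -
      have "8 * real q \<le> 2 ^ c\<beta>" using c\<beta> by (metis of_nat_le_iff of_nat_mult of_nat_numeral of_nat_power)
      also have "\<dots> \<le> real s ^ c\<beta>" using s by (intro power_mono) auto
      also have "\<dots> < real s ^ (B - j)" using jB s by (intro power_strict_increasing) auto
      finally show ?thesis unfolding \<beta>_def using q s by (intro divide_strict_left_mono mult_pos_pos) auto
    qed
    finally have err: "err < \<beta>" .
    have "1 / real s \<le> 1/2" using s by (simp add: field_simps)
    then have lt1: "frac (real s ^ j * x) + err < 1" using fx err \<beta> by linarith
    have "real s ^ j * y = of_int \<lfloor>real s ^ j * x\<rfloor> + (frac (real s ^ j * x) + err)"
      unfolding err_def frac_def by (simp add: algebra_simps)
    then have "frac (real s ^ j * y) = frac (frac (real s ^ j * x) + err)" by (simp only: frac_of_int_add)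
    also have "\<dots> = frac (real s ^ j * x) + err" using lt1 err0 by (intro frac_eq[THEN iffD2]) auto
    finally show "j \<in> {j \<in> {e..<B}. frac (real s ^ j * y) < 1 / real s + \<beta>}"
      using fx err jB i A by auto
  qed
  have "card Z = card ((\<lambda>i. A + i) ` Z)" by (simp add: card_image)
  also have "\<dots> \<le> card {j \<in> {e..<B}. frac (real s ^ j * y) < 1 / real s + \<beta>}" by (rule card_mono[OF _ sub]) simp
  finally have cZ: "real (card Z) \<le> real (card {j \<in> {e..<B}. frac (real s ^ j * y) < 1 / real s + \<beta>})" by simp
  have Be: "e \<le> B" using m' A by simp
  define l where "l = real B - real e"
  have l: "real m' = l - (c\<beta> + 3)" using m' A by (simp add: l_def)
  have "real (8 * q * (c\<beta> + 3)) \<le> real (B - e)" using len by (simp only: of_nat_le_iff)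
  then have "8 * real q * (c\<beta> + 3) \<le> l" using Be by (simp add: l_def of_nat_diff)
  then have ll: "c\<beta> + 3 \<le> \<beta> * l" using q by (simp add: \<beta>_def field_simps)
  have p: "1 / real s + 3 * \<beta> \<le> zero_prob s q - \<beta>"
  proof -
    have "1 / (2 * real q) = 4 * \<beta>" by (simp add: \<beta>_def)
    then show ?thesis using zero_prob_ge[OF s q] by linarith
  qed
  have "(1 / real s + 2 * \<beta>) * l \<le> (1 / real s + 3 * \<beta>) * m'"
  proof -
    have "(1 / real s + 3 * \<beta>) * (real c\<beta> + 3) \<le> 1 * (real c\<beta> + 3)"
    proof (rule mult_right_mono)
      have "1 / real s \<le> 1/2" using s by (simp add: field_simps)
      then show "1 / real s + 3 * \<beta> \<le> 1" using \<beta> by linarith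
    qed simp
    then show ?thesis unfolding l using ll by (simp add: algebra_simps)
  qed
  also have "\<dots> \<le> (zero_prob s q - \<beta>) * m'" using p by (rule mult_right_mono) simp
  also have "\<dots> \<le> (\<Sum>i<m'. of_bool (digit s (w i) = 0))" using cnt by (simp add: \<beta>_def)
  also have "\<dots> = real (card Z)" unfolding Z_def by (rule card_eq_sum_of_bool[symmetric])
  also note cZ
  finally show ?thesis unfolding biased_def q_def[symmetric] e_def[symmetric] B_def[symmetric] y_def[symmetric] \<beta>_def[symmetric]
    by (simp add: l_def \<beta>_def)
qed

lemma expo_tendsto: "2 \<le> r \<Longrightarrow> \<exists>M0. \<forall>M\<ge>M0. e \<le> expo r M"
  using expo_ge by blast

text \<open>Three extra base-\<open>s\<close> digits make the cells shorter than a quarter of the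
  dyadic interval, so some cell lies in its left half; the right half is room for rounding
  up.\<close>

lemma task_words_start:
  fixes M p0 s :: nat
  defines "A \<equiv> expo s M + 3"
  assumes s: "2 \<le> s"
  obtains c where "real p0 / 2 ^ M \<le> real c / real s ^ A" "real c / real s ^ A + 1 / real s ^ A < (real p0 + 1/2) / 2 ^ M"
proof -
  define c where "c = nat \<lceil>real p0 * real s ^ A / 2 ^ M\<rceil>"
  have sA: "0 < real s ^ A" using s by simp
  have c: "real p0 * real s ^ A / 2 ^ M \<le> real c" "real c < real p0 * real s ^ A / 2 ^ M + 1"
    unfolding c_def by (auto simp: real_nat_ceiling_ge) linarith
  have "4 * (2::nat) ^ M < s ^ 2 * s ^ Suc (expo s M)"
    using expo_bounds(2)[OF s, of M] power_mono[of 2 s 2] s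
    by (intro mult_le_less_imp_less) auto
  also have "\<dots> = s ^ A" by (simp add: A_def power_add eval_nat_numeral)
  finally have "real (4 * 2 ^ M) < real (s ^ A)" by (simp only: of_nat_less_iff)
  then have big: "4 * 2 ^ M < real s ^ A" by simp
  show ?thesis
  proof (rule that[of c])
    show "real p0 / 2 ^ M \<le> real c / real s ^ A" using c(1) sA by (simp add: field_simps)
    have "2 / real s ^ A < 1 / 2 / 2 ^ M" using big sA by (simp add: field_simps)
    moreover have "real c / real s ^ A < real p0 / 2 ^ M + 1 / real s ^ A"

    proof -
      have "real c / real s ^ A < (real p0 * real s ^ A / 2 ^ M + 1) / real s ^ A"
        using c(2) sA by (rule divide_strict_right_mono)
      also have "\<dots> = real p0 / 2 ^ M + 1 / real s ^ A" using s by (simp add: add_divide_distrib)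
      finally show ?thesis .
    qed
    ultimately show "real c / real s ^ A + 1 / real s ^ A < (real p0 + 1/2) / 2 ^ M"
      by (simp add: add_divide_distrib)
  qed
qed

text \<open>A random word with biased base-\<open>s\<close> digits has small mean exponential sums for all bases independent of
  \<open>s\<close> simultaneously, so a single word can be chosen.\<close>

theorem ex_task:
  assumes s: "2 \<le> s" and indep: "\<And>r. prime r \<Longrightarrow> r \<noteq> s \<Longrightarrow> mult_indep r s"
  shows "\<exists>M0. \<forall>M\<ge>M0. \<forall>p0. \<exists>p. p0 * 2 ^ M \<le> p \<and> p < (p0 + 1) * 2 ^ M \<and> task_ok s m k M p"
proof -
  define q where "q = bias_denom m"
  have q: "2 \<le> q" "1 \<le> q" by (auto simp: q_def bias_denom_def)
  define R where "R = {r. prime r \<and> r \<le> k \<and> r \<noteq> s}"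
  have R: "finite R" "card R \<le> k + 1" "\<And>r. r \<in> R \<Longrightarrow> prime r \<and> r \<noteq> s \<and> 2 \<le> r \<and> mult_indep r s \<and> r \<le> k"
  proof -
    have sub: "R \<subseteq> {..k}" by (auto simp: R_def)
    then show "finite R" by (rule finite_subset) simp
    show "card R \<le> k + 1" using card_mono[OF _ sub] by simp
    show "prime r \<and> r \<noteq> s \<and> 2 \<le> r \<and> mult_indep r s \<and> r \<le> k" if "r \<in> R" for r
      using that indep prime_ge_2_nat by (auto simp: R_def)
  qed
  define H where "H = 8 * (k + m) ^ 4"
  \<comment> \<open>Chosen so that the mean energies of at most \<open>k + 1\<close> primes add up
    to at most 1/4.\<close>
  define \<epsilon> where "\<epsilon> = 1 / (4 * 114425856 * (real k + 1) ^ 16)"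
  have \<epsilon>: "0 < \<epsilon>" by (simp add: \<epsilon>_def)
  \<comment> \<open>Bounds the lag between the bases: \<open>s^A \<le> s^3 * 2^M\<close> and
    \<open>2^M \<le> r * r^(expo r M)\<close>.\<close>
  define C where "C r = real s ^ 3 * real r" for r
  have "\<forall>h\<in>{1..H}. \<forall>r\<in>R. \<exists>B0. \<forall>B\<ge>B0. \<forall>A n a N q x0. a \<le> N \<longrightarrow> N \<le> B \<longrightarrow> 2 \<le> q \<longrightarrow> real s ^ A \<le> C r * real r ^ a \<longrightarrow>
     real h * real r ^ N \<le> real s ^ (A + n) \<longrightarrow>
     mean (words (s * q) n) (\<lambda>w. (cmod (exp_sum r h a N (x0 + word_val s n w / real s ^ A)))^2) \<le> \<epsilon> * real B ^ 2"
  proof (intro ballI)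
    fix h r assume h: "h \<in> {1..H}" and r: "r \<in> R"
    have "mult_indep r s" "2 \<le> r" "1 \<le> h" using R(3)[OF r] h by auto
    then show "\<exists>B0. \<forall>B\<ge>B0. \<forall>A n a N q x0. a \<le> N \<longrightarrow> N \<le> B \<longrightarrow> 2 \<le> q \<longrightarrow> real s ^ A \<le> C r * real r ^ a \<longrightarrow>
       real h * real r ^ N \<le> real s ^ (A + n) \<longrightarrow>
       mean (words (s * q) n) (\<lambda>w. (cmod (exp_sum r h a N (x0 + word_val s n w / real s ^ A)))^2) \<le> \<epsilon> * real B ^ 2"
      using s \<epsilon> by (intro mean_exp_sum_indep) (auto simp: C_def)
  qed
  then obtain B0 where B0: "\<And>h r B A n a N q x0. h \<in> {1..H} \<Longrightarrow> r \<in> R \<Longrightarrow> B0 h r \<le> B \<Longrightarrow> a \<le> N \<Longrightarrow> N \<le> B \<Longrightarrow> 2 \<le> q \<Longrightarrow> real s ^ A \<le> C r * real r ^ a \<Longrightarrow>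
     real h * real r ^ N \<le> real s ^ (A + n) \<Longrightarrow>
     mean (words (s * q) n) (\<lambda>w. (cmod (exp_sum r h a N (x0 + word_val s n w / real s ^ A)))^2) \<le> \<epsilon> * real B ^ 2"
    by metis
  define c\<beta> where "c\<beta> = 8 * q"
  have c\<beta>: "8 * q \<le> 2 ^ c\<beta>" unfolding c\<beta>_def by (intro less_imp_le less_exp)
  define E where "E = 16 * (k + m + 1) ^ 2 + (\<Sum>h\<in>{1..H}. \<Sum>r\<in>R. B0 h r) + 64 * q * q * (c\<beta> + 3) * 8 + 64 * bias_denom m"
  have "\<forall>r\<in>insert s R. \<exists>M0. \<forall>M\<ge>M0. E \<le> expo r M" using expo_tendsto R(3) s by blast
  then obtain F where F: "\<And>r M. r \<in> insert s R \<Longrightarrow> F r \<le> M \<Longrightarrow> E \<le> expo r M" by metis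
  show ?thesis
  proof (rule exI[of _ "Suc (\<Sum>r\<in>insert s R. F r)"], intro allI impI)
    fix M p0 assume M: "Suc (\<Sum>r\<in>insert s R. F r) \<le> M"
    have Epos: "0 < E" by (simp add: E_def)
    have EM: "E \<le> expo r M" if "r \<in> insert s R" for r
    proof -
      have "F r \<le> (\<Sum>r\<in>insert s R. F r)" using that R(1) by (intro member_le_sum) auto
      then show ?thesis using F[OF that] M by simp
    qed
    define e where "e = expo s M"
    define A where "A = e + 3"
    define B where "B = expo s (2 * M)"
    obtain c where c: "real p0 / 2 ^ M \<le> real c / real s ^ A" "real c / real s ^ A + 1 / real s ^ A < (real p0 + 1/2) / 2 ^ M"
      using task_words_start[OF s, of p0 M] unfolding A_def e_def by blast
    \<comment> \<open>\<open>2 * M\<close> letters cover the block in every base, and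
      \<open>H\<close> further ones absorb the factor \<open>h \<le> H \<le> 2^H\<close> of the
      frequency.\<close>
    define n where "n = 2 * M + H"
    define W where "W = words (s * q) n"
    have W: "finite W" "W \<noteq> {}" using s q by (auto simp: W_def intro!: words_nonempty)
    define x where "x w = real c / real s ^ A + word_val s n w / real s ^ A" for w
    have eE: "E \<le> e" unfolding e_def by (rule EM) simp
    have Be: "2 * e \<le> B" "B \<le> 2 * e + 1" unfolding B_def e_def using expo_double[OF s] by auto
    have BM: "B \<le> 2 * M" unfolding B_def by (rule expo_le[OF s])
    define m' where "m' = B - A - c\<beta>"
    have E1: "64 * q * q * (c\<beta> + 3) * 8 \<le> e" "64 * q \<le> e" using eE unfolding E_def q_def by linarith+
    have E1': "c\<beta> + 3 \<le> 64 * q * q * (c\<beta> + 3)" using q by simp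
    have m': "A + m' + c\<beta> = B" "m' \<le> n" "64 * q * q \<le> m'"
    proof -
      have "A + c\<beta> \<le> B" using E1 E1' Be unfolding A_def by linarith
      then show "A + m' + c\<beta> = B" by (simp add: m'_def)
      then show "m' \<le> n" using BM by (simp add: n_def)
      have "64 * q * q * 1 \<le> 64 * q * q * (c\<beta> + 3)" by (intro mult_left_mono) auto
      then have "64 * q * q + (c\<beta> + 3) \<le> e" using E1(1) E1' by linarith
      then show "64 * q * q \<le> m'" using Be unfolding m'_def A_def by linarith
    qed
    have len: "8 * q * (c\<beta> + 3) \<le> B - e"
    proof -
      have "8 * q * (c\<beta> + 3) * 1 \<le> 8 * q * (c\<beta> + 3) * (64 * q)" using q by (intro mult_left_mono) auto
      then have "8 * q * (c\<beta> + 3) \<le> 8 * q * (c\<beta> + 3) * (64 * q)" by (simp only: mult_1_right)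
      also have "\<dots> \<le> e" using E1(1) by (simp add: algebra_simps)
      finally show ?thesis using Be by simp
    qed
    \<comment> \<open>Three nonnegative quantities, each of mean at most 1/4: the energies of the
      other primes, the energy of \<open>s\<close>, and the normalised squared deviation of the
      number of zeros. A word with total below 1 meets all requirements at once.\<close>
    define F1 where "F1 w = (\<Sum>r\<in>R. exp_energy r k M (x w))" for w
    define F2 where "F2 w = (if prime s \<and> 1 \<le> m then exp_energy s m M (x w) else 0)" for w
    define Z where "Z w = ((\<Sum>i<m'. of_bool (digit s (w i) = 0)) - zero_prob s q * real m')" for w :: "nat \<Rightarrow> nat"
    define F3 where "F3 w = (Z w)^2 / (m' / (8 * real q))^2" for w
    have h_pow: "real h \<le> 2 ^ h" for h :: nat by (simp add: less_imp_le of_nat_less_two_power)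
    have fin: "real h * real r ^ N \<le> real s ^ (A + n)" if "h \<le> H" "N \<le> expo r (2 * M)" "2 \<le> r" for h r N
    proof -
      have "r ^ N \<le> 2 ^ (2 * M)" using that by (simp add: le_expo_iff)
      then have "real r ^ N \<le> 2 ^ (2 * M)" by (metis of_nat_le_iff of_nat_numeral of_nat_power)
      moreover have "real h \<le> 2 ^ H" 
      proof -
        have "real h \<le> real H" using that(1) by simp
        then show ?thesis using h_pow[of H] by linarith
      qed
      ultimately have "real h * real r ^ N \<le> 2 ^ H * 2 ^ (2 * M)" by (intro mult_mono) auto
      also have "\<dots> = 2 ^ n" by (simp add: n_def power_add)
      also have "\<dots> \<le> real s ^ n" using s by (intro power_mono) auto
      also have "\<dots> \<le> real s ^ (A + n)" using s by (intro power_increasing) auto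
      finally show ?thesis .
    qed
    have m1: "mean W F1 \<le> 1/4"
    proof -
      have each: "mean W (\<lambda>w. exp_energy r k M (x w)) \<le> 114425856 * real k ^ 15 * \<epsilon>" if r: "r \<in> R" for r
      proof (rule mean_exp_energy)
        have r': "2 \<le> r" "r \<le> k" using R(3)[OF r] by auto
        show "1 \<le> k" using r' by simp
        have Er: "E \<le> expo r M" using r by (intro EM) simp
        show "0 < expo r (2 * M)" using Er expo_double(1)[OF r'(1), of M] Epos by linarith
        show "0 \<le> \<epsilon>" using \<epsilon> by simp
        fix h N assume h: "1 \<le> h" "h \<le> 8 * k ^ 4" and N: "expo r M \<le> N" "N \<le> expo r (2 * M)"
        have "8 * k ^ 4 \<le> H" unfolding H_def by (intro mult_left_mono power_mono) auto
        then have hH: "h \<in> {1..H}" using h by simp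
        have start: "real s ^ A \<le> C r * real r ^ expo r M"
        proof -
          have "s ^ e \<le> 2 ^ M" unfolding e_def by (rule expo_bounds[OF s])
          also have "\<dots> \<le> r ^ Suc (expo r M)" using expo_bounds(2)[OF r'(1), of M] by simp
          finally have "real (s ^ e) \<le> real (r ^ Suc (expo r M))" by (simp only: of_nat_le_iff)
          then have "real s ^ 3 * real s ^ e \<le> real s ^ 3 * (real r * real r ^ expo r M)" by (intro mult_left_mono) auto
          then show ?thesis by (simp add: A_def C_def power_add mult_ac)
        qed
        have "B0 h r \<le> (\<Sum>r\<in>R. B0 h r)" using r R(1) by (intro member_le_sum) auto
        also have "\<dots> \<le> (\<Sum>h\<in>{1..H}. \<Sum>r\<in>R. B0 h r)" using hH member_le_sum[of h "{1..H}" "\<lambda>h. \<Sum>r\<in>R. B0 h r"] by simp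
        also have "\<dots> \<le> E" by (simp add: E_def)
        also have "E \<le> expo r (2 * M)" using Er expo_double(1)[OF r'(1), of M] by linarith
        finally have "B0 h r \<le> expo r (2 * M)" .
        then show "mean W (\<lambda>w. (cmod (exp_sum r h (expo r M) N (x w)))^2) \<le> \<epsilon> * real (expo r (2 * M)) ^ 2"
          unfolding W_def x_def using hH N h fin[of h N r] r' q(1) start \<open>8 * k ^ 4 \<le> H\<close>
          by (intro B0[OF hH r]) auto
      qed
      have "mean W F1 = (\<Sum>r\<in>R. mean W (\<lambda>w. exp_energy r k M (x w)))" unfolding F1_def by (rule mean_sum)
      also have "\<dots> \<le> (\<Sum>r\<in>R. 114425856 * real k ^ 15 * \<epsilon>)" by (intro sum_mono each)
      also have "\<dots> = real (card R) * (114425856 * real k ^ 15 * \<epsilon>)" by simp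
      also have "\<dots> \<le> (real k + 1) * (114425856 * (real k + 1) ^ 15 * \<epsilon>)"
      proof (intro mult_mono power_mono)
        show "real (card R) \<le> real k + 1" using R(2) by simp
      qed (use \<epsilon> in auto)
      also have "\<dots> = 114425856 * (real k + 1) ^ 16 * \<epsilon>" by (simp add: eval_nat_numeral)
      also have "\<dots> = 1/4" unfolding \<epsilon>_def by (simp add: field_simps)
      finally show ?thesis .
    qed
    have m2: "mean W F2 \<le> 1/4"
    proof (cases "prime s \<and> 1 \<le> m")
      case True
      define c2 where "c2 = 8 / real B + 2 / real q"
      have B0: "0 < B" using E1 Be q by linarith
      have "mean W (\<lambda>w. exp_energy s m M (x w)) \<le> 114425856 * real m ^ 15 * c2"
      proof (rule mean_exp_energy)
        show "1 \<le> m" using True by simp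
        show "0 < expo s (2 * M)" using B0 by (simp add: B_def)
        show "0 \<le> c2" by (simp add: c2_def)
        fix h N assume h: "1 \<le> h" "h \<le> 8 * m ^ 4" and N: "expo s M \<le> N" "N \<le> expo s (2 * M)"
        have "8 * m ^ 4 \<le> H" unfolding H_def by (intro mult_left_mono power_mono) auto
        then have "mean W (\<lambda>w. (cmod (exp_sum s h (expo s M) N (x w)))^2) \<le> 8 * real B + 2 * real B ^ 2 / q"
          unfolding W_def x_def using h q N BM by (intro mean_exp_sum_same[OF s]) (auto simp: A_def e_def n_def B_def)
        also have "\<dots> = c2 * real B ^ 2" using B0 by (simp add: c2_def field_simps power2_eq_square)
        finally show "mean W (\<lambda>w. (cmod (exp_sum s h (expo s M) N (x w)))^2) \<le> c2 * real (expo s (2 * M)) ^ 2" by (simp add: B_def)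
      qed
      also have "\<dots> \<le> 114425856 * real m ^ 15 * (17 / (8 * real q))"
      proof (intro mult_left_mono)
        have "64 * q \<le> B" using E1 Be by linarith
        then have "64 * real q \<le> real B" by (metis of_nat_le_iff of_nat_mult of_nat_numeral)
        then have "8 / real B \<le> 8 / (64 * real q)" using q by (intro divide_left_mono) auto
        then show "c2 \<le> 17 / (8 * real q)" unfolding c2_def by simp
      qed auto
      also have "\<dots> \<le> 114425856 * real (m + 1) ^ 15 * (17 / (8 * real q))" by (intro mult_right_mono mult_left_mono power_mono) auto
      also have "\<dots> \<le> 1/4" unfolding q_def bias_denom_def by (simp add: divide_le_eq)
      finally show ?thesis using True unfolding F2_def by simp
    next
      case False
      then have "F2 = (\<lambda>_. 0)" by (auto simp: F2_def)
      then show ?thesis by (simp add: mean_def)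
    qed
    have m3: "mean W F3 \<le> 1/4"
    proof -
      have "0 < m'" 
      proof -
        have "0 < 64 * q * q" using q by simp
        then show ?thesis using m'(3) by linarith
      qed
      have "mean W F3 = mean W (\<lambda>w. (Z w)^2) / (m' / (8 * real q))^2" unfolding F3_def by (rule mean_divide)
      also have "\<dots> \<le> m' / (m' / (8 * real q))^2"
        unfolding Z_def W_def using m'(2) q by (intro divide_right_mono mean_zero_count[OF s]) auto
      also have "\<dots> = 64 * real q ^ 2 / m'" using \<open>0 < m'\<close> by (simp add: power2_eq_square)
      finally have "mean W F3 \<le> 64 * real q ^ 2 / m'" .
      moreover have "4 * (64 * q * q) \<le> m'"
      proof -
        have "64 * q * q * 1 \<le> 64 * q * q * (c\<beta> + 3)" by (intro mult_left_mono) auto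
        then show ?thesis using E1(1) E1' Be unfolding m'_def A_def by linarith
      qed
      then have "4 * (64 * real q * real q) \<le> real m'" by (metis of_nat_le_iff of_nat_mult of_nat_numeral)
      then have "64 * real q ^ 2 / m' \<le> 1/4" using \<open>0 < m'\<close> by (simp add: divide_le_eq power2_eq_square)
      ultimately show ?thesis by simp
    qed
    have "mean W (\<lambda>w. F1 w + F2 w + F3 w) < 1" using m1 m2 m3 by (simp add: mean_add)
    from ex_less_mean[OF W this] obtain w where w: "F1 w + F2 w + F3 w < 1" by blast
    have pos: "0 \<le> F1 w" "0 \<le> F2 w" "0 \<le> F3 w"
      by (auto simp: F1_def F2_def F3_def exp_energy_nonneg intro!: sum_nonneg)
    define p where "p = nat \<lceil>x w * 2 ^ (2 * M)\<rceil>"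
    have xlo: "real p0 / 2 ^ M \<le> x w"
      using c(1) word_val_bounds(1)[OF s, of n w] by (auto simp: x_def intro: add_increasing2)
    have xhi: "x w < (real p0 + 1/2) / 2 ^ M"
    proof -
      have "word_val s n w / real s ^ A \<le> 1 / real s ^ A" using word_val_bounds(2)[OF s, of n w] by (rule divide_right_mono) simp
      then show ?thesis using c(2) by (simp add: x_def)
    qed
    have x0: "0 \<le> x w" using xlo by (rule order_trans[rotated]) simp
    have p: "x w * 2 ^ (2 * M) \<le> real p" "real p < x w * 2 ^ (2 * M) + 1"
      using x0 unfolding p_def by (auto simp: real_nat_ceiling_ge) linarith
    have two: "(2::real) ^ (2 * M) = 2 ^ M * 2 ^ M" by (simp add: mult_2 power_add)
    have plo: "p0 * 2 ^ M \<le> p"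
    proof -
      have "real p0 / 2 ^ M * 2 ^ (2 * M) \<le> x w * 2 ^ (2 * M)" using xlo by (rule mult_right_mono) simp
      moreover have "real p0 / 2 ^ M * 2 ^ (2 * M) = real (p0 * 2 ^ M)" by (simp add: two)
      ultimately have "real (p0 * 2 ^ M) \<le> real p" using p(1) by linarith
      then show ?thesis by (simp only: of_nat_le_iff)
    qed
    have phi: "p < (p0 + 1) * 2 ^ M"
    proof -
      have "x w * 2 ^ (2 * M) < (real p0 + 1/2) / 2 ^ M * 2 ^ (2 * M)" using xhi by (rule mult_strict_right_mono) simp
      moreover have "(real p0 + 1/2) / 2 ^ M * 2 ^ (2 * M) = (real p0 + 1/2) * 2 ^ M" by (simp add: two)
      ultimately have "real p < (real p0 + 1/2) * 2 ^ M + 1" using p(2) by linarith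
      also have "\<dots> \<le> real ((p0 + 1) * 2 ^ M)"
      proof -
        have "(2::real) ^ 1 \<le> 2 ^ M" using M by (intro power_increasing) auto
        then show ?thesis by (simp add: algebra_simps)
      qed
      finally show ?thesis by (simp only: of_nat_less_iff)
    qed
    have xp: "x w \<le> real p / 2 ^ (2 * M)" "real p / 2 ^ (2 * M) - x w \<le> 1 / 2 ^ (2 * M)"
    proof -
      show "x w \<le> real p / 2 ^ (2 * M)" using p(1) by (simp add: le_divide_eq)
      have "real p / 2 ^ (2 * M) < (x w * 2 ^ (2 * M) + 1) / 2 ^ (2 * M)" using p(2) by (rule divide_strict_right_mono) simp
      also have "\<dots> = x w + 1 / 2 ^ (2 * M)" by (simp add: add_divide_distrib)
      finally show "real p / 2 ^ (2 * M) - x w \<le> 1 / 2 ^ (2 * M)" by simp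
    qed
    then have xp': "\<bar>real p / 2 ^ (2 * M) - x w\<bar> \<le> 1 / 2 ^ (2 * M)" by simp
    have big: "16 * K ^ 2 \<le> expo r M" if "K \<le> k + m" "r \<in> insert s R" for K r
    proof -
      have "16 * K ^ 2 \<le> 16 * (k + m + 1) ^ 2" using that(1) by (intro mult_left_mono power_mono) auto
      also have "\<dots> \<le> E" by (simp add: E_def)
      also have "E \<le> expo r M" by (rule EM) fact
      finally show ?thesis .
    qed
    have sp1: "spread r k M p" if "r \<le> k" "prime r" "r \<noteq> s" for r
    proof -
      have r: "r \<in> R" using that by (simp add: R_def)
      have "exp_energy r k M (x w) \<le> F1 w" unfolding F1_def using r R(1) exp_energy_nonneg by (intro member_le_sum) auto
      then have "exp_energy r k M (x w) < 1" using w pos by linarith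
      moreover have "2 \<le> r" using R(3)[OF r] by simp
      ultimately show ?thesis using that big[of k r] r xp' by (intro spread_if_exp_energy) auto
    qed
    have sp2: "spread s m M p" if "prime s"
    proof (cases "1 \<le> m")
      case True
      then have "exp_energy s m M (x w) < 1" using w pos that unfolding F2_def by simp
      then show ?thesis using True s big[of m s] xp' by (intro spread_if_exp_energy) auto
    qed (simp add: spread_def)
    have "biased s m M p"
    proof (rule biased_if_zero_count[OF s])
      show "A = expo s M + 3" by (simp add: A_def e_def)
      show "x w = real c / real s ^ A + word_val s n w / real s ^ A" by (simp add: x_def)
      show "(zero_prob s (bias_denom m) - 1 / (8 * real (bias_denom m))) * m' \<le> (\<Sum>i<m'. of_bool (digit s (w i) = 0))"
      proof -
        have "(Z w)^2 / (m' / (8 * real q))^2 < 1" using w pos unfolding F3_def by linarith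
        moreover have D: "0 < m' / (8 * real q)"
        proof -
          have "0 < 64 * q * q" using q by simp
          then have "0 < m'" using m'(3) by linarith
          then show ?thesis using q by simp
        qed
        ultimately have "(Z w)^2 < 1 * (m' / (8 * real q))^2" by (metis pos_divide_less_eq zero_less_power)
        then have "(Z w)^2 < (m' / (8 * real q))^2" by (simp only: mult_1)
        then have "\<bar>Z w\<bar>^2 < (m' / (8 * real q))^2" by (simp only: power2_abs)
        then have "\<bar>Z w\<bar> < m' / (8 * real q)" by (rule power2_less_imp_less) (use D in simp)
        then show ?thesis unfolding Z_def q_def[symmetric] by (simp add: algebra_simps abs_less_iff)
      qed
    qed (use xp c\<beta> m' len in \<open>auto simp: q_def[symmetric] e_def[symmetric] B_def[symmetric]\<close>)
    then show "\<exists>p. p0 * 2 ^ M \<le> p \<and> p < (p0 + 1) * 2 ^ M \<and> task_ok s m k M p"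
      using plo phi sp1 sp2 unfolding task_ok_def by blast
  qed
qed

section \<open>The staged construction\<close>

text \<open>Holds of the primes and of the numbers that are not prime powers. The bounds on
  \<open>r\<close> and \<open>e\<close> make it decidable by bounded search and lose nothing, as
  \<open>e < r^e\<close>.\<close>

definition valid_base :: "nat \<Rightarrow> bool" where
  "valid_base s \<longleftrightarrow> 2 \<le> s \<and> (\<forall>r<s. prime r \<longrightarrow> (\<forall>e\<le>s. s \<noteq> r ^ e))"

lemma valid_base_prime_power:
  assumes "valid_base s" "prime r" "s = r ^ e" shows "s = r"
proof (rule ccontr)
  assume ne: "s \<noteq> r"
  have s: "2 \<le> s" using assms by (simp add: valid_base_def)
  have r: "2 \<le> r" using assms prime_ge_2_nat by blast
  have e2: "1 < e" using ne s assms(3) by (cases e rule: nat.exhaust; cases "e = 1") auto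
  have "r ^ 1 < r ^ e" using r e2 by (intro power_strict_increasing) auto
  then have "r < s" using assms(3) by simp
  moreover have "e < 2 ^ e" by (rule less_exp)
  then have "e < r ^ e" using power_mono[of 2 r e] r by linarith
  then have "e \<le> s" using assms(3) by simp
  ultimately show False using assms unfolding valid_base_def by blast
qed

text \<open>An equation \<open>r^g = s^i\<close> makes \<open>s\<close> a divisor of a power of the
  prime \<open>r\<close>, hence itself a power of \<open>r\<close>.\<close>

lemma valid_base_indep:
  assumes "valid_base s" "prime r" "r \<noteq> s" shows "mult_indep r s"
  unfolding mult_indep_def
proof (intro allI impI notI)
  fix g i :: nat assume g: "0 < g" and eq: "r ^ g = s ^ i"
  have "1 < r ^ g" using assms(2) g by (intro one_less_power) (auto dest: prime_gt_1_nat)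
  then have "i \<noteq> 0" using eq by (cases i) auto
  then have "s dvd r ^ g" unfolding eq by (simp add: dvd_power)
  then obtain e where "s = r ^ e" using divides_primepow_nat[OF assms(2)] by blast
  then show False using valid_base_prime_power[OF assms(1,2) \<open>s = r ^ e\<close>] assms(3) by simp
qed

text \<open>Base 6 is the default for tasks whose first component is not a valid base. As 6 is not
  prime, its tasks keep every prime base up to the current precision equidistributed.\<close>

lemma valid_base_6: "valid_base 6" "\<not> prime (6::nat)"
proof -
  have "(6::nat) \<noteq> r ^ e" if "prime r" for r e :: nat
  proof
    assume eq: "(6::nat) = r ^ e"
    have "prime (2::nat)" "prime (3::nat)" by simp_all
    moreover have "2 dvd r ^ e" "3 dvd r ^ e" unfolding eq[symmetric] by simp_all
    ultimately have "2 dvd r" "3 dvd r" using prime_dvd_power by blast+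
    then have "2 = r" "3 = r" using that primes_dvd_imp_eq \<open>prime 2\<close> \<open>prime 3\<close> by blast+
    then show False by simp
  qed
  then show "valid_base 6" by (simp add: valid_base_def)
  show "\<not> prime (6::nat)"
  proof
    assume "prime (6::nat)"
    then have "(2::nat) dvd 6 \<longrightarrow> (2::nat) = 1 \<or> (2::nat) = 6" unfolding prime_nat_iff by blast
    then show False by simp
  qed
qed

lemma valid_base_if_prime: "prime s \<Longrightarrow> valid_base s"
  unfolding valid_base_def
proof (intro conjI allI impI notI)
  fix r e assume s: "prime s" "r < s" "prime r" "s = r ^ e"
  have "s dvd r ^ e" using s by simp
  then have "s dvd r" using s(1) prime_dvd_power by blast
  then show False using s by (metis primes_dvd_imp_eq less_irrefl)
qed (rule prime_ge_2_nat)

lemma base_cases: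
  assumes "2 \<le> b"
  obtains r e where "prime r" "0 < e" "b = r ^ e" | "valid_base b" "\<not> prime b"
proof (cases "valid_base b")
  case True
  then show ?thesis using that(1)[of b 1] that(2) by fastforce
next
  case False
  then obtain r e where r: "prime r" "b = r ^ e" using assms by (auto simp: valid_base_def)
  then have "0 < e" using assms by (cases e) auto
  then show ?thesis using r that(1) by blast
qed

section \<open>Enumeration of primes and tasks; states of the construction\<close>

definition prime_index :: "nat \<Rightarrow> nat" where
  "prime_index s = card {q. q < s \<and> prime q}"

lemma prime_index_Suc: "prime_index (Suc n) = prime_index n + (if prime n then 1 else 0)"
proof -
  have "{q. q < Suc n \<and> prime q} = {q. q < n \<and> prime q} \<union> (if prime n then {n} else {})"
    by (auto simp: less_Suc_eq)
  then show ?thesis by (simp add: prime_index_def)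
qed

lemma prime_index_surj: "\<exists>r. prime r \<and> prime_index r = i"
proof -
  have "\<exists>n. i < prime_index n"
  proof -
    obtain S where S: "finite S" "card S = Suc i" "S \<subseteq> {p::nat. prime p}"
      using infinite_arbitrarily_large[OF primes_infinite] by blast
    have "S \<subseteq> {q. q < Suc (Max S) \<and> prime q}" using S Max_ge[OF S(1)] by (auto simp: less_Suc_eq_le)
    then have "card S \<le> prime_index (Suc (Max S))" unfolding prime_index_def by (intro card_mono) auto
    then show ?thesis using S by (intro exI[of _ "Suc (Max S)"]) auto
  qed
  define n where "n = (LEAST n. i < prime_index n)"
  have n: "i < prime_index n" unfolding n_def by (rule LeastI_ex) fact
  have "prime_index 0 = 0" by (simp add: prime_index_def)
  then have "n \<noteq> 0" using n by (metis not_less_zero)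
  then obtain r where r: "n = Suc r" by (cases n) auto
  have "\<not> i < prime_index r" using not_less_Least[of r "\<lambda>n. i < prime_index n"] r by (simp add: n_def)
  then have "prime r" "prime_index r = i" using n unfolding r prime_index_Suc by (auto split: if_splits)
  then show ?thesis by blast
qed

definition task_base :: "nat \<Rightarrow> nat" where
  "task_base t = (if valid_base (fst (prod_decode t)) then fst (prod_decode t) else 6)"

text \<open>The constant level 0 for bases that are not prime makes one fixed bias recur; for a
  prime the second component of the task runs through its sequence.\<close>

definition task_level :: "(nat \<Rightarrow> nat \<Rightarrow> nat) \<Rightarrow> nat \<Rightarrow> nat" where
  "task_level f t = (if prime (fst (prod_decode t)) then f (prime_index (fst (prod_decode t))) (snd (prod_decode t)) else 0)"

definition child :: "nat \<Rightarrow> nat \<Rightarrow> nat \<Rightarrow> bool" where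
  "child n p0 p \<longleftrightarrow> p0 * 2 ^ 2 ^ n \<le> p \<and> p < (p0 + 1) * 2 ^ 2 ^ n"

definition task_child :: "(nat \<Rightarrow> nat \<Rightarrow> nat) \<Rightarrow> nat \<Rightarrow> nat \<Rightarrow> nat \<Rightarrow> nat \<Rightarrow> bool" where
  "task_child f t n p0 p \<longleftrightarrow> child n p0 p \<and> task_ok (task_base t) (task_level f t) t (2 ^ n) p"

definition safe_child :: "nat \<Rightarrow> nat \<Rightarrow> nat \<Rightarrow> nat \<Rightarrow> bool" where
  "safe_child k n p0 p \<longleftrightarrow> child n p0 p \<and> (\<forall>r\<le>k. prime r \<longrightarrow> spread r k (2 ^ n) p)"

text \<open>The best precision up to \<open>n\<close> that some child offers. Searching for the
  least loss \<open>i\<close> turns a maximum into a minimum, and the loss \<open>n\<close> always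
  succeeds because precision 0 demands nothing.\<close>

definition safe_level :: "nat \<Rightarrow> nat \<Rightarrow> nat" where
  "safe_level n p0 = n - (LEAST i. \<exists>p. safe_child (n - i) n p0 p)"

text \<open>In each stage the pending task is carried out if some child interval allows it; otherwise the best
  available unbiased child is taken. No effective bound on when a task becomes possible is needed.\<close>

definition step :: "(nat \<Rightarrow> nat \<Rightarrow> nat) \<Rightarrow> nat \<Rightarrow> nat \<times> nat \<Rightarrow> nat \<times> nat" where
  "step f n st = (case st of (t, p0) \<Rightarrow>
     if \<exists>p. task_child f t n p0 p then (Suc t, LEAST p. task_child f t n p0 p)
     else (t, LEAST p. safe_child (safe_level n p0) n p0 p))"

primrec state :: "(nat \<Rightarrow> nat \<Rightarrow> nat) \<Rightarrow> nat \<Rightarrow> nat \<times> nat" where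
  "state f 0 = (0, 0)"
| "state f (Suc n) = step f n (state f n)"

definition pos :: "(nat \<Rightarrow> nat \<Rightarrow> nat) \<Rightarrow> nat \<Rightarrow> nat" where "pos f n = snd (state f n)"

definition approx :: "(nat \<Rightarrow> nat \<Rightarrow> nat) \<Rightarrow> nat \<Rightarrow> real" where
  "approx f n = real (pos f n) / 2 ^ 2 ^ n"

definition limit_point :: "(nat \<Rightarrow> nat \<Rightarrow> nat) \<Rightarrow> real" where
  "limit_point f = (SUP n. approx f n)"

lemma ex_safe_child: "\<exists>i\<le>n. \<exists>p. safe_child (n - i) n p0 p"
proof -
  have "safe_child (n - n) n p0 (p0 * 2 ^ 2 ^ n)" by (simp add: safe_child_def child_def)
  then show ?thesis by blast
qed

lemma safe_level: "\<exists>p. safe_child (safe_level n p0) n p0 p"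
  unfolding safe_level_def using LeastI_ex[of "\<lambda>i. \<exists>p. safe_child (n - i) n p0 p"] ex_safe_child by blast

lemma safe_level_ge:
  assumes "k \<le> n" "\<exists>p. safe_child k n p0 p" shows "k \<le> safe_level n p0"
proof -
  have "(LEAST i. \<exists>p. safe_child (n - i) n p0 p) \<le> n - k"
    using assms by (intro Least_le) auto
  then show ?thesis using assms(1) unfolding safe_level_def by linarith
qed

lemma step_cases:
  obtains "fst (state f (Suc n)) = Suc (fst (state f n))" "task_child f (fst (state f n)) n (pos f n) (pos f (Suc n))"
  | "fst (state f (Suc n)) = fst (state f n)" "\<not> (\<exists>p. task_child f (fst (state f n)) n (pos f n) p)"
    "safe_child (safe_level n (pos f n)) n (pos f n) (pos f (Suc n))"
proof (cases "\<exists>p. task_child f (fst (state f n)) n (pos f n) p")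
  case True
  then have "state f (Suc n) = (Suc (fst (state f n)), LEAST p. task_child f (fst (state f n)) n (pos f n) p)"
    by (simp add: step_def pos_def split: prod.split) (metis fst_conv snd_conv)
  then show ?thesis using that(1) LeastI_ex[OF True] by (simp add: pos_def)
next
  case False
  then have "state f (Suc n) = (fst (state f n), LEAST p. safe_child (safe_level n (pos f n)) n (pos f n) p)"
    by (simp add: step_def pos_def split: prod.split) (metis fst_conv snd_conv)
  then show ?thesis using that(2) False LeastI_ex[OF safe_level[of n "pos f n"]] by (simp add: pos_def)
qed

lemma child_pos: "child n (pos f n) (pos f (Suc n))"
  by (rule step_cases[of f n]) (auto simp: task_child_def safe_child_def)

lemma approx_Suc: "approx f n \<le> approx f (Suc n)" "approx f (Suc n) + 1 / 2 ^ 2 ^ Suc n \<le> approx f n + 1 / 2 ^ 2 ^ n"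
proof -
  have two: "(2::real) ^ 2 ^ Suc n = 2 ^ 2 ^ n * 2 ^ 2 ^ n" by (simp add: mult_2 power_add)
  have c: "pos f n * 2 ^ 2 ^ n \<le> pos f (Suc n)" "pos f (Suc n) + 1 \<le> (pos f n + 1) * 2 ^ 2 ^ n"
    using child_pos[of n f] by (auto simp: child_def)
  have "real (pos f n * 2 ^ 2 ^ n) \<le> real (pos f (Suc n))" using c(1) by (simp only: of_nat_le_iff)
  then show "approx f n \<le> approx f (Suc n)" unfolding approx_def two by (simp add: field_simps)
  have "real (pos f (Suc n) + 1) \<le> real ((pos f n + 1) * 2 ^ 2 ^ n)" using c(2) by (simp only: of_nat_le_iff)
  then have "(real (pos f (Suc n)) + 1) / (2 ^ 2 ^ n * 2 ^ 2 ^ n) \<le> ((real (pos f n) + 1) * 2 ^ 2 ^ n) / (2 ^ 2 ^ n * 2 ^ 2 ^ n)"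
    by (intro divide_right_mono) (auto simp: algebra_simps)
  also have "\<dots> = (real (pos f n) + 1) / 2 ^ 2 ^ n" by simp
  finally show "approx f (Suc n) + 1 / 2 ^ 2 ^ Suc n \<le> approx f n + 1 / 2 ^ 2 ^ n"
    unfolding approx_def two by (simp add: add_divide_distrib)
qed

lemma approx_bounds:
  assumes "n \<le> m" shows "approx f n \<le> approx f m" "approx f m + 1 / 2 ^ 2 ^ m \<le> approx f n + 1 / 2 ^ 2 ^ n"
proof -
  show "approx f n \<le> approx f m" using assms
  proof (induction m rule: dec_induct)
    case (step m) then show ?case using approx_Suc(1)[of f m] by linarith
  qed simp
  show "approx f m + 1 / 2 ^ 2 ^ m \<le> approx f n + 1 / 2 ^ 2 ^ n" using assms
  proof (induction m rule: dec_induct)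
    case (step m) then show ?case using approx_Suc(2)[of f m] by linarith
  qed simp
qed

lemma approx_le: "approx f m \<le> approx f n + 1 / 2 ^ 2 ^ n"
proof (cases "n \<le> m")
  case True
  have "approx f m \<le> approx f m + 1 / 2 ^ 2 ^ m" by simp
  then show ?thesis using approx_bounds(2)[OF True, of f] by linarith
next
  case False
  then have "approx f m \<le> approx f n" by (intro approx_bounds) simp
  then show ?thesis by (simp add: add_increasing2)
qed

lemma limit_point_bounds: "approx f n \<le> limit_point f" "limit_point f \<le> approx f n + 1 / 2 ^ 2 ^ n"
proof -
  have "bdd_above (range (approx f))" using approx_le[of f _ 0] by (intro bdd_aboveI2)
  then show "approx f n \<le> limit_point f" unfolding limit_point_def by (intro cSUP_upper) auto
  show "limit_point f \<le> approx f n + 1 / 2 ^ 2 ^ n"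
    unfolding limit_point_def by (intro cSUP_least approx_le) auto
qed

section \<open>Progress of the stages\<close>

lemma task_base: "valid_base (task_base t)" "2 \<le> task_base t"
  using valid_base_6 by (auto simp: task_base_def valid_base_def)

lemma task_eventually: "\<exists>n0. \<forall>n\<ge>n0. \<forall>p0. \<exists>p. task_child f t n p0 p"
proof -
  obtain M0 where M0: "\<And>M p0. M0 \<le> M \<Longrightarrow> \<exists>p. p0 * 2 ^ M \<le> p \<and> p < (p0 + 1) * 2 ^ M \<and> task_ok (task_base t) (task_level f t) t M p"
    using ex_task[OF task_base(2) valid_base_indep[OF task_base(1)], of t "task_level f t" t] by blast
  have "M0 \<le> 2 ^ n" if "M0 \<le> n" for n using less_imp_le[OF less_exp[of n]] that by linarith
  then show ?thesis unfolding task_child_def child_def using M0 by (intro exI[of _ M0]) blast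
qed

text \<open>A child solving a task for base 6 spreads all primes up to \<open>k\<close>, none of
  which is 6, and is therefore safe at level \<open>k\<close>.\<close>

lemma safe_level_tendsto: "\<exists>n0. \<forall>n\<ge>n0. \<forall>p0. k \<le> safe_level n p0"
proof -
  have "\<And>r. prime r \<Longrightarrow> r \<noteq> 6 \<Longrightarrow> mult_indep r 6" using valid_base_indep valid_base_6 by blast
  then have "\<exists>M0. \<forall>M\<ge>M0. \<forall>p0. \<exists>p. p0 * 2 ^ M \<le> p \<and> p < (p0 + 1) * 2 ^ M \<and> task_ok 6 0 k M p"
    by (intro ex_task) auto
  then obtain M0 where M0: "\<And>M p0. M0 \<le> M \<Longrightarrow> \<exists>p. p0 * 2 ^ M \<le> p \<and> p < (p0 + 1) * 2 ^ M \<and> task_ok 6 0 k M p"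
    by blast
  show ?thesis
  proof (intro exI[of _ "max M0 k"] allI impI)
    fix n p0 assume n: "max M0 k \<le> n"
    have "M0 \<le> 2 ^ n" using less_imp_le[OF less_exp[of n]] n by linarith
    from M0[OF this, of p0] obtain p where "p0 * 2 ^ 2 ^ n \<le> p" "p < (p0 + 1) * 2 ^ 2 ^ n" "task_ok 6 0 k (2 ^ n) p" by blast
    then have "safe_child k n p0 p" using valid_base_6(2) unfolding safe_child_def child_def task_ok_def by metis
    then show "k \<le> safe_level n p0" using n by (intro safe_level_ge) auto
  qed
qed

lemma fst_state_Suc: "fst (state f (Suc n)) = fst (state f n) \<or> fst (state f (Suc n)) = Suc (fst (state f n))"
  by (rule step_cases[of f n]) auto

lemma fst_state_mono: "n \<le> m \<Longrightarrow> fst (state f n) \<le> fst (state f m)"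
proof (induction m rule: dec_induct)
  case (step m) then show ?case using fst_state_Suc[of f m] by auto
qed simp

lemma fst_state_le: "fst (state f n) \<le> n"
proof (induction n)
  case (Suc n) then show ?case using fst_state_Suc[of f n] by auto
qed simp

lemma fst_state_unbounded: "\<exists>n. T \<le> fst (state f n)"
proof (induction T)
  case (Suc T)
  then obtain n1 where n1: "T \<le> fst (state f n1)" by blast
  obtain n0 where n0: "\<And>n p0. n0 \<le> n \<Longrightarrow> \<exists>p. task_child f T n p0 p" using task_eventually[of f T] by blast
  define n where "n = max n0 n1"
  show ?case
  proof (cases "fst (state f n) = T")
    case True
    have "fst (state f (Suc n)) = Suc (fst (state f n))"
      by (rule step_cases[of f n]) (use n0[of n "pos f n"] True in \<open>auto simp: n_def\<close>)
    then show ?thesis using True by (intro exI[of _ "Suc n"]) auto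
  next
    case False
    have "T \<le> fst (state f n)" using n1 fst_state_mono[of n1 n f] by (simp add: n_def)
    then show ?thesis using False by (intro exI[of _ n]) auto
  qed
qed auto

text \<open>The stage number is at least \<open>t\<close> because the task counter advances by at
  most one per stage; infinitely many tasks for a base therefore reach arbitrarily late
  stages.\<close>

lemma task_performed: "\<exists>n\<ge>t. task_child f t n (pos f n) (pos f (Suc n))"
proof -
  define n where "n = (LEAST n. Suc t \<le> fst (state f n))"
  have n: "Suc t \<le> fst (state f n)" unfolding n_def by (rule LeastI_ex[OF fst_state_unbounded])
  then obtain n' where n': "n = Suc n'" by (cases n) auto
  have "\<not> Suc t \<le> fst (state f n')" using not_less_Least[of n' "\<lambda>n. Suc t \<le> fst (state f n)"] n' by (simp add: n_def)
  then have t: "fst (state f (Suc n')) = Suc (fst (state f n'))" "fst (state f n') = t"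
    using n fst_state_Suc[of f n'] unfolding n' by auto
  have "task_child f t n' (pos f n') (pos f (Suc n'))"
    by (rule step_cases[of f n']) (use t in auto)
  moreover have "t \<le> n'" using fst_state_le[of f n'] t by simp
  ultimately show ?thesis by blast
qed

section \<open>From stages to the limit point\<close>

lemma frac_add_less_1: "0 \<le> e \<Longrightarrow> frac x + e < 1 \<Longrightarrow> frac (x + e) = frac x + (e::real)"
proof -
  assume e: "0 \<le> e" "frac x + e < 1"
  have "x + e = of_int \<lfloor>x\<rfloor> + (frac x + e)" by (simp add: frac_def)
  then have "frac (x + e) = frac (frac x + e)" by (simp only: frac_of_int_add)
  also have "\<dots> = frac x + e" using e by (intro frac_eq[THEN iffD2]) auto
  finally show ?thesis .
qed

text \<open>As \<open>B \<ge> 2 * A\<close>, the block from \<open>A\<close> to \<open>B\<close> is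
  at least half of the first \<open>B\<close> places. An excess of \<open>\<beta> / 2\<close> per
  place yields at least \<open>\<beta> * B / 4\<close>, whereas normality permits only
  \<open>\<beta> / 16\<close> times \<open>A + B\<close>, plus the \<open>c + 1\<close> places at
  the end of the block where the dyadic point and the limit may disagree.\<close>

lemma biased_imp_not_normal:
  assumes s: "2 \<le> s" and b: "\<And>n0. \<exists>n\<ge>n0. biased s m (2 ^ n) (P n)"
    and \<xi>: "\<And>n. real (P n) / 2 ^ (2 * 2 ^ n) \<le> \<xi>" "\<And>n. \<xi> \<le> real (P n) / 2 ^ (2 * 2 ^ n) + 1 / 2 ^ (2 * 2 ^ n)"
  shows "\<not> normal_to_base s \<xi>"
proof
  assume norm: "normal_to_base s \<xi>"
  define q where "q = bias_denom m"
  define \<beta> where "\<beta> = 1 / (8 * real q)"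
  have q: "2 \<le> q" by (simp add: q_def bias_denom_def)
  have \<beta>: "0 < \<beta>" "\<beta> \<le> 1/16" using q by (auto simp: \<beta>_def field_simps)
  have s2: "1 / real s \<le> 1/2" using s by (simp add: field_simps)
  \<comment> \<open>Midway between the interval end \<open>1 / s + \<beta>\<close> and the rate
    \<open>1 / s + 2 * \<beta>\<close> in \<open>biased\<close>: half a \<open>\<beta>\<close> pays
    for moving the point, the other half is the excess.\<close>
  define v where "v = 1 / real s + 3/2 * \<beta>"
  have "0 \<le> 1 / real s" by simp
  then have v: "0 < v" "v \<le> 1" using \<beta> s2 unfolding v_def by linarith+
  define I where "I j = (of_bool (frac (real s ^ j * \<xi>) < v) :: real)" for j
  have "avg_to I (v - 0)"
    using normal_interval_freq[OF norm] v unfolding interval_freq_def I_def by fastforce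
  then have "avg_to I v" by simp
  then obtain N0 where N0: "\<And>N. N0 \<le> N \<Longrightarrow> \<bar>(\<Sum>j<N. I j) - v * real N\<bar> \<le> \<beta>/16 * real N"
    using \<beta> unfolding avg_to_def by (metis divide_pos_pos zero_less_numeral)
  define c where "c = 16 * q"
  define L where "L = max N0 (Suc (128 * q * c))"
  obtain M0 where M0: "\<And>M. M0 \<le> M \<Longrightarrow> L \<le> expo s M" using expo_tendsto[OF s, of L] by blast
  obtain n where n: "n \<ge> M0" "biased s m (2 ^ n) (P n)" using b by blast
  define A where "A = expo s (2 ^ n)"
  define B where "B = expo s (2 * 2 ^ n)"
  have LA: "L \<le> A" unfolding A_def using n(1) less_imp_le[OF less_exp[of n]] by (intro M0) linarith
  have AB: "2 * A \<le> B" unfolding A_def B_def by (rule expo_double[OF s])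
  define y where "y = real (P n) / 2 ^ (2 * 2 ^ n)"
  define S where "S = {j \<in> {A..<B}. frac (real s ^ j * y) < 1 / real s + \<beta>}"
  have cS: "(1 / real s + 2 * \<beta>) * (real B - real A) \<le> real (card S)"
    using n(2) unfolding biased_def q_def[symmetric] A_def[symmetric] B_def[symmetric] y_def[symmetric] S_def \<beta>_def by simp
  have tr: "I j = 1" if j: "j \<in> S" "j + c < B" for j
  proof -
    define err where "err = real s ^ j * (\<xi> - y)"
    have "s ^ B \<le> 2 ^ (2 * 2 ^ n)" unfolding B_def by (rule expo_bounds[OF s])
    then have sB: "real s ^ B \<le> 2 ^ (2 * 2 ^ n)" by (metis of_nat_le_iff of_nat_numeral of_nat_power)
    have err0: "0 \<le> err" unfolding err_def using \<xi>(1)[of n] by (intro mult_nonneg_nonneg) (auto simp: y_def)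
    have "err \<le> real s ^ j * (1 / 2 ^ (2 * 2 ^ n))"
      unfolding err_def using \<xi>(2)[of n] by (intro mult_left_mono) (auto simp: y_def algebra_simps)
    also have "\<dots> \<le> real s ^ j * (1 / real s ^ B)" using sB s by (intro mult_left_mono divide_left_mono) auto
    also have "\<dots> = 1 / real s ^ (B - j)"
    proof -
      have "B = j + (B - j)" using j(2) by simp
      then have "real s ^ B = real s ^ j * real s ^ (B - j)" by (metis power_add)
      then show ?thesis using s by simp
    qed
    also have "\<dots> < 1 / (16 * real q)"
    proof -
      have "16 * real q \<le> 2 ^ c" unfolding c_def using of_nat_less_two_power[of "16 * q", where ?'a = real] by simp
      also have "\<dots> \<le> real s ^ c" using s by (intro power_mono) auto
      also have "\<dots> < real s ^ (B - j)" using j(2) s by (intro power_strict_increasing) auto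
      finally show ?thesis using q s by (intro divide_strict_left_mono mult_pos_pos) auto
    qed
    also have "\<dots> = \<beta> / 2" by (simp add: \<beta>_def)
    finally have err: "err < \<beta> / 2" .
    have f: "frac (real s ^ j * y) < 1 / real s + \<beta>" using j(1) by (simp add: S_def)
    have "real s ^ j * \<xi> = real s ^ j * y + err" by (simp add: err_def algebra_simps)
    moreover have "frac (real s ^ j * y + err) = frac (real s ^ j * y) + err"
      using f err err0 \<beta> s2 by (intro frac_add_less_1) linarith+
    ultimately have "frac (real s ^ j * \<xi>) = frac (real s ^ j * y) + err" by (simp only:)
    then have "frac (real s ^ j * \<xi>) < v" using f err unfolding v_def by linarith
    then show ?thesis by (simp add: I_def)
  qed
  have I0: "0 \<le> I j" for j by (simp add: I_def)
  have "real (card S) \<le> (\<Sum>j\<in>{A..<B}. I j) + c + 1"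
  proof -
    have "S \<subseteq> {j \<in> S. j + c < B} \<union> {B - c - 1..<B}" by (auto simp: S_def)
    then have "card S \<le> card ({j \<in> S. j + c < B} \<union> {B - c - 1..<B})" by (intro card_mono) (auto simp: S_def)
    also have "\<dots> \<le> card {j \<in> S. j + c < B} + card {B - c - 1..<B}" by (rule card_Un_le)
    also have "\<dots> \<le> card {j \<in> S. j + c < B} + (c + 1)" by simp
    finally have "real (card S) \<le> real (card {j \<in> S. j + c < B}) + c + 1" by simp
    also have "real (card {j \<in> S. j + c < B}) = (\<Sum>j\<in>{j \<in> S. j + c < B}. I j)"
      using tr by simp
    also have "\<dots> \<le> (\<Sum>j\<in>{A..<B}. I j)" using I0 by (intro sum_mono2) (auto simp: S_def)
    finally show ?thesis by simp
  qed
  also have "(\<Sum>j\<in>{A..<B}. I j) = (\<Sum>j<B. I j) - (\<Sum>j<A. I j)"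
  proof -
    have "(\<Sum>j<A. I j) + (\<Sum>j\<in>{A..<B}. I j) = (\<Sum>j<B. I j)"
      using AB sum.atLeastLessThan_concat[of 0 A B I] by (simp add: atLeast0LessThan)
    then show ?thesis by simp
  qed
  finally have "(1 / real s + 2 * \<beta>) * (real B - real A) \<le> (\<Sum>j<B. I j) - (\<Sum>j<A. I j) + c + 1" using cS by linarith
  moreover have "\<bar>(\<Sum>j<B. I j) - v * B\<bar> \<le> \<beta>/16 * B" "\<bar>(\<Sum>j<A. I j) - v * A\<bar> \<le> \<beta>/16 * A"
    using LA AB N0[of A] N0[of B] by (auto simp: L_def)
  moreover have "(1 / real s + 2 * \<beta>) * (real B - real A) = v * B - v * A + \<beta>/2 * (real B - real A)"
  proof -
    have "1 / real s + 2 * \<beta> = v + \<beta>/2" by (simp add: v_def)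
    then show ?thesis by (simp only: distrib_right right_diff_distrib)
  qed
  ultimately have "\<beta>/2 * (real B - real A) \<le> \<beta>/16 * B + \<beta>/16 * A + c + 1" by linarith
  moreover have "\<beta>/2 * (real B / 2) \<le> \<beta>/2 * (real B - real A)" using AB \<beta> by (intro mult_left_mono) auto
  moreover have "\<beta>/16 * A \<le> \<beta>/16 * B" using AB \<beta> by (intro mult_left_mono) auto
  ultimately have "\<beta>/8 * B \<le> c + 1" by (simp add: field_simps)
  then have "real B \<le> 64 * real q * (real c + 1)" using q by (simp add: \<beta>_def field_simps)
  then have "real B \<le> real (64 * q * (c + 1))" by (simp add: algebra_simps)
  then have "B \<le> 64 * q * (c + 1)" by (simp only: of_nat_le_iff)
  also have "\<dots> \<le> 128 * q * c" using q by (simp add: c_def algebra_simps)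
  finally show False using LA AB unfolding L_def by linarith
qed

lemma spread_mono:
  assumes "spread r K' M p" "K \<le> K'" shows "spread r K M p"
  unfolding spread_def
proof (intro allI impI)
  fix d a N assume h: "1 \<le> a" "a < d" "d \<le> K" "N \<le> expo r (2 * M)"
  then have "\<bar>tent_dev r d a (expo r M) N (real p / 2 ^ (2 * M))\<bar> \<le> real N / real K'"
    using assms unfolding spread_def by (meson le_trans)
  also have "\<dots> \<le> real N / real K" using h assms(2) by (intro divide_left_mono) auto
  finally show "\<bar>tent_dev r d a (expo r M) N (real p / 2 ^ (2 * M))\<bar> \<le> real N / real K" .
qed

text \<open>Each block adds an error of \<open>2 / K\<close> times its end point. The end points at
  least double, so all completed blocks together cost \<open>4 / K\<close> times the last end point,
  the unfinished block another \<open>2 / K\<close>, and the stages before \<open>n0\<close> a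
  constant.\<close>

lemma spread_imp_normal:
  assumes r: "2 \<le> r" and sp: "\<And>K. \<exists>n0. \<forall>n\<ge>n0. spread r K (2 ^ n) (P n)"
    and \<xi>: "\<And>n. \<bar>real (P n) / 2 ^ (2 * 2 ^ n) - \<xi>\<bar> \<le> 1 / 2 ^ (2 * 2 ^ n)"
  shows "normal_to_base r \<xi>"
  unfolding normal_iff_tent_freq tent_freq_def
proof (intro allI impI)
  fix d a :: nat assume a: "1 \<le> a" "a < d"
  show "avg_to (\<lambda>j. tent d a (real r ^ j * \<xi>)) (1 / real d)"
    unfolding avg_to_def
  proof (intro allI impI)
    fix \<epsilon> :: real assume \<epsilon>: "0 < \<epsilon>"
    obtain K0 :: nat where K0: "12 / \<epsilon> < real K0" using reals_Archimedean2 by blast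
    define K where "K = max d (max 1 K0)"
    have K: "d \<le> K" "1 \<le> K" "12 / \<epsilon> \<le> real K" using K0 by (auto simp: K_def)
    have K6: "6 / K \<le> \<epsilon> / 2" using K \<epsilon> by (simp add: field_simps)
    obtain n1 where n1: "\<And>n. n1 \<le> n \<Longrightarrow> spread r K (2 ^ n) (P n)" using sp by blast
    obtain M0 where M0: "\<And>M. M0 \<le> M \<Longrightarrow> K * d \<le> expo r M" using expo_tendsto[OF r] by blast
    define n0 where "n0 = max n1 M0"
    define A where "A n = expo r (2 ^ n)" for n
    have A2: "2 * A n \<le> A (Suc n)" for n unfolding A_def using expo_double(1)[OF r, of "2 ^ n"] by simp
    have Ad: "real d \<le> real N / K" if "n0 \<le> n" "A n \<le> N" for n N
    proof -
      have "M0 \<le> n" using that(1) by (simp add: n0_def)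
      then have "M0 \<le> 2 ^ n" using less_imp_le[OF less_exp[of n]] by linarith
      then have "K * d \<le> N" using M0[of "2 ^ n"] that(2) by (simp add: A_def)
      then have "real (K * d) \<le> real N" by (simp only: of_nat_le_iff)
      then show ?thesis using K by (simp add: field_simps)
    qed
    define T where "T N = tent_dev r d a 0 N \<xi>" for N
    have T_eq: "T N = (\<Sum>j<N. tent d a (real r ^ j * \<xi>)) - 1 / d * N" for N
      by (simp add: T_def tent_dev_def sum_subtractf atLeast0LessThan)
    have block: "\<bar>T N - T (A n)\<bar> \<le> 2 * real N / K" if n: "n0 \<le> n" and N: "A n \<le> N" "N \<le> A (Suc n)" for n N
    proof -
      have "T N - T (A n) = tent_dev r d a (A n) N \<xi>"
        unfolding T_def tent_dev_def using N sum.atLeastLessThan_concat[of 0 "A n" N "\<lambda>j. tent d a (real r ^ j * \<xi>) - 1 / d"] by simp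
      moreover have "\<bar>tent_dev r d a (A n) N (real (P n) / 2 ^ (2 * 2 ^ n)) - tent_dev r d a (A n) N \<xi>\<bar> \<le> d"
      proof (rule tent_dev_perturb[OF r a])
        have "r ^ N \<le> 2 ^ (2 * 2 ^ n)" using N(2) r unfolding A_def by (simp add: le_expo_iff)
        then show "real r ^ N \<le> 2 ^ (2 * 2 ^ n)" by (metis of_nat_le_iff of_nat_numeral of_nat_power)
      qed (use \<xi> in auto)
      moreover have "\<bar>tent_dev r d a (A n) N (real (P n) / 2 ^ (2 * 2 ^ n))\<bar> \<le> N / K"
        using n1[of n] n a K N(2) unfolding spread_def A_def n0_def by auto
      moreover have "real d \<le> N / K" using Ad n N by blast
      ultimately show ?thesis by (simp add: abs_le_iff)
    qed
    have TA: "\<bar>T (A n)\<bar> \<le> A n0 + 4 * real (A n) / K" if "n0 \<le> n" for n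
      using that
    proof (induction n rule: dec_induct)
      case base
      have "\<bar>T (A n0)\<bar> \<le> (\<Sum>j\<in>{0..<A n0}. 1)"
        unfolding T_def tent_dev_def
      proof (rule order_trans[OF sum_abs], rule sum_mono)
        fix j
        have "0 \<le> 1 / real d" "1 / real d \<le> 1" using a by auto
        then show "\<bar>tent d a (real r ^ j * \<xi>) - 1 / d\<bar> \<le> 1" using tent_bounds[of d a "real r ^ j * \<xi>"] by linarith
      qed
      then show ?case by (simp add: add_increasing2)
    next
      case (step n)
      have "\<bar>T (A (Suc n)) - T (A n)\<bar> \<le> 2 * real (A (Suc n)) / K" by (rule block) (use A2[of n] step in auto)
      moreover have "4 * real (A n) / K \<le> 2 * real (A (Suc n)) / K" using A2[of n] by (intro divide_right_mono) auto
      ultimately have "\<bar>T (A (Suc n))\<bar> \<le> A n0 + (2 * real (A (Suc n)) / K + 2 * real (A (Suc n)) / K)" using step.IH by linarith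
      then show ?case by simp
    qed
    obtain N1 :: nat where N1: "2 * real (A n0) / \<epsilon> < N1" using reals_Archimedean2 by blast
    show "\<exists>N0. \<forall>N\<ge>N0. \<bar>(\<Sum>j<N. tent d a (real r ^ j * \<xi>)) - 1 / real d * real N\<bar> \<le> \<epsilon> * real N"
    proof (intro exI[of _ "max N1 (A n0)"] allI impI)
      fix N assume N: "max N1 (A n0) \<le> N"
      have "\<exists>n. N < A (n0 + n)"
      proof -
        obtain M1 where "\<And>M. M1 \<le> M \<Longrightarrow> Suc N \<le> expo r M" using expo_tendsto[OF r] by blast
        then have "Suc N \<le> A (n0 + M1)" unfolding A_def using less_imp_le[OF less_exp[of "n0 + M1"]] by (meson le_add2 le_trans)
        then show ?thesis by (intro exI[of _ M1]) simp
      qed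
      define k where "k = (LEAST n. N < A (n0 + n))"
      have k: "N < A (n0 + k)" unfolding k_def by (rule LeastI_ex) fact
      then have "k \<noteq> 0" using N by (cases k) auto
      then obtain k' where k': "k = Suc k'" by (cases k) auto
      have "\<not> N < A (n0 + k')" using not_less_Least[of k' "\<lambda>n. N < A (n0 + n)"] k' by (simp add: k_def)
      then have n: "A (n0 + k') \<le> N" "N \<le> A (Suc (n0 + k'))" using k by (auto simp: k')
      have "\<bar>T N\<bar> \<le> A n0 + 4 * real (A (n0 + k')) / K + 2 * real N / K"
        using block[of "n0 + k'" N] TA[of "n0 + k'"] n by (auto simp: abs_le_iff)
      also have "\<dots> \<le> A n0 + 4 * real N / K + 2 * real N / K" using n(1) by (intro add_mono divide_right_mono) auto
      also have "\<dots> = A n0 + 6 / K * N" by (simp add: field_simps)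
      also have "\<dots> \<le> \<epsilon> / 2 * N + \<epsilon> / 2 * N"
      proof (intro add_mono mult_right_mono K6)
        have "2 * real (A n0) / \<epsilon> \<le> N" using N1 N by linarith
        then show "real (A n0) \<le> \<epsilon> / 2 * N" using \<epsilon> by (simp add: field_simps)
      qed simp
      finally show "\<bar>(\<Sum>j<N. tent d a (real r ^ j * \<xi>)) - 1 / real d * real N\<bar> \<le> \<epsilon> * real N"
        unfolding T_eq[symmetric] by simp
    qed
  qed
qed

definition diverges :: "(nat \<Rightarrow> nat) \<Rightarrow> bool" where
  "diverges g \<longleftrightarrow> (\<forall>b. \<exists>N. \<forall>u\<ge>N. b \<le> g u)"

text \<open>A level that recurs imposes the same positive excess on infinitely many blocks.\<close>

lemma not_normal_limit_point:
  assumes s: "valid_base s" and m: "\<And>u0. \<exists>u\<ge>u0. task_level f (prod_encode (s, u)) = m"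
  shows "\<not> normal_to_base s (limit_point f)"
proof (rule biased_imp_not_normal[where P = "\<lambda>n. pos f (Suc n)" and m = m])
  show "2 \<le> s" using s by (simp add: valid_base_def)
  show "\<exists>n\<ge>n0. biased s m (2 ^ n) (pos f (Suc n))" for n0
  proof -
    obtain u where u: "u \<ge> n0" "task_level f (prod_encode (s, u)) = m" using m by blast
    obtain n where n: "n \<ge> prod_encode (s, u)" "task_child f (prod_encode (s, u)) n (pos f n) (pos f (Suc n))"
      using task_performed by blast
    have "n0 \<le> n" using u(1) n(1) le_prod_encode_2[of u s] by linarith
    moreover have "biased s m (2 ^ n) (pos f (Suc n))"
      using n(2) u(2) s unfolding task_child_def task_ok_def by (simp add: task_base_def)
    ultimately show ?thesis by blast
  qed
  have *: "real (pos f (Suc n)) / 2 ^ (2 * 2 ^ n) = approx f (Suc n)" for n by (simp add: approx_def)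
  show "real (pos f (Suc n)) / 2 ^ (2 * 2 ^ n) \<le> limit_point f" for n
    unfolding * by (rule limit_point_bounds)
  show "limit_point f \<le> real (pos f (Suc n)) / 2 ^ (2 * 2 ^ n) + 1 / 2 ^ (2 * 2 ^ n)" for n
    unfolding * using limit_point_bounds(2)[of f "Suc n"] by simp
qed

lemma not_diverges_obtain:
  assumes "\<not> diverges g" obtains m where "\<And>u0. \<exists>u\<ge>u0. g u = m"
proof -
  obtain b where b: "\<And>N. \<exists>u\<ge>N. g u < b" using assms by (auto simp: diverges_def not_le)
  show ?thesis
  proof (rule ccontr)
    assume "\<not> thesis"
    then have "\<forall>m. \<exists>u0. \<forall>u\<ge>u0. g u \<noteq> m" using that by blast
    then obtain U where U: "\<And>m u. U m \<le> u \<Longrightarrow> g u \<noteq> m" by metis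
    obtain u where u: "u \<ge> (\<Sum>m<b. U m)" "g u < b" using b by blast
    have "U (g u) \<le> (\<Sum>m<b. U m)" using u(2) by (intro member_le_sum) auto
    then show False using U[of "g u" u] u(1) by simp
  qed
qed

text \<open>Every late stage spreads \<open>r\<close>: tasks for other bases and safe children do so
  with growing precision, and a task for \<open>r\<close> itself occurs late only with large
  \<open>u\<close>, where its level is at least any given \<open>K\<close>.\<close>

lemma normal_limit_point:
  assumes r: "prime r" and div: "diverges (f (prime_index r))"
  shows "normal_to_base r (limit_point f)"
proof (rule spread_imp_normal[where P = "\<lambda>n. pos f (Suc n)"])
  show r2: "2 \<le> r" using r by (rule prime_ge_2_nat)
  show "\<exists>n0. \<forall>n\<ge>n0. spread r K (2 ^ n) (pos f (Suc n))" for K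
  proof -
    obtain U where U: "\<And>u. U \<le> u \<Longrightarrow> K \<le> f (prime_index r) u" using div unfolding diverges_def by blast
    \<comment> \<open>Exceeds the codes of all tasks \<open>(r, u)\<close> with
      \<open>u < U\<close>, whose levels may be small.\<close>
    define T where "T = K + r + Suc (\<Sum>u<U. prod_encode (r, u))"
    obtain n1 where n1: "T \<le> fst (state f n1)" using fst_state_unbounded by blast
    obtain n2 where n2: "\<And>n p0. n2 \<le> n \<Longrightarrow> K + r \<le> safe_level n p0" using safe_level_tendsto by blast
    show ?thesis
    proof (intro exI[of _ "max n1 n2"] allI impI)
      fix n assume n: "max n1 n2 \<le> n"
      define t where "t = fst (state f n)"
      have tT: "T \<le> t" using n1 fst_state_mono[of n1 n f] n unfolding t_def by linarith
      show "spread r K (2 ^ n) (pos f (Suc n))"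
      proof (rule step_cases[of f n])
        assume tc: "task_child f (fst (state f n)) n (pos f n) (pos f (Suc n))"
        then have ok: "task_ok (task_base t) (task_level f t) t (2 ^ n) (pos f (Suc n))" by (simp add: t_def task_child_def)
        show ?thesis
        proof (cases "r = task_base t")
          case False
          then have "spread r t (2 ^ n) (pos f (Suc n))" using ok r tT unfolding task_ok_def T_def by auto
          then show ?thesis by (rule spread_mono) (use tT in \<open>simp add: T_def\<close>)
        next
          case True
          obtain u where u: "prod_decode t = (r, u)"
          proof -
            have "r \<noteq> 6" using r valid_base_6 by auto
            then have "fst (prod_decode t) = r" using True unfolding task_base_def by (auto split: if_splits)
            then show ?thesis using that[of "snd (prod_decode t)"] by (metis prod.collapse)
          qed
          then have t: "t = prod_encode (r, u)" by (metis prod_decode_inverse)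
          have "U \<le> u"
          proof (rule ccontr)
            assume "\<not> U \<le> u"
            then have "prod_encode (r, u) \<le> (\<Sum>u<U. prod_encode (r, u))" by (intro member_le_sum) auto
            then show False using tT t unfolding T_def by linarith
          qed
          then have "K \<le> task_level f t" using U r unfolding task_level_def u by simp
          moreover have "spread r (task_level f t) (2 ^ n) (pos f (Suc n))"
            using ok r True unfolding task_ok_def by auto
          ultimately show ?thesis by (rule spread_mono[rotated])
        qed
      next
        assume "safe_child (safe_level n (pos f n)) n (pos f n) (pos f (Suc n))"
        moreover have "K + r \<le> safe_level n (pos f n)" using n2 n by simp
        ultimately show ?thesis using r unfolding safe_child_def
          by (meson add_leD1 add_leD2 spread_mono)
      qed
    qed
  qed
  have *: "real (pos f (Suc n)) / 2 ^ (2 * 2 ^ n) = approx f (Suc n)" for n by (simp add: approx_def)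
  show "\<bar>real (pos f (Suc n)) / 2 ^ (2 * 2 ^ n) - limit_point f\<bar> \<le> 1 / 2 ^ (2 * 2 ^ n)" for n
    unfolding * using limit_point_bounds[of f "Suc n"] by simp
qed

theorem normal_limit_point_iff:
  "normal_to_some_base (limit_point f) \<longleftrightarrow> (\<exists>i. diverges (f i))"
proof
  assume "\<exists>i. diverges (f i)"
  then obtain i where i: "diverges (f i)" by blast
  obtain r where r: "prime r" "prime_index r = i" using prime_index_surj by blast
  then have "normal_to_base r (limit_point f)" using i normal_limit_point by blast
  then show "normal_to_some_base (limit_point f)"
    using prime_ge_2_nat[OF r(1)] unfolding normal_to_some_base_def by blast
next
  assume "normal_to_some_base (limit_point f)"
  then obtain b where b: "2 \<le> b" "normal_to_base b (limit_point f)" unfolding normal_to_some_base_def by blast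
  show "\<exists>i. diverges (f i)"
  proof (rule base_cases[OF b(1)])
    fix r e assume re: "prime r" "0 < e" "b = r ^ e"
    have n: "normal_to_base r (limit_point f)"
      using b(2) re prime_gt_0_nat by (intro normal_power_imp_normal[of r e]) auto
    have "diverges (f (prime_index r))"
    proof (rule ccontr)
      assume "\<not> diverges (f (prime_index r))"
      then obtain m where "\<And>u0. \<exists>u\<ge>u0. f (prime_index r) u = m" by (rule not_diverges_obtain) blast
      then have "\<not> normal_to_base r (limit_point f)"
        using re(1) by (intro not_normal_limit_point valid_base_if_prime[OF re(1)]) (simp add: task_level_def)
      then show False using n by blast
    qed
    then show ?thesis by blast
  next
    assume "valid_base b" "\<not> prime b"
    then have "\<not> normal_to_base b (limit_point f)"
      by (intro not_normal_limit_point[where m = 0]) (auto simp: task_level_def)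
    then show ?thesis using b(2) by blast
  qed
qed

section \<open>The Borel hierarchy\<close>

text \<open>A single \<open>k\<close> bounds the resolution of the tents and sets the precision, so
  normality becomes three number quantifiers over a condition that is closed in
  \<open>\<xi>\<close>.\<close>

lemma normal_iff_tent_dev:
  "normal_to_base r \<xi> \<longleftrightarrow> (\<forall>k. \<exists>N0. \<forall>N\<ge>N0. \<forall>d a. 1 \<le> a \<longrightarrow> a < d \<longrightarrow> d \<le> Suc k \<longrightarrow>
     \<bar>tent_dev r d a 0 N \<xi>\<bar> \<le> real N / real (Suc k))" (is "_ \<longleftrightarrow> ?R")
proof -
  have T: "tent_dev r d a 0 N \<xi> = (\<Sum>j<N. tent d a (real r ^ j * \<xi>)) - 1 / real d * real N" for d a N
    by (simp add: tent_dev_def sum_subtractf atLeast0LessThan)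
  show ?thesis
  proof
    assume "normal_to_base r \<xi>"
    then have n: "\<And>d a \<epsilon>. 1 \<le> a \<Longrightarrow> a < d \<Longrightarrow> 0 < \<epsilon> \<Longrightarrow> \<exists>N0. \<forall>N\<ge>N0. \<bar>tent_dev r d a 0 N \<xi>\<bar> \<le> \<epsilon> * real N"
      unfolding normal_iff_tent_freq tent_freq_def avg_to_def T by blast
    show ?R
    proof
      fix k
      have "\<forall>d a. \<exists>N0. 1 \<le> a \<longrightarrow> a < d \<longrightarrow> (\<forall>N\<ge>N0. \<bar>tent_dev r d a 0 N \<xi>\<bar> \<le> 1 / real (Suc k) * real N)"
        using n[of _ _ "1 / real (Suc k)"] by simp
      then obtain F where F: "\<And>d a N. 1 \<le> a \<Longrightarrow> a < d \<Longrightarrow> F d a \<le> N \<Longrightarrow> \<bar>tent_dev r d a 0 N \<xi>\<bar> \<le> 1 / real (Suc k) * real N"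
        by metis
      show "\<exists>N0. \<forall>N\<ge>N0. \<forall>d a. 1 \<le> a \<longrightarrow> a < d \<longrightarrow> d \<le> Suc k \<longrightarrow> \<bar>tent_dev r d a 0 N \<xi>\<bar> \<le> real N / real (Suc k)"
      proof (intro exI[of _ "\<Sum>d\<le>Suc k. \<Sum>a\<le>Suc k. F d a"] allI impI)
        fix N d a assume N: "(\<Sum>d\<le>Suc k. \<Sum>a\<le>Suc k. F d a) \<le> N" and a: "1 \<le> a" "a < d" "d \<le> Suc k"
        have "F d a \<le> (\<Sum>a\<le>Suc k. F d a)" using a by (intro member_le_sum) auto
        also have "\<dots> \<le> (\<Sum>d\<le>Suc k. \<Sum>a\<le>Suc k. F d a)" using a(3) by (intro member_le_sum[of d "{..Suc k}" "\<lambda>d. \<Sum>a\<le>Suc k. F d a"]) auto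
        finally show "\<bar>tent_dev r d a 0 N \<xi>\<bar> \<le> real N / real (Suc k)" using F[OF a(1,2), of N] N by simp
      qed
    qed
  next
    assume R: ?R
    show "normal_to_base r \<xi>"
      unfolding normal_iff_tent_freq tent_freq_def avg_to_def T[symmetric]
    proof (intro allI impI)
      fix d a :: nat and \<epsilon> :: real assume a: "1 \<le> a" "a < d" and \<epsilon>: "0 < \<epsilon>"
      obtain k0 :: nat where k0: "1 / \<epsilon> < real k0" using reals_Archimedean2 by blast
      define k where "k = max d k0"
      obtain N0 where N0: "\<And>N. N0 \<le> N \<Longrightarrow> \<bar>tent_dev r d a 0 N \<xi>\<bar> \<le> real N / real (Suc k)"
        using R a by (metis k_def le_SucI max.cobounded1)
      have "1 / \<epsilon> \<le> real (Suc k)" using k0 by (simp add: k_def)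
      then have "1 / real (Suc k) \<le> \<epsilon>" using \<epsilon> by (simp add: field_simps)
      then have "real N * (1 / real (Suc k)) \<le> real N * \<epsilon>" for N by (rule mult_left_mono) simp
      then have "real N / real (Suc k) \<le> \<epsilon> * real N" for N by (simp add: mult.commute)
      then show "\<exists>N0. \<forall>N\<ge>N0. \<bar>tent_dev r d a 0 N \<xi>\<bar> \<le> \<epsilon> * real N" using N0 order_trans by blast
    qed
  qed
qed

lemma borel_Sigma_normal: "borel_Sigma 4 {\<xi>. normal_to_some_base \<xi>}"
proof -
  define C where "C r k N0 = {\<xi>. \<forall>N\<ge>N0. \<forall>d a. 1 \<le> a \<longrightarrow> a < d \<longrightarrow> d \<le> Suc k \<longrightarrow> \<bar>tent_dev r d a 0 N \<xi>\<bar> \<le> real N / real (Suc k)}" for r k N0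
  have closed: "closed (C r k N0)" for r k N0
  proof -
    have "closed {\<xi>. \<bar>tent_dev r d a 0 N \<xi>\<bar> \<le> real N / real (Suc k)}" if "1 \<le> a" "a < d" for d a N
      unfolding tent_dev_def
      by (intro closed_Collect_le continuous_intros continuous_on_compose2[OF continuous_tent[OF that, of UNIV]]) auto
    then have "closed (\<Inter>N\<in>{N0..}. \<Inter>d\<in>{..Suc k}. \<Inter>a\<in>{a. 1 \<le> a \<and> a < d}. {\<xi>. \<bar>tent_dev r d a 0 N \<xi>\<bar> \<le> real N / real (Suc k)})"
      by (intro closed_INT ballI) (simp only: mem_Collect_eq)
    moreover have "C r k N0 = (\<Inter>N\<in>{N0..}. \<Inter>d\<in>{..Suc k}. \<Inter>a\<in>{a. 1 \<le> a \<and> a < d}. {\<xi>. \<bar>tent_dev r d a 0 N \<xi>\<bar> \<le> real N / real (Suc k)})"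
      by (auto simp: C_def)
    ultimately show ?thesis by simp
  qed
  have "{\<xi>. normal_to_some_base \<xi>} = (\<Union>r. \<Inter>k. \<Union>N0. C (r + 2) k N0)"
  proof -
    have "normal_to_some_base \<xi> \<longleftrightarrow> (\<exists>r. normal_to_base (r + 2) \<xi>)" for \<xi>
    proof
      assume "normal_to_some_base \<xi>"
      then obtain r where "2 \<le> r" "normal_to_base r \<xi>" unfolding normal_to_some_base_def by blast
      moreover have "r - 2 + 2 = r" using calculation by simp
      ultimately have "normal_to_base (r - 2 + 2) \<xi>" by (simp only:)
      then show "\<exists>r. normal_to_base (r + 2) \<xi>" by blast
    next
      assume "\<exists>r. normal_to_base (r + 2) \<xi>"
      then obtain r where "normal_to_base (r + 2) \<xi>" by blast
      then show "normal_to_some_base \<xi>" unfolding normal_to_some_base_def by (intro exI[of _ "r + 2"]) simp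
    qed
    moreover have "normal_to_base r \<xi> \<longleftrightarrow> (\<forall>k. \<exists>N0. \<xi> \<in> C r k N0)" for r \<xi>
      unfolding C_def mem_Collect_eq by (rule normal_iff_tent_dev)
    ultimately show ?thesis by (intro set_eqI) (simp only: mem_Collect_eq UN_iff INT_iff UNIV_I bex_simps ball_simps simp_thms Bex_def Ball_def)
  qed
  moreover have "borel_Sigma (Suc (Suc (Suc 1))) (\<Union>r. \<Inter>k. \<Union>N0. C (r + 2) k N0)"
    by (intro borel_Sigma_borel_Pi.intros closed)
  ultimately show ?thesis by (simp add: eval_nat_numeral)
qed

text \<open>The \<open>\<Pi>\<^sup>0\<^sub>3\<close> condition \<open>\<forall>b. \<exists>c. \<forall>d. R b c d\<close> as divergence of a sequence: the value \<open>b\<close> is output whenever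
  the least candidate \<open>c\<close> for \<open>b\<close> has to be revised.\<close>

definition candidate :: "(nat \<Rightarrow> nat \<Rightarrow> bool) \<Rightarrow> nat \<Rightarrow> nat" where
  "candidate P u = (LEAST c. c = u \<or> (\<forall>d<u. P c d))"

text \<open>The index \<open>t\<close> codes a value \<open>b\<close> and a time \<open>u\<close>.
  Without a revision the output is \<open>t\<close> itself, which tends to infinity, so divergence
  only depends on how often each \<open>b\<close> is output.\<close>

definition revision_seq :: "(nat \<Rightarrow> nat \<Rightarrow> nat \<Rightarrow> bool) \<Rightarrow> nat \<Rightarrow> nat" where
  "revision_seq R t = (if candidate (R (fst (prod_decode t))) (snd (prod_decode t)) \<noteq>
      candidate (R (fst (prod_decode t))) (Suc (snd (prod_decode t))) then fst (prod_decode t) else t)"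

lemma candidate: "candidate P u = u \<or> (\<forall>d<u. P (candidate P u) d)"
  unfolding candidate_def by (rule LeastI[of _ u]) simp

lemma candidate_le: "c = u \<or> (\<forall>d<u. P c d) \<Longrightarrow> candidate P u \<le> c"
  unfolding candidate_def by (rule Least_le)

lemma candidate_Suc: "candidate P u \<le> candidate P (Suc u)"
proof -
  have "candidate P u \<le> u" by (rule candidate_le) simp
  then show ?thesis using candidate[of P "Suc u"] candidate_le[of "candidate P (Suc u)" u P] by auto
qed

lemma finite_increases:
  fixes g :: "nat \<Rightarrow> nat"
  assumes "\<And>u. g u \<le> g (Suc u)" "\<And>u. g u \<le> b"
  shows "finite {u. g u \<noteq> g (Suc u)}"
proof -
  have "card ({u. g u \<noteq> g (Suc u)} \<inter> {..<n}) \<le> g n" for n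
  proof (induction n)
    case (Suc n)
    have "{u. g u \<noteq> g (Suc u)} \<inter> {..<Suc n} = ({u. g u \<noteq> g (Suc u)} \<inter> {..<n}) \<union> (if g n \<noteq> g (Suc n) then {n} else {})"
      by (auto simp: less_Suc_eq)
    then show ?case using Suc assms(1)[of n] by auto
  qed simp
  then have *: "card ({u. g u \<noteq> g (Suc u)} \<inter> {..<n}) \<le> b" for n using assms(2) le_trans by blast
  show ?thesis
  proof (rule ccontr)
    assume "infinite {u. g u \<noteq> g (Suc u)}"
    then obtain S where S: "finite S" "card S = Suc b" "S \<subseteq> {u. g u \<noteq> g (Suc u)}"
      using infinite_arbitrarily_large by blast
    have "S \<subseteq> {u. g u \<noteq> g (Suc u)} \<inter> {..<Suc (Max S)}" using S Max_ge[OF S(1)] by (auto simp: less_Suc_eq_le)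
    then have "card S \<le> card ({u. g u \<noteq> g (Suc u)} \<inter> {..<Suc (Max S)})" by (intro card_mono) auto
    then show False using *[of "Suc (Max S)"] S(2) by linarith
  qed
qed

text \<open>Candidates never decrease. A true \<open>c\<close> bounds them; conversely a limit value
  passes every test, since for large \<open>u\<close> it differs from the default
  \<open>u\<close>.\<close>

lemma candidate_stabilizes:
  "finite {u. candidate P u \<noteq> candidate P (Suc u)} \<longleftrightarrow> (\<exists>c. \<forall>d. P c d)"
proof
  assume "\<exists>c. \<forall>d. P c d"
  then obtain c where "\<forall>d. P c d" by blast
  then have "candidate P u \<le> c" for u by (intro candidate_le) auto
  then show "finite {u. candidate P u \<noteq> candidate P (Suc u)}" using candidate_Suc by (intro finite_increases) auto
next
  assume fin: "finite {u. candidate P u \<noteq> candidate P (Suc u)}"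
  then obtain n where n': "\<And>u. u \<in> {u. candidate P u \<noteq> candidate P (Suc u)} \<Longrightarrow> u < n"
    unfolding finite_nat_set_iff_bounded by blast
  have n: "candidate P u = candidate P (Suc u)" if "n \<le> u" for u
    using n'[of u] that by (auto simp: not_less[symmetric])
  define c where "c = candidate P n"
  have c: "candidate P u = c" if "n \<le> u" for u
    using that
  proof (induction u rule: dec_induct)
    case (step u) then show ?case using n[of u] by simp
  qed (simp add: c_def)
  have "P c d" for d
  proof -
    define u where "u = Suc (max n (max c d))"
    have "candidate P u = c" by (rule c) (simp add: u_def)
    moreover have "c \<noteq> u" "d < u" by (auto simp: u_def)
    ultimately show ?thesis using candidate[of P u] by auto
  qed
  then show "\<exists>c. \<forall>d. P c d" by blast
qed

lemma diverges_revision_seq: "diverges (revision_seq R) \<longleftrightarrow> (\<forall>b. \<exists>c. \<forall>d. R b c d)"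
proof -
  define Ch where "Ch b = {u. candidate (R b) u \<noteq> candidate (R b) (Suc u)}" for b
  have g: "revision_seq R (prod_encode (b, u)) = (if u \<in> Ch b then b else prod_encode (b, u))" for b u
    by (simp add: revision_seq_def Ch_def)
  have "diverges (revision_seq R) \<longleftrightarrow> (\<forall>b. finite (Ch b))"
  proof
    assume div: "diverges (revision_seq R)"
    show "\<forall>b. finite (Ch b)"
    proof
      fix b
      obtain N where N: "\<And>t. N \<le> t \<Longrightarrow> Suc b \<le> revision_seq R t" using div unfolding diverges_def by blast
      have "u < N" if "u \<in> Ch b" for u
      proof (rule ccontr)
        assume "\<not> u < N"
        then have "N \<le> prod_encode (b, u)" using le_prod_encode_2[of u b] by linarith
        then show False using N[of "prod_encode (b, u)"] g[of b u] that by simp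
      qed
      then have "Ch b \<subseteq> {..<N}" by auto
      then show "finite (Ch b)" by (rule finite_subset) simp
    qed
  next
    assume fin: "\<forall>b. finite (Ch b)"
    show "diverges (revision_seq R)" unfolding diverges_def
    proof
      fix B
      \<comment> \<open>Contains all indices with an output below \<open>B\<close>: small indices,
        which may output themselves, and revisions of some \<open>b < B\<close>.\<close>
      define S where "S = {..<B} \<union> (\<Union>b<B. (\<lambda>u. prod_encode (b, u)) ` Ch b)"
      have "finite S" unfolding S_def using fin by auto
      then obtain N where N: "\<And>t. t \<in> S \<Longrightarrow> t < N" unfolding finite_nat_set_iff_bounded by blast
      have "B \<le> revision_seq R t" if t: "N \<le> t" for t
      proof (rule ccontr)
        assume *: "\<not> B \<le> revision_seq R t"
        obtain b u where bu: "t = prod_encode (b, u)" by (metis prod_decode_inverse surj_pair)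
        have "t \<in> S"
        proof (cases "u \<in> Ch b")
          case True then show ?thesis using * g[of b u] unfolding S_def bu by auto
        next
          case False then show ?thesis using * g[of b u] unfolding S_def bu by auto
        qed
        then show False using N t by fastforce
      qed
      then show "\<exists>N. \<forall>t\<ge>N. B \<le> revision_seq R t" by blast
    qed
  qed
  then show ?thesis unfolding Ch_def candidate_stabilizes .
qed

text \<open>Continuity into a discrete space: finitely many coordinates decide the value, and how
  many may vary with \<open>x\<close>.\<close>

definition locally_determined :: "((nat \<Rightarrow> nat) \<Rightarrow> 'b) \<Rightarrow> bool" where
  "locally_determined h \<longleftrightarrow> (\<forall>x. \<exists>D. \<forall>y. (\<forall>i<D. y i = x i) \<longrightarrow> h y = h x)"

section \<open>Cylinders and Borel classes of Baire space\<close>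

lemma open_cylinder: "open {y :: nat \<Rightarrow> nat. \<forall>i<D. y i = x i}"
proof -
  have "open ((\<lambda>y :: nat \<Rightarrow> nat. y i) -` {x i})" for i
    by (intro open_vimage continuous_on_product_coordinates) (simp add: open_discrete)
  then have "open (\<Inter>i\<in>{..<D}. (\<lambda>y :: nat \<Rightarrow> nat. y i) -` {x i})" by (intro open_INT) auto
  moreover have "(\<Inter>i\<in>{..<D}. (\<lambda>y :: nat \<Rightarrow> nat. y i) -` {x i}) = {y. \<forall>i<D. y i = x i}" by auto
  ultimately show ?thesis by simp
qed

lemma open_contains_cylinder:
  fixes U :: "(nat \<Rightarrow> nat) set"
  assumes "open U" "x \<in> U" shows "\<exists>D. \<forall>y. (\<forall>i<D. y i = x i) \<longrightarrow> y \<in> U"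
proof -
  have "openin (product_topology (\<lambda>i. euclidean) UNIV) U" using assms(1) by (simp add: open_fun_def)
  from product_topology_open_contains_basis[OF this assms(2)]
  obtain X where X: "x \<in> PiE UNIV X" "finite {i. X i \<noteq> topspace (euclidean :: nat topology)}" "PiE UNIV X \<subseteq> U" by blast
  obtain D where D: "\<And>i. X i \<noteq> UNIV \<Longrightarrow> i < D" using X(2) unfolding finite_nat_set_iff_bounded by auto
  have "y \<in> U" if "\<forall>i<D. y i = x i" for y
  proof -
    have "y i \<in> X i" for i using that D[of i] X(1) by (cases "X i = UNIV") (auto simp: PiE_def Pi_def)
    then show ?thesis using X(3) by (auto simp: PiE_def Pi_def)
  qed
  then show ?thesis by blast
qed

text \<open>The union and intersection rules also match level 1; with nothing at level 0, a level 1
  set can only arise as open or closed.\<close>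

lemma borel_level_0: "\<not> borel_Sigma 0 A" "\<not> borel_Pi 0 A"
  by (auto elim: borel_Sigma.cases borel_Pi.cases)

lemma borel_Pi_1_closed: "borel_Pi (Suc 0) C \<Longrightarrow> closed C"
  by (erule borel_Pi.cases) (auto simp: borel_level_0)

lemma borel_Sigma_SucE:
  assumes "borel_Sigma (Suc (Suc n)) A" obtains F where "\<And>i::nat. borel_Pi (Suc n) (F i)" "A = (\<Union>i. F i)"
  using assms by (cases rule: borel_Sigma.cases) auto

lemma borel_Pi_SucE:
  assumes "borel_Pi (Suc (Suc n)) A" obtains F where "\<And>i::nat. borel_Sigma (Suc n) (F i)" "A = (\<Inter>i. F i)"
  using assms by (cases rule: borel_Pi.cases) auto

text \<open>A closed set consists of the branches of a tree: \<open>R\<close> says that the first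
  \<open>d\<close> entries of \<open>x\<close> extend to a member of the closed set. This depends on
  those entries only and, taken for all \<open>d\<close>, amounts to membership.\<close>

lemma borel_Sigma_4_locally_determined:
  fixes A :: "(nat \<Rightarrow> nat) set"
  assumes "borel_Sigma 4 A"
  obtains R :: "(nat \<Rightarrow> nat) \<Rightarrow> nat \<Rightarrow> nat \<Rightarrow> nat \<Rightarrow> nat \<Rightarrow> bool"
  where "\<And>a b c d. locally_determined (\<lambda>x. R x a b c d)" "\<And>x. x \<in> A \<longleftrightarrow> (\<exists>a. \<forall>b. \<exists>c. \<forall>d. R x a b c d)"
proof -
  have "borel_Sigma (Suc (Suc (Suc (Suc 0)))) A" using assms by (simp add: eval_nat_numeral)
  then obtain F1 where F1: "\<And>a::nat. borel_Pi (Suc (Suc (Suc 0))) (F1 a)" "A = (\<Union>a. F1 a)" by (rule borel_Sigma_SucE) (rule that)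
  have "\<forall>a. \<exists>F. (\<forall>b::nat. borel_Sigma (Suc (Suc 0)) (F b)) \<and> F1 a = (\<Inter>b. F b)"
  proof
    fix a
    obtain F where "\<And>b::nat. borel_Sigma (Suc (Suc 0)) (F b)" "F1 a = (\<Inter>b. F b)"
      using F1(1)[of a] by (rule borel_Pi_SucE) (rule that)
    then show "\<exists>F. (\<forall>b::nat. borel_Sigma (Suc (Suc 0)) (F b)) \<and> F1 a = (\<Inter>b. F b)" by blast
  qed
  then obtain F2 where F2: "\<And>a b::nat. borel_Sigma (Suc (Suc 0)) (F2 a b)" "\<And>a. F1 a = (\<Inter>b. F2 a b)" by metis
  have "\<forall>a b. \<exists>F. (\<forall>c::nat. borel_Pi (Suc 0) (F c)) \<and> F2 a b = (\<Union>c. F c)"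
  proof (intro allI)
    fix a b
    obtain F where "\<And>c::nat. borel_Pi (Suc 0) (F c)" "F2 a b = (\<Union>c. F c)"
      using F2(1)[of a b] by (rule borel_Sigma_SucE) (rule that)
    then show "\<exists>F. (\<forall>c::nat. borel_Pi (Suc 0) (F c)) \<and> F2 a b = (\<Union>c. F c)" by blast
  qed
  then obtain F3 where F3: "\<And>a b c::nat. borel_Pi (Suc 0) (F3 a b c)" "\<And>a b. F2 a b = (\<Union>c. F3 a b c)" by metis
  define R where "R x a b c d \<longleftrightarrow> (\<exists>y\<in>F3 a b c. \<forall>i<d. y i = x i)" for x a b c d
  have "locally_determined (\<lambda>x. R x a b c d)" for a b c d
    unfolding locally_determined_def R_def by (intro allI exI[of _ d]) auto
  moreover have mem: "x \<in> F3 a b c \<longleftrightarrow> (\<forall>d. R x a b c d)" for x a b c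
  proof
    assume R: "\<forall>d. R x a b c d"
    show "x \<in> F3 a b c"
    proof (rule ccontr)
      assume "x \<notin> F3 a b c"
      moreover have "open (- F3 a b c)" using borel_Pi_1_closed[OF F3(1)] by (simp add: open_Compl)
      ultimately obtain D where "\<And>y. (\<forall>i<D. y i = x i) \<Longrightarrow> y \<notin> F3 a b c"
        using open_contains_cylinder[of "- F3 a b c" x] by auto
      then show False using R unfolding R_def by blast
    qed
  qed (auto simp: R_def)
  moreover have "x \<in> A \<longleftrightarrow> (\<exists>a. \<forall>b. \<exists>c. \<forall>d. R x a b c d)" for x
    unfolding F1(2) F2(2) F3(2) mem[symmetric] by auto
  ultimately show ?thesis by (intro that)
qed

section \<open>Continuity of the reduction\<close>

lemma step_cong: "task_level f (fst st) = task_level g (fst st) \<Longrightarrow> step f n st = step g n st"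
proof -
  assume "task_level f (fst st) = task_level g (fst st)"
  then have "task_child f (fst st) = task_child g (fst st)" by (intro ext) (simp add: task_child_def)
  then show ?thesis by (cases st) (simp add: step_def)
qed

lemma locally_determined_state:
  assumes g: "\<And>i u. locally_determined (\<lambda>x. g x i u)"
  shows "locally_determined (\<lambda>x. state (g x) n)"
proof (induction n)
  case 0 show ?case by (simp add: locally_determined_def)
next
  case (Suc n)
  show ?case unfolding locally_determined_def
  proof
    fix x
    obtain D1 where D1: "\<And>y. (\<forall>i<D1. y i = x i) \<Longrightarrow> state (g y) n = state (g x) n"
      using Suc unfolding locally_determined_def by blast
    define t where "t = fst (state (g x) n)"
    obtain D2 where D2: "\<And>y. (\<forall>i<D2. y i = x i) \<Longrightarrow> g y (prime_index (fst (prod_decode t))) (snd (prod_decode t)) = g x (prime_index (fst (prod_decode t))) (snd (prod_decode t))"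
      using g unfolding locally_determined_def by blast
    show "\<exists>D. \<forall>y. (\<forall>i<D. y i = x i) \<longrightarrow> state (g y) (Suc n) = state (g x) (Suc n)"
    proof (intro exI[of _ "max D1 D2"] allI impI)
      fix y assume y: "\<forall>i<max D1 D2. y i = x i"
      have eq: "state (g y) n = state (g x) n" using y by (intro D1) auto
      moreover have "task_level (g y) t = task_level (g x) t" using D2[of y] y by (simp add: task_level_def)
      ultimately show "state (g y) (Suc n) = state (g x) (Suc n)"
        using step_cong[of "g y" "state (g x) n" "g x" n] by (simp add: t_def)
    qed
  qed
qed

text \<open>The state at stage \<open>n\<close> is locally determined and confines the limit to an
  interval of length \<open>1 / 2^(2^n)\<close>.\<close>

lemma continuous_limit_point:
  assumes g: "\<And>i u. locally_determined (\<lambda>x. g x i u)"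
  shows "continuous_on UNIV (\<lambda>x. limit_point (g x))"
proof (unfold continuous_on_def, intro ballI tendstoI)
  fix x :: "nat \<Rightarrow> nat" and e :: real assume e: "0 < e"
  obtain n where n: "(1/2::real) ^ n < e" using real_arch_pow_inv[OF e, of "1/2"] by auto
  have "(1/2::real) ^ 2 ^ n \<le> (1/2) ^ n" by (intro power_decreasing less_imp_le less_exp) auto
  then have n': "1 / (2::real) ^ 2 ^ n < e" using n by (simp add: power_one_over)
  have "locally_determined (\<lambda>x. state (g x) n)" by (rule locally_determined_state[OF g])
  then have "\<exists>D. \<forall>y. (\<forall>i<D. y i = x i) \<longrightarrow> state (g y) n = state (g x) n"
    unfolding locally_determined_def by (rule spec)
  then obtain D where D: "\<And>y. (\<forall>i<D. y i = x i) \<Longrightarrow> state (g y) n = state (g x) n" by blast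
  have "dist (limit_point (g y)) (limit_point (g x)) < e" if "y \<in> {y. \<forall>i<D. y i = x i}" for y
  proof -
    have "approx (g y) n = approx (g x) n" using D[of y] that by (simp add: approx_def pos_def)
    then show ?thesis
      using limit_point_bounds[of "g y" n] limit_point_bounds[of "g x" n] n' by (simp add: dist_real_def abs_less_iff)
  qed
  then have "eventually (\<lambda>y. dist (limit_point (g y)) (limit_point (g x)) < e) (nhds x)"
    unfolding eventually_nhds using open_cylinder[of D x] by (intro exI[of _ "{y. \<forall>i<D. y i = x i}"]) auto
  then show "eventually (\<lambda>y. dist (limit_point (g y)) (limit_point (g x)) < e) (at x)"
    unfolding eventually_at_filter by (rule eventually_mono) simp
qed

text \<open>Candidates up to time \<open>u + 1\<close> consult \<open>R\<close> only at arguments up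
  to \<open>u + 1\<close>, so finitely many moduli \<open>D c d\<close> have a common bound.\<close>

lemma locally_determined_revision_seq:
  assumes "\<And>b c d. locally_determined (\<lambda>x. R x b c d)"
  shows "locally_determined (\<lambda>x. revision_seq (R x) t)"
  unfolding locally_determined_def
proof
  fix x
  define b where "b = fst (prod_decode t)"
  define u where "u = snd (prod_decode t)"
  have "\<forall>c d. \<exists>D. \<forall>y. (\<forall>i<D. y i = x i) \<longrightarrow> R y b c d = R x b c d"
    using assms unfolding locally_determined_def by blast
  then obtain D where D: "\<And>c d y. (\<forall>i<D c d. y i = x i) \<Longrightarrow> R y b c d = R x b c d" by metis
  define D' where "D' = (\<Sum>c\<le>Suc u. \<Sum>d\<le>Suc u. D c d)"
  have DD: "D c d \<le> D'" if "c \<le> Suc u" "d \<le> Suc u" for c d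
  proof -
    have "D c d \<le> (\<Sum>d\<le>Suc u. D c d)" using that by (intro member_le_sum) auto
    also have "\<dots> \<le> D'" unfolding D'_def using that by (intro member_le_sum[of c "{..Suc u}" "\<lambda>c. \<Sum>d\<le>Suc u. D c d"]) auto
    finally show ?thesis .
  qed
  show "\<exists>D. \<forall>y. (\<forall>i<D. y i = x i) \<longrightarrow> revision_seq (R y) t = revision_seq (R x) t"
  proof (intro exI[of _ D'] allI impI)
    fix y assume y: "\<forall>i<D'. y i = x i"
    have R: "R y b c d = R x b c d" if "c \<le> Suc u" "d \<le> Suc u" for c d
      using y DD[OF that] by (intro D) auto
    have cand: "candidate (R y b) v = candidate (R x b) v" if v: "v \<le> Suc u" for v
    proof -
      have le: "candidate P v \<le> v" for P by (rule candidate_le) simp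
      have "candidate (R z b) v \<le> candidate (R z' b) v" if zz: "{z, z'} = {x, y}" for z z'
      proof (rule candidate_le)
        have "R z b c d = R z' b c d" if "c \<le> Suc u" "d \<le> Suc u" for c d
          using R[OF that] zz by (metis doubleton_eq_iff)
        moreover have "candidate (R z' b) v \<le> Suc u" using le[of "R z' b"] v by linarith
        ultimately show "candidate (R z' b) v = v \<or> (\<forall>d<v. R z b (candidate (R z' b) v) d)"
          using candidate[of "R z' b" v] v by (metis le_trans less_imp_le)
      qed
      from this[of x y] this[of y x] show ?thesis by (simp add: insert_commute)
    qed
    show "revision_seq (R y) t = revision_seq (R x) t"
      unfolding revision_seq_def b_def[symmetric] u_def[symmetric] by (simp add: cand)
  qed
qed

theorem borel_Sigma_complete_normal: "borel_Sigma_complete 4 {\<xi>. normal_to_some_base \<xi>}"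
  unfolding borel_Sigma_complete_def
proof (intro conjI allI impI borel_Sigma_normal)
  fix A :: "(nat \<Rightarrow> nat) set" assume "borel_Sigma 4 A"
  then obtain R :: "(nat \<Rightarrow> nat) \<Rightarrow> nat \<Rightarrow> nat \<Rightarrow> nat \<Rightarrow> nat \<Rightarrow> bool"
    where R: "\<And>a b c d. locally_determined (\<lambda>x. R x a b c d)" "\<And>x. x \<in> A \<longleftrightarrow> (\<exists>a. \<forall>b. \<exists>c. \<forall>d. R x a b c d)"
    by (rule borel_Sigma_4_locally_determined) (rule that)
  define g where "g x a = revision_seq (R x a)" for x a
  have "continuous_on UNIV (\<lambda>x. limit_point (g x))"
    unfolding g_def by (intro continuous_limit_point locally_determined_revision_seq R)
  moreover have "x \<in> A \<longleftrightarrow> limit_point (g x) \<in> {\<xi>. normal_to_some_base \<xi>}" for x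
    unfolding R(2) by (simp add: normal_limit_point_iff g_def diverges_revision_seq)
  ultimately show "\<exists>f. continuous_on UNIV f \<and> (\<forall>x. (x \<in> A) = (f x \<in> {\<xi>. normal_to_some_base \<xi>}))" by blast
qed

section \<open>Closure properties of computable functions\<close>

lemma computable_iff: "computable f \<longleftrightarrow> (\<exists>F. \<forall>x. recf_eval F x = Some (f x))"
proof
  assume "computable f"
  then obtain e where "\<forall>x. phi e x = Some (f x)" unfolding computable_def by blast
  then show "\<exists>F. \<forall>x. recf_eval F x = Some (f x)" unfolding phi_def by blast
next
  assume "\<exists>F. \<forall>x. recf_eval F x = Some (f x)"
  then obtain F where "\<forall>x. recf_eval F x = Some (f x)" by blast
  then show "computable f"
    unfolding computable_def phi_def using bij_recf_num by (intro exI[of _ "recf_num F"]) (simp add: bij_is_inj)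
qed

lemma phi_recf_num [simp]: "phi (recf_num F) = recf_eval F"
  unfolding phi_def using bij_recf_num by (simp add: bij_is_inj)

definition pfst :: "nat \<Rightarrow> nat" where "pfst z = fst (prod_decode z)"
definition psnd :: "nat \<Rightarrow> nat" where "psnd z = snd (prod_decode z)"

lemma pfst_psnd [simp]: "pfst (prod_encode (a, b)) = a" "psnd (prod_encode (a, b)) = b" "prod_encode (pfst z, psnd z) = z"
  by (simp_all add: pfst_def psnd_def)

lemma computable_comp: "computable f \<Longrightarrow> computable g \<Longrightarrow> computable (\<lambda>x. f (g x))"
proof -
  assume "computable f" "computable g"
  then obtain F G where "\<forall>x. recf_eval F x = Some (f x)" "\<forall>x. recf_eval G x = Some (g x)" unfolding computable_iff by blast
  then have "\<forall>x. recf_eval (RComp F G) x = Some (f (g x))" by simp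
  then show ?thesis unfolding computable_iff by blast
qed

lemma computable_pair: "computable f \<Longrightarrow> computable g \<Longrightarrow> computable (\<lambda>x. prod_encode (f x, g x))"
proof -
  assume "computable f" "computable g"
  then obtain F G where "\<forall>x. recf_eval F x = Some (f x)" "\<forall>x. recf_eval G x = Some (g x)" unfolding computable_iff by blast
  then have "\<forall>x. recf_eval (RPair F G) x = Some (prod_encode (f x, g x))" by simp
  then show ?thesis unfolding computable_iff by blast
qed

lemma computable_id: "computable (\<lambda>x. x)"
proof -
  have "\<forall>x. recf_eval (RPair RFst RSnd) x = Some x" by simp
  then show ?thesis unfolding computable_iff by blast
qed

lemma computable_pfst: "computable f \<Longrightarrow> computable (\<lambda>x. pfst (f x))"
proof -
  have "\<forall>x. recf_eval RFst x = Some (pfst x)" by (simp add: pfst_def)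
  then have "computable pfst" unfolding computable_iff by blast
  then show "computable f \<Longrightarrow> computable (\<lambda>x. pfst (f x))" by (rule computable_comp)
qed

lemma computable_psnd: "computable f \<Longrightarrow> computable (\<lambda>x. psnd (f x))"
proof -
  have "\<forall>x. recf_eval RSnd x = Some (psnd x)" by (simp add: psnd_def)
  then have "computable psnd" unfolding computable_iff by blast
  then show "computable f \<Longrightarrow> computable (\<lambda>x. psnd (f x))" by (rule computable_comp)
qed

lemma computable_Suc: "computable f \<Longrightarrow> computable (\<lambda>x. Suc (f x))"
proof -
  have "\<forall>x. recf_eval RSucc x = Some (Suc x)" by simp
  then have "computable Suc" unfolding computable_iff by blast
  then show "computable f \<Longrightarrow> computable (\<lambda>x. Suc (f x))" by (rule computable_comp)
qed

primrec recf_const :: "nat \<Rightarrow> recf" where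
  "recf_const 0 = RZero"
| "recf_const (Suc n) = RComp RSucc (recf_const n)"

lemma recf_eval_const [simp]: "recf_eval (recf_const n) x = Some n"
  by (induction n) auto

lemma computable_const: "computable (\<lambda>x. n)"
  unfolding computable_iff using recf_eval_const by blast

lemma computable_rec:
  assumes a: "computable a" and g: "computable (\<lambda>z. g (pfst z) (pfst (psnd z)) (psnd (psnd z)))" and n: "computable n"
  shows "computable (\<lambda>x. rec_nat (a x) (\<lambda>k y. g x k y) (n x))"
proof -
  obtain A where A: "\<And>x. recf_eval A x = Some (a x)" using a unfolding computable_iff by blast
  obtain G where G: "\<And>z. recf_eval G z = Some (g (pfst z) (pfst (psnd z)) (psnd (psnd z)))" using g unfolding computable_iff by blast
  have "rec_nat (recf_eval A x) (\<lambda>k r. Option.bind r (\<lambda>y. recf_eval G (prod_encode (x, prod_encode (k, y))))) m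
     = Some (rec_nat (a x) (\<lambda>k y. g x k y) m)" for x m
    by (induction m) (auto simp: A G)
  then have "\<forall>z. recf_eval (RPrim A G) z = Some (rec_nat (a (pfst z)) (\<lambda>k y. g (pfst z) k y) (psnd z))"
    by (simp add: pfst_def psnd_def split: prod.split)
  then have "computable (\<lambda>z. rec_nat (a (pfst z)) (\<lambda>k y. g (pfst z) k y) (psnd z))"
    unfolding computable_iff by blast
  from computable_comp[OF this computable_pair[OF computable_id n]] show ?thesis by simp
qed

definition decid :: "(nat \<Rightarrow> bool) \<Rightarrow> bool" where
  "decid P \<longleftrightarrow> computable (\<lambda>x. of_bool (P x))"

text \<open>Minimisation searches for the value 0, so the characteristic function is first inverted
  by the program \<open>N\<close>.\<close>

lemma computable_Least:
  assumes P: "decid (\<lambda>z. P (pfst z) (psnd z))" and ex: "\<And>x. \<exists>i. P x i"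
  shows "computable (\<lambda>x. LEAST i. P x i)"
proof -
  obtain F0 where F0: "\<And>z. recf_eval F0 z = Some (of_bool (P (pfst z) (psnd z)))" using P unfolding decid_def computable_iff by blast
  have "computable (\<lambda>y. rec_nat 1 (\<lambda>k r. 0) y)"
    by (rule computable_rec[OF computable_const computable_const computable_id])
  then obtain N where N: "\<And>y. recf_eval N y = Some (rec_nat 1 (\<lambda>k r. 0) y)" unfolding computable_iff by blast
  define F where "F = RComp N F0"
  have F: "recf_eval F (prod_encode (x, i)) = Some (if P x i then 0 else 1)" for x i
    unfolding F_def by (simp add: F0 N)
  have "recf_eval (RMin F) x = Some (LEAST i. P x i)" for x
  proof -
    have "\<exists>n. recf_eval F (prod_encode (x, n)) = Some 0 \<and> (\<forall>m<n. recf_eval F (prod_encode (x, m)) \<noteq> None)"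
      using ex[of x] by (auto simp: F)
    moreover have "(\<lambda>n. recf_eval F (prod_encode (x, n)) = Some 0) = (\<lambda>n. P x n)" by (auto simp: F)
    ultimately show ?thesis by simp
  qed
  then show ?thesis unfolding computable_iff by blast
qed

lemma computable_add: "computable f \<Longrightarrow> computable g \<Longrightarrow> computable (\<lambda>x. f x + g x)"
proof -
  assume f: "computable f" and g: "computable g"
  have "rec_nat a (\<lambda>k r. Suc r) b = a + b" for a b by (induction b) auto
  moreover have "computable (\<lambda>x. rec_nat (f x) (\<lambda>k r. Suc r) (g x))"
    by (intro computable_rec computable_Suc computable_psnd computable_id f g)
  ultimately show ?thesis by simp
qed

lemma computable_mult: "computable f \<Longrightarrow> computable g \<Longrightarrow> computable (\<lambda>x. f x * g x)"
proof -
  assume f: "computable f" and g: "computable g"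
  have "rec_nat 0 (\<lambda>k r. r + a) b = a * b" for a b :: nat by (induction b) auto
  moreover have "computable (\<lambda>x. rec_nat 0 (\<lambda>k r. r + f x) (g x))"
    by (intro computable_rec computable_add computable_const computable_psnd computable_pfst computable_id
       computable_comp[OF f] f g)
  ultimately show ?thesis by simp
qed

lemma computable_diff: "computable f \<Longrightarrow> computable g \<Longrightarrow> computable (\<lambda>x. f x - g x)"
proof -
  assume f: "computable f" and g: "computable g"
  have p: "rec_nat 0 (\<lambda>k r. k) b = b - 1" for b :: nat by (cases b) auto
  have "computable (\<lambda>x. rec_nat 0 (\<lambda>k r. k) x)"
    by (intro computable_rec computable_const computable_psnd computable_pfst computable_id)
  then have pred: "computable (\<lambda>x. x - 1)" unfolding p .
  have "rec_nat a (\<lambda>k r. r - 1) b = a - b" for a b :: nat by (induction b) auto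
  moreover have "computable (\<lambda>x. rec_nat (f x) (\<lambda>k r. r - 1) (g x))"
    by (intro computable_rec computable_comp[OF pred] computable_psnd computable_id f g)
  ultimately show ?thesis by simp
qed

lemma computable_power: "computable f \<Longrightarrow> computable g \<Longrightarrow> computable (\<lambda>x. f x ^ g x)"
proof -
  assume f: "computable f" and g: "computable g"
  have "rec_nat (Suc 0) (\<lambda>k r. r * a) b = a ^ b" for a b :: nat by (induction b) auto
  moreover have "computable (\<lambda>x. rec_nat (Suc 0) (\<lambda>k r. r * f x) (g x))"
    by (intro computable_rec computable_mult computable_const computable_psnd computable_pfst computable_id
       computable_comp[OF f] f g)
  ultimately show ?thesis by simp
qed

lemma computable_sum:
  assumes f: "computable (\<lambda>z. f (pfst z) (psnd z))" and n: "computable n"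
  shows "computable (\<lambda>x. \<Sum>i<n x. f x i)"
proof -
  have "rec_nat 0 (\<lambda>k r. r + f x k) m = (\<Sum>i<m. f x i)" for x m by (induction m) auto
  moreover have "computable (\<lambda>z. f (pfst z) (pfst (psnd z)))"
    using computable_comp[OF f, of "\<lambda>z. prod_encode (pfst z, pfst (psnd z))"]
    by (simp add: computable_pair computable_pfst computable_psnd computable_id)
  then have "computable (\<lambda>x. rec_nat 0 (\<lambda>k r. r + f x k) (n x))"
    by (intro computable_rec computable_add computable_const computable_psnd computable_id n)
  ultimately show ?thesis by simp
qed

section \<open>Decidable predicates\<close>

lemma decid_le: "computable f \<Longrightarrow> computable g \<Longrightarrow> decid (\<lambda>x. f x \<le> g x)"
proof -
  assume "computable f" "computable g"
  then have "computable (\<lambda>x. 1 - (f x - g x))" by (intro computable_diff computable_const)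
  moreover have "1 - (f x - g x) = of_bool (f x \<le> g x)" for x by auto
  ultimately show ?thesis unfolding decid_def by simp
qed

lemma decid_not: "decid P \<Longrightarrow> decid (\<lambda>x. \<not> P x)"
proof -
  assume "decid P"
  then have "computable (\<lambda>x. 1 - of_bool (P x))" unfolding decid_def by (intro computable_diff computable_const)
  moreover have "1 - of_bool (P x) = (of_bool (\<not> P x) :: nat)" for x by auto
  ultimately show ?thesis unfolding decid_def by simp
qed

lemma decid_conj: "decid P \<Longrightarrow> decid Q \<Longrightarrow> decid (\<lambda>x. P x \<and> Q x)"
proof -
  assume "decid P" "decid Q"
  then have "computable (\<lambda>x. of_bool (P x) * of_bool (Q x))" unfolding decid_def by (intro computable_mult)
  then show ?thesis unfolding decid_def by (simp add: of_bool_conj)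
qed

lemma decid_disj:
  assumes "decid P" "decid Q" shows "decid (\<lambda>x. P x \<or> Q x)"
proof -
  have "decid (\<lambda>x. \<not> (\<not> P x \<and> \<not> Q x))" by (intro decid_not decid_conj assms)
  then show ?thesis by (simp only: de_Morgan_conj not_not)
qed

lemma decid_imp:
  assumes "decid P" "decid Q" shows "decid (\<lambda>x. P x \<longrightarrow> Q x)"
proof -
  have "decid (\<lambda>x. \<not> P x \<or> Q x)" by (intro decid_not decid_disj assms)
  then show ?thesis by (simp only: imp_conv_disj)
qed

lemma decid_less:
  assumes "computable f" "computable g" shows "decid (\<lambda>x. f x < g x)"
proof -
  have "decid (\<lambda>x. \<not> g x \<le> f x)" by (intro decid_not decid_le assms)
  then show ?thesis by (simp only: not_le)
qed

lemma decid_eq: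
  assumes "computable f" "computable g" shows "decid (\<lambda>x. f x = g x)"
proof -
  have "decid (\<lambda>x. f x \<le> g x \<and> g x \<le> f x)" by (intro decid_conj decid_le assms)
  moreover have "(\<lambda>x. f x \<le> g x \<and> g x \<le> f x) = (\<lambda>x. f x = g x)" by (rule ext) auto
  ultimately show ?thesis by (simp only:)
qed

lemma decid_const: "decid (\<lambda>x. b)"
  unfolding decid_def by (rule computable_const)

lemma decid_comp: "decid P \<Longrightarrow> computable f \<Longrightarrow> decid (\<lambda>x. P (f x))"
  unfolding decid_def by (rule computable_comp)

lemma computable_of_bool: "decid P \<Longrightarrow> computable (\<lambda>x. of_bool (P x))"
  by (simp add: decid_def)

lemma computable_if:
  assumes "decid P" "computable f" "computable g"
  shows "computable (\<lambda>x. if P x then f x else g x)"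
proof -
  have "computable (\<lambda>x. of_bool (P x) * f x + (1 - of_bool (P x)) * g x)"
    using assms unfolding decid_def by (intro computable_add computable_mult computable_diff computable_const)
  moreover have "of_bool (P x) * f x + (1 - of_bool (P x)) * g x = (if P x then f x else g x)" for x by auto
  ultimately show ?thesis by simp
qed

lemma decid_all_less:
  assumes "decid (\<lambda>z. P (pfst z) (psnd z))" "computable n"
  shows "decid (\<lambda>x. \<forall>i<n x. P x i)"
proof -
  have "computable (\<lambda>z. of_bool (\<not> P (pfst z) (psnd z)))"
    using decid_not[OF assms(1)] by (simp add: decid_def)
  then have "decid (\<lambda>x. (\<Sum>i<n x. of_bool (\<not> P x i)) = (0::nat))"
    by (intro decid_eq computable_sum computable_const assms)
  moreover have "(\<Sum>i<n x. of_bool (\<not> P x i)) = (0::nat) \<longleftrightarrow> (\<forall>i<n x. P x i)" for x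
    by (subst sum_eq_0_iff) auto
  ultimately show ?thesis by simp
qed

lemma decid_all_le:
  assumes "decid (\<lambda>z. P (pfst z) (psnd z))" "computable n"
  shows "decid (\<lambda>x. \<forall>i\<le>n x. P x i)"
  using decid_all_less[OF assms(1) computable_Suc[OF assms(2)]] by (simp add: less_Suc_eq_le)

lemma decid_ex_less:
  assumes "decid (\<lambda>z. P (pfst z) (psnd z))" "computable n"
  shows "decid (\<lambda>x. \<exists>i<n x. P x i)"
  using decid_not[OF decid_all_less[OF decid_not[OF assms(1)] assms(2)]] by simp

lemma decid_ex_le:
  assumes "decid (\<lambda>z. P (pfst z) (psnd z))" "computable n"
  shows "decid (\<lambda>x. \<exists>i\<le>n x. P x i)"
  using decid_not[OF decid_all_le[OF decid_not[OF assms(1)] assms(2)]] by simp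

lemma computable_div: "computable f \<Longrightarrow> computable g \<Longrightarrow> computable (\<lambda>x. f x div g x)"
proof -
  assume f: "computable f" and g: "computable g"
  \<comment> \<open>The quotient counts the positive multiples of \<open>b\<close> up to
    \<open>a\<close>; the guard \<open>0 < b\<close> yields the value 0 for division by 0.\<close>
  have eq: "(\<Sum>i<a. of_bool (0 < b \<and> Suc i * b \<le> a)) = a div b" for a b :: nat
  proof (cases "b = 0")
    case False
    have "{..<a} \<inter> {i. 0 < b \<and> Suc i * b \<le> a} = {..<a div b}"
    proof -
      have "Suc i * b \<le> a \<longleftrightarrow> i < a div b" for i using False by (simp add: less_eq_div_iff_mult_less_eq Suc_le_eq[symmetric])
      moreover have "a div b \<le> a" by simp
      ultimately show ?thesis using False by (auto intro: less_le_trans)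
    qed
    then show ?thesis by simp
  qed simp
  have "computable (\<lambda>x. \<Sum>i<f x. of_bool (0 < g x \<and> Suc i * g x \<le> f x))"
  proof -
    have f': "computable (\<lambda>z. f (pfst z))" and g': "computable (\<lambda>z. g (pfst z))"
      by (rule computable_comp[OF f] computable_comp[OF g], intro computable_pfst computable_id)+
    show ?thesis
      by (intro computable_sum computable_of_bool decid_conj decid_less decid_le computable_mult computable_Suc
         computable_const[of 0] computable_psnd computable_id f' g' f)
  qed
  then show ?thesis unfolding eq .
qed

lemma computable_mod:
  assumes "computable f" "computable g" shows "computable (\<lambda>x. f x mod g x)"
proof -
  have "computable (\<lambda>x. f x - f x div g x * g x)"
    by (intro computable_diff computable_mult computable_div assms)
  then show ?thesis by (simp only: minus_div_mult_eq_mod)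
qed

lemma decid_dvd:
  assumes "computable f" "computable g" shows "decid (\<lambda>x. f x dvd g x)"
proof -
  have "decid (\<lambda>x. g x mod f x = 0)" by (intro decid_eq computable_mod computable_const assms)
  then show ?thesis by (simp only: dvd_eq_mod_eq_0)
qed

lemmas computable_intros = computable_id computable_const computable_Suc computable_pfst computable_psnd computable_pair
  computable_add computable_mult computable_diff computable_power computable_sum computable_if computable_of_bool
  computable_div computable_mod
  decid_le decid_less decid_eq decid_not decid_conj decid_disj decid_imp decid_const decid_all_less decid_all_le
  decid_ex_less decid_ex_le decid_dvd

lemma decid_prime: "computable f \<Longrightarrow> decid (\<lambda>x. prime (f x))"
proof -
  have eq: "prime p \<longleftrightarrow> 1 < p \<and> (\<forall>d<p. d dvd p \<longrightarrow> d = 1)" for p :: nat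
  proof
    assume "prime p"
    then have "1 < p" "\<And>m. m dvd p \<Longrightarrow> m = 1 \<or> m = p" unfolding prime_nat_iff by blast+
    then show "1 < p \<and> (\<forall>d<p. d dvd p \<longrightarrow> d = 1)" by (metis less_irrefl)
  next
    assume p: "1 < p \<and> (\<forall>d<p. d dvd p \<longrightarrow> d = 1)"
    have "d = 1 \<or> d = p" if "d dvd p" for d
    proof -
      have "d \<le> p" using that p by (intro dvd_imp_le) auto
      then show ?thesis using p that by (cases "d = p") auto
    qed
    then show "prime p" using p unfolding prime_nat_iff by blast
  qed
  have "prime = (\<lambda>p::nat. 1 < p \<and> (\<forall>d<p. d dvd p \<longrightarrow> d = 1))" by (rule ext) (rule eq)
  moreover have "decid (\<lambda>p. 1 < p \<and> (\<forall>d<p. d dvd p \<longrightarrow> d = 1))" by (intro computable_intros)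
  ultimately have "decid prime" by (simp only:)
  then show "computable f \<Longrightarrow> decid (\<lambda>x. prime (f x))" by (rule decid_comp)
qed

text \<open>The program for \<open>x\<close> pairs the constant \<open>x\<close> with its input and
  passes the pair to one fixed program; the number of the constant program is a primitive recursive
  function of \<open>x\<close>.\<close>

lemma smn:
  assumes "computable h"
  obtains idx where "computable idx" "\<And>x n. phi (idx x) n = Some (h (prod_encode (x, n)))"
proof -
  obtain F where F: "\<And>z. recf_eval F z = Some (h z)" using assms unfolding computable_iff by blast
  define cn where "cn x = rec_nat 0 (\<lambda>k y. 4 * prod_encode (1, y) + 5) x" for x
  have cn: "recf_num (recf_const x) = cn x" for x
  proof (induction x)
    case (Suc x)
    have "cn (Suc x) = 4 * prod_encode (1, cn x) + 5" by (simp only: cn_def old.nat.simps(7))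
    then show ?case by (simp only: recf_const.simps recf_num.simps Suc)
  qed (simp add: cn_def)
  define I where "I = RPair RFst RSnd"
  define idx where "idx x = recf_num (RComp F (RPair (recf_const x) I))" for x
  have idx: "idx x = 4 * prod_encode (recf_num F, 4 * prod_encode (cn x, recf_num I) + 4) + 5" for x
    by (simp only: idx_def cn recf_num.simps)
  have "computable cn" unfolding cn_def by (intro computable_rec computable_intros)
  then have "computable idx" unfolding idx[abs_def] by (intro computable_intros)
  moreover have "phi (idx x) n = Some (h (prod_encode (x, n)))" for x n
    unfolding idx_def phi_recf_num by (simp add: I_def F)
  ultimately show ?thesis using that by blast
qed

section \<open>Normal forms of arithmetical sets\<close>

text \<open>Repeated unpairing reads a number as an infinite list, so an assignment of all variables
  is a single number and binding a variable is pairing on the left.\<close>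

primrec nth_comp :: "nat \<Rightarrow> nat \<Rightarrow> nat" where
  "nth_comp 0 x = pfst x"
| "nth_comp (Suc i) x = nth_comp i (psnd x)"

definition valuation :: "nat \<Rightarrow> nat \<Rightarrow> nat" where "valuation x = (\<lambda>i. nth_comp i x)"

lemma valuation_pair: "valuation (prod_encode (y, x)) = case_nat y (valuation x)"
  by (rule ext) (simp add: valuation_def split: nat.split)

lemma computable_tm_val: "computable (\<lambda>x. tm_val (valuation x) t)"
proof (induction t)
  case (TVar i)
  have "computable (nth_comp i)"
  proof (induction i)
    case 0
    have "nth_comp 0 = (\<lambda>x. pfst x)" by (rule ext) simp
    then show ?case by (simp add: computable_pfst computable_id)
  next
    case (Suc i)
    have "computable (\<lambda>x. nth_comp i (psnd x))" by (intro computable_comp[OF Suc] computable_intros)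
    moreover have "nth_comp (Suc i) = (\<lambda>x. nth_comp i (psnd x))" by (rule ext) simp
    ultimately show ?case by simp
  qed
  then show ?case by (simp add: valuation_def)
qed (simp_all add: computable_intros)

lemma decid_bounded_fm: "bounded_fm \<phi> \<Longrightarrow> decid (\<lambda>x. fm_true (valuation x) \<phi>)"
proof (induction \<phi>)
  case (FBAll t \<phi>)
  have D: "decid (\<lambda>x. fm_true (valuation x) \<phi>)" using FBAll by simp
  have "decid (\<lambda>x. \<forall>y\<le>tm_val (valuation x) t. fm_true (valuation (prod_encode (y, x))) \<phi>)"
    by (intro decid_all_le computable_tm_val decid_comp[OF D] computable_intros)
  then show ?case by (simp add: valuation_pair)
next
  case (FBEx t \<phi>)
  have D: "decid (\<lambda>x. fm_true (valuation x) \<phi>)" using FBEx by simp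
  have "decid (\<lambda>x. \<exists>y\<le>tm_val (valuation x) t. fm_true (valuation (prod_encode (y, x))) \<phi>)"
    by (intro decid_ex_le computable_tm_val decid_comp[OF D] computable_intros)
  then show ?case by (simp add: valuation_pair)
qed (simp_all add: decid_eq decid_le decid_not decid_conj decid_disj computable_tm_val)

text \<open>Prenex form with exactly one quantifier per level over a decidable matrix. Only
  existential steps occur; universal ones are expressed through negation.\<close>

primrec sigma_rel :: "nat \<Rightarrow> (nat \<Rightarrow> bool) \<Rightarrow> bool" where
  "sigma_rel 0 P = decid P"
| "sigma_rel (Suc n) P = (\<exists>Q. sigma_rel n (\<lambda>x. \<not> Q x) \<and> (\<forall>x. P x = (\<exists>a. Q (prod_encode (a, x)))))"

lemma sigma_rel_comp: "sigma_rel n P \<Longrightarrow> computable f \<Longrightarrow> sigma_rel n (\<lambda>x. P (f x))"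
proof (induction n arbitrary: P f)
  case 0 then show ?case by (simp add: decid_comp)
next
  case (Suc n)
  then obtain Q where Q: "sigma_rel n (\<lambda>x. \<not> Q x)" "\<And>x. P x = (\<exists>a. Q (prod_encode (a, x)))" by auto
  have "computable (\<lambda>z. prod_encode (pfst z, f (psnd z)))"
    by (intro computable_intros computable_comp[OF Suc.prems(2)])
  from Suc.IH[OF Q(1) this] have "sigma_rel n (\<lambda>z. \<not> Q (prod_encode (pfst z, f (psnd z))))" .
  then show ?case using Q(2) by (auto intro!: exI[of _ "\<lambda>z. Q (prod_encode (pfst z, f (psnd z)))"])
qed

text \<open>A further quantifier of the same kind is merged with the leading one by pairing; a level
  entered without a quantifier receives a dummy one through \<open>psnd\<close>.\<close>

lemma fm_sigma_rel:
  "Sigma_fm n \<phi> \<Longrightarrow> sigma_rel n (\<lambda>x. fm_true (valuation x) \<phi>)"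
  "Pi_fm n \<phi> \<Longrightarrow> sigma_rel n (\<lambda>x. \<not> fm_true (valuation x) \<phi>)"
proof (induction n \<phi> and n \<phi> rule: Sigma_fm_Pi_fm.inducts)
  case (1 \<phi>) then show ?case by (simp add: decid_bounded_fm)
next
  case (2 \<phi>) then show ?case by (simp add: decid_bounded_fm decid_not)
next
  case (3 n \<phi>)
  have "sigma_rel n (\<lambda>z. \<not> fm_true (valuation (psnd z)) \<phi>)" by (rule sigma_rel_comp[OF 3(2)]) (intro computable_intros)
  then show ?case by (auto intro!: exI[of _ "\<lambda>z. fm_true (valuation (psnd z)) \<phi>"])
next
  case (4 n \<phi>)
  then obtain Q where Q: "sigma_rel n (\<lambda>x. \<not> Q x)" "\<And>x. fm_true (valuation x) \<phi> = (\<exists>a. Q (prod_encode (a, x)))" by auto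
  have "sigma_rel n (\<lambda>z. \<not> Q (prod_encode (pfst (pfst z), prod_encode (psnd (pfst z), psnd z))))"
    by (rule sigma_rel_comp[OF Q(1)]) (intro computable_intros)
  moreover have "fm_true (valuation x) (FEx \<phi>) \<longleftrightarrow> (\<exists>a. Q (prod_encode (pfst a, prod_encode (psnd a, x))))" for x
    unfolding fm_true.simps valuation_pair[symmetric] Q(2) by (metis pfst_psnd(1,2))
  ultimately show ?case by (auto intro!: exI[of _ "\<lambda>z. Q (prod_encode (pfst (pfst z), prod_encode (psnd (pfst z), psnd z)))"])
next
  case (5 n \<phi>)
  have "sigma_rel n (\<lambda>z. fm_true (valuation (psnd z)) \<phi>)" by (rule sigma_rel_comp[OF 5(2)]) (intro computable_intros)
  then show ?case by (auto intro!: exI[of _ "\<lambda>z. \<not> fm_true (valuation (psnd z)) \<phi>"])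
next
  case (6 n \<phi>)
  then obtain Q where Q: "sigma_rel n (\<lambda>x. \<not> Q x)" "\<And>x. (\<not> fm_true (valuation x) \<phi>) = (\<exists>a. Q (prod_encode (a, x)))" by auto
  have "sigma_rel n (\<lambda>z. \<not> Q (prod_encode (pfst (pfst z), prod_encode (psnd (pfst z), psnd z))))"
    by (rule sigma_rel_comp[OF Q(1)]) (intro computable_intros)
  moreover have "(\<not> fm_true (valuation x) (FAll \<phi>)) \<longleftrightarrow> (\<exists>a. Q (prod_encode (pfst a, prod_encode (psnd a, x))))" for x
    unfolding fm_true.simps valuation_pair[symmetric] not_all Q(2) by (metis pfst_psnd(1,2))
  ultimately show ?case by (auto intro!: exI[of _ "\<lambda>z. Q (prod_encode (pfst (pfst z), prod_encode (psnd (pfst z), psnd z)))"])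
qed

lemma arith_Sigma_4_decid:
  assumes "arith_Sigma 4 B"
  obtains R where "decid R" "\<And>n. n \<in> B \<longleftrightarrow> (\<exists>a. \<forall>b. \<exists>c. \<forall>d. R (prod_encode (d, prod_encode (c, prod_encode (b, prod_encode (a, n))))))"
proof -
  obtain \<phi> where \<phi>: "Sigma_fm 4 \<phi>" "\<And>n v. n \<in> B \<longleftrightarrow> fm_true (case_nat n v) \<phi>" using assms unfolding arith_Sigma_def by blast
  have "sigma_rel 4 (\<lambda>n. fm_true (valuation (prod_encode (n, 0))) \<phi>)"
    by (rule sigma_rel_comp[OF fm_sigma_rel(1)[OF \<phi>(1)]]) (intro computable_intros)
  then have "sigma_rel 4 (\<lambda>n. n \<in> B)" unfolding valuation_pair \<phi>(2)[symmetric] .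
  then have "sigma_rel (Suc (Suc (Suc (Suc 0)))) (\<lambda>n. n \<in> B)" by (simp add: eval_nat_numeral)
  then obtain Q1 where Q1: "sigma_rel (Suc (Suc (Suc 0))) (\<lambda>x. \<not> Q1 x)" "\<And>n. n \<in> B \<longleftrightarrow> (\<exists>a. Q1 (prod_encode (a, n)))"
    unfolding sigma_rel.simps(2)[of "Suc (Suc (Suc 0))"] by blast
  then obtain Q2 where Q2: "sigma_rel (Suc (Suc 0)) (\<lambda>x. \<not> Q2 x)" "\<And>n. (\<not> Q1 n) \<longleftrightarrow> (\<exists>a. Q2 (prod_encode (a, n)))"
    unfolding sigma_rel.simps(2)[of "Suc (Suc 0)"] by blast
  then obtain Q3 where Q3: "sigma_rel (Suc 0) (\<lambda>x. \<not> Q3 x)" "\<And>n. (\<not> Q2 n) \<longleftrightarrow> (\<exists>a. Q3 (prod_encode (a, n)))"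
    unfolding sigma_rel.simps(2)[of "Suc 0"] by blast
  then obtain Q4 where Q4: "sigma_rel 0 (\<lambda>x. \<not> Q4 x)" "\<And>n. (\<not> Q3 n) \<longleftrightarrow> (\<exists>a. Q4 (prod_encode (a, n)))"
    unfolding sigma_rel.simps(2)[of 0] by blast
  have "decid (\<lambda>x. \<not> Q4 x)" using Q4(1) by simp
  moreover have "n \<in> B \<longleftrightarrow> (\<exists>a. \<forall>b. \<exists>c. \<forall>d. \<not> Q4 (prod_encode (d, prod_encode (c, prod_encode (b, prod_encode (a, n))))))" for n
    using Q1(2) Q2(2) Q3(2) Q4(2) by metis
  ultimately show ?thesis by (rule that)
qed

section \<open>Effectivity of the construction\<close>

text \<open>The tent at \<open>z / B\<close> in units of \<open>1 / B\<close>. Truncated subtraction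
  yields the absolute value, as the sum of both differences, and also the cut-off at 0.\<close>

definition tent_nat :: "nat \<Rightarrow> nat \<Rightarrow> nat \<Rightarrow> nat \<Rightarrow> nat" where
  "tent_nat d a z B = B - ((d * z - a * B) + (a * B - d * z))"

definition tent_sum :: "nat \<Rightarrow> nat \<Rightarrow> nat \<Rightarrow> nat \<Rightarrow> nat \<Rightarrow> nat \<Rightarrow> nat \<Rightarrow> nat" where
  "tent_sum r d a A N y B = (\<Sum>i<N - A. tent_nat d a ((r ^ (A + i) * y) mod B) B)"

text \<open>The bound \<open>N / K\<close> on the tent deviation at \<open>y / B\<close>, multiplied
  through by \<open>d * B * K\<close>.\<close>

definition dev_le :: "nat \<Rightarrow> nat \<Rightarrow> nat \<Rightarrow> nat \<Rightarrow> nat \<Rightarrow> nat \<Rightarrow> nat \<Rightarrow> nat \<Rightarrow> bool" where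
  "dev_le r d a A N y B K \<longleftrightarrow>
     ((d * tent_sum r d a A N y B - (N - A) * B) + ((N - A) * B - d * tent_sum r d a A N y B)) * K \<le> d * B * N"

lemma real_abs_diff_nat: "real ((m - n) + (n - m)) = \<bar>real m - real n\<bar>"
  by (cases "m \<le> n") (auto simp: of_nat_diff)

lemma frac_nat_divide: "0 < B \<Longrightarrow> frac (real y / real B) = real (y mod B) / real B"
proof -
  assume B: "0 < B"
  have "real y = real B * real (y div B) + real (y mod B)" by (metis mult_div_mod_eq of_nat_add of_nat_mult)
  then have "real y / real B = of_int (int (y div B)) + real (y mod B) / real B" using B by (simp add: field_simps)
  then have "frac (real y / real B) = frac (real (y mod B) / real B)" by (simp only: frac_of_int_add)
  moreover have "real (y mod B) < real B" using B by simp
  then have "frac (real (y mod B) / real B) = real (y mod B) / real B" using B by (intro frac_eq[THEN iffD2]) auto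
  ultimately show ?thesis by simp
qed

lemma tent_nat_real:
  assumes B: "0 < B" shows "tent d a (real y / real B) = real (tent_nat d a (y mod B) B) / real B"
proof -
  define z where "z = y mod B"
  define D where "D = (d * z - a * B) + (a * B - d * z)"
  have D: "real D = \<bar>real d * real z - real a * real B\<bar>" unfolding D_def real_abs_diff_nat by simp
  have "1 - \<bar>real d * (real z / real B) - real a\<bar> = (real B - real D) / real B"
  proof -
    have "real d * (real z / real B) - real a = (real d * real z - real a * real B) / real B" using B by (simp add: field_simps)
    then have "\<bar>real d * (real z / real B) - real a\<bar> = real D / real B" unfolding D using B by (simp add: abs_divide)
    then show ?thesis using B by (simp add: diff_divide_distrib)
  qed
  moreover have "real (tent_nat d a z B) = max 0 (real B - real D)"
    unfolding tent_nat_def D_def[symmetric] by (cases "D \<le> B") (auto simp: of_nat_diff)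
  moreover have "max 0 ((real B - real D) / real B) = max 0 (real B - real D) / real B"
  proof (cases "0 \<le> real B - real D")
    case False
    then have "(real B - real D) / real B < 0" using B by (intro divide_neg_pos) auto
    then show ?thesis using False by simp
  qed simp
  ultimately show ?thesis unfolding tent_def frac_nat_divide[OF B] z_def[symmetric] by simp
qed

lemma tent_dev_nat:
  assumes B: "0 < B"
  shows "tent_dev r d a A N (real y / real B) = real (tent_sum r d a A N y B) / real B - real (N - A) / real d"
proof -
  have t: "tent d a (real r ^ j * (real y / real B)) = real (tent_nat d a ((r ^ j * y) mod B) B) / real B" for j
    using tent_nat_real[OF B, of d a "r ^ j * y"] by simp
  have "(\<Sum>j\<in>{A..<N}. real (tent_nat d a ((r ^ j * y) mod B) B)) = real (tent_sum r d a A N y B)"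
  proof (cases "A \<le> N")
    case True
    then show ?thesis
      using sum.shift_bounds_nat_ivl[of "\<lambda>j. real (tent_nat d a ((r ^ j * y) mod B) B)" 0 A "N - A"]
      by (simp add: tent_sum_def atLeast0LessThan add.commute)
  qed (simp add: tent_sum_def)
  then show ?thesis unfolding tent_dev_def sum_subtractf t by (simp add: sum_divide_distrib[symmetric])
qed

lemma dev_le_iff:
  assumes "0 < d" "0 < K" "0 < B"
  shows "\<bar>tent_dev r d a A N (real y / real B)\<bar> \<le> real N / real K \<longleftrightarrow> dev_le r d a A N y B K"
proof -
  define X where "X = d * tent_sum r d a A N y B"
  define Y where "Y = (N - A) * B"
  have "tent_dev r d a A N (real y / real B) = (real X - real Y) / (real d * real B)"
    unfolding tent_dev_nat[OF assms(3)] X_def Y_def using assms by (simp add: field_simps)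
  then have "\<bar>tent_dev r d a A N (real y / real B)\<bar> = real ((X - Y) + (Y - X)) / (real d * real B)"
    unfolding real_abs_diff_nat using assms by (simp add: abs_divide)
  moreover have "Z / c \<le> real N / real K \<longleftrightarrow> Z * real K \<le> c * real N" if "0 < c" for Z c :: real
    using that assms(2) by (simp add: pos_divide_le_eq pos_le_divide_eq mult.commute)
  moreover have "0 < real d * real B" using assms by simp
  ultimately have "\<bar>tent_dev r d a A N (real y / real B)\<bar> \<le> real N / real K \<longleftrightarrow> real ((X - Y) + (Y - X)) * real K \<le> real d * real B * real N"
    by (simp only:)
  also have "\<dots> \<longleftrightarrow> real (((X - Y) + (Y - X)) * K) \<le> real (d * B * N)" by (simp only: of_nat_mult)
  also have "\<dots> \<longleftrightarrow> dev_le r d a A N y B K" unfolding dev_le_def X_def Y_def by (simp only: of_nat_le_iff)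
  finally show ?thesis .
qed

lemma spread_nat:
  "spread r K M p \<longleftrightarrow> (\<forall>d\<le>K. \<forall>a<d. 1 \<le> a \<longrightarrow> (\<forall>N\<le>expo r (2 * M). dev_le r d a (expo r M) N p (2 ^ (2 * M)) K))"
proof -
  have "\<bar>tent_dev r d a (expo r M) N (real p / 2 ^ (2 * M))\<bar> \<le> real N / real K \<longleftrightarrow> dev_le r d a (expo r M) N p (2 ^ (2 * M)) K"
    if "1 \<le> a" "a < d" "d \<le> K" for d a N
    using dev_le_iff[of d K "2 ^ (2 * M)" r a "expo r M" N p] that by simp
  then show ?thesis unfolding spread_def by auto
qed

lemma biased_nat:
  assumes s: "2 \<le> s"
  shows "biased s m M p \<longleftrightarrow> (4 * bias_denom m + s) * (expo s (2 * M) - expo s M) \<le>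
     4 * bias_denom m * s * (\<Sum>i<expo s (2 * M) - expo s M. of_bool (((s ^ (expo s M + i) * p) mod 2 ^ (2 * M)) * (8 * bias_denom m * s) < (8 * bias_denom m + s) * 2 ^ (2 * M)))"
proof -
  define q where "q = bias_denom m"
  have q: "0 < q" by (simp add: q_def bias_denom_def)
  define A where "A = expo s M"
  define B where "B = expo s (2 * M)"
  have AB: "A \<le> B" using expo_double(1)[OF s, of M] by (simp add: A_def B_def)
  define D where "D = (2::nat) ^ (2 * M)"
  have D: "0 < D" by (simp add: D_def)
  have c: "frac (real s ^ j * (real p / 2 ^ (2 * M))) < 1 / real s + 1 / (8 * real q) \<longleftrightarrow>
     ((s ^ j * p) mod D) * (8 * q * s) < (8 * q + s) * D" for j
  proof -
    have "real s ^ j * (real p / 2 ^ (2 * M)) = real (s ^ j * p) / real D" by (simp add: D_def)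
    then have "frac (real s ^ j * (real p / 2 ^ (2 * M))) = real ((s ^ j * p) mod D) / real D" by (simp only: frac_nat_divide[OF D])
    moreover have "real z / real D < 1 / real s + 1 / (8 * real q) \<longleftrightarrow> real (z * (8 * q * s)) < real ((8 * q + s) * D)" for z
      using s q D by (simp add: field_simps)
    ultimately show ?thesis by (simp only: of_nat_less_iff)
  qed
  define S where "S = (\<Sum>i<B - A. of_bool (((s ^ (A + i) * p) mod D) * (8 * q * s) < (8 * q + s) * D) :: nat)"
  have "card {j \<in> {A..<B}. frac (real s ^ j * (real p / 2 ^ (2 * M))) < 1 / real s + 1 / (8 * real q)} = S"
  proof -
    have "card {j \<in> {A..<B}. ((s ^ j * p) mod D) * (8 * q * s) < (8 * q + s) * D} = (\<Sum>j\<in>{A..<B}. of_bool (((s ^ j * p) mod D) * (8 * q * s) < (8 * q + s) * D))"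
    proof -
      have "{j \<in> {A..<B}. ((s ^ j * p) mod D) * (8 * q * s) < (8 * q + s) * D} = {A..<B} \<inter> {j. ((s ^ j * p) mod D) * (8 * q * s) < (8 * q + s) * D}"
        by auto
      then show ?thesis by simp
    qed
    also have "\<dots> = S" unfolding S_def
      using AB sum.shift_bounds_nat_ivl[of "\<lambda>j. of_bool (((s ^ j * p) mod D) * (8 * q * s) < (8 * q + s) * D) :: nat" 0 A "B - A"]
      by (simp add: atLeast0LessThan add.commute del: sum_of_bool_eq)
    finally show ?thesis unfolding c .
  qed
  then have "biased s m M p \<longleftrightarrow> (1 / real s + 1 / (4 * real q)) * (real B - real A) \<le> real S"
    unfolding biased_def q_def[symmetric] A_def[symmetric] B_def[symmetric] by simp
  also have "(1 / real s + 1 / (4 * real q)) * (real B - real A) = real ((4 * q + s) * (B - A)) / real (4 * q * s)"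
    using s q AB by (simp add: field_simps of_nat_diff)
  also have "\<dots> \<le> real S \<longleftrightarrow> real ((4 * q + s) * (B - A)) \<le> real (4 * q * s * S)"
    using s q by (simp add: divide_le_eq mult.commute)
  also have "\<dots> \<longleftrightarrow> (4 * q + s) * (B - A) \<le> 4 * q * s * S" by (simp only: of_nat_le_iff)
  finally show ?thesis unfolding S_def q_def A_def B_def D_def .
qed

section \<open>Decidability of the stage conditions\<close>

lemma card_less_eq_sum:
  fixes M :: nat shows "card {i. i < M \<and> P i} = (\<Sum>i<M. of_bool (P i))"
proof -
  have "{i. i < M \<and> P i} = {..<M} \<inter> {i. P i}" by auto
  then show ?thesis by simp
qed

lemma computable_expo:
  assumes f: "computable f" and g: "computable g" shows "computable (\<lambda>x. expo (f x) (g x))"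
proof -
  have e: "expo r M = (\<Sum>i<M. of_bool (r ^ Suc i \<le> 2 ^ M))" for r M
    unfolding expo_def by (rule card_less_eq_sum)
  show ?thesis unfolding e
    by (intro computable_intros computable_comp[OF f] computable_comp[OF g])
qed

lemma decid_dev_le:
  assumes "computable r" "computable d" "computable a" "computable A" "computable N" "computable y" "computable B" "computable K"
  shows "decid (\<lambda>x. dev_le (r x) (d x) (a x) (A x) (N x) (y x) (B x) (K x))"
  unfolding dev_le_def tent_sum_def tent_nat_def
  by (intro computable_intros assms[THEN computable_comp])

lemma decid_spread:
  assumes "computable r" "computable K" "computable M" "computable p"
  shows "decid (\<lambda>x. spread (r x) (K x) (M x) (p x))"
  unfolding spread_nat
  by (intro computable_intros decid_dev_le computable_expo assms[THEN computable_comp])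

lemma decid_valid_base: "computable f \<Longrightarrow> decid (\<lambda>x. valid_base (f x))"
  unfolding valid_base_def
  by (intro computable_intros decid_prime) (rule computable_comp, assumption, intro computable_intros)+

lemma decid_task_ok:
  assumes s2: "\<And>x. 2 \<le> s x" and c: "computable s" "computable m" "computable k" "computable M" "computable p"
  shows "decid (\<lambda>x. task_ok (s x) (m x) (k x) (M x) (p x))"
  unfolding task_ok_def biased_nat[OF s2] bias_denom_def
  by (intro computable_intros decid_prime decid_spread computable_expo c[THEN computable_comp])

lemma computable_prime_index: "computable f \<Longrightarrow> computable (\<lambda>x. prime_index (f x))"
proof -
  assume f: "computable f"
  have e: "prime_index s = (\<Sum>q<s. of_bool (prime q))" for s
    unfolding prime_index_def by (rule card_less_eq_sum)
  show ?thesis unfolding e by (intro computable_intros decid_prime f)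
qed

lemma decid_safe_child:
  assumes "computable k" "computable n" "computable p0" "computable p"
  shows "decid (\<lambda>x. safe_child (k x) (n x) (p0 x) (p x))"
  unfolding safe_child_def child_def
  by (intro computable_intros decid_prime decid_spread assms[THEN computable_comp])

lemma child_less: "child n p0 p \<Longrightarrow> p < (p0 + 1) * 2 ^ 2 ^ n"
  by (simp add: child_def)

lemma computable_safe_level:
  assumes "computable n" "computable p0" shows "computable (\<lambda>x. safe_level (n x) (p0 x))"
proof -
  have e: "(\<exists>p. safe_child k n p0 p) \<longleftrightarrow> (\<exists>p<(p0 + 1) * 2 ^ 2 ^ n. safe_child k n p0 p)" for k n p0
    using child_less unfolding safe_child_def by blast
  show ?thesis unfolding safe_level_def
  proof (intro computable_diff computable_Least assms)
    show "decid (\<lambda>z. \<exists>p. safe_child (n (pfst z) - psnd z) (n (pfst z)) (p0 (pfst z)) p)"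
      unfolding e by (intro computable_intros decid_safe_child assms[THEN computable_comp])
    show "\<exists>i p. safe_child (n x - i) (n x) (p0 x) p" for x using ex_safe_child by blast
  qed
qed

lemma task_base_pfst: "task_base t = (if valid_base (pfst t) then pfst t else 6)"
  by (simp add: task_base_def pfst_def)

lemma task_level_pfst: "task_level f t = (if prime (pfst t) then f (prime_index (pfst t)) (psnd t) else 0)"
  by (simp add: task_level_def pfst_def psnd_def)

lemma decid_task_child:
  assumes G: "computable (\<lambda>z. G (pfst z) (pfst (psnd z)) (psnd (psnd z)))"
    and c: "computable x" "computable t" "computable n" "computable p0" "computable p"
  shows "decid (\<lambda>z. task_child (G (x z)) (t z) (n z) (p0 z) (p z))"
proof -
  have G': "computable (\<lambda>z. G (f z) (i z) (u z))" if "computable f" "computable i" "computable u" for f i u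
    using computable_comp[OF G computable_pair[OF that(1) computable_pair[OF that(2,3)]]] by simp
  have "computable (\<lambda>z. task_level (G (x z)) (t z))"
    unfolding task_level_pfst by (intro computable_intros decid_prime G' computable_prime_index c)
  moreover have "computable (\<lambda>z. task_base (t z))"
    unfolding task_base_pfst by (intro computable_intros decid_valid_base c)
  ultimately show ?thesis unfolding task_child_def child_def
    by (intro computable_intros decid_task_ok task_base c)
qed

text \<open>\<open>computable_Least\<close> asks for a witness at every argument. The artificial
  witness \<open>b\<close> keeps the search total and, above all true ones, leaves the result
  unchanged.\<close>

lemma Least_bounded:
  fixes b :: nat
  assumes "\<exists>p. P p" "\<And>p. P p \<Longrightarrow> p < b" shows "(LEAST p. P p \<or> p = b) = (LEAST p. P p)"
proof (rule Least_equality)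
  show "P (LEAST p. P p) \<or> (LEAST p. P p) = b" using LeastI_ex[OF assms(1)] by simp
  show "(LEAST p. P p) \<le> y" if "P y \<or> y = b" for y
    using that Least_le[of P] assms(2)[OF LeastI_ex[OF assms(1)]] by auto
qed

lemma computable_state:
  assumes G: "computable (\<lambda>z. G (pfst z) (pfst (psnd z)) (psnd (psnd z)))"
  shows "computable (\<lambda>z. prod_encode (state (G (pfst z)) (psnd z)))"
proof -
  \<comment> \<open>All children lie below this bound, so the existence of a suitable child is a
    bounded search.\<close>
  define bd where "bd n p0 = (p0 + 1) * 2 ^ 2 ^ n" for n p0 :: nat
  define st where "st x n y = (if \<exists>p<bd n (psnd y). task_child (G x) (pfst y) n (psnd y) p
      then prod_encode (Suc (pfst y), LEAST p. task_child (G x) (pfst y) n (psnd y) p \<or> p = bd n (psnd y))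
      else prod_encode (pfst y, LEAST p. safe_child (safe_level n (psnd y)) n (psnd y) p))" for x n y
  have st: "prod_encode (step (G x) n (prod_decode y)) = st x n y" for x n y
  proof -
    have y: "prod_decode y = (pfst y, psnd y)" by (simp add: pfst_def psnd_def)
    have b: "p < bd n (psnd y)" if "task_child (G x) (pfst y) n (psnd y) p" for p
      using that child_less unfolding task_child_def bd_def by blast
    then have ex: "(\<exists>p<bd n (psnd y). task_child (G x) (pfst y) n (psnd y) p) \<longleftrightarrow> (\<exists>p. task_child (G x) (pfst y) n (psnd y) p)" by blast
    show ?thesis
    proof (cases "\<exists>p. task_child (G x) (pfst y) n (psnd y) p")
      case True
      then show ?thesis unfolding st_def step_def y ex by (simp add: Least_bounded[OF True b])
    next
      case False
      show ?thesis unfolding st_def step_def y ex prod.case if_not_P[OF False] by simp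
    qed
  qed
  have sl: "\<exists>p. safe_child (safe_level n p0) n p0 p" for n p0 by (rule safe_level)
  have rec: "prod_encode (state (G x) n) = rec_nat (prod_encode (0, 0)) (\<lambda>k y. st x k y) n" for x n
  proof (induction n)
    case (Suc n)
    have "prod_encode (state (G x) (Suc n)) = st x n (prod_encode (state (G x) n))" by (simp add: st[symmetric])
    then show ?case using Suc by simp
  qed simp
  have "computable (\<lambda>z. st (pfst z) (pfst (psnd z)) (psnd (psnd z)))"
    unfolding st_def bd_def
  proof (intro computable_if computable_pair decid_ex_less computable_Least)
    show "\<exists>i. task_child (G (pfst x)) (pfst (psnd (psnd x))) (pfst (psnd x)) (psnd (psnd (psnd x))) i \<or> i = (psnd (psnd (psnd x)) + 1) * 2 ^ 2 ^ pfst (psnd x)" for x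
      by blast
    show "\<exists>i. safe_child (safe_level (pfst (psnd x)) (psnd (psnd (psnd x)))) (pfst (psnd x)) (psnd (psnd (psnd x))) i" for x
      by (rule safe_level)
  qed (intro computable_intros decid_task_child[OF G] decid_safe_child computable_safe_level)+
  then have "computable (\<lambda>z. rec_nat (prod_encode (0, 0)) (\<lambda>k y. st (pfst z) k y) (psnd z))"
    by (intro computable_rec computable_intros) (rule computable_comp[of "\<lambda>z. st (pfst z) (pfst (psnd z)) (psnd (psnd z))" "\<lambda>z. prod_encode (pfst (pfst z), psnd z)", simplified], assumption, intro computable_intros)
  then show ?thesis unfolding rec .
qed

text \<open>The code \<open>2 * k\<close> stands for the nonnegative integer \<open>k\<close> in the
  integer coding that underlies \<open>nat_to_rat_surj\<close>.\<close>

lemma nat_to_rat_dyadic: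
  assumes "0 < b" shows "of_rat (nat_to_rat_surj (prod_encode (2 * p, 2 * b))) = real p / real b"
proof -
  have i: "int_decode (2 * k) = int k" for k by (simp add: int_decode_def sum_decode_def)
  show ?thesis using assms by (simp add: nat_to_rat_surj_def i of_rat_rat)
qed

text \<open>Makes the real quantified in the index set the limit point itself, so that membership of
  an index is decided by the normality of that point.\<close>

lemma computable_real_index_unique:
  assumes "computable_real_index e \<xi>" "computable_real_index e \<xi>'" shows "\<xi> = \<xi>'"
proof (rule ccontr)
  assume "\<xi> \<noteq> \<xi>'"
  then obtain n where n: "(1/2::real) ^ n < \<bar>\<xi> - \<xi>'\<bar> / 2" using real_arch_pow_inv[of "\<bar>\<xi> - \<xi>'\<bar> / 2" "1/2"] by auto
  obtain c where c: "phi e n = Some c" "\<bar>of_rat (nat_to_rat_surj c) - \<xi>\<bar> \<le> 1 / 2 ^ n"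
    using assms(1) unfolding computable_real_index_def by blast
  moreover obtain c' where c': "phi e n = Some c'" "\<bar>of_rat (nat_to_rat_surj c') - \<xi>'\<bar> \<le> 1 / 2 ^ n"
    using assms(2) unfolding computable_real_index_def by blast
  ultimately have "\<bar>of_rat (nat_to_rat_surj c) - \<xi>'\<bar> \<le> 1 / 2 ^ n" by simp
  then show False using c(2) n by (simp add: power_one_over)
qed

theorem arith_hard_normal:
  assumes "arith_Sigma 4 B"
  shows "\<exists>f. computable f \<and> (\<forall>n. n \<in> B \<longleftrightarrow> f n \<in> {e. \<exists>\<xi>. computable_real_index e \<xi> \<and> normal_to_some_base \<xi>})"
proof -
  obtain R where R: "decid R" "\<And>n. n \<in> B \<longleftrightarrow> (\<exists>a. \<forall>b. \<exists>c. \<forall>d. R (prod_encode (d, prod_encode (c, prod_encode (b, prod_encode (a, n))))))"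
    using assms by (rule arith_Sigma_4_decid) (rule that)
  define Q where "Q n a b c d = R (prod_encode (d, prod_encode (c, prod_encode (b, prod_encode (a, n)))))" for n a b c d
  define G where "G n a = revision_seq (Q n a)" for n a
  have Q: "decid (\<lambda>z. Q (n z) (a z) (b z) (c z) (d z))" if "computable n" "computable a" "computable b" "computable c" "computable d" for n a b c d
    unfolding Q_def by (intro decid_comp[OF R(1)] computable_intros that)
  have cand: "computable (\<lambda>z. candidate (Q (n z) (a z) (b z)) (u z))" if "computable n" "computable a" "computable b" "computable u" for n a b u
    unfolding candidate_def
  proof (rule computable_Least)
    show "decid (\<lambda>z. psnd z = u (pfst z) \<or> (\<forall>d<u (pfst z). Q (n (pfst z)) (a (pfst z)) (b (pfst z)) (psnd z) d))"
      by (intro computable_intros Q that[THEN computable_comp])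
  qed blast
  have "computable (\<lambda>z. G (pfst z) (pfst (psnd z)) (psnd (psnd z)))"
    unfolding G_def revision_seq_def pfst_def[symmetric] psnd_def[symmetric] by (intro computable_intros cand)
  from computable_state[OF this] have st: "computable (\<lambda>z. prod_encode (state (G (pfst z)) (psnd z)))" .
  define h where "h z = prod_encode (2 * psnd (prod_encode (state (G (pfst z)) (psnd z))), 2 * 2 ^ 2 ^ psnd z)" for z
  have "computable h" unfolding h_def by (intro computable_intros st)
  then obtain idx where idx: "computable idx" "\<And>x n. phi (idx x) n = Some (h (prod_encode (x, n)))" by (rule smn) blast
  have cr: "computable_real_index (idx x) (limit_point (G x))" for x
    unfolding computable_real_index_def
  proof
    fix n
    have "psnd (prod_encode (state (G x) n)) = pos (G x) n" by (simp add: psnd_def pos_def)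
    then have "of_rat (nat_to_rat_surj (h (prod_encode (x, n)))) = approx (G x) n"
      unfolding h_def pfst_psnd by (subst nat_to_rat_dyadic) (simp_all add: approx_def)
    moreover have "1 / (2::real) ^ 2 ^ n \<le> 1 / 2 ^ n"
      by (intro divide_left_mono power_increasing less_imp_le less_exp) auto
    then have "\<bar>approx (G x) n - limit_point (G x)\<bar> \<le> 1 / 2 ^ n"
      using limit_point_bounds[of "G x" n] by simp
    ultimately show "\<exists>c. phi (idx x) n = Some c \<and> \<bar>of_rat (nat_to_rat_surj c) - limit_point (G x)\<bar> \<le> 1 / 2 ^ n"
      unfolding idx(2) by simp
  qed
  have "n \<in> B \<longleftrightarrow> normal_to_some_base (limit_point (G n))" for n
    unfolding R(2) normal_limit_point_iff G_def diverges_revision_seq Q_def ..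
  then have "n \<in> B \<longleftrightarrow> idx n \<in> {e. \<exists>\<xi>. computable_real_index e \<xi> \<and> normal_to_some_base \<xi>}" for n
    using cr[of n] computable_real_index_unique by blast
  then show ?thesis using idx(1) by blast
qed

section \<open>Arithmetical definability of computations\<close>

text \<open>A closed set of triples certifies computations: by structural induction on the program, closedness
  alone makes every member true, although no well-foundedness of the justifications is recorded.\<close>

definition justified :: "nat \<Rightarrow> (nat \<Rightarrow> nat \<Rightarrow> nat \<Rightarrow> bool) \<Rightarrow> nat \<Rightarrow> nat \<Rightarrow> nat \<Rightarrow> bool" where
  "justified M D e x y \<longleftrightarrow>
     e = 0 \<and> y = 0 \<or> e = 1 \<and> y = Suc x
   \<or> e = 2 \<and> (\<exists>v\<le>M. x = prod_encode (y, v)) \<or> e = 3 \<and> (\<exists>v\<le>M. x = prod_encode (v, y))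
   \<or> (\<exists>k\<le>M. \<exists>f\<le>M. \<exists>g\<le>M. k = prod_encode (f, g) \<and>
        (e = 4 * k + 4 \<and> (\<exists>u\<le>M. \<exists>v\<le>M. D f x u \<and> D g x v \<and> y = prod_encode (u, v))
       \<or> e = 4 * k + 5 \<and> (\<exists>u\<le>M. D g x u \<and> D f u y)
       \<or> e = 4 * k + 6 \<and> (\<exists>a\<le>M. x = prod_encode (a, 0) \<and> D f a y)
       \<or> e = 4 * k + 6 \<and> (\<exists>a\<le>M. \<exists>n\<le>M. \<exists>u\<le>M. \<exists>x'\<le>M. \<exists>s\<le>M. \<exists>t\<le>M. x = prod_encode (a, Suc n) \<and>
           x' = prod_encode (a, n) \<and> D e x' u \<and> s = prod_encode (n, u) \<and> t = prod_encode (a, s) \<and> D g t y)))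
   \<or> (\<exists>f\<le>M. e = 4 * f + 7 \<and> (\<exists>z\<le>M. z = prod_encode (x, y) \<and> D f z 0) \<and>
        (\<forall>m\<le>y. m < y \<longrightarrow> (\<exists>z\<le>M. \<exists>v\<le>M. z = prod_encode (x, m) \<and> D f z (Suc v))))"

lemma justified_mono:
  assumes "justified M D e x y" "M \<le> M'" "\<And>e x y. D e x y \<Longrightarrow> D' e x y"
  shows "justified M' D' e x y"
proof -
  have D: "D e x y \<longrightarrow> D' e x y" and M: "i \<le> M \<longrightarrow> i \<le> M'" for e x y i using assms(2,3) by auto
  show ?thesis
    by (insert assms(1), unfold justified_def, elim disj_forward conj_forward ex_forward all_forward imp_forward; (assumption | erule D[rule_format] | erule M[rule_format]))
qed

definition closed_cert :: "nat \<Rightarrow> (nat \<Rightarrow> nat \<Rightarrow> nat \<Rightarrow> bool) \<Rightarrow> bool" where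
  "closed_cert M D \<longleftrightarrow> (\<forall>e x y. D e x y \<longrightarrow> justified M D e x y)"

lemma mod4_clash:
  "4 * (k::nat) + 4 = 4 * l + 5 \<Longrightarrow> P" "4 * k + 4 = 4 * l + 6 \<Longrightarrow> P" "4 * k + 4 = 4 * l + 7 \<Longrightarrow> P"
  "4 * k + 5 = 4 * l + 4 \<Longrightarrow> P" "4 * k + 5 = 4 * l + 6 \<Longrightarrow> P" "4 * k + 5 = 4 * l + 7 \<Longrightarrow> P"
  "4 * k + 6 = 4 * l + 4 \<Longrightarrow> P" "4 * k + 6 = 4 * l + 5 \<Longrightarrow> P" "4 * k + 6 = 4 * l + 7 \<Longrightarrow> P"
  "4 * k + 7 = 4 * l + 4 \<Longrightarrow> P" "4 * k + 7 = 4 * l + 5 \<Longrightarrow> P" "4 * k + 7 = 4 * l + 6 \<Longrightarrow> P"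
  by presburger+

lemma justified_pairD:
  assumes "justified M D (4 * k + 4) x y"
  shows "\<exists>f g u v. k = prod_encode (f, g) \<and> D f x u \<and> D g x v \<and> y = prod_encode (u, v)"
  by (insert assms, unfold justified_def, elim disjE exE conjE; (erule mod4_clash | (rule FalseE, linarith))?) (auto simp: prod_encode_eq)

lemma justified_compD:
  assumes "justified M D (4 * k + 5) x y"
  shows "\<exists>f g u. k = prod_encode (f, g) \<and> D g x u \<and> D f u y"
  by (insert assms, unfold justified_def, elim disjE exE conjE; (erule mod4_clash | (rule FalseE, linarith))?) (simp, blast)

lemma justified_prim_zeroD:
  assumes "justified M D (4 * k + 6) (prod_encode (a, 0)) y"
  shows "\<exists>f g. k = prod_encode (f, g) \<and> D f a y"
  by (insert assms, unfold justified_def, elim disjE exE conjE; (erule mod4_clash | (rule FalseE, linarith))?) (auto simp: prod_encode_eq)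

lemma justified_prim_SucD:
  assumes "justified M D (4 * k + 6) (prod_encode (a, Suc n)) y"
  shows "\<exists>f g u. k = prod_encode (f, g) \<and> D (4 * k + 6) (prod_encode (a, n)) u \<and> D g (prod_encode (a, prod_encode (n, u))) y"
  by (insert assms, unfold justified_def, elim disjE exE conjE; (erule mod4_clash | (rule FalseE, linarith))?) (simp_all add: prod_encode_eq, blast)

lemma justified_minD:
  assumes "justified M D (4 * f + 7) x y"
  shows "D f (prod_encode (x, y)) 0 \<and> (\<forall>m<y. \<exists>v. D f (prod_encode (x, m)) (Suc v))"
  by (insert assms, unfold justified_def, elim disjE exE conjE; (erule mod4_clash | (rule FalseE, linarith))?) (simp, metis less_imp_le)

lemma closed_cert_sound:
  assumes cl: "closed_cert M D"
  shows "D (recf_num F) x y \<Longrightarrow> recf_eval F x = Some y"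
proof (induction F arbitrary: x y)
  case RZero
  have "justified M D 0 x y" using RZero cl by (simp add: closed_cert_def)
  then show ?case by (auto simp: justified_def)
next
  case RSucc
  have "justified M D 1 x y" using RSucc cl by (simp add: closed_cert_def)
  then show ?case by (auto simp: justified_def)
next
  case RFst
  have "justified M D 2 x y" using RFst cl by (simp add: closed_cert_def)
  then show ?case by (auto simp: justified_def)
next
  case RSnd
  have "justified M D 3 x y" using RSnd cl by (simp add: closed_cert_def)
  then show ?case by (auto simp: justified_def)
next
  case (RPair F G)
  define k where "k = prod_encode (recf_num F, recf_num G)"
  have "justified M D (4 * k + 4) x y" using RPair.prems cl by (simp add: closed_cert_def k_def)
  then obtain f g u v where "k = prod_encode (f, g)" "D f x u" "D g x v" "y = prod_encode (u, v)"
    using justified_pairD by blast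
  then show ?case using RPair.IH by (simp add: k_def prod_encode_eq)
next
  case (RComp F G)
  define k where "k = prod_encode (recf_num F, recf_num G)"
  have "justified M D (4 * k + 5) x y" using RComp.prems cl by (simp add: closed_cert_def k_def)
  then obtain f g u where "k = prod_encode (f, g)" "D g x u" "D f u y"
    using justified_compD by blast
  then show ?case using RComp.IH by (simp add: k_def prod_encode_eq)
next
  case (RPrim F G)
  define k where "k = prod_encode (recf_num F, recf_num G)"
  \<comment> \<open>Primitive recursion is the only clause with a premise about the same program
    number. The recursion argument drops there, so an inner induction on \<open>n\<close> makes up
    for the missing well-foundedness.\<close>
  have main: "D (4 * k + 6) (prod_encode (a, n)) y \<Longrightarrow>
     rec_nat (recf_eval F a) (\<lambda>k r. Option.bind r (\<lambda>y. recf_eval G (prod_encode (a, prod_encode (k, y))))) n = Some y" for a n y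
  proof (induction n arbitrary: y)
    case 0
    have "justified M D (4 * k + 6) (prod_encode (a, 0)) y" using 0 cl by (simp add: closed_cert_def)
    then obtain f g where "k = prod_encode (f, g)" "D f a y"
      using justified_prim_zeroD by blast
    then show ?case using RPrim.IH(1) by (simp add: k_def prod_encode_eq)
  next
    case (Suc n)
    have "justified M D (4 * k + 6) (prod_encode (a, Suc n)) y" using Suc.prems cl by (simp add: closed_cert_def)
    then obtain f g u where "k = prod_encode (f, g)" "D (4 * k + 6) (prod_encode (a, n)) u" "D g (prod_encode (a, prod_encode (n, u))) y"
      using justified_prim_SucD by blast
    then show ?case using RPrim.IH(2) Suc.IH by (simp add: k_def prod_encode_eq)
  qed
  obtain a n where x: "x = prod_encode (a, n)" by (metis prod_decode_inverse surj_pair)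
  show ?case using main[of a n y] RPrim.prems by (simp add: x k_def)
next
  case (RMin F)
  define f where "f = recf_num F"
  have "justified M D (4 * f + 7) x y" using RMin.prems cl by (simp add: closed_cert_def f_def)
  then have j: "D f (prod_encode (x, y)) 0" "\<And>m. m < y \<Longrightarrow> \<exists>v. D f (prod_encode (x, m)) (Suc v)"
    using justified_minD by blast+
  have 0: "recf_eval F (prod_encode (x, y)) = Some 0" using RMin.IH j(1) by (simp add: f_def)
  have m: "\<exists>v. recf_eval F (prod_encode (x, m)) = Some (Suc v)" if "m < y" for m
    using RMin.IH j(2)[OF that] by (auto simp: f_def)
  have "(LEAST n. recf_eval F (prod_encode (x, n)) = Some 0) = y"
  proof (rule Least_equality)
    show "y \<le> z" if "recf_eval F (prod_encode (x, z)) = Some 0" for z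
      using m[of z] that by (cases "z < y") auto
  qed (rule 0)
  moreover have "\<exists>n. recf_eval F (prod_encode (x, n)) = Some 0 \<and> (\<forall>m<n. recf_eval F (prod_encode (x, m)) \<noteq> None)"
    using 0 m by fastforce
  ultimately show ?case by simp
qed

section \<open>Finite certificates and their completeness\<close>

definition derivable :: "nat \<Rightarrow> nat \<Rightarrow> nat \<Rightarrow> bool" where
  "derivable e x y \<longleftrightarrow> (\<exists>M S. finite S \<and> closed_cert M (\<lambda>e x y. (e, x, y) \<in> S) \<and> (e, x, y) \<in> S)"

text \<open>The certificates of the premises are united and the new triple is added. Justification
  is monotone in the set and in the bound, so the union is closed again.\<close>

lemma derivableI:
  assumes S: "finite S" "\<And>e x y. (e, x, y) \<in> S \<Longrightarrow> derivable e x y"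
    and j: "justified M0 (\<lambda>e x y. (e, x, y) \<in> S) e x y"
  shows "derivable e x y"
proof -
  have "\<forall>s\<in>S. \<exists>M T. finite T \<and> closed_cert M (\<lambda>e x y. (e, x, y) \<in> T) \<and> s \<in> T"
    using S(2) unfolding derivable_def by force
  then obtain M T where T: "\<And>s. s \<in> S \<Longrightarrow> finite (T s)" "\<And>s. s \<in> S \<Longrightarrow> closed_cert (M s) (\<lambda>e x y. (e, x, y) \<in> T s)" "\<And>s. s \<in> S \<Longrightarrow> s \<in> T s"
    by metis
  define U where "U = insert (e, x, y) (\<Union>s\<in>S. T s)"
  define M' where "M' = M0 + (\<Sum>s\<in>S. M s)"
  have "closed_cert M' (\<lambda>e x y. (e, x, y) \<in> U)"
    unfolding closed_cert_def
  proof (intro allI impI)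
    fix e' x' y' assume "(e', x', y') \<in> U"
    then consider "(e', x', y') = (e, x, y)" | s where "s \<in> S" "(e', x', y') \<in> T s" unfolding U_def by blast
    then show "justified M' (\<lambda>e x y. (e, x, y) \<in> U) e' x' y'"
    proof cases
      case 1
      have "justified M' (\<lambda>e x y. (e, x, y) \<in> U) e x y"
        using j by (rule justified_mono) (use T(3) in \<open>auto simp: M'_def U_def\<close>)
      then show ?thesis using 1 by simp
    next
      case 2
      then have "justified (M s) (\<lambda>e x y. (e, x, y) \<in> T s) e' x' y'" using T(2) unfolding closed_cert_def by blast
      moreover have "M s \<le> M'" unfolding M'_def using 2(1) S(1) member_le_sum[of s S M] by (simp add: trans_le_add2)
      ultimately show ?thesis by (rule justified_mono) (use 2(1) in \<open>auto simp: U_def\<close>)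
    qed
  qed
  moreover have "finite U" using S(1) T(1) by (simp add: U_def)
  moreover have "(e, x, y) \<in> U" by (simp add: U_def)
  ultimately show ?thesis unfolding derivable_def by blast
qed

lemma justified_prim_SucI:
  assumes "k = prod_encode (f, g)" "x' = prod_encode (a, n)" "s = prod_encode (n, u)" "t = prod_encode (a, s)"
    and "D (4 * k + 6) x' u" "D g t y"
    and "k \<le> M" "f \<le> M" "g \<le> M" "a \<le> M" "n \<le> M" "u \<le> M" "x' \<le> M" "s \<le> M" "t \<le> M"
  shows "justified M D (4 * k + 6) (prod_encode (a, Suc n)) y"
  unfolding justified_def
  by (rule disjI2, rule disjI2, rule disjI2, rule disjI2, rule disjI1, rule exI[of _ k], rule conjI, rule assms,
      rule exI[of _ f], rule conjI, rule assms, rule exI[of _ g], rule conjI, rule assms, rule conjI, rule assms,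
      rule disjI2, rule disjI2, rule disjI2, rule conjI, rule refl,
      rule exI[of _ a], rule conjI, rule assms, rule exI[of _ n], rule conjI, rule assms, rule exI[of _ u], rule conjI, rule assms,
      rule exI[of _ x'], rule conjI, rule assms, rule exI[of _ s], rule conjI, rule assms, rule exI[of _ t], rule conjI, rule assms)
    (intro conjI refl assms)

lemma derivable_complete: "recf_eval F x = Some y \<Longrightarrow> derivable (recf_num F) x y"
proof (induction F arbitrary: x y)
  case RZero
  show ?case by (rule derivableI[where S = "{}" and ?M0.0 = 0]) (use RZero in \<open>auto simp: justified_def\<close>)
next
  case RSucc
  show ?case by (rule derivableI[where S = "{}" and ?M0.0 = 0]) (use RSucc in \<open>auto simp: justified_def\<close>)
next
  case RFst
  obtain u v where x: "x = prod_encode (u, v)" by (metis prod_decode_inverse surj_pair)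
  show ?case by (rule derivableI[where S = "{}" and ?M0.0 = v]) (use RFst in \<open>auto simp: justified_def x\<close>)
next
  case RSnd
  obtain u v where x: "x = prod_encode (u, v)" by (metis prod_decode_inverse surj_pair)
  show ?case by (rule derivableI[where S = "{}" and ?M0.0 = u]) (use RSnd in \<open>auto simp: justified_def x\<close>)
next
  case (RPair F G)
  then obtain u v where uv: "recf_eval F x = Some u" "recf_eval G x = Some v" "y = prod_encode (u, v)"
    by (auto simp: bind_eq_Some_conv)
  define f g where "f = recf_num F" and "g = recf_num G"
  show ?case
  proof (rule derivableI[where S = "{(f, x, u), (g, x, v)}" and ?M0.0 = "prod_encode (f, g) + f + g + u + v"])
    show "derivable e x' y'" if "(e, x', y') \<in> {(f, x, u), (g, x, v)}" for e x' y'
      using that uv RPair.IH by (auto simp: f_def g_def)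
    show "justified (prod_encode (f, g) + f + g + u + v) (\<lambda>e xa y. (e, xa, y) \<in> {(f, x, u), (g, x, v)}) (recf_num (RPair F G)) x y"
      unfolding justified_def
      by (rule disjI2, rule disjI2, rule disjI2, rule disjI2, rule disjI1, rule exI[of _ "prod_encode (f, g)"], rule conjI, simp,
          rule exI[of _ f], rule conjI, simp, rule exI[of _ g], rule conjI, simp, rule conjI, simp, rule disjI1, rule conjI,
          simp add: f_def g_def, rule exI[of _ u], rule conjI, simp, rule exI[of _ v], rule conjI, simp) (simp add: uv(3))
  qed simp
next
  case (RComp F G)
  then obtain u where u: "recf_eval G x = Some u" "recf_eval F u = Some y" by (auto simp: bind_eq_Some_conv)
  define f g where "f = recf_num F" and "g = recf_num G"
  show ?case
  proof (rule derivableI[where S = "{(g, x, u), (f, u, y)}" and ?M0.0 = "prod_encode (f, g) + f + g + u"])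
    show "derivable e x' y'" if "(e, x', y') \<in> {(g, x, u), (f, u, y)}" for e x' y'
      using that u RComp.IH by (auto simp: f_def g_def)
    show "justified (prod_encode (f, g) + f + g + u) (\<lambda>e xa ya. (e, xa, ya) \<in> {(g, x, u), (f, u, y)}) (recf_num (RComp F G)) x y"
      unfolding justified_def
      by (rule disjI2, rule disjI2, rule disjI2, rule disjI2, rule disjI1, rule exI[of _ "prod_encode (f, g)"], rule conjI, simp,
          rule exI[of _ f], rule conjI, simp, rule exI[of _ g], rule conjI, simp, rule conjI, simp, rule disjI2, rule disjI1, rule conjI,
          simp add: f_def g_def, rule exI[of _ u], rule conjI, simp) simp
  qed simp
next
  case (RPrim F G)
  define f g k where "f = recf_num F" and "g = recf_num G" and "k = prod_encode (f, g)"
  have main: "rec_nat (recf_eval F a) (\<lambda>k r. Option.bind r (\<lambda>y. recf_eval G (prod_encode (a, prod_encode (k, y))))) n = Some y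
     \<Longrightarrow> derivable (4 * k + 6) (prod_encode (a, n)) y" for a n y
  proof (induction n arbitrary: y)
    case 0
    show ?case
    proof (rule derivableI[where S = "{(f, a, y)}" and ?M0.0 = "k + f + g + a"])
      show "derivable e x' y'" if "(e, x', y') \<in> {(f, a, y)}" for e x' y'
        using that 0 RPrim.IH(1) by (auto simp: f_def)
      show "justified (k + f + g + a) (\<lambda>e x ya. (e, x, ya) \<in> {(f, a, y)}) (4 * k + 6) (prod_encode (a, 0)) y"
        unfolding justified_def
        by (rule disjI2, rule disjI2, rule disjI2, rule disjI2, rule disjI1, rule exI[of _ k], rule conjI, simp,
          rule exI[of _ f], rule conjI, simp, rule exI[of _ g], rule conjI, simp, rule conjI, simp add: k_def,
          rule disjI2, rule disjI2, rule disjI1, rule conjI, simp, rule exI[of _ a], rule conjI, simp) simp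
    qed simp
  next
    case (Suc n)
    then obtain u where u: "rec_nat (recf_eval F a) (\<lambda>k r. Option.bind r (\<lambda>y. recf_eval G (prod_encode (a, prod_encode (k, y))))) n = Some u"
      "recf_eval G (prod_encode (a, prod_encode (n, u))) = Some y" by (auto simp: bind_eq_Some_conv)
    define x' s t where "x' = prod_encode (a, n)" and "s = prod_encode (n, u)" and "t = prod_encode (a, s)"
    show ?case
    proof (rule derivableI[where S = "{(4 * k + 6, x', u), (g, t, y)}" and ?M0.0 = "k + f + g + a + n + u + x' + s + t"])
      show "derivable e z y'" if "(e, z, y') \<in> {(4 * k + 6, x', u), (g, t, y)}" for e z y'
        using that u Suc.IH RPrim.IH(2) by (auto simp: g_def x'_def t_def s_def)
      show "justified (k + f + g + a + n + u + x' + s + t) (\<lambda>e x ya. (e, x, ya) \<in> {(4 * k + 6, x', u), (g, t, y)}) (4 * k + 6) (prod_encode (a, Suc n)) y"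
        by (rule justified_prim_SucI[where k = k and f = f and g = g and a = a and n = n and u = u and x' = x' and s = s and t = t])
          (simp_all add: k_def x'_def s_def t_def)
    qed simp
  qed
  obtain a n where x: "x = prod_encode (a, n)" by (metis prod_decode_inverse surj_pair)
  show ?case using main[of a n y] RPrim.prems by (simp add: x k_def f_def g_def)
next
  case (RMin F)
  define f where "f = recf_num F"
  from RMin.prems have ex: "\<exists>n. recf_eval F (prod_encode (x, n)) = Some 0 \<and> (\<forall>m<n. recf_eval F (prod_encode (x, m)) \<noteq> None)"
    and y: "y = (LEAST n. recf_eval F (prod_encode (x, n)) = Some 0)" by (auto split: if_splits)
  obtain n where n: "recf_eval F (prod_encode (x, n)) = Some 0" "\<forall>m<n. recf_eval F (prod_encode (x, m)) \<noteq> None" using ex by blast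
  have y0: "recf_eval F (prod_encode (x, y)) = Some 0" unfolding y by (rule LeastI[of _ n]) (rule n(1))
  have yn: "y \<le> n" unfolding y by (rule Least_le) (rule n(1))
  have "\<exists>v. recf_eval F (prod_encode (x, m)) = Some (Suc v)" if "m < y" for m
  proof -
    have "recf_eval F (prod_encode (x, m)) \<noteq> Some 0" using that not_less_Least[of m "\<lambda>n. recf_eval F (prod_encode (x, n)) = Some 0"] by (simp add: y)
    moreover have "m < n" using that yn by simp
    then obtain w where "recf_eval F (prod_encode (x, m)) = Some w" using n(2) by blast
    ultimately show ?thesis by (cases w) auto
  qed
  then obtain V where V: "\<And>m. m < y \<Longrightarrow> recf_eval F (prod_encode (x, m)) = Some (Suc (V m))" by metis
  define S where "S = insert (f, prod_encode (x, y), 0) ((\<lambda>m. (f, prod_encode (x, m), Suc (V m))) ` {..<y})"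
  define M where "M = f + prod_encode (x, y) + (\<Sum>m<y. prod_encode (x, m) + V m)"
  have Mm: "prod_encode (x, m) \<le> M" "V m \<le> M" if "m < y" for m
    using member_le_sum[of m "{..<y}" "\<lambda>m. prod_encode (x, m) + V m"] that by (auto simp: M_def)
  show ?case
  proof (rule derivableI[where S = S and ?M0.0 = M])
    show "derivable e z w" if "(e, z, w) \<in> S" for e z w
      using that y0 V RMin.IH by (auto simp: S_def f_def)
    show "justified M (\<lambda>e x y. (e, x, y) \<in> S) (recf_num (RMin F)) x y"
      unfolding justified_def
    proof (rule disjI2, rule disjI2, rule disjI2, rule disjI2, rule disjI2, rule exI[of _ f], intro conjI allI impI)
      show "\<exists>z\<le>M. z = prod_encode (x, y) \<and> (f, z, 0) \<in> S" by (rule exI[of _ "prod_encode (x, y)"]) (simp add: M_def S_def)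
      show "\<exists>z\<le>M. \<exists>v\<le>M. z = prod_encode (x, m) \<and> (f, z, Suc v) \<in> S" if "m < y" for m
        by (rule exI[of _ "prod_encode (x, m)"], rule conjI, rule Mm[OF that], rule exI[of _ "V m"], rule conjI, rule Mm[OF that])
          (use that in \<open>simp add: S_def\<close>)
    qed (auto simp: f_def M_def)
  qed (simp add: S_def)
qed

lemma derivable_iff: "derivable (recf_num F) x y \<longleftrightarrow> recf_eval F x = Some y"
proof
  assume "derivable (recf_num F) x y"
  then obtain M S where "closed_cert M (\<lambda>e x y. (e, x, y) \<in> S)" "(recf_num F, x, y) \<in> S" unfolding derivable_def by blast
  then show "recf_eval F x = Some y" using closed_cert_sound by blast
qed (rule derivable_complete)

text \<open>Twice the pairing function is a polynomial, hence a term of arithmetic, whereas the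
  pairing function itself involves a division by 2.\<close>

definition dbl_pair :: "nat \<Rightarrow> nat \<Rightarrow> nat" where
  "dbl_pair u v = (u + v) * (u + v + 1) + 2 * u"

lemma dbl_pair_prod_encode: "dbl_pair u v = 2 * prod_encode (u, v)"
proof -
  have "2 * triangle n = n * Suc n" for n by (induction n) simp_all
  from this[of "u + v"] show ?thesis by (simp add: dbl_pair_def prod_encode_def)
qed

definition triple_code :: "nat \<Rightarrow> nat \<Rightarrow> nat \<Rightarrow> nat" where
  "triple_code e x y = dbl_pair e (dbl_pair x y)"

lemma triple_code_eq: "triple_code e x y = triple_code e' x' y' \<longleftrightarrow> e = e' \<and> x = x' \<and> y = y'"
  by (auto simp: triple_code_def dbl_pair_prod_encode prod_encode_eq)

text \<open>Goedel's coding of finite sets: the moduli \<open>1 + (c + 1) b\<close> for \<open>c \<le> C\<close> are pairwise coprime when \<open>b\<close> is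
  divisible by all numbers up to \<open>C\<close>, and \<open>a\<close> is the product of those belonging to the set.\<close>

lemma ex_divisor_code:
  fixes C :: nat
  assumes S: "S \<subseteq> {..C}"
  obtains a b where "\<And>c. c \<le> C \<Longrightarrow> Suc (Suc c * b) dvd a \<longleftrightarrow> c \<in> S"
proof -
  define b where "b = (fact (Suc C) :: nat)"
  define m where "m c = Suc (Suc c * b)" for c
  have cop: "coprime (m i) (m j)" if "i < j" "j \<le> C" for i j
  proof (rule ccontr)
    assume "\<not> coprime (m i) (m j)"
    then obtain p where p: "prime p" "p dvd m i" "p dvd m j"
      using prime_factor_nat[of "gcd (m i) (m j)"] by (auto simp: coprime_iff_gcd_eq_1)
    have "m j - m i = (j - i) * b" unfolding m_def by (simp add: diff_mult_distrib)
    then have "p dvd (j - i) * b" using dvd_diff_nat[OF p(3,2)] by simp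
    moreover have "j - i dvd b" unfolding b_def using that by (intro dvd_fact) auto
    ultimately have "p dvd b" using p(1) prime_dvd_mult_iff dvd_trans by blast
    then have "p dvd Suc i * b" by (rule dvd_mult)
    then have "p dvd 1" using p(2) unfolding m_def by (metis dvd_add_right_iff add.commute plus_1_eq_Suc)
    then show False using p(1) by simp
  qed
  have cop: "coprime (m i) (m j)" if "i \<noteq> j" "i \<le> C" "j \<le> C" for i j
    using cop[of i j] cop[of j i] that by (cases "i < j") (auto simp: coprime_commute)
  define a where "a = (\<Prod>c\<in>S. m c)"
  have fin: "finite S" using S by (rule finite_subset) simp
  have "m c dvd a \<longleftrightarrow> c \<in> S" if c: "c \<le> C" for c
  proof
    assume d: "m c dvd a"
    show "c \<in> S"
    proof (rule ccontr)
      assume n: "c \<notin> S"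
      have "coprime (m c) (m i)" if "i \<in> S" for i
        using cop[of c i] c n S that by blast
      then have "coprime (m c) a" unfolding a_def by (rule prod_coprime_right)
      then have "is_unit (m c)" using d by (metis coprime_absorb_left)
      then show False by (simp add: m_def b_def)
    qed
  next
    assume "c \<in> S"
    then show "m c dvd a" unfolding a_def using fin by (intro dvd_prodI)
  qed
  then show ?thesis using that[of b a] unfolding m_def by blast
qed

definition coded :: "nat \<Rightarrow> nat \<Rightarrow> nat \<Rightarrow> nat \<Rightarrow> nat \<Rightarrow> nat \<Rightarrow> bool" where
  "coded M a b e x y \<longleftrightarrow> triple_code e x y \<le> M \<and> Suc (Suc (triple_code e x y) * b) dvd a"

definition computation :: "nat \<Rightarrow> nat \<Rightarrow> nat \<Rightarrow> nat \<Rightarrow> nat \<Rightarrow> nat \<Rightarrow> bool" where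
  "computation M a b e x y \<longleftrightarrow> coded M a b e x y \<and>
     (\<forall>e\<le>M. \<forall>x\<le>M. \<forall>y\<le>M. coded M a b e x y \<longrightarrow> justified M (coded M a b) e x y)"

text \<open>The components are bounded by the code, so the bounded quantifiers in
  \<open>computation\<close> range over all coded triples.\<close>

lemma coded_le: "coded M a b e x y \<Longrightarrow> e \<le> M \<and> x \<le> M \<and> y \<le> M"
proof -
  have "u \<le> dbl_pair u v" "v \<le> dbl_pair u v" for u v by (auto simp: dbl_pair_def)
  then have "e \<le> triple_code e x y" "x \<le> triple_code e x y" "y \<le> triple_code e x y"
    unfolding triple_code_def using le_trans by blast+
  then show "coded M a b e x y \<Longrightarrow> e \<le> M \<and> x \<le> M \<and> y \<le> M" unfolding coded_def by auto
qed

text \<open>A finite certificate is stored in a divisor code \<open>a\<close>, \<open>b\<close>,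
  with \<open>M\<close> large enough for the codes and for all justifying witnesses. Conversely,
  numbers that code a closed set are sound whatever their origin.\<close>

lemma phi_iff_computation: "phi e x = Some y \<longleftrightarrow> (\<exists>M a b. computation M a b e x y)"
proof -
  obtain F where F: "e = recf_num F" using recf_num_surj by metis
  show ?thesis
  proof
    assume "phi e x = Some y"
    then have "derivable e x y" by (simp add: F derivable_iff)
    then obtain M0 S where S: "finite S" "closed_cert M0 (\<lambda>e x y. (e, x, y) \<in> S)" "(e, x, y) \<in> S"
      unfolding derivable_def by blast
    define T where "T = (\<lambda>(e, x, y). triple_code e x y) ` S"
    have T: "triple_code e x y \<in> T \<longleftrightarrow> (e, x, y) \<in> S" for e x y
      by (force simp: T_def triple_code_eq image_iff)
    have "finite T" using S(1) by (simp add: T_def)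
    define M where "M = M0 + \<Sum>T"
    have TM: "c \<le> M" if "c \<in> T" for c
      using member_le_sum[of c T "\<lambda>c. c"] \<open>finite T\<close> that by (simp add: M_def)
    then have "T \<subseteq> {..M}" by auto
    then obtain a b where ab: "\<And>c. c \<le> M \<Longrightarrow> Suc (Suc c * b) dvd a \<longleftrightarrow> c \<in> T" by (rule ex_divisor_code) (rule that)
    have coded: "coded M a b e x y \<longleftrightarrow> (e, x, y) \<in> S" for e x y
      unfolding coded_def using ab TM T by blast
    have "computation M a b e x y" unfolding computation_def
    proof (intro conjI allI impI)
      show "coded M a b e x y" using S(3) coded by blast
      fix e x y assume "coded M a b e x y"
      then have "justified M0 (\<lambda>e x y. (e, x, y) \<in> S) e x y" using S(2) coded unfolding closed_cert_def by blast
      then show "justified M (coded M a b) e x y"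
        by (rule justified_mono) (simp_all only: coded, simp add: M_def)
    qed
    then show "\<exists>M a b. computation M a b e x y" by blast
  next
    assume "\<exists>M a b. computation M a b e x y"
    then obtain M a b where c: "computation M a b e x y" by blast
    then have "closed_cert M (coded M a b)" unfolding computation_def closed_cert_def using coded_le by blast
    moreover have "coded M a b (recf_num F) x y" using c unfolding computation_def F by blast
    ultimately show "phi e x = Some y" unfolding F phi_recf_num by (rule closed_cert_sound)
  qed
qed

section \<open>Definable functions and relations\<close>

definition tdef :: "((nat \<Rightarrow> nat) \<Rightarrow> nat) \<Rightarrow> bool" where
  "tdef t \<longleftrightarrow> (\<exists>\<tau>. \<forall>v. tm_val v \<tau> = t v)"

definition bdef :: "((nat \<Rightarrow> nat) \<Rightarrow> bool) \<Rightarrow> bool" where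
  "bdef P \<longleftrightarrow> (\<exists>\<phi>. bounded_fm \<phi> \<and> (\<forall>v. fm_true v \<phi> = P v))"

definition sdef :: "nat \<Rightarrow> ((nat \<Rightarrow> nat) \<Rightarrow> bool) \<Rightarrow> bool" where
  "sdef n P \<longleftrightarrow> (\<exists>\<phi>. Sigma_fm n \<phi> \<and> (\<forall>v. fm_true v \<phi> = P v))"

definition pdef :: "nat \<Rightarrow> ((nat \<Rightarrow> nat) \<Rightarrow> bool) \<Rightarrow> bool" where
  "pdef n P \<longleftrightarrow> (\<exists>\<phi>. Pi_fm n \<phi> \<and> (\<forall>v. fm_true v \<phi> = P v))"

lemma tdef_var: "tdef (\<lambda>v. v i)"
  unfolding tdef_def by (rule exI[of _ "TVar i"]) simp

lemma tdef_Suc: assumes "tdef s" shows "tdef (\<lambda>v. Suc (s v))"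
proof -
  obtain \<sigma> where "\<And>v. tm_val v \<sigma> = s v" using assms unfolding tdef_def by blast
  then show ?thesis unfolding tdef_def by (intro exI[of _ "TSucc \<sigma>"]) simp
qed

lemma tdef_const: "tdef (\<lambda>v. n)"
proof (induction n)
  case 0 show ?case unfolding tdef_def by (rule exI[of _ TZero]) simp
qed (rule tdef_Suc)

lemma tdef_add: assumes "tdef s" "tdef t" shows "tdef (\<lambda>v. s v + t v)"
proof -
  obtain \<sigma> \<tau> where "\<And>v. tm_val v \<sigma> = s v" "\<And>v. tm_val v \<tau> = t v" using assms unfolding tdef_def by blast
  then show ?thesis unfolding tdef_def by (intro exI[of _ "TAdd \<sigma> \<tau>"]) simp
qed

lemma tdef_mult: assumes "tdef s" "tdef t" shows "tdef (\<lambda>v. s v * t v)"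
proof -
  obtain \<sigma> \<tau> where "\<And>v. tm_val v \<sigma> = s v" "\<And>v. tm_val v \<tau> = t v" using assms unfolding tdef_def by blast
  then show ?thesis unfolding tdef_def by (intro exI[of _ "TMul \<sigma> \<tau>"]) simp
qed

lemma tdef_shift: assumes "tdef t" shows "tdef (\<lambda>v. t (\<lambda>i. v (Suc i)))"
proof -
  have shift: "tdef (\<lambda>v. tm_val (\<lambda>i. v (Suc i)) \<tau>)" for \<tau>
    by (induction \<tau>) (simp_all add: tdef_var tdef_const tdef_Suc tdef_add tdef_mult)
  obtain \<tau> where \<tau>: "\<And>v. tm_val v \<tau> = t v" using assms unfolding tdef_def by blast
  show ?thesis using shift[of \<tau>] by (simp only: \<tau>)
qed

lemma bdef_eq: assumes "tdef s" "tdef t" shows "bdef (\<lambda>v. s v = t v)"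
proof -
  obtain \<sigma> \<tau> where "\<And>v. tm_val v \<sigma> = s v" "\<And>v. tm_val v \<tau> = t v" using assms unfolding tdef_def by blast
  then show ?thesis unfolding bdef_def by (intro exI[of _ "FEq \<sigma> \<tau>"]) simp
qed

lemma bdef_le: assumes "tdef s" "tdef t" shows "bdef (\<lambda>v. s v \<le> t v)"
proof -
  obtain \<sigma> \<tau> where "\<And>v. tm_val v \<sigma> = s v" "\<And>v. tm_val v \<tau> = t v" using assms unfolding tdef_def by blast
  then show ?thesis unfolding bdef_def by (intro exI[of _ "FLe \<sigma> \<tau>"]) simp
qed

lemma bdef_not: assumes "bdef P" shows "bdef (\<lambda>v. \<not> P v)"
proof -
  obtain \<phi> where "bounded_fm \<phi>" "\<And>v. fm_true v \<phi> = P v" using assms unfolding bdef_def by blast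
  then show ?thesis unfolding bdef_def by (intro exI[of _ "FNot \<phi>"]) simp
qed

lemma bdef_conj: assumes "bdef P" "bdef Q" shows "bdef (\<lambda>v. P v \<and> Q v)"
proof -
  obtain \<phi> \<psi> where "bounded_fm \<phi>" "\<And>v. fm_true v \<phi> = P v" "bounded_fm \<psi>" "\<And>v. fm_true v \<psi> = Q v" using assms unfolding bdef_def by blast
  then show ?thesis unfolding bdef_def by (intro exI[of _ "FAnd \<phi> \<psi>"]) simp
qed

lemma bdef_disj: assumes "bdef P" "bdef Q" shows "bdef (\<lambda>v. P v \<or> Q v)"
proof -
  obtain \<phi> \<psi> where "bounded_fm \<phi>" "\<And>v. fm_true v \<phi> = P v" "bounded_fm \<psi>" "\<And>v. fm_true v \<psi> = Q v" using assms unfolding bdef_def by blast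
  then show ?thesis unfolding bdef_def by (intro exI[of _ "FOr \<phi> \<psi>"]) simp
qed

lemma bdef_imp: "bdef P \<Longrightarrow> bdef Q \<Longrightarrow> bdef (\<lambda>v. P v \<longrightarrow> Q v)"
  unfolding imp_conv_disj by (intro bdef_disj bdef_not)

lemma bdef_less: "tdef s \<Longrightarrow> tdef t \<Longrightarrow> bdef (\<lambda>v. s v < t v)"
  unfolding not_le[symmetric] by (intro bdef_not bdef_le)

text \<open>De Bruijn binding seen semantically: under the quantifier the bound value is entry 0 of
  the valuation and the outer variables are shifted by one. Relations can so be shown definable
  without writing formulas.\<close>

lemma bdef_ball:
  assumes "tdef t" "bdef (\<lambda>v. P (v 0) (\<lambda>i. v (Suc i)))" shows "bdef (\<lambda>v. \<forall>x\<le>t v. P x v)"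
proof -
  obtain \<tau> \<phi> where "\<And>v. tm_val v \<tau> = t v" "bounded_fm \<phi>" "\<And>v. fm_true v \<phi> = P (v 0) (\<lambda>i. v (Suc i))"
    using assms unfolding tdef_def bdef_def by blast
  then show ?thesis unfolding bdef_def by (intro exI[of _ "FBAll \<tau> \<phi>"]) simp
qed

lemma bdef_bex:
  assumes "tdef t" "bdef (\<lambda>v. P (v 0) (\<lambda>i. v (Suc i)))" shows "bdef (\<lambda>v. \<exists>x\<le>t v. P x v)"
proof -
  obtain \<tau> \<phi> where "\<And>v. tm_val v \<tau> = t v" "bounded_fm \<phi>" "\<And>v. fm_true v \<phi> = P (v 0) (\<lambda>i. v (Suc i))"
    using assms unfolding tdef_def bdef_def by blast
  then show ?thesis unfolding bdef_def by (intro exI[of _ "FBEx \<tau> \<phi>"]) simp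
qed

lemma bdef_dvd:
  assumes "tdef s" "tdef t" shows "bdef (\<lambda>v. s v dvd t v)"
proof -
  have eq: "a dvd b \<longleftrightarrow> (\<exists>q\<le>b. b = a * q)" for a b :: nat
  proof
    assume "a dvd b"
    then obtain q where q: "b = a * q" by (rule dvdE)
    show "\<exists>q\<le>b. b = a * q"
    proof (cases "a = 0")
      case False
      then have "q \<le> b" using q by simp
      then show ?thesis using q by blast
    qed (use q in simp)
  qed auto
  show ?thesis unfolding eq by (intro bdef_bex bdef_eq tdef_mult tdef_var assms assms[THEN tdef_shift])
qed

lemma bdef_prod_encode:
  assumes "tdef z" "tdef s" "tdef t" shows "bdef (\<lambda>v. z v = prod_encode (s v, t v))"
proof -
  have eq: "c = prod_encode (x, y) \<longleftrightarrow> 2 * c = dbl_pair x y" for c x y unfolding dbl_pair_prod_encode by simp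
  show ?thesis unfolding eq dbl_pair_def by (intro bdef_eq tdef_mult tdef_add tdef_const assms)
qed

lemmas bdef_intros = tdef_var tdef_const tdef_Suc tdef_add tdef_mult bdef_prod_encode bdef_eq bdef_le bdef_less bdef_not bdef_conj
  bdef_disj bdef_imp bdef_ball bdef_bex bdef_dvd

lemma bdef_coded:
  assumes "tdef M" "tdef a" "tdef b" "tdef e" "tdef x" "tdef y"
  shows "bdef (\<lambda>v. coded (M v) (a v) (b v) (e v) (x v) (y v))"
  unfolding coded_def triple_code_def dbl_pair_def by (intro bdef_intros assms)

lemma bdef_justified: "bdef (\<lambda>v. justified (v M) (coded (v M) (v a) (v b)) (v e) (v x) (v y))"
  unfolding justified_def by (intro bdef_intros bdef_coded)

lemma bdef_computation: "bdef (\<lambda>v. computation (v M) (v a) (v b) (v e) (v x) (v y))"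
  unfolding computation_def by (intro bdef_intros bdef_coded bdef_justified)

lemma sdef_bdef: "bdef P \<Longrightarrow> sdef 0 P"
  unfolding bdef_def sdef_def using Sigma_fm_Pi_fm.intros(1) by blast

lemma sdef_pdef: "pdef n P \<Longrightarrow> sdef (Suc n) P"
  unfolding pdef_def sdef_def using Sigma_fm_Pi_fm.intros(3) by blast

lemma pdef_sdef: "sdef n P \<Longrightarrow> pdef (Suc n) P"
  unfolding pdef_def sdef_def using Sigma_fm_Pi_fm.intros(5) by blast

lemma sdef_ex:
  assumes "sdef (Suc n) (\<lambda>v. P (v 0) (\<lambda>i. v (Suc i)))" shows "sdef (Suc n) (\<lambda>v. \<exists>x. P x v)"
proof -
  obtain \<phi> where "Sigma_fm (Suc n) \<phi>" "\<And>v. fm_true v \<phi> = P (v 0) (\<lambda>i. v (Suc i))"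
    using assms unfolding sdef_def by blast
  then show ?thesis unfolding sdef_def by (intro exI[of _ "FEx \<phi>"]) (simp add: Sigma_fm_Pi_fm.intros(4))
qed

lemma pdef_all:
  assumes "pdef (Suc n) (\<lambda>v. P (v 0) (\<lambda>i. v (Suc i)))" shows "pdef (Suc n) (\<lambda>v. \<forall>x. P x v)"
proof -
  obtain \<phi> where "Pi_fm (Suc n) \<phi>" "\<And>v. fm_true v \<phi> = P (v 0) (\<lambda>i. v (Suc i))"
    using assms unfolding pdef_def by blast
  then show ?thesis unfolding pdef_def by (intro exI[of _ "FAll \<phi>"]) (simp add: Sigma_fm_Pi_fm.intros(6))
qed

text \<open>The decision value exists and is unique, so \<open>R\<close> can be phrased universally:
  every computation on the input has output 1. This merges with the innermost universal block, and
  the level stays at 4.\<close>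

lemma arith_Sigma_4I:
  assumes R: "decid R"
    and A: "\<And>n. n \<in> A \<longleftrightarrow> (\<exists>a. \<forall>b. \<exists>c. \<forall>d. R (prod_encode (d, prod_encode (c, prod_encode (b, prod_encode (a, n))))))"
  shows "arith_Sigma 4 A"
proof -
  obtain i where i: "\<And>x. phi i x = Some (of_bool (R x))" using R unfolding decid_def computable_def by blast
  have R_iff: "R x \<longleftrightarrow> (\<forall>y M s t. computation M s t i x y \<longrightarrow> y = 1)" for x
  proof -
    have "R x \<longleftrightarrow> (\<forall>y. phi i x = Some y \<longrightarrow> y = 1)" unfolding i by simp
    then show ?thesis unfolding phi_iff_computation by blast
  qed
  \<comment> \<open>The pairs and the program number \<open>i\<close> are named by universally
    quantified variables, because pairing is not a term and \<open>bdef_computation\<close> speaks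
    of variables.\<close>
  have A': "n \<in> A \<longleftrightarrow> (\<exists>a. \<forall>b. \<exists>c. \<forall>d z1 z2 z3 z4 e y M s t.
      z1 = prod_encode (a, n) \<and> z2 = prod_encode (b, z1) \<and> z3 = prod_encode (c, z2) \<and> z4 = prod_encode (d, z3) \<and> e = i
      \<and> computation M s t e z4 y \<longrightarrow> y = 1)" for n
    unfolding A R_iff by simp
  have "sdef (Suc (Suc (Suc (Suc 0)))) (\<lambda>v. v 0 \<in> A)"
    unfolding A'
    by (rule sdef_ex, rule sdef_pdef, rule pdef_all, rule pdef_sdef, rule sdef_ex, rule sdef_pdef, (rule pdef_all)+,
        rule pdef_sdef, rule sdef_bdef) (intro bdef_intros bdef_computation)
  then have "sdef 4 (\<lambda>v. v 0 \<in> A)" by (simp add: eval_nat_numeral)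
  then obtain \<phi> where \<phi>: "Sigma_fm 4 \<phi>" "\<And>v. fm_true v \<phi> = (v 0 \<in> A)" unfolding sdef_def by blast
  have "n \<in> A \<longleftrightarrow> fm_true (case_nat n v) \<phi>" for n v by (simp add: \<phi>(2))
  then show ?thesis unfolding arith_Sigma_def using \<phi>(1) by blast
qed

section \<open>Definability of normality\<close>

lemma decid_coded:
  assumes "computable M" "computable a" "computable b" "computable e" "computable x" "computable y"
  shows "decid (\<lambda>z. coded (M z) (a z) (b z) (e z) (x z) (y z))"
  unfolding coded_def triple_code_def dbl_pair_def by (intro computable_intros assms)

lemma decid_justified:
  assumes "computable M" "computable a" "computable b" "computable e" "computable x" "computable y"
  shows "decid (\<lambda>z. justified (M z) (coded (M z) (a z) (b z)) (e z) (x z) (y z))"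
  unfolding justified_def
  by (intro computable_intros decid_coded assms[THEN computable_comp])

lemma decid_computation:
  assumes "computable M" "computable a" "computable b" "computable e" "computable x" "computable y"
  shows "decid (\<lambda>z. computation (M z) (a z) (b z) (e z) (x z) (y z))"
  unfolding computation_def
  by (intro computable_intros decid_coded decid_justified assms[THEN computable_comp])

definition witness :: "nat \<Rightarrow> nat \<Rightarrow> nat \<Rightarrow> nat \<Rightarrow> bool" where
  "witness e x y w \<longleftrightarrow> computation (pfst w) (pfst (psnd w)) (psnd (psnd w)) e x y"

lemma phi_iff_witness: "phi e x = Some y \<longleftrightarrow> (\<exists>w. witness e x y w)"
proof
  assume "phi e x = Some y"
  then obtain M a b where "computation M a b e x y" unfolding phi_iff_computation by blast
  then have "witness e x y (prod_encode (M, prod_encode (a, b)))" by (simp add: witness_def)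
  then show "\<exists>w. witness e x y w" by blast
qed (auto simp: witness_def phi_iff_computation)

lemma decid_witness:
  assumes "computable e" "computable x" "computable y" "computable w"
  shows "decid (\<lambda>z. witness (e z) (x z) (y z) (w z))"
  unfolding witness_def by (intro decid_computation computable_intros assms)

text \<open>Even codes stand for nonnegative and odd ones for negative integers, with modulus
  \<open>(n + 1) div 2\<close> in both cases. A zero denominator denotes the rational 0, represented
  here as 0 / 1.\<close>

definition rat_abs_num :: "nat \<Rightarrow> nat" where
  "rat_abs_num c = (if psnd c = 0 then 0 else (pfst c + 1) div 2)"

definition rat_den :: "nat \<Rightarrow> nat" where
  "rat_den c = (if psnd c = 0 then 1 else (psnd c + 1) div 2)"

text \<open>The numerator of the coded rational plus \<open>m\<close>. Codes of equal parity give a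
  nonnegative quotient; a large \<open>m\<close> makes the result a natural number, and an integer
  shift leaves the tent sums unchanged.\<close>

definition shifted_num :: "nat \<Rightarrow> nat \<Rightarrow> nat" where
  "shifted_num c m = (if (pfst c + psnd c) mod 2 = 0 then m * rat_den c + rat_abs_num c else m * rat_den c - rat_abs_num c)"

lemma rat_den_pos: "0 < rat_den c"
  by (simp add: rat_den_def)

lemma shifted_num:
  assumes m: "rat_abs_num c \<le> m"
  shows "real (shifted_num c m) / real (rat_den c) = of_rat (nat_to_rat_surj c) + real m"
proof -
  define a b where "a = pfst c" and "b = psnd c"
  have dec: "int_decode n = (if n mod 2 = 0 then int ((n + 1) div 2) else - int ((n + 1) div 2))" for n
    unfolding int_decode_def sum_decode_def by (cases "n mod 2 = 0") (auto elim!: evenE oddE)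
  have pd: "prod_decode c = (a, b)" by (simp add: a_def b_def pfst_def psnd_def)
  have q: "nat_to_rat_surj c = Fract (int_decode a) (int_decode b)" unfolding nat_to_rat_surj_def pd by simp
  have B: "0 < rat_den c" by (rule rat_den_pos)
  have "m * 1 \<le> m * rat_den c" using B by (intro mult_le_mono2) simp
  then have le: "rat_abs_num c \<le> m * rat_den c" unfolding mult_1_right by (rule le_trans[OF m])
  have "(of_rat (nat_to_rat_surj c) :: real) = (if (a + b) mod 2 = 0 then real (rat_abs_num c) else - real (rat_abs_num c)) / real (rat_den c)"
  proof (cases "b = 0")
    case True
    then have "int_decode b = 0" by (simp add: dec)
    then have "nat_to_rat_surj c = 0" unfolding q by (simp add: rat_number_collapse)
    then show ?thesis using True by (simp add: rat_abs_num_def b_def)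
  next
    case False
    then have b: "int_decode b \<noteq> 0" by (simp add: dec)
    have A: "rat_abs_num c = (a + 1) div 2" "rat_den c = (b + 1) div 2" using False by (simp_all add: rat_abs_num_def rat_den_def a_def b_def)
    have i: "of_int (int_decode n) = (if n mod 2 = 0 then real ((n + 1) div 2) else - real ((n + 1) div 2))" for n
      unfolding dec by (simp only: of_int_minus of_int_of_nat_eq if_distrib[of of_int])
    have sgn: "(if P then u else - u) / (if Q then w else - w) = (if P \<longleftrightarrow> Q then u else - u) / w" for P Q and u w :: real
      by simp
    have "(of_rat (nat_to_rat_surj c) :: real) = of_int (int_decode a) / of_int (int_decode b)" unfolding q using b by (rule of_rat_rat)
    also have "\<dots> = (if a mod 2 = 0 \<longleftrightarrow> b mod 2 = 0 then real ((a + 1) div 2) else - real ((a + 1) div 2)) / real ((b + 1) div 2)"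
      unfolding i by (rule sgn)
    also have "(a mod 2 = 0 \<longleftrightarrow> b mod 2 = 0) \<longleftrightarrow> (a + b) mod 2 = 0" by presburger
    finally show ?thesis unfolding A .
  qed
  moreover have "real (shifted_num c m) = (if (a + b) mod 2 = 0 then real (rat_abs_num c) else - real (rat_abs_num c)) + real m * real (rat_den c)"
    unfolding shifted_num_def a_def b_def using le by (simp add: of_nat_diff)
  ultimately show ?thesis using B by (simp add: add_divide_distrib)
qed

text \<open>What two approximations of one real with errors \<open>1 / 2^n\<close> and
  \<open>1 / 2^n'\<close> must satisfy; for all pairs together it is also sufficient for a common
  limit with these errors.\<close>

definition rat_close :: "nat \<Rightarrow> nat \<Rightarrow> nat \<Rightarrow> nat \<Rightarrow> bool" where
  "rat_close n n' c c' \<longleftrightarrow>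
     (let m = rat_abs_num c + rat_abs_num c'; x = shifted_num c m * rat_den c'; y = shifted_num c' m * rat_den c
      in ((x - y) + (y - x)) * 2 ^ n * 2 ^ n' \<le> (2 ^ n + 2 ^ n') * rat_den c * rat_den c')"

lemma rat_close_iff:
  "rat_close n n' c c' \<longleftrightarrow> \<bar>of_rat (nat_to_rat_surj c) - of_rat (nat_to_rat_surj c')\<bar> \<le> 1 / 2 ^ n + (1 / 2 ^ n' :: real)"
proof -
  define q q' :: real where "q = of_rat (nat_to_rat_surj c)" and "q' = of_rat (nat_to_rat_surj c')"
  define m where "m = rat_abs_num c + rat_abs_num c'"
  define B B' where "B = rat_den c" and "B' = rat_den c'"
  have B: "0 < B" "0 < B'" by (simp_all add: B_def B'_def rat_den_pos)
  define x y where "x = shifted_num c m * B'" and "y = shifted_num c' m * B"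
  have "real x / (real B * real B') = q + real m" "real y / (real B * real B') = q' + real m"
    using shifted_num[of c m] shifted_num[of c' m] B by (simp_all add: x_def y_def q_def q'_def m_def B_def B'_def)
  then have "q - q' = real x / (real B * real B') - real y / (real B * real B')" by linarith
  also have "\<dots> = (real x - real y) / (real B * real B')" by (simp add: diff_divide_distrib)
  finally have "\<bar>q - q'\<bar> = real ((x - y) + (y - x)) / (real B * real B')"
    unfolding real_abs_diff_nat using B by (simp add: abs_divide)
  moreover have "1 / 2 ^ n + (1 / 2 ^ n' :: real) = (2 ^ n + 2 ^ n') / (2 ^ n * 2 ^ n')" by (simp add: field_simps)
  ultimately have "\<bar>q - q'\<bar> \<le> 1 / 2 ^ n + 1 / 2 ^ n' \<longleftrightarrow>
      real ((x - y) + (y - x)) * (2 ^ n * 2 ^ n') \<le> (2 ^ n + 2 ^ n') * (real B * real B')"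
    using B by (simp only: divide_le_eq le_divide_eq) (simp add: field_simps)
  also have "\<dots> \<longleftrightarrow> real (((x - y) + (y - x)) * 2 ^ n * 2 ^ n') \<le> real ((2 ^ n + 2 ^ n') * B * B')" by (simp add: mult.assoc)
  finally show ?thesis
    unfolding rat_close_def Let_def q_def q'_def x_def y_def m_def B_def B'_def of_nat_le_iff ..
qed

text \<open>An error of \<open>1 / 2^n\<close> still controls \<open>N = n div r\<close> orbit
  points in base \<open>r\<close>, because \<open>r^N \<le> 2^(r * N) \<le> 2^n\<close>, and every
  \<open>N\<close> arises as such a quotient.\<close>

definition dev_small :: "nat \<Rightarrow> nat \<Rightarrow> nat \<Rightarrow> nat \<Rightarrow> bool" where
  "dev_small r k n c \<longleftrightarrow> (\<forall>d\<le>Suc k. \<forall>a<d. 1 \<le> a \<longrightarrow>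
     dev_le r d a 0 (n div r) (shifted_num c (rat_abs_num c)) (rat_den c) (Suc k))"

lemma tent_dev_add_nat: "tent_dev r d a A N (x + real m) = tent_dev r d a A N x"
proof -
  have "frac (real r ^ j * (x + real m)) = frac (real r ^ j * x)" for j
  proof -
    have "real r ^ j * (x + real m) = of_int (int (r ^ j * m)) + real r ^ j * x" by (simp add: algebra_simps)
    then show ?thesis by (simp only: frac_of_int_add)
  qed
  then show ?thesis by (simp add: tent_dev_def tent_def)
qed

lemma dev_small_iff:
  "dev_small r k n c \<longleftrightarrow> (\<forall>d a. 1 \<le> a \<longrightarrow> a < d \<longrightarrow> d \<le> Suc k \<longrightarrow>
     \<bar>tent_dev r d a 0 (n div r) (of_rat (nat_to_rat_surj c))\<bar> \<le> real (n div r) / real (Suc k))"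
proof -
  have "\<bar>tent_dev r d a 0 (n div r) (of_rat (nat_to_rat_surj c))\<bar> \<le> real (n div r) / real (Suc k) \<longleftrightarrow>
      dev_le r d a 0 (n div r) (shifted_num c (rat_abs_num c)) (rat_den c) (Suc k)" if "1 \<le> a" "a < d" for d a
    using dev_le_iff[of d "Suc k" "rat_den c" r a 0 "n div r" "shifted_num c (rat_abs_num c)"] that rat_den_pos[of c]
    by (simp only: shifted_num[OF order_refl] tent_dev_add_nat)
  then show ?thesis unfolding dev_small_def by blast
qed

text \<open>Moving the point costs at most \<open>d \<le> k + 1\<close>, half of the allowance once
  \<open>N \<ge> 2 * (k + 1)^2\<close>; the doubled precision of the hypothesis supplies the other
  half.\<close>

lemma tent_dev_transfer:
  assumes r: "2 \<le> r" and a: "1 \<le> a" "a < d" "d \<le> Suc k" and xy: "\<bar>x - y\<bar> \<le> 1 / 2 ^ n" and n: "r * N \<le> n"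
    and N: "2 * (Suc k)^2 \<le> N" and dev: "\<bar>tent_dev r d a 0 N x\<bar> \<le> real N / real (Suc (2 * k + 1))"
  shows "\<bar>tent_dev r d a 0 N y\<bar> \<le> real N / real (Suc k)"
proof -
  have "r ^ N \<le> (2 ^ r) ^ N" by (rule power_mono) (simp_all add: less_imp_le)
  also have "\<dots> \<le> 2 ^ n" unfolding power_mult[symmetric] using n by (intro power_increasing) auto
  finally have "real (r ^ N) \<le> real (2 ^ n)" by (simp only: of_nat_le_iff)
  then have rN: "real r ^ N \<le> 2 ^ n" by simp
  define K where "K = real (Suc k)"
  have K: "0 < K" by (simp add: K_def)
  have "\<bar>tent_dev r d a 0 N x - tent_dev r d a 0 N y\<bar> \<le> real d"
    by (rule tent_dev_perturb[OF r a(1,2) rN xy]) simp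
  moreover have "real d \<le> K" using a(3) by (simp add: K_def)
  moreover have "K \<le> real N / (2 * K)"
  proof -
    have "real (2 * (Suc k)^2) \<le> real N" using N by (simp only: of_nat_le_iff)
    then have "K * (2 * K) \<le> real N" by (simp add: K_def power2_eq_square algebra_simps)
    then show ?thesis using K by (simp add: pos_le_divide_eq)
  qed
  moreover have "real (Suc (2 * k + 1)) = 2 * K" by (simp add: K_def)
  with dev have "\<bar>tent_dev r d a 0 N x\<bar> \<le> real N / (2 * K)" by (simp only:)
  moreover have "real N / (2 * K) + real N / (2 * K) = real N / K" using K by (simp add: field_simps)
  ultimately show ?thesis unfolding K_def[symmetric] by linarith
qed

lemma rational_Cauchy_limit:
  fixes q :: "nat \<Rightarrow> real"
  assumes q: "\<And>n n'. \<bar>q n - q n'\<bar> \<le> 1 / 2 ^ n + 1 / 2 ^ n'"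
  obtains \<xi> where "\<And>n. \<bar>q n - \<xi>\<bar> \<le> 1 / 2 ^ n"
proof -
  have z: "(\<lambda>n. 1 / (2::real) ^ n) \<longlonglongrightarrow> 0"
    using LIMSEQ_realpow_zero[of "1/2::real"] by (simp add: power_one_over)
  have "Cauchy q"
  proof (rule metric_CauchyI)
    fix e :: real assume "0 < e"
    then have "0 < e / 2" by simp
    then obtain M where M: "\<And>n. M \<le> n \<Longrightarrow> norm (1 / (2::real) ^ n - 0) < e / 2" using LIMSEQ_D[OF z] by blast
    have "dist (q m) (q n) < e" if "M \<le> m" "M \<le> n" for m n
      using q[of m n] M[OF that(1)] M[OF that(2)] by (simp add: dist_real_def)
    then show "\<exists>M. \<forall>m\<ge>M. \<forall>n\<ge>M. dist (q m) (q n) < e" by blast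
  qed
  then obtain \<xi> where \<xi>: "q \<longlonglongrightarrow> \<xi>" using Cauchy_convergent_iff convergent_def by blast
  have "\<bar>q n - \<xi>\<bar> \<le> 1 / 2 ^ n" for n
  proof (rule LIMSEQ_le)
    show "(\<lambda>n'. \<bar>q n - q n'\<bar>) \<longlonglongrightarrow> \<bar>q n - \<xi>\<bar>" by (intro tendsto_intros \<xi>)
    show "(\<lambda>n'. 1 / 2 ^ n + 1 / (2::real) ^ n') \<longlonglongrightarrow> 1 / 2 ^ n" using tendsto_add[OF tendsto_const z] by simp
  qed (use q in blast)
  then show ?thesis by (rule that)
qed

text \<open>Being an index means totality and consistency of the approximations. Both are spread
  over the existing prefix, totality at \<open>k\<close> beside the choice of \<open>N0\<close> and
  consistency beside the deviation test, so no further alternation arises. Passing between the real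
  and its approximations halves the precision, hence \<open>2 * k + 1\<close> in both
  directions.\<close>

lemma normal_index_iff:
  "(\<exists>\<xi>. computable_real_index e \<xi> \<and> normal_to_some_base \<xi>) \<longleftrightarrow>
   (\<exists>r. \<forall>k. (\<exists>c. phi e k = Some c) \<and> (\<exists>N0. \<forall>n n' c c'. phi e n = Some c \<longrightarrow> phi e n' = Some c' \<longrightarrow>
      rat_close n n' c c' \<and> (N0 \<le> n \<longrightarrow> dev_small (r + 2) k n c)))" (is "?L \<longleftrightarrow> ?R")
proof
  assume ?L
  then obtain \<xi> r' where \<xi>: "computable_real_index e \<xi>" "2 \<le> r'" "normal_to_base r' \<xi>" unfolding normal_to_some_base_def by blast
  define r where "r = r' - 2"
  have r: "r' = r + 2" using \<xi>(2) by (simp add: r_def)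
  have tot: "\<exists>c. phi e n = Some c" for n using \<xi>(1) unfolding computable_real_index_def by blast
  have ap: "\<bar>of_rat (nat_to_rat_surj c) - \<xi>\<bar> \<le> 1 / 2 ^ n" if "phi e n = Some c" for n c
  proof -
    obtain c' where "phi e n = Some c'" "\<bar>of_rat (nat_to_rat_surj c') - \<xi>\<bar> \<le> 1 / 2 ^ n"
      using \<xi>(1) unfolding computable_real_index_def by blast
    then show ?thesis using that by simp
  qed
  show ?R
  proof (rule exI[of _ r], intro allI conjI tot)
    fix k
    obtain N1 where N1: "\<And>N d a. N1 \<le> N \<Longrightarrow> 1 \<le> a \<Longrightarrow> a < d \<Longrightarrow> d \<le> Suc (2 * k + 1) \<Longrightarrow> \<bar>tent_dev r' d a 0 N \<xi>\<bar> \<le> real N / real (Suc (2 * k + 1))"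
      using \<xi>(3)[unfolded normal_iff_tent_dev, rule_format, of "2 * k + 1"] by blast
    show "\<exists>N0. \<forall>n n' c c'. phi e n = Some c \<longrightarrow> phi e n' = Some c' \<longrightarrow>
      rat_close n n' c c' \<and> (N0 \<le> n \<longrightarrow> dev_small (r + 2) k n c)"
    proof (rule exI[of _ "(N1 + 2 * (Suc k)^2) * r'"], intro allI impI conjI)
      fix n n' c c' assume c: "phi e n = Some c" "phi e n' = Some c'"
      show "rat_close n n' c c'" unfolding rat_close_iff using ap[OF c(1)] ap[OF c(2)] by linarith
      assume n: "(N1 + 2 * (Suc k)^2) * r' \<le> n"
      have N: "N1 + 2 * (Suc k)^2 \<le> n div r'" using n \<xi>(2) by (simp only: less_eq_div_iff_mult_less_eq)
      show "dev_small (r + 2) k n c" unfolding dev_small_iff r[symmetric]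
      proof (intro allI impI)
        fix d a :: nat assume a: "1 \<le> a" "a < d" "d \<le> Suc k"
        show "\<bar>tent_dev r' d a 0 (n div r') (of_rat (nat_to_rat_surj c))\<bar> \<le> real (n div r') / real (Suc k)"
        proof (rule tent_dev_transfer[OF \<xi>(2) a])
          show "\<bar>\<xi> - of_rat (nat_to_rat_surj c)\<bar> \<le> 1 / 2 ^ n" using ap[OF c(1)] by (simp add: abs_minus_commute)
          show "r' * (n div r') \<le> n" by simp
          show "2 * (Suc k)^2 \<le> n div r'" using N by linarith
          show "\<bar>tent_dev r' d a 0 (n div r') \<xi>\<bar> \<le> real (n div r') / real (Suc (2 * k + 1))"
            using a N by (intro N1) auto
        qed
      qed
    qed
  qed
next
  assume ?R
  then obtain r where tot: "\<And>k. \<exists>c. phi e k = Some c" and R: "\<And>k. \<exists>N0. \<forall>n n' c c'. phi e n = Some c \<longrightarrow> phi e n' = Some c' \<longrightarrow>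
      rat_close n n' c c' \<and> (N0 \<le> n \<longrightarrow> dev_small (r + 2) k n c)" by blast
  obtain g where g: "\<And>n. phi e n = Some (g n)" using tot by metis
  define q :: "nat \<Rightarrow> real" where "q n = of_rat (nat_to_rat_surj (g n))" for n
  have "rat_close n n' (g n) (g n')" for n n' using R[of 0] g by blast
  then obtain \<xi> where \<xi>: "\<And>n. \<bar>q n - \<xi>\<bar> \<le> 1 / 2 ^ n"
    unfolding rat_close_iff q_def[symmetric] by (rule rational_Cauchy_limit) (rule that)
  have "computable_real_index e \<xi>" unfolding computable_real_index_def using g \<xi> by (simp add: q_def)
  moreover have "normal_to_base (r + 2) \<xi>" unfolding normal_iff_tent_dev
  proof
    fix k
    obtain N0 where N0: "\<And>n. N0 \<le> n \<Longrightarrow> dev_small (r + 2) (2 * k + 1) n (g n)" using R[of "2 * k + 1"] g by blast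
    show "\<exists>N0. \<forall>N\<ge>N0. \<forall>d a. 1 \<le> a \<longrightarrow> a < d \<longrightarrow> d \<le> Suc k \<longrightarrow> \<bar>tent_dev (r + 2) d a 0 N \<xi>\<bar> \<le> real N / real (Suc k)"
    proof (rule exI[of _ "N0 + 2 * (Suc k)^2"], intro allI impI)
      fix N d a :: nat assume N: "N0 + 2 * (Suc k)^2 \<le> N" and a: "1 \<le> a" "a < d" "d \<le> Suc k"
      define n where "n = (r + 2) * N"
      have nd: "n div (r + 2) = N" unfolding n_def by (rule nonzero_mult_div_cancel_left) simp
      have "N \<le> n" unfolding n_def by simp
      then have s: "dev_small (r + 2) (2 * k + 1) n (g n)" using N0 N by simp
      show "\<bar>tent_dev (r + 2) d a 0 N \<xi>\<bar> \<le> real N / real (Suc k)"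
      proof (rule tent_dev_transfer[OF _ a \<xi>[of n]])
        show "\<bar>tent_dev (r + 2) d a 0 N (q n)\<bar> \<le> real N / real (Suc (2 * k + 1))"
          using s a unfolding dev_small_iff nd q_def[symmetric] by simp
      qed (use N in \<open>simp_all add: n_def\<close>)
    qed
  qed
  ultimately show ?L unfolding normal_to_some_base_def by (intro exI[of _ \<xi>] conjI exI[of _ "r + 2"]) simp_all
qed

lemma decid_rat_close:
  assumes "computable n" "computable n'" "computable c" "computable c'"
  shows "decid (\<lambda>z. rat_close (n z) (n' z) (c z) (c' z))"
  unfolding rat_close_def Let_def shifted_num_def rat_abs_num_def rat_den_def by (intro computable_intros assms)

lemma decid_dev_small:
  assumes "computable r" "computable k" "computable n" "computable c"
  shows "decid (\<lambda>z. dev_small (r z) (k z) (n z) (c z))"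
  unfolding dev_small_def shifted_num_def rat_abs_num_def rat_den_def
  by (intro computable_intros decid_dev_le assms[THEN computable_comp])

lemma arith_Sigma_normal: "arith_Sigma 4 {e. \<exists>\<xi>. computable_real_index e \<xi> \<and> normal_to_some_base \<xi>}"
proof -
  define P where "P N0 n n' c c' r k \<longleftrightarrow> rat_close n n' c c' \<and> (N0 \<le> n \<longrightarrow> dev_small (r + 2) k n c)" for N0 n n' c c' r k
  \<comment> \<open>\<open>u\<close> packs the value at \<open>k\<close>, a witness for it and
    \<open>N0\<close>; \<open>v\<close> packs \<open>n\<close>, \<open>n'\<close>, \<open>c\<close>,
    \<open>c'\<close> and a witness for each of the two values. Witnesses occurring in hypotheses
    become universal and so join \<open>v\<close>.\<close>
  define Q where "Q u v k r e \<longleftrightarrow> witness e k (pfst u) (pfst (psnd u)) \<and>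
     (witness e (pfst v) (pfst (psnd (psnd v))) (pfst (psnd (psnd (psnd (psnd v))))) \<longrightarrow>
      witness e (pfst (psnd v)) (pfst (psnd (psnd (psnd v)))) (psnd (psnd (psnd (psnd (psnd v))))) \<longrightarrow>
      P (psnd (psnd u)) (pfst v) (pfst (psnd v)) (pfst (psnd (psnd v))) (pfst (psnd (psnd (psnd v)))) r k)" for u v k r e
  define R where "R z = Q (pfst (psnd z)) (pfst z) (pfst (psnd (psnd z))) (pfst (psnd (psnd (psnd z)))) (psnd (psnd (psnd (psnd z))))" for z
  have "decid R"
    unfolding R_def Q_def P_def by (intro computable_intros decid_witness decid_rat_close decid_dev_small)
  moreover have "(\<exists>c. phi e k = Some c) \<and> (\<exists>N0. \<forall>n n' c c'. phi e n = Some c \<longrightarrow> phi e n' = Some c' \<longrightarrow> P N0 n n' c c' r k)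
      \<longleftrightarrow> (\<exists>u. \<forall>v. Q u v k r e)" for e k r
  proof
    assume "(\<exists>c. phi e k = Some c) \<and> (\<exists>N0. \<forall>n n' c c'. phi e n = Some c \<longrightarrow> phi e n' = Some c' \<longrightarrow> P N0 n n' c c' r k)"
    then obtain c w N0 where "witness e k c w" "\<And>n n' c c'. phi e n = Some c \<Longrightarrow> phi e n' = Some c' \<Longrightarrow> P N0 n n' c c' r k"
      unfolding phi_iff_witness by blast
    then have "Q (prod_encode (c, prod_encode (w, N0))) v k r e" for v unfolding Q_def pfst_psnd phi_iff_witness by blast
    then show "\<exists>u. \<forall>v. Q u v k r e" by blast
  next
    assume "\<exists>u. \<forall>v. Q u v k r e"
    then obtain u where u: "\<And>v. Q u v k r e" by blast
    have "phi e k = Some (pfst u)" using u[of 0] unfolding Q_def phi_iff_witness by blast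
    moreover have "P (psnd (psnd u)) n n' c c' r k" if "phi e n = Some c" "phi e n' = Some c'" for n n' c c'
    proof -
      obtain w w' where "witness e n c w" "witness e n' c' w'" using \<open>phi e n = Some c\<close> \<open>phi e n' = Some c'\<close> unfolding phi_iff_witness by blast
      then show ?thesis
        using u[of "prod_encode (n, prod_encode (n', prod_encode (c, prod_encode (c', prod_encode (w, w')))))"] unfolding Q_def pfst_psnd by blast
    qed
    ultimately show "(\<exists>c. phi e k = Some c) \<and> (\<exists>N0. \<forall>n n' c c'. phi e n = Some c \<longrightarrow> phi e n' = Some c' \<longrightarrow> P N0 n n' c c' r k)" by blast
  qed
  then have "e \<in> {e. \<exists>\<xi>. computable_real_index e \<xi> \<and> normal_to_some_base \<xi>} \<longleftrightarrow>
      (\<exists>r. \<forall>k. \<exists>u. \<forall>v. R (prod_encode (v, prod_encode (u, prod_encode (k, prod_encode (r, e))))))" for e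
    unfolding mem_Collect_eq normal_index_iff R_def pfst_psnd P_def[symmetric] by simp
  ultimately show ?thesis by (rule arith_Sigma_4I)
qed

theorem theorem1:
  shows "arith_Sigma_complete 4
           {e. \<exists>\<xi>. computable_real_index e \<xi> \<and> normal_to_some_base \<xi>}
         \<and> borel_Sigma_complete 4 {\<xi>. normal_to_some_base \<xi>}"
proof
  show "arith_Sigma_complete 4 {e. \<exists>\<xi>. computable_real_index e \<xi> \<and> normal_to_some_base \<xi>}"
    unfolding arith_Sigma_complete_def using arith_Sigma_normal arith_hard_normal by blast
qed (rule borel_Sigma_complete_normal)

end
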